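(* For $f\in L^2_{cusp}(\Gamma\backslash D)$, $$\xi_{1/2}I_M(\tau,f)=-\pi I(\tau,f).$$ If moreover $f$ is an eigenfunction of $\Delta$ with eigenvalue $\lambda$, then $$\xi_{3/2}I(\tau,f)=-\frac{\lambda}{4\pi}I_M(\tau,f).$$
   Context: $V$ is a 3-dim isotropic rational quadratic space of signature $(1,2)$ (trace-zero matrices, $q(X)=d\det X$), $L$ an even lattice, $\Gamma$ a congruence subgroup preserving $L$ and acting trivially on $L^\#/L$, $D\simeq\mathbb{H}$, $M=\Gamma\backslash D$, $L^2_{cusp}(\Gamma\backslash D)$ the cuspidal square integrable functions. With $X(z)=\frac1{\sqrt d y}\begin{pmatrix}-\frac12(z+\bar z)&z\bar z\\-1&\frac12(z+\bar z)\end{pmatrix}$, $(X,X)_z=(X,X(z))^2-(X,X)$, $\omega=\frac{dx\,dy}{y^2}$: $I(\tau,f)=\sum_h\big(\int_Mf(z)\sum_{X\in L+h}\varphi_{KM}(X,\tau,z)\big)\mathfrak e_h$ with $\varphi_{KM}(X,\tau,z)=\big(v(X,X(z))^2-\frac1{2\pi}\big)e^{\pi i(u(X,X)+iv(X,X)_z)}\omega$, and the Maass lift $I_M(\tau,f)=\sum_h\big(\int_Mf(z)\sum_{X\in L+h}\varphi_{2,1}(X,\tau,z)\,\omega\big)\mathfrak e_h$ with $\varphi_{2,1}(X,\tau,z)=v\,e^{\pi i(-u(X,X)+iv(X,X)_z)}$. $\xi_k(f)=v^{k-2}\overline{L_kf}$ with $L_k=-2iv^2\frac{\partial}{\partial\bar\tau}$;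 $\Delta=-y^2(\partial_x^2+\partial_y^2)$.
   Formalization: The printed formulas fail; corrected here: the factor v in φ_{2,1} becomes v^{1/2}, f on both right-hand sides becomes its complex conjugate, and -λ/(4π) becomes +λ/(4π); the integral over M is the limit over truncated surfaces. *)

theory Defs
  imports "HOL-Analysis.Analysis"
begin

type_synonym mat2 = "real^2^2"

definition mat2 :: "real \<Rightarrow> real \<Rightarrow> real \<Rightarrow> real \<Rightarrow> mat2" where
  "mat2 a b c e = vector [vector [a, b], vector [c, e]]"

text \<open>The quadratic space $V$ with $q(X) = d \det X$, its bilinear form normalised by
  $(X,X) = 2 q(X)$, so that $(X,Y) = -d\, tr(XY)$, and its lattices.\<close>

definition VQ :: "mat2 set" where
  "VQ = {X. trace X = 0 \<and> (\<forall>i j. X $ i $ j \<in> \<rat>)}"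

definition qform :: "real \<Rightarrow> mat2 \<Rightarrow> real" where
  "qform d X = d * det X"

definition bil :: "real \<Rightarrow> mat2 \<Rightarrow> mat2 \<Rightarrow> real" where
  "bil d X Y = qform d (X + Y) - qform d X - qform d Y"

definition lattice_in_V :: "mat2 set \<Rightarrow> bool" where
  "lattice_in_V L \<longleftrightarrow> (\<exists>B. B \<subseteq> VQ \<and> finite B \<and> card B = 3 \<and> independent B \<and>
     L = {(\<Sum>b\<in>B. of_int (c b) *\<^sub>R b) | c :: mat2 \<Rightarrow> int. True})"

definition even_lattice :: "real \<Rightarrow> mat2 set \<Rightarrow> bool" where
  "even_lattice d L \<longleftrightarrow> lattice_in_V L \<and> (\<forall>X\<in>L. qform d X \<in> \<int>)"

definition dual_lattice :: "real \<Rightarrow> mat2 set \<Rightarrow> mat2 set" where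
  "dual_lattice d L = {X \<in> VQ. \<forall>Y\<in>L. bil d X Y \<in> \<int>}"

text \<open>The elements $L + h$ of $L^{\#}/L$. They index the basis $e_h$ of the group ring
  $C[L^{\#}/L]$, an element of which is represented by its coefficient function.\<close>

definition discriminant_group :: "real \<Rightarrow> mat2 set \<Rightarrow> mat2 set set" where
  "discriminant_group d L = {(\<lambda>X. X + h) ` L | h. h \<in> dual_lattice d L}"

text \<open>Congruence subgroups of $SL_2(Q) = Spin(V)$, acting on $V$ by conjugation. They need not
  be contained in $SL_2(Z)$, since $L$ is an arbitrary lattice in $V$.\<close>

definition SL2Q :: "mat2 set" where
  "SL2Q = {g. det g = 1 \<and> (\<forall>i j. g $ i $ j \<in> \<rat>)}"

definition SL2Z :: "mat2 set" where
  "SL2Z = {g. det g = 1 \<and> (\<forall>i j. g $ i $ j \<in> \<int>)}"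

definition principal_subgroup :: "nat \<Rightarrow> mat2 set" where
  "principal_subgroup N =
     {g \<in> SL2Z. \<forall>i j. \<exists>k :: int. g $ i $ j = (mat 1 :: mat2) $ i $ j + of_nat N * of_int k}"

definition congruence_subgroup :: "mat2 set \<Rightarrow> bool" where
  "congruence_subgroup \<Gamma> \<longleftrightarrow>
     \<Gamma> \<subseteq> SL2Q \<and> mat 1 \<in> \<Gamma> \<and> (\<forall>g\<in>\<Gamma>. \<forall>h\<in>\<Gamma>. g ** h \<in> \<Gamma>) \<and> (\<forall>g\<in>\<Gamma>. matrix_inv g \<in> \<Gamma>) \<and>
     (\<exists>N\<ge>1. principal_subgroup N \<subseteq> \<Gamma> \<and>
        (\<exists>R. finite R \<and> R \<subseteq> \<Gamma> \<and> \<Gamma> = {r ** g | r g. r \<in> R \<and> g \<in> principal_subgroup N}))"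

definition conj_act :: "mat2 \<Rightarrow> mat2 \<Rightarrow> mat2" where
  "conj_act g X = g ** X ** matrix_inv g"

text \<open>The upper half plane as a model of $D$.\<close>

definition uhp :: "complex set" where
  "uhp = {z. Im z > 0}"

definition moebius :: "mat2 \<Rightarrow> complex \<Rightarrow> complex" where
  "moebius g z = (of_real (g $ 1 $ 1) * z + of_real (g $ 1 $ 2)) /
                 (of_real (g $ 2 $ 1) * z + of_real (g $ 2 $ 2))"

definition hyp_measure :: "complex measure" where
  "hyp_measure = density lborel (\<lambda>z. ennreal (indicator uhp z / (Im z)\<^sup>2))"

definition Xpt :: "real \<Rightarrow> complex \<Rightarrow> mat2" where
  "Xpt d z = (1 / (sqrt d * Im z)) *\<^sub>R mat2 (- Re z) ((cmod z)\<^sup>2) (-1) (Re z)"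

definition majorant :: "real \<Rightarrow> mat2 \<Rightarrow> complex \<Rightarrow> real" where
  "majorant d X z = (bil d X (Xpt d z))\<^sup>2 - bil d X X"

text \<open>A fundamental domain for $\Gamma$ modulo $\pm 1$; overlaps of measure zero are allowed, so
  that the usual polygons qualify.\<close>

definition fundamental_domain :: "mat2 set \<Rightarrow> complex set \<Rightarrow> bool" where
  "fundamental_domain \<Gamma> F \<longleftrightarrow>
     F \<in> sets borel \<and> F \<subseteq> uhp \<and> (\<forall>z\<in>uhp. \<exists>g\<in>\<Gamma>. moebius g z \<in> F) \<and>
     (\<forall>g\<in>\<Gamma>. g \<noteq> mat 1 \<and> g \<noteq> - mat 1 \<longrightarrow> (AE z in lborel. z \<in> F \<longrightarrow> moebius g z \<notin> F))"

text \<open>The cusps are the points $\sigma\infty$ with $\sigma \in SL_2(Z)$. For a number \<open>a\<close> with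
  \<open>cusp_period \<Gamma> \<sigma> a\<close>, the function $f \circ \sigma$ is periodic with period \<open>a\<close> whenever
  $f$ is invariant under $\Gamma$.\<close>

definition cusp_period :: "mat2 set \<Rightarrow> mat2 \<Rightarrow> real \<Rightarrow> bool" where
  "cusp_period \<Gamma> \<sigma> a \<longleftrightarrow> a > 0 \<and> \<sigma> ** mat2 1 a 0 1 ** matrix_inv \<sigma> \<in> \<Gamma>"

text \<open>The preimage in the upper half plane of the truncated surface $M_T$: the neighbourhoods
  $|q_\sigma| < e^{-2\pi T}$ of all cusps are removed, where
  $q_\sigma = \exp (2\pi i\, \sigma^{-1}z / a)$ with \<open>a\<close> the least period. Because of the
  normalisation by \<open>a\<close> this set is invariant under $\Gamma$.\<close>

definition truncated_uhp :: "mat2 set \<Rightarrow> real \<Rightarrow> complex set" where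
  "truncated_uhp \<Gamma> T = {z \<in> uhp. \<forall>\<sigma>\<in>SL2Z. \<forall>a. cusp_period \<Gamma> \<sigma> a \<longrightarrow>
     Im (moebius (matrix_inv \<sigma>) z) \<le> T * a}"

text \<open>The integral over $M = \Gamma \backslash D$ against $dx\,dy/y^2$, as the limit of the
  integrals over $M_T$. It is the Lebesgue integral over \<open>F\<close> if that exists. The limit is
  needed: the theta kernel of the Maass lift grows linearly in the cusps, so that its product
  with a square integrable function need not be absolutely integrable. For cuspidal functions the
  constant term of the kernel does not contribute, and the limit exists.\<close>

definition integral_M :: "mat2 set \<Rightarrow> complex set \<Rightarrow> (complex \<Rightarrow> complex) \<Rightarrow> complex" where
  "integral_M \<Gamma> F g =
     Lim at_top (\<lambda>T. set_lebesgue_integral hyp_measure (F \<inter> truncated_uhp \<Gamma> T) g)"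

text \<open>Cuspidal square integrable functions; functions on $M$ are functions on the upper half plane
  which are invariant under $\Gamma$, and the values outside the upper half plane are irrelevant.\<close>

definition L2_cusp :: "mat2 set \<Rightarrow> complex set \<Rightarrow> (complex \<Rightarrow> complex) set" where
  "L2_cusp \<Gamma> F = {f.
     set_borel_measurable borel uhp f \<and>
     (\<forall>g\<in>\<Gamma>. \<forall>z\<in>uhp. f (moebius g z) = f z) \<and>
     set_integrable hyp_measure F (\<lambda>z. (cmod (f z))\<^sup>2) \<and>
     (\<forall>\<sigma>\<in>SL2Z. \<forall>a. cusp_period \<Gamma> \<sigma> a \<longrightarrow>
        (AE y in lborel. y > 0 \<longrightarrow>
           set_lebesgue_integral lborel {0..a} (\<lambda>x. f (moebius \<sigma> (Complex x y))) = 0))}"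

text \<open>The Schwartz forms; \<open>\<phi>_KM\<close> is the coefficient of $dx\,dy/y^2$. The exponent of $v$ in
  \<open>\<phi>_21\<close> is $1/2$, as it must be for a theta kernel of weight $1/2$ in signature $(2,1)$.\<close>

definition \<phi>_KM :: "real \<Rightarrow> mat2 \<Rightarrow> complex \<Rightarrow> complex \<Rightarrow> complex" where
  "\<phi>_KM d X \<tau> z = of_real (Im \<tau> * (bil d X (Xpt d z))\<^sup>2 - 1 / (2 * pi)) *
     exp (of_real pi * \<i> * (of_real (Re \<tau> * bil d X X) + \<i> * of_real (Im \<tau> * majorant d X z)))"

definition \<phi>_21 :: "real \<Rightarrow> mat2 \<Rightarrow> complex \<Rightarrow> complex \<Rightarrow> complex" where
  "\<phi>_21 d X \<tau> z = of_real (sqrt (Im \<tau>)) *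
     exp (of_real pi * \<i> * (- of_real (Re \<tau> * bil d X X) + \<i> * of_real (Im \<tau> * majorant d X z)))"

text \<open>The coefficients at \<open>C = L + h\<close> of $I(\tau,f)$ and $I_M(\tau,f)$.\<close>

definition lift_KM ::
    "real \<Rightarrow> mat2 set \<Rightarrow> complex set \<Rightarrow> complex \<Rightarrow> (complex \<Rightarrow> complex) \<Rightarrow> mat2 set \<Rightarrow> complex" where
  "lift_KM d \<Gamma> F \<tau> f C = integral_M \<Gamma> F (\<lambda>z. f z * (\<Sum>\<^sub>\<infinity>X\<in>C. \<phi>_KM d X \<tau> z))"

definition lift_Maass ::
    "real \<Rightarrow> mat2 set \<Rightarrow> complex set \<Rightarrow> complex \<Rightarrow> (complex \<Rightarrow> complex) \<Rightarrow> mat2 set \<Rightarrow> complex" where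
  "lift_Maass d \<Gamma> F \<tau> f C = integral_M \<Gamma> F (\<lambda>z. f z * (\<Sum>\<^sub>\<infinity>X\<in>C. \<phi>_21 d X \<tau> z))"

text \<open>\<open>has_xi k G \<tau> w\<close>: the partial derivatives $a$, $b$ of \<open>G\<close> in $u$ and $v$ exist at
  $\tau = u + iv$, and $w = v^{k-2}\, \overline{L_k G(\tau)}$ with
  $L_k = -2iv^2\, \partial/\partial\bar\tau$ and
  $\partial G/\partial\bar\tau = (a + ib)/2$.\<close>

definition has_xi :: "real \<Rightarrow> (complex \<Rightarrow> complex) \<Rightarrow> complex \<Rightarrow> complex \<Rightarrow> bool" where
  "has_xi k G \<tau> w \<longleftrightarrow> (\<exists>a b.
     ((\<lambda>t. G (\<tau> + of_real t)) has_vector_derivative a) (at 0) \<and>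
     ((\<lambda>t. G (\<tau> + \<i> * of_real t)) has_vector_derivative b) (at 0) \<and>
     w = of_real (Im \<tau> powr (k - 2)) * cnj (-2 * \<i> * of_real ((Im \<tau>)\<^sup>2) * ((a + \<i> * b) / 2)))"

definition partial_x :: "(complex \<Rightarrow> complex) \<Rightarrow> complex \<Rightarrow> complex" where
  "partial_x f z = vector_derivative (\<lambda>t. f (z + of_real t)) (at 0)"

definition partial_y :: "(complex \<Rightarrow> complex) \<Rightarrow> complex \<Rightarrow> complex" where
  "partial_y f z = vector_derivative (\<lambda>t. f (z + \<i> * of_real t)) (at 0)"

definition C1_uhp :: "(complex \<Rightarrow> complex) \<Rightarrow> bool" where
  "C1_uhp f \<longleftrightarrow> f differentiable_on uhp \<and>
     continuous_on uhp (partial_x f) \<and> continuous_on uhp (partial_y f)"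

definition hyp_laplacian :: "(complex \<Rightarrow> complex) \<Rightarrow> complex \<Rightarrow> complex" where
  "hyp_laplacian f z =
     - of_real ((Im z)\<^sup>2) * (partial_x (partial_x f) z + partial_y (partial_y f) z)"

definition laplace_eigenfunction :: "real \<Rightarrow> (complex \<Rightarrow> complex) \<Rightarrow> bool" where
  "laplace_eigenfunction ev f \<longleftrightarrow> C1_uhp f \<and> C1_uhp (partial_x f) \<and> C1_uhp (partial_y f) \<and>
     (\<forall>z\<in>uhp. hyp_laplacian f z = of_real ev * f z)"

end

(* Both kernels are theta series formed with functions p^n a^l exp (A a - B (p^2 - a)) of
p = (X, X(z)) and a = (X, X), where A = +- i pi u and B = pi v. Pairing a function h on M with such a
series is bounded by the L^1 norm of h, although the series grows in the cusps: there its value at z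
may be replaced by its difference with the value at i Im z, which is bounded, because h has mean
zero on horocycles. Hence the lifts can be differentiated in A and B under the integral sign, and
the first identity is a comparison of kernels.

The derivative of the kernel of I is in turn a multiple of the Laplacian of the kernel of I_M, and
the Laplacian has to be moved to f. Nothing is known about the size of f or of its derivatives, so f
is first averaged over small hyperbolic discs against a point-pair kernel k(z, w). Green's formula is
then needed only on a disc, where both f and the kernel of I_M are smooth; averaging is symmetric on
M and does not spoil cuspidality; and the averages tend to f in L^1 as the discs shrink. *)
theory Submission
  imports Defs
begin

section \<open>The action on the upper half plane\<close>

text \<open>The set \<open>F\<close> is an arbitrary Borel fundamental domain with no control of its
  shape in the cusps, so the cancellation along horocycles cannot be seen on \<open>F\<close>
  itself. Integrals of invariant functions over \<open>F\<close> are therefore rewritten as finite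
  sums of integrals over a Siegel set, with a density that is constant high up in the cusp. A
  truncation then cuts each Siegel set at a fixed height and leaves full horocycles. All bounds use
  the L^1 norm on the quotient, because both limits that are needed, the exhaustion by truncated
  domains and the shrinking of the discs, take place in it. In signature (1,2) the variables satisfy
  2 a <= p^2. Then p and a are both controlled by the majorant p^2 - a, which is why functions of
  (p, a) can be estimated without reference to the lattice. The operator xi is antilinear while the
  lifts are linear in f; hence the right-hand sides contain \<open>cnj (f z)\<close>. The same
  conjugation exchanges the two signs of A = +- i pi u.\<close>

lemmas bochner_cong = Bochner_Integration.integral_cong and bochner_bound = Bochner_Integration.integrable_bound

abbreviation \<mu> :: "complex measure" where
 "\<mu> \<equiv> hyp_measure"

abbreviation hyp_int :: "complex set \<Rightarrow> (complex \<Rightarrow> 'a) \<Rightarrow> 'a :: {banach, second_countable_topology}" where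
 "hyp_int S h \<equiv> set_lebesgue_integral hyp_measure S h"

abbreviation uhp_measurable :: "(complex \<Rightarrow> 'a :: real_normed_vector) \<Rightarrow> bool" where
 "uhp_measurable h \<equiv> set_borel_measurable borel uhp h"

definition SL2R :: "mat2 set" where
 "SL2R = {g. det g = 1}"

lemma mat2_nth [simp]:
 "mat2 a b c e $ 1 $ 1 = a" "mat2 a b c e $ 1 $ 2 = b"
 "mat2 a b c e $ 2 $ 1 = c" "mat2 a b c e $ 2 $ 2 = e"
 by (simp_all add: mat2_def)

lemma mat2_eq_iff: "(X :: mat2) = Y \<longleftrightarrow> X $ 1 $ 1 = Y $ 1 $ 1 \<and> X $ 1 $ 2 = Y $ 1 $ 2 \<and>
  X $ 2 $ 1 = Y $ 2 $ 1 \<and> X $ 2 $ 2 = Y $ 2 $ 2"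
 by (auto simp: vec_eq_iff forall_2)

lemma mm_nth [simp]: "((X :: mat2) ** Y) $ i $ j = X $ i $ 1 * Y $ 1 $ j + X $ i $ 2 * Y $ 2 $ j"
 by (simp add: matrix_matrix_mult_def sum_2)

lemma mat1_nth [simp]: "(mat 1 :: mat2) $ 1 $ 1 = 1" "(mat 1 :: mat2) $ 1 $ 2 = 0"
 "(mat 1 :: mat2) $ 2 $ 1 = 0" "(mat 1 :: mat2) $ 2 $ 2 = 1"
 by (simp_all add: mat_def)

lemma det_mat2: "det (X :: mat2) = X $ 1 $ 1 * X $ 2 $ 2 - X $ 1 $ 2 * X $ 2 $ 1"
 by (simp add: det_2)

lemma SL2R_det: "g \<in> SL2R \<Longrightarrow> g $ 1 $ 1 * g $ 2 $ 2 - g $ 1 $ 2 * g $ 2 $ 1 = 1"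
 by (simp add: SL2R_def det_mat2)

lemma SL2R_I: "g $ 1 $ 1 * g $ 2 $ 2 - g $ 1 $ 2 * g $ 2 $ 1 = 1 \<Longrightarrow> g \<in> SL2R"
 by (simp add: SL2R_def det_mat2)

text \<open>\<open>matrix_inv\<close> is a choice among two-sided inverses; the adjugate is one of
  them when the determinant is 1, and inverses are unique.\<close>

lemma matrix_inv_SL2R:
 assumes "g \<in> SL2R"
 shows "matrix_inv g = mat2 (g $ 2 $ 2) (- g $ 1 $ 2) (- g $ 2 $ 1) (g $ 1 $ 1)"
proof -
 let ?h = "mat2 (g $ 2 $ 2) (- g $ 1 $ 2) (- g $ 2 $ 1) (g $ 1 $ 1)"
 have 1: "g ** ?h = mat 1" "?h ** g = mat 1"
  using SL2R_det[OF assms] by (auto simp: mat2_eq_iff algebra_simps)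
 have "g ** matrix_inv g = mat 1 \<and> matrix_inv g ** g = mat 1"
  unfolding matrix_inv_def by (rule someI[of _ ?h]) (use 1 in auto)
 then have "matrix_inv g = ?h"
  by (metis 1 matrix_mul_assoc matrix_mul_lid matrix_mul_rid)
 then show ?thesis .
qed

lemma SL2R_inv:
 assumes "g \<in> SL2R"
 shows "matrix_inv g \<in> SL2R" "g ** matrix_inv g = mat 1" "matrix_inv g ** g = mat 1"
  "matrix_inv (matrix_inv g) = g"
proof -
 show *: "matrix_inv g \<in> SL2R"
  using SL2R_det[OF assms] by (intro SL2R_I) (simp add: matrix_inv_SL2R[OF assms] mult.commute)
 show "g ** matrix_inv g = mat 1" "matrix_inv g ** g = mat 1"
  using SL2R_det[OF assms] by (simp_all add: matrix_inv_SL2R[OF assms] mat2_eq_iff algebra_simps)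
 show "matrix_inv (matrix_inv g) = g"
  by (subst matrix_inv_SL2R[OF *]) (simp add: matrix_inv_SL2R[OF assms] mat2_eq_iff)
qed

lemma SL2R_mult: "g \<in> SL2R \<Longrightarrow> h \<in> SL2R \<Longrightarrow> g ** h \<in> SL2R"
 by (simp add: SL2R_def det_mul)

lemma SL2R_one: "mat 1 \<in> SL2R" "- mat 1 \<in> SL2R"
 by (auto intro: SL2R_I)

lemma matrix_inv_mult: "g \<in> SL2R \<Longrightarrow> h \<in> SL2R \<Longrightarrow> matrix_inv (g ** h) = matrix_inv h ** matrix_inv g"
 by (simp add: matrix_inv_SL2R SL2R_mult mat2_eq_iff algebra_simps)

lemma uhp_iff: "z \<in> uhp \<longleftrightarrow> Im z > 0"
 by (simp add: uhp_def)

text \<open>The automorphy factor. Its absolute square is the quotient of the imaginary parts of z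
  and of its image.\<close>

definition den :: "mat2 \<Rightarrow> complex \<Rightarrow> complex" where
 "den g z = of_real (g $ 2 $ 1) * z + of_real (g $ 2 $ 2)"

lemma den_nz:
 assumes "g \<in> SL2R" "z \<in> uhp"
 shows "den g z \<noteq> 0"
proof
 assume "den g z = 0"
 then have "g $ 2 $ 1 * Im z = 0" "g $ 2 $ 1 * Re z + g $ 2 $ 2 = 0"
  by (auto simp: den_def complex_eq_iff)
 then have "g $ 2 $ 1 = 0" "g $ 2 $ 2 = 0"
  using assms(2) by (auto simp: uhp_iff)
 then show False using SL2R_det[OF assms(1)] by simp
qed

lemma cmod_den_sq: "(cmod (den g z))\<^sup>2 = (g $ 2 $ 1 * Re z + g $ 2 $ 2)\<^sup>2 + (g $ 2 $ 1 * Im z)\<^sup>2"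
 by (simp add: den_def cmod_power2)

lemma Im_moebius:
 assumes "g \<in> SL2R" "z \<in> uhp"
 shows "Im (moebius g z) = Im z / (cmod (den g z))\<^sup>2"
proof -
 have "Im (moebius g z) = (g $ 1 $ 1 * g $ 2 $ 2 - g $ 1 $ 2 * g $ 2 $ 1) * Im z / (cmod (den g z))\<^sup>2"
  by (simp add: moebius_def Im_divide cmod_den_sq algebra_simps)
 then show ?thesis using SL2R_det[OF assms(1)] by simp
qed

lemma Re_moebius:
 assumes "g \<in> SL2R" "z \<in> uhp"
 shows "Re (moebius g z) = (g $ 1 $ 1 * g $ 2 $ 1 * (cmod z)\<^sup>2 +
  (g $ 1 $ 1 * g $ 2 $ 2 + g $ 1 $ 2 * g $ 2 $ 1) * Re z + g $ 1 $ 2 * g $ 2 $ 2) / (cmod (den g z))\<^sup>2"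
 unfolding cmod_den_sq unfolding cmod_power2 moebius_def Re_divide
 by (simp add: power2_eq_square algebra_simps)

lemma cmod_moebius:
 assumes "g \<in> SL2R" "z \<in> uhp"
 shows "(cmod (moebius g z))\<^sup>2 = ((g $ 1 $ 1 * Re z + g $ 1 $ 2)\<^sup>2 + (g $ 1 $ 1 * Im z)\<^sup>2) / (cmod (den g z))\<^sup>2"
 by (simp add: moebius_def norm_divide power_divide den_def[symmetric])
   (simp add: cmod_power2)

lemma moebius_uhp [intro]: "g \<in> SL2R \<Longrightarrow> z \<in> uhp \<Longrightarrow> moebius g z \<in> uhp"
 using den_nz[of g z] by (simp add: uhp_iff Im_moebius)

text \<open>By the cocycle relation of \<open>den\<close> (the fact \<open>e\<close>), numerator and
  denominator of the outer fraction can both be multiplied by \<open>den h z\<close>, which clears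
  the inner fraction.\<close>

lemma moebius_mult:
 assumes "g \<in> SL2R" "h \<in> SL2R" "z \<in> uhp"
 shows "moebius (g ** h) z = moebius g (moebius h z)"
proof -
 have nz: "den h z \<noteq> 0" "den (g ** h) z \<noteq> 0"
  using assms den_nz SL2R_mult by blast+
 have e: "den g (moebius h z) * den h z = den (g ** h) z"
  using nz(1) by (simp add: den_def moebius_def field_simps)
 have m: "moebius h z * den h z = of_real (h $ 1 $ 1) * z + of_real (h $ 1 $ 2)"
  using nz(1) by (simp add: moebius_def den_def)
 have "moebius g (moebius h z) =
   ((of_real (g $ 1 $ 1) * moebius h z + of_real (g $ 1 $ 2)) * den h z) / (den g (moebius h z) * den h z)"
  using nz(1) by (simp add: moebius_def[of g] den_def[of g, symmetric])
 also have "(of_real (g $ 1 $ 1) * moebius h z + of_real (g $ 1 $ 2)) * den h z =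
   of_real ((g ** h) $ 1 $ 1) * z + of_real ((g ** h) $ 1 $ 2)"
  by (simp only: distrib_right mult.assoc m) (simp add: den_def algebra_simps)
 finally show ?thesis
  unfolding e moebius_def[of "g ** h"] den_def[of "g ** h"] by (rule sym)
qed

lemma moebius_one [simp]: "moebius (mat 1) z = z" "moebius (- mat 1) z = z"
 by (simp_all add: moebius_def)

lemma moebius_uminus: "moebius (- g) z = moebius g z"
proof -
 have "moebius (- g) z = - (of_real (g $ 1 $ 1) * z + of_real (g $ 1 $ 2)) / - (of_real (g $ 2 $ 1) * z + of_real (g $ 2 $ 2))"
  by (simp add: moebius_def)
 then show ?thesis by (simp only: minus_divide_divide moebius_def)
qed

lemma moebius_inv [simp]:
 assumes "g \<in> SL2R" "z \<in> uhp"
 shows "moebius g (moebius (matrix_inv g) z) = z" "moebius (matrix_inv g) (moebius g z) = z"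
 using assms by (metis SL2R_inv moebius_mult moebius_one(1))+

lemma moebius_measurable [measurable]: "moebius g \<in> borel_measurable borel"
 unfolding moebius_def[abs_def] by measurable

section \<open>The invariant measure\<close>

lemma sets_hyp [measurable_cong, simp]: "sets \<mu> = sets borel"
 by (simp add: hyp_measure_def)

lemma space_hyp [simp]: "space \<mu> = UNIV"
 by (simp add: hyp_measure_def)

lemma uhp_borel [measurable]: "uhp \<in> sets borel"
proof -
 have "uhp = {z \<in> space borel. Im z > 0}" by (auto simp: uhp_def)
 also have "\<dots> \<in> sets borel" by measurable
 finally show ?thesis .
qed

lemma AE_uhp: "AE z in \<mu>. z \<in> uhp"
 unfolding hyp_measure_def by (subst AE_density) (auto intro!: AE_I2 simp: indicator_def)

lemma AE_hyp_iff:
 "(AE z in \<mu>. P z) \<longleftrightarrow> (AE z in lborel. z \<in> uhp \<longrightarrow> P z)"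
proof -
 have "(AE z in \<mu>. P z) \<longleftrightarrow> (AE z in lborel. 0 < ennreal (indicator uhp z / (Im z)\<^sup>2) \<longrightarrow> P z)"
  unfolding hyp_measure_def by (rule AE_density) measurable
 also have "\<dots> \<longleftrightarrow> (AE z in lborel. z \<in> uhp \<longrightarrow> P z)"
  by (rule AE_cong) (auto simp: indicator_def uhp_iff)
 finally show ?thesis .
qed

section \<open>Cartesian coordinates and the inversion\<close>

lemma Complex_measurable [measurable]: "(\<lambda>p. Complex (fst p) (snd p)) \<in> borel_measurable (borel \<Otimes>\<^sub>M borel)"
proof -
 have "(\<lambda>p. of_real (fst p) + \<i> * of_real (snd p)) \<in> borel_measurable (borel \<Otimes>\<^sub>M borel)"
  by measurable
 then show ?thesis by (simp add: Complex_eq[abs_def] cong: measurable_cong)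
qed

lemma Complex_measurable' [measurable (raw)]:
 assumes [measurable]: "f \<in> borel_measurable M" "g \<in> borel_measurable M"
 shows "(\<lambda>p. Complex (f p) (g p)) \<in> borel_measurable M"
proof -
 have "(\<lambda>p. of_real (f p) + \<i> * of_real (g p)) \<in> borel_measurable M"
  by measurable
 then show ?thesis by (simp add: Complex_eq)
qed

text \<open>Makes iterated integration in x and y available: a Borel measure that gives every box
  its volume is Lebesgue measure, and preimages of boxes are rectangles.\<close>

lemma lborel_complex_eq: "lborel = distr (lborel \<Otimes>\<^sub>M lborel) borel (\<lambda>p. Complex (fst p) (snd p))"
proof (rule lborel_eqI)
 fix l u :: complex assume "\<And>b. b \<in> Basis \<Longrightarrow> l \<bullet> b \<le> u \<bullet> b"
 from this[of 1] this[of \<i>] have le: "Re l \<le> Re u" "Im l \<le> Im u"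
  by (auto simp: Basis_complex_def inner_complex_def)
 have vi: "(\<lambda>p. Complex (fst p) (snd p)) -` box l u \<inter> space (lborel \<Otimes>\<^sub>M lborel) =
   {Re l<..<Re u} \<times> {Im l<..<Im u}"
  by (auto simp: box_def Basis_complex_def inner_complex_def space_pair_measure)
 have "emeasure (distr (lborel \<Otimes>\<^sub>M lborel) borel (\<lambda>p. Complex (fst p) (snd p))) (box l u) =
   emeasure (lborel \<Otimes>\<^sub>M lborel) ({Re l<..<Re u} \<times> {Im l<..<Im u})"
  by (subst emeasure_distr) (auto simp: vi)
 also have "\<dots> = ennreal (Re u - Re l) * ennreal (Im u - Im l)"
  using le by (simp add: lborel.emeasure_pair_measure_Times)
 finally show "emeasure (distr (lborel \<Otimes>\<^sub>M lborel) borel (\<lambda>p. Complex (fst p) (snd p))) (box l u) =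
   ennreal (\<Prod>b\<in>Basis. (u - l) \<bullet> b)"
  using le by (simp add: Basis_complex_def inner_complex_def ennreal_mult complex_eq_iff)
qed simp

lemma nn_integral_complex:
 assumes [measurable]: "f \<in> borel_measurable borel"
 shows "(\<integral>\<^sup>+z. f z \<partial>lborel) = (\<integral>\<^sup>+y. \<integral>\<^sup>+x. f (Complex x y) \<partial>lborel \<partial>lborel)"
proof -
 have "(\<integral>\<^sup>+z. f z \<partial>lborel) = (\<integral>\<^sup>+p. f (Complex (fst p) (snd p)) \<partial>(lborel \<Otimes>\<^sub>M lborel))"
  by (subst lborel_complex_eq) (simp add: nn_integral_distr)
 also have "\<dots> = (\<integral>\<^sup>+y. \<integral>\<^sup>+x. f (Complex x y) \<partial>lborel \<partial>lborel)"
  by (subst lborel_pair.nn_integral_snd[symmetric]) (auto simp: split_beta')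
 finally show ?thesis .
qed

lemma nn_integral_hyp:
 assumes [measurable]: "f \<in> borel_measurable borel"
 shows "(\<integral>\<^sup>+z. f z \<partial>\<mu>) =
  (\<integral>\<^sup>+y. ennreal (indicator {0<..} y / y\<^sup>2) * (\<integral>\<^sup>+x. f (Complex x y) \<partial>lborel) \<partial>lborel)"
proof -
 have "(\<integral>\<^sup>+z. f z \<partial>\<mu>) = (\<integral>\<^sup>+z. ennreal (indicator uhp z / (Im z)\<^sup>2) * f z \<partial>lborel)"
  unfolding hyp_measure_def by (subst nn_integral_density) auto
 also have "\<dots> = (\<integral>\<^sup>+y. \<integral>\<^sup>+x. ennreal (indicator {0<..} y / y\<^sup>2) * f (Complex x y) \<partial>lborel \<partial>lborel)"
  by (subst nn_integral_complex)
    (auto intro!: nn_integral_cong simp: indicator_def uhp_def)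
 also have "\<dots> = (\<integral>\<^sup>+y. ennreal (indicator {0<..} y / y\<^sup>2) * (\<integral>\<^sup>+x. f (Complex x y) \<partial>lborel) \<partial>lborel)"
  by (intro nn_integral_cong nn_integral_cmult) auto
 finally show ?thesis .
qed

text \<open>The inversion y -> 1 / y is decreasing, so it is split into the reflection y -> -y and
  the increasing map y -> -1 / y, to which the substitution rule applies. The measure dy / y is
  preserved.\<close>

lemma nn_integral_inverse_interval:
 fixes q :: "real \<Rightarrow> ennreal"
 assumes [measurable]: "q \<in> borel_measurable borel" and "0 < a" "a < b"
 shows "(\<integral>\<^sup>+y. q (1 / y) * ennreal (1 / y) * indicator {a..b} y \<partial>lborel) =
     (\<integral>\<^sup>+y. q y * ennreal (1 / y) * indicator {1/b..1/a} y \<partial>lborel)"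
proof -
 have "(\<integral>\<^sup>+y. q y * ennreal (1 / y) * indicator {1/b..1/a} y \<partial>lborel) =
   (\<integral>\<^sup>+y. q (- y) * ennreal (1 / (- y)) * indicator {-1/a..-1/b} y \<partial>lborel)"
  by (subst nn_integral_real_affine[of _ "-1" 0])
    (auto intro!: nn_integral_cong simp: indicator_def)
 also have "\<dots> = (\<integral>\<^sup>+y. (q (1 / y) * ennreal y) * (1 / y\<^sup>2) * indicator {a..b} y \<partial>lborel)"
  using assms
  by (subst nn_integral_substitution_aux[where g = "\<lambda>x. -1/x" and g' = "\<lambda>x. 1/x\<^sup>2"])
    (auto intro!: derivative_eq_intros continuous_intros simp: power2_eq_square field_simps)
 also have "\<dots> = (\<integral>\<^sup>+y. q (1 / y) * ennreal (1 / y) * indicator {a..b} y \<partial>lborel)"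
  using assms
  by (intro nn_integral_cong)
    (auto simp: indicator_def power2_eq_square mult.assoc ennreal_mult[symmetric])
 finally show ?thesis by simp
qed

text \<open>The intervals [1 / (n + 2), n + 2] exhaust the half line and are mapped to themselves by
  the inversion, so monotone convergence reduces to one interval. The summand 2 keeps them
  nondegenerate for every n.\<close>

lemma nn_integral_inverse:
 fixes q :: "real \<Rightarrow> ennreal"
 assumes [measurable]: "q \<in> borel_measurable borel"
 shows "(\<integral>\<^sup>+y. q (1 / y) * ennreal (indicator {0<..} y / y) \<partial>lborel) =
     (\<integral>\<^sup>+y. q y * ennreal (indicator {0<..} y / y) \<partial>lborel)"
proof -
 have *: "(\<integral>\<^sup>+y. p y * ennreal (indicator {0<..} y / y) \<partial>lborel) =
   (SUP n::nat. (\<integral>\<^sup>+y. p y * ennreal (1 / y) * indicator {1 / (real n + 2)..real n + 2} y \<partial>lborel))"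
  if [measurable]: "p \<in> borel_measurable borel" for p
 proof -
  have inc: "incseq (\<lambda>n y. p y * ennreal (1 / y) * indicator {1 / (real n + 2)..real n + 2} y)"
  proof (rule incseq_SucI, rule le_funI)
   fix n :: nat and y :: real
   have "1 / (real (Suc n) + 2) \<le> 1 / (real n + 2)" by (simp add: field_simps)
   then show "p y * ennreal (1 / y) * indicator {1 / (real n + 2)..real n + 2} y \<le>
      p y * ennreal (1 / y) * indicator {1 / (real (Suc n) + 2)..real (Suc n) + 2} y"
    by (auto simp: indicator_def split: if_splits)
  qed
  have sup: "(SUP n::nat. p y * ennreal (1 / y) * indicator {1 / (real n + 2)..real n + 2} y) =
    p y * ennreal (indicator {0<..} y / y)" for y
  proof (cases "y > 0")
   case True
   obtain n1 :: nat where n1: "y \<le> real n1" using real_arch_simple by blast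
   obtain n2 :: nat where n2: "1 / y \<le> real n2" using real_arch_simple by blast
   have "y \<in> {1 / (real (n1 + n2) + 2)..real (n1 + n2) + 2}"
   proof -
    have "1 \<le> y * real n2" using n2 True by (simp add: field_simps)
    also have "\<dots> \<le> y * (real (n1 + n2) + 2)" using True by simp
    finally have "1 / (real (n1 + n2) + 2) \<le> y"
     by (subst pos_divide_le_eq) (auto simp: mult.commute)
    then show ?thesis using n1 by auto
   qed
   then have "p y * ennreal (1 / y) \<le> (SUP n::nat. p y * ennreal (1 / y) * indicator {1 / (real n + 2)..real n + 2} y)"
    by (intro SUP_upper2[of "n1 + n2"]) auto
   moreover have "(SUP n::nat. p y * ennreal (1 / y) * indicator {1 / (real n + 2)..real n + 2} y) \<le> p y * ennreal (1 / y)"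
    by (intro SUP_least) (auto simp: indicator_def)
   ultimately show ?thesis using True by (simp add: indicator_def)
  next
   case False
   have "y \<notin> {1 / (real n + 2)..real n + 2}" for n
   proof -
    have "0 < 1 / (real n + 2)" by simp
    then show ?thesis using False by (simp only: atLeastAtMost_iff) linarith
   qed
   then show ?thesis using False by (simp add: indicator_def)
  qed
  show ?thesis
   by (subst nn_integral_monotone_convergence_SUP[symmetric, OF inc]) (auto simp: sup)
 qed
 have "(\<integral>\<^sup>+y. q (1 / y) * ennreal (1 / y) * indicator {1 / (real n + 2)..real n + 2} y \<partial>lborel) =
   (\<integral>\<^sup>+y. q y * ennreal (1 / y) * indicator {1 / (real n + 2)..real n + 2} y \<partial>lborel)" for n :: nat
 proof -
  have "1 / (real n + 2) < 1" "1 < real n + 2" by auto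
  then have "1 / (real n + 2) < real n + 2" by linarith
  then show ?thesis
   using nn_integral_inverse_interval[of q "1 / (real n + 2)" "real n + 2"] by simp
 qed
 then show ?thesis using *[of q] *[of "\<lambda>y. q (1 / y)"] by simp
qed

text \<open>In the coordinates t = x / y and y the invariant measure is dt dy / y, and z -> -1 / z
  becomes (t, y) -> (-t, c / y) with c = 1 / (1 + t^2).\<close>

lemma nn_integral_hyp':
 assumes [measurable]: "f \<in> borel_measurable borel"
 shows "(\<integral>\<^sup>+z. f z \<partial>\<mu>) =
  (\<integral>\<^sup>+t. \<integral>\<^sup>+y. f (Complex (y * t) y) * ennreal (indicator {0<..} y / y) \<partial>lborel \<partial>lborel)"
proof -
 have "(\<integral>\<^sup>+z. f z \<partial>\<mu>) =
   (\<integral>\<^sup>+y. \<integral>\<^sup>+t. f (Complex (y * t) y) * ennreal (indicator {0<..} y / y) \<partial>lborel \<partial>lborel)"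
 proof (subst nn_integral_hyp[OF assms], rule nn_integral_cong)
  fix y :: real
  show "ennreal (indicator {0<..} y / y\<^sup>2) * (\<integral>\<^sup>+x. f (Complex x y) \<partial>lborel) =
    (\<integral>\<^sup>+t. f (Complex (y * t) y) * ennreal (indicator {0<..} y / y) \<partial>lborel)"
  proof (cases "y > 0")
   case True
   have "(\<integral>\<^sup>+x. f (Complex x y) \<partial>lborel) = ennreal y * (\<integral>\<^sup>+t. f (Complex (y * t) y) \<partial>lborel)"
    using True by (subst nn_integral_real_affine[of _ y 0]) auto
   moreover have "ennreal (1 / y\<^sup>2) * ennreal y = ennreal (1 / y)"
    using True by (simp add: ennreal_mult[symmetric] power2_eq_square)
   ultimately show ?thesis using True
    by (simp add: nn_integral_multc mult.assoc[symmetric]) (simp add: mult.commute)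
  qed simp
 qed
 also have "\<dots> = (\<integral>\<^sup>+t. \<integral>\<^sup>+y. f (Complex (y * t) y) * ennreal (indicator {0<..} y / y) \<partial>lborel \<partial>lborel)"
  by (rule lborel_pair.Fubini') (auto simp: split_beta')
 finally show ?thesis .
qed

text \<open>For a fixed slope t the heights are mapped by y -> c / y, the composite of an inversion
  and a scaling, both of which preserve dy / y. The change of sign of t is a reflection.\<close>

lemma nn_integral_hyp_inversion:
 assumes [measurable]: "f \<in> borel_measurable borel"
 shows "(\<integral>\<^sup>+z. f (- 1 / z) \<partial>\<mu>) = (\<integral>\<^sup>+z. f z \<partial>\<mu>)"
proof -
 have [measurable]: "(\<lambda>z::complex. f (- 1 / z)) \<in> borel_measurable borel"
  by measurable
 have "(\<integral>\<^sup>+z. f (- 1 / z) \<partial>\<mu>) =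
   (\<integral>\<^sup>+t. \<integral>\<^sup>+y. f (Complex (y * (-t)) y) * ennreal (indicator {0<..} y / y) \<partial>lborel \<partial>lborel)"
 proof (subst nn_integral_hyp', measurable, rule nn_integral_cong)
  fix t :: real
  define c where "c = 1 / (1 + t\<^sup>2)"
  have c: "c > 0" by (auto simp: c_def add_pos_nonneg)
  have "(\<integral>\<^sup>+y. f (-1 / Complex (y * t) y) * ennreal (indicator {0<..} y / y) \<partial>lborel) =
    (\<integral>\<^sup>+y. f (Complex (c * (1 / y) * (-t)) (c * (1/y))) * ennreal (indicator {0<..} y / y) \<partial>lborel)"
  proof (rule nn_integral_cong)
   fix y :: real
   have "-1 / Complex (y * t) y = Complex (c * (1 / y) * (-t)) (c * (1/y))" if "y > 0"
   proof -
    have "(y * t)\<^sup>2 + y\<^sup>2 = y\<^sup>2 * (1 + t\<^sup>2)" by (simp add: algebra_simps power2_eq_square)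
    then show ?thesis using that c
     by (simp add: complex_eq_iff Re_divide Im_divide c_def) (simp add: power2_eq_square)
   qed
   then show "f (-1 / Complex (y * t) y) * ennreal (indicator {0<..} y / y) =
     f (Complex (c * (1 / y) * (-t)) (c * (1/y))) * ennreal (indicator {0<..} y / y)"
    by (auto simp: indicator_def)
  qed
  also have "\<dots> = (\<integral>\<^sup>+y. f (Complex (c * y * (-t)) (c * y)) * ennreal (indicator {0<..} y / y) \<partial>lborel)"
   by (rule nn_integral_inverse[of "\<lambda>y. f (Complex (c * y * (-t)) (c * y))"]) measurable
  also have "\<dots> = (\<integral>\<^sup>+y. f (Complex (y * (-t)) y) * ennreal (indicator {0<..} y / y) \<partial>lborel)"
  proof (subst nn_integral_real_affine[of "\<lambda>y. f (Complex (y * (-t)) y) * ennreal (indicator {0<..} y / y)" c 0])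
   show "(\<integral>\<^sup>+y. f (Complex (c * y * (-t)) (c * y)) * ennreal (indicator {0<..} y / y) \<partial>lborel) =
    ennreal \<bar>c\<bar> * (\<integral>\<^sup>+x. f (Complex ((0 + c * x) * - t) (0 + c * x)) * ennreal (indicator {0<..} (0 + c * x) / (0 + c * x)) \<partial>lborel)"
   proof (subst nn_integral_cmult[symmetric], measurable, rule nn_integral_cong)
    fix y :: real
    have "ennreal (indicator {0<..} y / y) = ennreal \<bar>c\<bar> * ennreal (indicator {0<..} (0 + c * y) / (0 + c * y))"
     using c by (auto simp: indicator_def ennreal_mult[symmetric] zero_less_mult_iff)
    then show "f (Complex (c * y * (-t)) (c * y)) * ennreal (indicator {0<..} y / y) =
     ennreal \<bar>c\<bar> * (f (Complex ((0 + c * y) * - t) (0 + c * y)) * ennreal (indicator {0<..} (0 + c * y) / (0 + c * y)))"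
     by (simp add: ac_simps)
   qed
  qed (use c in auto)
  finally show "(\<integral>\<^sup>+y. f (-1 / Complex (y * t) y) * ennreal (indicator {0<..} y / y) \<partial>lborel) = \<dots>" .
 qed
 also have "\<dots> = (\<integral>\<^sup>+t. \<integral>\<^sup>+y. f (Complex (y * t) y) * ennreal (indicator {0<..} y / y) \<partial>lborel \<partial>lborel)"
  by (subst nn_integral_real_affine[of _ "-1" 0]) auto
 also have "\<dots> = (\<integral>\<^sup>+z. f z \<partial>\<mu>)"
  by (rule nn_integral_hyp'[symmetric]) measurable
 finally show ?thesis .
qed

lemma nn_integral_hyp_affine:
 assumes [measurable]: "f \<in> borel_measurable borel" and r: "r > 0"
 shows "(\<integral>\<^sup>+z. f (of_real r * z + of_real b) \<partial>\<mu>) = (\<integral>\<^sup>+z. f z \<partial>\<mu>)"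
proof -
 define g where "g = (\<lambda>y. ennreal (indicator {0<..} y / y\<^sup>2) * (\<integral>\<^sup>+x. f (Complex x y) \<partial>lborel))"
 have [measurable]: "g \<in> borel_measurable borel" unfolding g_def by measurable
 have "(\<integral>\<^sup>+z. f (of_real r * z + of_real b) \<partial>\<mu>) = (\<integral>\<^sup>+y. r * g (0 + r * y) \<partial>lborel)"
 proof (subst nn_integral_hyp, measurable, rule nn_integral_cong)
  fix y :: real
  have "(\<integral>\<^sup>+x. f (Complex x (r * y)) \<partial>lborel) = ennreal r * (\<integral>\<^sup>+x. f (Complex (b + r * x) (r * y)) \<partial>lborel)"
   using r by (subst nn_integral_real_affine[of _ r b]) auto
  moreover have "of_real r * Complex x y + of_real b = Complex (b + r * x) (r * y)" for x
   by (simp add: complex_eq_iff)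
  moreover have "ennreal (indicator {0<..} y / y\<^sup>2) = ennreal r * (ennreal (indicator {0<..} (r * y) / (r * y)\<^sup>2) * ennreal r)"
   using r by (auto simp: indicator_def ennreal_mult[symmetric] zero_less_mult_iff power2_eq_square)
  ultimately show "ennreal (indicator {0<..} y / y\<^sup>2) * (\<integral>\<^sup>+x. f (of_real r * Complex x y + of_real b) \<partial>lborel) =
    ennreal r * g (0 + r * y)"
   by (simp add: g_def mult.assoc)
 qed
 also have "\<dots> = (\<integral>\<^sup>+y. g y \<partial>lborel)"
  using r by (subst nn_integral_real_affine[of g r 0]) (auto simp: nn_integral_cmult)
 also have "\<dots> = (\<integral>\<^sup>+z. f z \<partial>\<mu>)"
  by (simp add: nn_integral_hyp g_def)
 finally show ?thesis .
qed

text \<open>Bruhat decomposition. For lower left entry 0 the map is affine; otherwise g z = a / c -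
  1 / (c^2 (z + e / c)), where a and e are the diagonal entries and c is the lower left one. This is
  a translation, the inversion and an affine map.\<close>

theorem nn_integral_hyp_moebius:
 assumes [measurable]: "f \<in> borel_measurable borel" and g: "g \<in> SL2R"
 shows "(\<integral>\<^sup>+z. f (moebius g z) \<partial>\<mu>) = (\<integral>\<^sup>+z. f z \<partial>\<mu>)"
proof (cases "g $ 2 $ 1 = 0")
 case True
 define a where "a = g $ 1 $ 1"
 have 1: "a * g $ 2 $ 2 = 1" using SL2R_det[OF g] True by (simp add: a_def)
 then have a: "a \<noteq> 0" by auto
 with 1 have a: "a \<noteq> 0" "g $ 2 $ 2 = 1 / a" by (auto simp: field_simps)
 have "moebius g z = of_real (a\<^sup>2) * z + of_real (a * g $ 1 $ 2)" for z
  using a by (simp add: moebius_def True a_def[symmetric] algebra_simps power2_eq_square)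
 then show ?thesis using nn_integral_hyp_affine[OF assms(1), of "a\<^sup>2" "a * g $ 1 $ 2"] a by simp
next
 case False
 define c where "c = g $ 2 $ 1"
 have c: "c \<noteq> 0" using False by (simp add: c_def)
 define f1 where "f1 = (\<lambda>z. f (of_real (1 / c\<^sup>2) * z + of_real (g $ 1 $ 1 / c)))"
 have [measurable]: "f1 \<in> borel_measurable borel" unfolding f1_def by measurable
 have "(\<integral>\<^sup>+z. f (moebius g z) \<partial>\<mu>) = (\<integral>\<^sup>+z. f1 (-1 / (of_real 1 * z + of_real (g $ 2 $ 2 / c))) \<partial>\<mu>)"
 proof (rule nn_integral_cong_AE, rule AE_mp[OF AE_uhp], rule AE_I2, rule impI)
  fix z assume z: "z \<in> uhp"
  have nz: "of_real c * z + of_real (g $ 2 $ 2) \<noteq> 0" using den_nz[OF g z] by (simp add: den_def c_def)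
  have "z + of_real (g $ 2 $ 2 / c) = (of_real c * z + of_real (g $ 2 $ 2)) / of_real c"
   using c by (simp add: field_simps)
  moreover have "complex_of_real (g $ 1 $ 1) * of_real (g $ 2 $ 2) = 1 + of_real c * of_real (g $ 1 $ 2)"
  proof -
   have "g $ 1 $ 1 * g $ 2 $ 2 = 1 + c * g $ 1 $ 2"
    using SL2R_det[OF g] by (simp add: c_def algebra_simps)
   from arg_cong[OF this, of complex_of_real] show ?thesis by simp
  qed
  moreover define w where "w = of_real c * z + of_real (g $ 2 $ 2)"
  ultimately have e: "of_real (g $ 1 $ 1) * w - 1 = of_real c * (of_real (g $ 1 $ 1) * z + of_real (g $ 1 $ 2))"
   and zc: "z + of_real (g $ 2 $ 2 / c) = w / of_real c"
   by (simp_all add: algebra_simps)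
  have w: "w \<noteq> 0" using nz by (simp add: w_def)
  have "of_real (1 / c\<^sup>2) * (-1 / (w / of_real c)) + of_real (g $ 1 $ 1 / c) =
    (of_real (g $ 1 $ 1) * w - 1) / (of_real c * w)"
   using w c by (simp add: field_simps power2_eq_square)
  also have "\<dots> = moebius g z"
   unfolding e using c w by (simp add: moebius_def c_def[symmetric] w_def[symmetric])
  finally have "moebius g z = of_real (1 / c\<^sup>2) * (-1 / (z + of_real (g $ 2 $ 2 / c))) + of_real (g $ 1 $ 1 / c)"
   unfolding zc by (rule sym)
  then show "f (moebius g z) = f1 (-1 / (of_real 1 * z + of_real (g $ 2 $ 2 / c)))"
   by (simp add: f1_def ac_simps)
 qed
 also have "\<dots> = (\<integral>\<^sup>+z. f1 (-1 / z) \<partial>\<mu>)"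
  by (rule nn_integral_hyp_affine[of "\<lambda>z. f1 (-1 / z)" 1]) auto
 also have "\<dots> = (\<integral>\<^sup>+z. f1 z \<partial>\<mu>)"
  by (rule nn_integral_hyp_inversion) measurable
 also have "\<dots> = (\<integral>\<^sup>+z. f z \<partial>\<mu>)"
  unfolding f1_def using c by (intro nn_integral_hyp_affine) auto
 finally show ?thesis .
qed

lemma distr_hyp_moebius:
 assumes g: "g \<in> SL2R"
 shows "distr \<mu> borel (moebius g) = \<mu>"
proof (rule measure_eqI)
 fix A assume "A \<in> sets (distr \<mu> borel (moebius g))"
 then have [measurable]: "A \<in> sets borel" by simp
 have "emeasure (distr \<mu> borel (moebius g)) A = (\<integral>\<^sup>+z. indicator A (moebius g z) \<partial>\<mu>)"
  by (simp add: nn_integral_distr flip: nn_integral_indicator)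
 also have "\<dots> = emeasure \<mu> A"
  by (subst nn_integral_hyp_moebius[OF _ g]) auto
 finally show "emeasure (distr \<mu> borel (moebius g)) A = emeasure \<mu> A" .
qed simp

lemma integral_hyp_moebius:
 fixes f :: "complex \<Rightarrow> 'a :: {banach, second_countable_topology}"
 assumes [measurable]: "f \<in> borel_measurable borel" and g: "g \<in> SL2R"
 shows "(\<integral>z. f (moebius g z) \<partial>\<mu>) = (\<integral>z. f z \<partial>\<mu>)"
 using integral_distr[of "moebius g" \<mu> borel f] by (simp add: distr_hyp_moebius[OF g])

lemma integrable_hyp_moebius:
 fixes f :: "complex \<Rightarrow> 'a :: {banach, second_countable_topology}"
 assumes [measurable]: "f \<in> borel_measurable borel" and g: "g \<in> SL2R"
 shows "integrable \<mu> (\<lambda>z. f (moebius g z)) \<longleftrightarrow> integrable \<mu> f"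
 using integrable_distr_eq[of "moebius g" \<mu> borel f] by (simp add: distr_hyp_moebius[OF g])

lemma AE_hyp_moebius:
 assumes g: "g \<in> SL2R" and "AE z in \<mu>. P z"
 shows "AE z in \<mu>. P (moebius g z)"
proof -
 from assms(2) obtain N where N: "{z. \<not> P z} \<subseteq> N" "N \<in> sets borel" "emeasure \<mu> N = 0"
  by (auto elim!: AE_E)
 have "AE z in distr \<mu> borel (moebius g). z \<notin> N"
  using N by (subst distr_hyp_moebius[OF g]) (auto intro!: AE_I[of _ _ N])
 then have "AE z in \<mu>. moebius g z \<notin> N"
  using N(2) by (subst (asm) AE_distr_iff) auto
 then show ?thesis by eventually_elim (use N in auto)
qed

lemma sigma_finite_hyp: "sigma_finite_measure \<mu>"
proof -
 show ?thesis unfolding hyp_measure_def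
  by (subst sigma_finite_measure.sigma_finite_iff_density_finite) (auto intro: sigma_finite_lborel)
qed

interpretation hyp: sigma_finite_measure \<mu>
 by (rule sigma_finite_hyp)

interpretation hyp_pair: pair_sigma_finite \<mu> \<mu> ..

section \<open>Congruence subgroups\<close>

definition mat_subgroup :: "mat2 set \<Rightarrow> bool" where
 "mat_subgroup H \<longleftrightarrow> H \<subseteq> SL2R \<and> mat 1 \<in> H \<and> (\<forall>g\<in>H. \<forall>h\<in>H. g ** h \<in> H) \<and> (\<forall>g\<in>H. matrix_inv g \<in> H)"

lemma mat_subgroupD:
 assumes "mat_subgroup H"
 shows "\<And>g. g \<in> H \<Longrightarrow> g \<in> SL2R" "mat 1 \<in> H" "\<And>g h. g \<in> H \<Longrightarrow> h \<in> H \<Longrightarrow> g ** h \<in> H"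
  "\<And>g. g \<in> H \<Longrightarrow> matrix_inv g \<in> H"
 using assms by (auto simp: mat_subgroup_def)

lemma SL2R_cancel:
 assumes "g \<in> SL2R"
 shows "matrix_inv g ** (g ** X) = X" "g ** (matrix_inv g ** X) = X"
  "(X ** matrix_inv g) ** g = X" "(X ** g) ** matrix_inv g = X"
proof -
 show "matrix_inv g ** (g ** X) = X" "g ** (matrix_inv g ** X) = X"
  by (simp_all only: matrix_mul_assoc SL2R_inv[OF assms] matrix_mul_lid)
 show "(X ** matrix_inv g) ** g = X" "(X ** g) ** matrix_inv g = X"
  by (simp_all only: matrix_mul_assoc[symmetric] SL2R_inv[OF assms] matrix_mul_rid)
qed

lemma bij_betw_matrix_inv:
 assumes "mat_subgroup H"
 shows "bij_betw matrix_inv H H"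
 by (rule bij_betwI[where g = matrix_inv])
   (use mat_subgroupD[OF assms] SL2R_inv(4) in auto)

lemma bij_betw_mult_right:
 assumes "mat_subgroup H" "h \<in> H"
 shows "bij_betw (\<lambda>g. g ** h) H H"
 by (rule bij_betwI[where g = "\<lambda>g. g ** matrix_inv h"])
   (use mat_subgroupD[OF assms(1)] assms(2) SL2R_cancel in auto)

text \<open>The set \<open>R\<close> represents left cosets of \<open>P\<close>; since every inverse
  of a group element lies in some r P, every element lies in P r^-1 for some r, and there are
  finitely many right cosets. The choice \<open>rep\<close> depends only on the right coset, because
  g and p g satisfy the same condition under the \<open>SOME\<close>.\<close>

lemma right_transversal:
 assumes P: "mat_subgroup P" and H: "mat_subgroup H" and "P \<subseteq> H" and "finite R"
  and HR: "H = {r ** p | r p. r \<in> R \<and> p \<in> P}" "R \<subseteq> H"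
 obtains I where "finite I" "I \<subseteq> H" "I \<noteq> {}" "bij_betw (\<lambda>(p, i). p ** i) (P \<times> I) H"
proof -
 define rep where "rep = (\<lambda>g. SOME h. h \<in> H \<and> g ** matrix_inv h \<in> P)"
 have rep: "rep g \<in> H" "g ** matrix_inv (rep g) \<in> P" if "g \<in> H" for g
 proof -
  have "\<exists>h. h \<in> H \<and> g ** matrix_inv h \<in> P"
   using that mat_subgroupD[OF H] mat_subgroupD[OF P] SL2R_inv by (intro exI[of _ g]) auto
  then have "rep g \<in> H \<and> g ** matrix_inv (rep g) \<in> P"
   unfolding rep_def by (rule someI_ex)
  then show "rep g \<in> H" "g ** matrix_inv (rep g) \<in> P" by auto
 qed
 have rep_mult: "rep (p ** g) = rep g" if "p \<in> P" "g \<in> H" for p g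
 proof -
  have "p ** g ** matrix_inv h \<in> P \<longleftrightarrow> g ** matrix_inv h \<in> P" for h
  proof
   assume "p ** g ** matrix_inv h \<in> P"
   then have "matrix_inv p ** (p ** g ** matrix_inv h) \<in> P"
    using that mat_subgroupD[OF P] by blast
   then show "g ** matrix_inv h \<in> P"
    using SL2R_cancel(1)[of p] that mat_subgroupD[OF P] by (simp add: matrix_mul_assoc[symmetric])
  next
   assume "g ** matrix_inv h \<in> P"
   then show "p ** g ** matrix_inv h \<in> P"
    using that mat_subgroupD[OF P] by (metis matrix_mul_assoc)
  qed
  then show ?thesis unfolding rep_def by simp
 qed
 have rep_rep: "rep (rep g) = rep g" if "g \<in> H" for g
 proof -
  have "rep ((g ** matrix_inv (rep g)) ** rep g) = rep (rep g)"
   using rep[OF that] by (intro rep_mult)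
  then show ?thesis using SL2R_cancel(3)[of "rep g" g] rep[OF that] mat_subgroupD[OF H] by simp
 qed
 let ?I = "rep ` H"
 have "?I \<subseteq> rep ` matrix_inv ` R"
 proof
  fix i assume "i \<in> ?I"
  then obtain g where g: "g \<in> H" "i = rep g" by auto
  then have "matrix_inv g \<in> H" using mat_subgroupD[OF H] by auto
  then obtain r p where rp: "r \<in> R" "p \<in> P" "matrix_inv g = r ** p" using HR by auto
  have S: "r \<in> SL2R" "p \<in> SL2R" "g \<in> SL2R" "r \<in> H"
   using rp(1,2) HR(2) g(1) mat_subgroupD(1)[OF P] mat_subgroupD(1)[OF H] by blast+
  have "g = matrix_inv p ** matrix_inv r"
   using rp(3) S by (metis SL2R_inv(4) matrix_inv_mult)
  then have "rep g = rep (matrix_inv r)"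
   using rep_mult rp S mat_subgroupD[OF P] mat_subgroupD[OF H] by auto
  then show "i \<in> rep ` matrix_inv ` R" using g rp by auto
 qed
 then have "finite ?I" using \<open>finite R\<close> finite_subset by blast
 moreover have "?I \<subseteq> H" using rep by auto
 moreover have "?I \<noteq> {}" using mat_subgroupD(2)[OF H] by auto
 moreover have "bij_betw (\<lambda>(p, i). p ** i) (P \<times> ?I) H"
 proof (rule bij_betwI')
  fix x y assume xy: "x \<in> P \<times> ?I" "y \<in> P \<times> ?I"
  obtain p i p' i' where e: "x = (p, i)" "y = (p', i')" by (cases x, cases y)
  have ii: "rep i = i" "rep i' = i'" "i \<in> H" "i' \<in> H" using xy e rep_rep rep by auto
  show "(case x of (p, i) \<Rightarrow> p ** i) = (case y of (p, i) \<Rightarrow> p ** i) \<longleftrightarrow> x = y"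
  proof
   assume "(case x of (p, i) \<Rightarrow> p ** i) = (case y of (p, i) \<Rightarrow> p ** i)"
   then have eq: "p ** i = p' ** i'" by (simp add: e)
   have "i = rep (p ** i)" using rep_mult ii xy e by auto
   also have "\<dots> = i'" using rep_mult ii xy e eq by auto
   finally have "i = i'" .
   moreover have "p = p'"
    using eq \<open>i = i'\<close> SL2R_cancel(4)[of i] ii mat_subgroupD[OF H] by metis
   ultimately show "x = y" by (simp add: e)
  qed auto
 next
  fix x assume "x \<in> P \<times> ?I"
  then show "(case x of (p, i) \<Rightarrow> p ** i) \<in> H"
   using rep \<open>P \<subseteq> H\<close> mat_subgroupD[OF H] by auto
 next
  fix g assume g: "g \<in> H"
  show "\<exists>x\<in>P \<times> ?I. g = (case x of (p, i) \<Rightarrow> p ** i)"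
   using rep[OF g] g SL2R_cancel(3)[of "rep g" g] mat_subgroupD[OF H]
   by (intro bexI[of _ "(g ** matrix_inv (rep g), rep g)"]) auto
 qed
 ultimately show ?thesis using that by blast
qed

section \<open>Integral matrices and principal congruence subgroups\<close>

definition int_mat :: "mat2 \<Rightarrow> bool" where
 "int_mat X \<longleftrightarrow> (\<forall>i j. X $ i $ j \<in> \<int>)"

lemma int_mat_iff: "int_mat X \<longleftrightarrow> X $ 1 $ 1 \<in> \<int> \<and> X $ 1 $ 2 \<in> \<int> \<and> X $ 2 $ 1 \<in> \<int> \<and> X $ 2 $ 2 \<in> \<int>"
 by (auto simp: int_mat_def forall_2)

lemma int_mat_intros [intro]:
 "int_mat X \<Longrightarrow> int_mat Y \<Longrightarrow> int_mat (X ** Y)" "int_mat X \<Longrightarrow> int_mat Y \<Longrightarrow> int_mat (X + Y)"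
 "int_mat (mat 1)" "int_mat X \<Longrightarrow> int_mat (real N *\<^sub>R X)"
 by (auto simp: int_mat_iff)

lemma SL2Z_iff: "g \<in> SL2Z \<longleftrightarrow> g \<in> SL2R \<and> int_mat g"
 by (auto simp: SL2Z_def SL2R_def int_mat_def)

lemma int_mat_inv: "g \<in> SL2R \<Longrightarrow> int_mat g \<Longrightarrow> int_mat (matrix_inv g)"
 by (simp add: matrix_inv_SL2R int_mat_iff)

lemma SL2Z_subgroup: "mat_subgroup SL2Z"
 using int_mat_inv by (auto simp: mat_subgroup_def SL2Z_iff SL2R_one SL2R_mult SL2R_inv intro: int_mat_intros)

text \<open>In the form 1 + N K, closure under products, inverses and conjugation becomes a
  statement about integral matrices K.\<close>

lemma principal_iff:
 "g \<in> principal_subgroup N \<longleftrightarrow> g \<in> SL2R \<and> (\<exists>K. int_mat K \<and> g = mat 1 + real N *\<^sub>R K)"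
proof
 assume g: "g \<in> principal_subgroup N"
 then have "\<forall>i j. \<exists>k :: int. g $ i $ j = (mat 1 :: mat2) $ i $ j + of_nat N * of_int k"
  by (simp add: principal_subgroup_def)
 then obtain k :: "2 \<Rightarrow> 2 \<Rightarrow> int" where k: "\<And>i j. g $ i $ j = (mat 1 :: mat2) $ i $ j + of_nat N * of_int (k i j)"
  by metis
 have "int_mat (\<chi> i j. of_int (k i j))" by (auto simp: int_mat_def)
 moreover have "g = mat 1 + real N *\<^sub>R (\<chi> i j. of_int (k i j))"
  by (simp add: vec_eq_iff k)
 ultimately show "g \<in> SL2R \<and> (\<exists>K. int_mat K \<and> g = mat 1 + real N *\<^sub>R K)"
  using g by (auto simp: principal_subgroup_def SL2Z_iff)
next
 assume "g \<in> SL2R \<and> (\<exists>K. int_mat K \<and> g = mat 1 + real N *\<^sub>R K)"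
 then obtain K where K: "g \<in> SL2R" "int_mat K" "g = mat 1 + real N *\<^sub>R K" by auto
 have "int_mat g" unfolding K(3) using K(2) by (auto simp: int_mat_iff)
 moreover have "\<exists>k :: int. g $ i $ j = (mat 1 :: mat2) $ i $ j + of_nat N * of_int k" for i j
 proof -
  have "K $ i $ j \<in> \<int>" using K(2) by (simp add: int_mat_def)
  then obtain k where "K $ i $ j = of_int k" by (elim Ints_cases)
  then show ?thesis by (intro exI[of _ k]) (simp add: K(3))
 qed
 ultimately show "g \<in> principal_subgroup N" using K(1) by (auto simp: principal_subgroup_def SL2Z_iff)
qed

lemma principal_subset: "principal_subgroup N \<subseteq> SL2Z"
 by (auto simp: principal_subgroup_def)

text \<open>Normality in \<open>SL2Z\<close>: s (1 + N K) s^-1 = 1 + N (s K s^-1). It makes N a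
  period at every cusp.\<close>

lemma principal_conj:
 assumes "g \<in> principal_subgroup N" "s \<in> SL2Z"
 shows "s ** g ** matrix_inv s \<in> principal_subgroup N"
proof -
 obtain K where K: "g \<in> SL2R" "int_mat K" "g = mat 1 + real N *\<^sub>R K" using assms(1) principal_iff by auto
 have s: "s \<in> SL2R" "int_mat s" using assms(2) by (auto simp: SL2Z_iff)
 have "s ** g ** matrix_inv s = mat 1 + real N *\<^sub>R (s ** K ** matrix_inv s)"
  using SL2R_det[OF s(1)] by (simp add: K(3) matrix_inv_SL2R[OF s(1)] mat2_eq_iff algebra_simps)
 moreover have "int_mat (s ** K ** matrix_inv s)"
  using s K int_mat_inv by (simp add: int_mat_iff)
 ultimately show ?thesis
  using principal_iff K s SL2R_mult SL2R_inv(1) by metis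
qed

lemma principal_group: "mat_subgroup (principal_subgroup N)"
 unfolding mat_subgroup_def
proof (intro conjI ballI)
 show "principal_subgroup N \<subseteq> SL2R" using principal_iff by auto
 show "mat 1 \<in> principal_subgroup N"
  unfolding principal_iff by (intro conjI exI[of _ 0]) (auto simp: SL2R_one int_mat_iff)
next
 fix g h assume "g \<in> principal_subgroup N" "h \<in> principal_subgroup N"
 then obtain K K' where K: "g \<in> SL2R" "int_mat K" "g = mat 1 + real N *\<^sub>R K"
   and K': "h \<in> SL2R" "int_mat K'" "h = mat 1 + real N *\<^sub>R K'" using principal_iff by auto
 have "g ** h = mat 1 + real N *\<^sub>R (K + K' + real N *\<^sub>R (K ** K'))"
  by (simp add: K(3) K'(3) mat2_eq_iff algebra_simps)
 moreover have "int_mat (K + K' + real N *\<^sub>R (K ** K'))"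
  using K K' by (simp add: int_mat_iff)
 ultimately show "g ** h \<in> principal_subgroup N"
  using principal_iff K K' SL2R_mult by metis
next
 fix g assume "g \<in> principal_subgroup N"
 then obtain K where K: "g \<in> SL2R" "int_mat K" "g = mat 1 + real N *\<^sub>R K" using principal_iff by auto
 have "matrix_inv g = mat 1 + real N *\<^sub>R (mat2 (K$2$2) (- K$1$2) (- K$2$1) (K$1$1))"
  unfolding matrix_inv_SL2R[OF K(1)] by (simp add: K(3) mat2_eq_iff)
 moreover have "int_mat (mat2 (K$2$2) (- K$1$2) (- K$2$1) (K$1$1))"
  using K by (simp add: int_mat_iff)
 ultimately show "matrix_inv g \<in> principal_subgroup N"
  using principal_iff K SL2R_inv(1) by metis
qed

text \<open>There are at most N^4 residues, and g = r + N k gives r^-1 g = 1 + N r^-1 k, so matrices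
  with equal residues lie in the same left coset.\<close>

lemma principal_finite_index:
 assumes "N \<ge> 1"
 obtains R where "finite R" "R \<subseteq> SL2Z" "SL2Z = {r ** p | r p. r \<in> R \<and> p \<in> principal_subgroup N}"
proof -
 define res :: "mat2 \<Rightarrow> int \<times> int \<times> int \<times> int" where
  "res g = (\<lfloor>g$1$1\<rfloor> mod int N, \<lfloor>g$1$2\<rfloor> mod int N, \<lfloor>g$2$1\<rfloor> mod int N, \<lfloor>g$2$2\<rfloor> mod int N)" for g
 define R where "R = (\<lambda>x. SOME g. g \<in> SL2Z \<and> res g = x) ` (res ` SL2Z)"
 have "res ` SL2Z \<subseteq> {0..<int N} \<times> {0..<int N} \<times> {0..<int N} \<times> {0..<int N}"
  using assms by (auto simp: res_def)
 then have "finite (res ` SL2Z)" by (rule finite_subset) auto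
 then have 1: "finite R" by (simp add: R_def)
 have r: "\<exists>r\<in>R. r \<in> SL2Z \<and> res r = res g" if "g \<in> SL2Z" for g
 proof -
  have "(SOME h. h \<in> SL2Z \<and> res h = res g) \<in> SL2Z \<and> res (SOME h. h \<in> SL2Z \<and> res h = res g) = res g"
   by (rule someI[of _ g]) (use that in auto)
  then show ?thesis unfolding R_def using that by blast
 qed
 have 2: "R \<subseteq> SL2Z"
 proof -
  have "(SOME h. h \<in> SL2Z \<and> res h = res g) \<in> SL2Z \<and> res (SOME h. h \<in> SL2Z \<and> res h = res g) = res g" if "g \<in> SL2Z" for g
   by (rule someI[of _ g]) (use that in auto)
  then show ?thesis unfolding R_def by blast
 qed
 have 3: "SL2Z = {r ** p | r p. r \<in> R \<and> p \<in> principal_subgroup N}"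
 proof (intro equalityI subsetI)
  fix g assume g: "g \<in> SL2Z"
  then obtain r where r: "r \<in> R" "r \<in> SL2Z" "res r = res g" using r by blast
  have int: "int_mat g" "int_mat r" "g \<in> SL2R" "r \<in> SL2R" using g r by (auto simp: SL2Z_iff)
  have key: "\<exists>k. int_mat k \<and> g = r + real N *\<^sub>R k"
  proof -
   have e: "\<exists>k::int. g$i$j = r$i$j + real N * of_int k" if "\<lfloor>g$i$j\<rfloor> mod int N = \<lfloor>r$i$j\<rfloor> mod int N" for i j
   proof -
    have fl: "of_int \<lfloor>g$i$j\<rfloor> = g$i$j" "of_int \<lfloor>r$i$j\<rfloor> = r$i$j" using int by (auto simp: int_mat_def)
    from that have "int N dvd \<lfloor>g$i$j\<rfloor> - \<lfloor>r$i$j\<rfloor>" by (simp add: mod_eq_dvd_iff)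
    then obtain k where "\<lfloor>g$i$j\<rfloor> - \<lfloor>r$i$j\<rfloor> = int N * k" by (elim dvdE)
    then have "real_of_int (\<lfloor>g$i$j\<rfloor> - \<lfloor>r$i$j\<rfloor>) = real_of_int (int N * k)" by simp
    then show ?thesis using fl by (intro exI[of _ k]) simp
   qed
   obtain k1 k2 k3 k4 :: int where "g$1$1 = r$1$1 + real N * of_int k1" "g$1$2 = r$1$2 + real N * of_int k2"
     "g$2$1 = r$2$1 + real N * of_int k3" "g$2$2 = r$2$2 + real N * of_int k4"
    using e r(3) unfolding res_def by (metis prod.inject)
   then show ?thesis
    by (intro exI[of _ "mat2 (of_int k1) (of_int k2) (of_int k3) (of_int k4)"])
      (simp add: int_mat_iff mat2_eq_iff)
  qed
  then obtain k where k: "int_mat k" "g = r + real N *\<^sub>R k" by auto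
  have "matrix_inv r ** g = mat 1 + real N *\<^sub>R (matrix_inv r ** k)"
   using SL2R_det[OF int(4)] unfolding k(2) matrix_inv_SL2R[OF int(4)] by (simp add: mat2_eq_iff algebra_simps)
  moreover have "int_mat (matrix_inv r ** k)" using int_mat_inv[OF int(4,2)] k by (simp add: int_mat_iff)
  ultimately have "matrix_inv r ** g \<in> principal_subgroup N"
   using principal_iff int SL2R_mult SL2R_inv(1) by metis
  moreover have "g = r ** (matrix_inv r ** g)" using SL2R_cancel int by simp
  ultimately show "g \<in> {r ** p | r p. r \<in> R \<and> p \<in> principal_subgroup N}" using r by blast
 next
  fix g assume "g \<in> {r ** p | r p. r \<in> R \<and> p \<in> principal_subgroup N}"
  then show "g \<in> SL2Z" using 2 principal_subset mat_subgroupD[OF SL2Z_subgroup] by blast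
 qed
 show ?thesis using that 1 2 3 by blast
qed

lemma countable_SL2Q: "countable SL2Q"
proof -
 have "SL2Q \<subseteq> (\<lambda>(a, b, c, e). mat2 a b c e) ` (\<rat> \<times> \<rat> \<times> \<rat> \<times> \<rat>)"
 proof
  fix g assume "g \<in> SL2Q"
  then have "(g$1$1, g$1$2, g$2$1, g$2$2) \<in> \<rat> \<times> \<rat> \<times> \<rat> \<times> \<rat>" by (auto simp: SL2Q_def)
  moreover have "g = mat2 (g$1$1) (g$1$2) (g$2$1) (g$2$2)" by (simp add: mat2_eq_iff)
  ultimately show "g \<in> (\<lambda>(a, b, c, e). mat2 a b c e) ` (\<rat> \<times> \<rat> \<times> \<rat> \<times> \<rat>)" by force
 qed
 moreover have "countable ((\<rat> :: real set) \<times> (\<rat> :: real set) \<times> (\<rat> :: real set) \<times> (\<rat> :: real set))" by (intro countable_SIGMA countable_rat)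
 ultimately show ?thesis by (meson countable_subset countable_image)
qed

lemma SL2Z_subset_SL2Q: "SL2Z \<subseteq> SL2Q"
 using Ints_subset_Rats by (auto simp: SL2Z_def SL2Q_def)

lemma measurable_nn_integral_count_space:
 fixes f :: "'i \<Rightarrow> 'a \<Rightarrow> ennreal"
 assumes "countable I" "\<And>i. i \<in> I \<Longrightarrow> f i \<in> borel_measurable M"
 shows "(\<lambda>x. \<integral>\<^sup>+i. f i x \<partial>count_space I) \<in> borel_measurable M"
proof -
 interpret sigma_finite_measure "count_space I"
  by (rule sigma_finite_measure_count_space_countable) fact
 have "(\<lambda>p. f (snd p) (fst p)) \<in> borel_measurable (M \<Otimes>\<^sub>M count_space I)"
  using _ _ assms(1)
  by (rule measurable_compose_countable'[where f="\<lambda>a b. f a (fst b)" and g=snd and I=I, simplified])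
    (use assms(2) in simp_all)
 then show ?thesis by (intro borel_measurable_nn_integral) (simp add: split_beta')
qed

text \<open>The mass transport principle: unfolding a sum over a group in two ways.\<close>

lemma transfer_unfolding:
 fixes A B h :: "complex \<Rightarrow> ennreal"
 assumes H: "mat_subgroup H" "countable H"
  and [measurable]: "A \<in> borel_measurable borel" "B \<in> borel_measurable borel" "h \<in> borel_measurable borel"
  and inv: "\<And>g z. g \<in> H \<Longrightarrow> z \<in> uhp \<Longrightarrow> h (moebius g z) = h z"
 shows "(\<integral>\<^sup>+z. A z * h z * (\<integral>\<^sup>+g. B (moebius g z) \<partial>count_space H) \<partial>\<mu>) =
     (\<integral>\<^sup>+z. B z * h z * (\<integral>\<^sup>+g. A (moebius g z) \<partial>count_space H) \<partial>\<mu>)"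
proof -
 have S: "\<And>g. g \<in> H \<Longrightarrow> g \<in> SL2R" using mat_subgroupD(1)[OF H(1)] .
 have "(\<integral>\<^sup>+z. A z * h z * (\<integral>\<^sup>+g. B (moebius g z) \<partial>count_space H) \<partial>\<mu>) =
   (\<integral>\<^sup>+z. \<integral>\<^sup>+g. A z * h z * B (moebius g z) \<partial>count_space H \<partial>\<mu>)"
  by (simp add: nn_integral_cmult)
 also have "\<dots> = (\<integral>\<^sup>+g. \<integral>\<^sup>+z. A z * h z * B (moebius g z) \<partial>\<mu> \<partial>count_space H)"
  by (rule nn_integral_count_space_nn_integral[OF H(2)]) measurable
 \<comment> \<open>In the summand of g the variable is moved by z -> g z, under which
   \<open>h\<close> and the measure are invariant. Replacing g by its inverse afterwards has
   exchanged the roles of \<open>A\<close> and \<open>B\<close>.\<close>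
 also have "\<dots> = (\<integral>\<^sup>+g. \<integral>\<^sup>+z. A (moebius (matrix_inv g) z) * h z * B z \<partial>\<mu> \<partial>count_space H)"
 proof (rule nn_integral_cong)
  fix g assume "g \<in> space (count_space H)"
  then have g: "g \<in> H" by simp
  have "(\<integral>\<^sup>+z. A z * h z * B (moebius g z) \<partial>\<mu>) =
    (\<integral>\<^sup>+z. A (moebius (matrix_inv g) (moebius g z)) * h (moebius g z) * B (moebius g z) \<partial>\<mu>)"
   by (rule nn_integral_cong_AE, rule AE_mp[OF AE_uhp]) (use inv[OF g] S[OF g] in auto)
  also have "\<dots> = (\<integral>\<^sup>+z. A (moebius (matrix_inv g) z) * h z * B z \<partial>\<mu>)"
   by (rule nn_integral_hyp_moebius[of "\<lambda>z. A (moebius (matrix_inv g) z) * h z * B z"]) (use S[OF g] in measurable)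
  finally show "(\<integral>\<^sup>+z. A z * h z * B (moebius g z) \<partial>\<mu>) =
    (\<integral>\<^sup>+z. A (moebius (matrix_inv g) z) * h z * B z \<partial>\<mu>)" .
 qed
 also have "\<dots> = (\<integral>\<^sup>+g. \<integral>\<^sup>+z. A (moebius g z) * h z * B z \<partial>\<mu> \<partial>count_space H)"
  by (rule nn_integral_bij_count_space[OF bij_betw_matrix_inv[OF H(1)],
    of "\<lambda>g. \<integral>\<^sup>+z. A (moebius g z) * h z * B z \<partial>\<mu>"])
 also have "\<dots> = (\<integral>\<^sup>+z. \<integral>\<^sup>+g. A (moebius g z) * h z * B z \<partial>count_space H \<partial>\<mu>)"
  by (rule nn_integral_count_space_nn_integral[OF H(2), symmetric]) measurable
 also have "\<dots> = (\<integral>\<^sup>+z. \<integral>\<^sup>+g. B z * h z * A (moebius g z) \<partial>count_space H \<partial>\<mu>)"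
  by (simp add: ac_simps)
 also have "\<dots> = (\<integral>\<^sup>+z. B z * h z * (\<integral>\<^sup>+g. A (moebius g z) \<partial>count_space H) \<partial>\<mu>)"
  by (simp add: nn_integral_cmult)
 finally show ?thesis .
qed

section \<open>Reduction theory for the modular group\<close>

text \<open>A positive definite form is bounded at finitely many integer points only. The bounds are
  crude: |c| <= c^2 <= M / y^2, and |c x + e| <= (c x + e)^2 + 1 <= M + 1.\<close>

lemma finite_den_le:
 assumes "z \<in> uhp"
 shows "finite {(c :: int, e :: int). (of_int c * Re z + of_int e)\<^sup>2 + (of_int c * Im z)\<^sup>2 \<le> M}"
proof -
 define K where "K = \<lceil>M / (Im z)\<^sup>2 + (M + 1 + \<bar>Re z\<bar> * (M / (Im z)\<^sup>2))\<rceil>"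
 have y: "Im z > 0" using assms by (simp add: uhp_iff)
 have "{(c :: int, e :: int). (of_int c * Re z + of_int e)\<^sup>2 + (of_int c * Im z)\<^sup>2 \<le> M} \<subseteq> {-K..K} \<times> {-K..K}"
 proof safe
  fix c e :: int
  assume h: "(of_int c * Re z + of_int e)\<^sup>2 + (of_int c * Im z)\<^sup>2 \<le> M"
  have M: "M \<ge> 0" using h by (smt (verit) zero_le_power2)
  have "(of_int c * Im z)\<^sup>2 \<le> M" using h by (smt (verit) zero_le_power2)
  then have c2: "(real_of_int c)\<^sup>2 \<le> M / (Im z)\<^sup>2" using y by (simp add: power_mult_distrib pos_le_divide_eq)
  have "\<bar>c\<bar> \<le> c\<^sup>2"
  proof (cases "c = 0")
   case False
   then have "\<bar>c\<bar> * 1 \<le> \<bar>c\<bar> * \<bar>c\<bar>" by (intro mult_left_mono) auto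
   then show ?thesis by (simp add: power2_eq_square)
  qed simp
  then have c1: "\<bar>real_of_int c\<bar> \<le> M / (Im z)\<^sup>2"
  proof -
   have "real_of_int \<bar>c\<bar> \<le> real_of_int (c\<^sup>2)" using \<open>\<bar>c\<bar> \<le> c\<^sup>2\<close> by (simp only: of_int_le_iff)
   then show ?thesis using c2 by simp
  qed
  have "\<bar>x\<bar> \<le> x\<^sup>2 + 1" for x :: real
   using zero_le_power2[of "\<bar>x\<bar> - 1"] by (simp add: power2_diff)
  then have "\<bar>of_int c * Re z + of_int e\<bar> \<le> (of_int c * Re z + of_int e)\<^sup>2 + 1" .
  then have "\<bar>of_int c * Re z + of_int e\<bar> \<le> M + 1" using h by (smt (verit) zero_le_power2)
  moreover have "\<bar>of_int c * Re z\<bar> \<le> \<bar>Re z\<bar> * (M / (Im z)\<^sup>2)"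
   using mult_left_mono[OF c1, of "\<bar>Re z\<bar>"] by (simp add: abs_mult mult.commute)
  ultimately have e1: "\<bar>real_of_int e\<bar> \<le> M + 1 + \<bar>Re z\<bar> * (M / (Im z)\<^sup>2)" by linarith
  have p: "0 \<le> M / (Im z)\<^sup>2" "0 \<le> \<bar>Re z\<bar> * (M / (Im z)\<^sup>2)" using M by auto
  have "\<bar>real_of_int c\<bar> \<le> of_int K" "\<bar>real_of_int e\<bar> \<le> of_int K"
   unfolding K_def using c1 e1 p M by linarith+
  then show "c \<in> {-K..K}" "e \<in> {-K..K}" by auto
 qed
 then show ?thesis by (rule finite_subset) auto
qed

definition translation :: "real \<Rightarrow> mat2" where
 "translation t = mat2 1 t 0 1"

lemma translation_SL2R [simp, intro]: "translation t \<in> SL2R"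
 by (intro SL2R_I) (simp add: translation_def)

lemma translation_SL2Z: "t \<in> \<int> \<Longrightarrow> translation t \<in> SL2Z"
 by (simp add: SL2Z_iff int_mat_iff) (simp add: translation_def)

lemma moebius_translation [simp]: "moebius (translation t) z = z + of_real t"
 by (simp add: moebius_def translation_def)

lemma SL2Z_Ints:
 assumes "g \<in> SL2Z"
 obtains a b c e :: int where "g $ 1 $ 1 = of_int a" "g $ 1 $ 2 = of_int b"
  "g $ 2 $ 1 = of_int c" "g $ 2 $ 2 = of_int e" "a * e - b * c = 1"
proof -
 from assms have i: "g $ 1 $ 1 \<in> \<int>" "g $ 1 $ 2 \<in> \<int>" "g $ 2 $ 1 \<in> \<int>" "g $ 2 $ 2 \<in> \<int>"
  by (auto simp: SL2Z_def)
 obtain a b c e :: int where e: "g $ 1 $ 1 = of_int a" "g $ 1 $ 2 = of_int b"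
  "g $ 2 $ 1 = of_int c" "g $ 2 $ 2 = of_int e"
  using i by (metis Ints_cases)
 have "real_of_int (a * e - b * c) = of_int 1"
  using SL2R_det[of g] assms by (simp add: SL2Z_iff e)
 then have "a * e - b * c = 1" by (simp only: of_int_eq_iff)
 with e show ?thesis using that by blast
qed

text \<open>The orbit has a point of largest imaginary part, since minimising |c z + e|^2 below 1
  involves finitely many values. After a translation into the strip, an imaginary part below 1/2
  would contradict maximality. The constant 1/2 is cruder than the sharp sqrt 3 / 2.\<close>

lemma SL2Z_reduction:
 assumes z: "z \<in> uhp"
 obtains s where "s \<in> SL2Z" "Im (moebius s z) \<ge> 1/2" "0 \<le> Re (moebius s z)" "Re (moebius s z) < 1"
proof -
 define V where "V = {(cmod (den s z))\<^sup>2 | s. s \<in> SL2Z \<and> (cmod (den s z))\<^sup>2 \<le> 1}"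
 have "V \<subseteq> (\<lambda>(c :: int, e :: int). (of_int c * Re z + of_int e)\<^sup>2 + (of_int c * Im z)\<^sup>2) `
   {(c :: int, e :: int). (of_int c * Re z + of_int e)\<^sup>2 + (of_int c * Im z)\<^sup>2 \<le> 1}"
 proof
  fix v assume "v \<in> V"
  then obtain s where s: "s \<in> SL2Z" "(cmod (den s z))\<^sup>2 \<le> 1" "v = (cmod (den s z))\<^sup>2" by (auto simp: V_def)
  obtain a b c e :: int where "s $ 2 $ 1 = of_int c" "s $ 2 $ 2 = of_int e" using SL2Z_Ints[OF s(1)] by metis
  then show "v \<in> (\<lambda>(c :: int, e :: int). (of_int c * Re z + of_int e)\<^sup>2 + (of_int c * Im z)\<^sup>2) `
   {(c :: int, e :: int). (of_int c * Re z + of_int e)\<^sup>2 + (of_int c * Im z)\<^sup>2 \<le> 1}"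
   using s by (intro image_eqI[of _ _ "(c, e)"]) (auto simp: cmod_den_sq)
 qed
 then have fin: "finite V" using finite_den_le[OF z, of 1] finite_surj by blast
 have "1 \<in> V"
  unfolding V_def using mat_subgroupD(2)[OF SL2Z_subgroup] by (intro CollectI exI[of _ "mat 1"]) (simp add: den_def)
 then have "Min V \<in> V" using fin by (intro Min_in) auto
 then obtain s where s: "s \<in> SL2Z" "(cmod (den s z))\<^sup>2 = Min V" by (auto simp: V_def)
 have sR: "s \<in> SL2R" using s(1) by (simp add: SL2Z_iff)
 have min: "(cmod (den s z))\<^sup>2 \<le> (cmod (den s' z))\<^sup>2" if "s' \<in> SL2Z" for s'
 proof (cases "(cmod (den s' z))\<^sup>2 \<le> 1")
  case True
  then have "(cmod (den s' z))\<^sup>2 \<in> V" using that by (auto simp: V_def)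
  then show ?thesis using s(2) fin by simp
 next
  case False
  then show ?thesis using s(2) fin \<open>1 \<in> V\<close> by (smt (verit) Min_le)
 qed
 have max: "Im (moebius s' z) \<le> Im (moebius s z)" if "s' \<in> SL2Z" for s'
 proof -
  have "s' \<in> SL2R" using that by (simp add: SL2Z_iff)
  then show ?thesis using min[OF that] den_nz[OF sR z] den_nz[OF _ z, of s'] z sR
   by (simp add: Im_moebius uhp_iff divide_left_mono)
 qed
 define t :: real where "t = - of_int \<lfloor>Re (moebius s z)\<rfloor>"
 define w where "w = moebius s z + of_real t"
 have t: "t \<in> \<int>" by (simp add: t_def)
 have wm: "w = moebius (translation t ** s) z" using moebius_mult[OF translation_SL2R sR z] by (simp add: w_def)
 have w: "Im w = Im (moebius s z)" "0 \<le> Re w" "Re w < 1"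
  by (auto simp: w_def t_def) linarith+
 have wu: "w \<in> uhp" using w moebius_uhp[OF sR z] by (simp add: uhp_iff)
 have "Im w \<ge> 1/2"
 proof (rule ccontr)
  assume "\<not> Im w \<ge> 1/2"
  then have i: "Im w < 1/2" "Im w > 0" using wu by (auto simp: uhp_iff)
  \<comment> \<open>The matrix \<open>g\<close> acts by w -> -1 / (w + u). The shift brings the real
    part to absolute value at most 1/2, so |w + u|^2 < 1/4 + 1/4 and the imaginary part
    increases.\<close>
  define u :: real where "u = (if Re w \<le> 1/2 then 0 else -1)"
  define g where "g = mat2 0 (-1) 1 u"
  have g: "g \<in> SL2Z" by (auto simp: SL2Z_iff int_mat_iff g_def u_def intro: SL2R_I)
  have "(Re w + u)\<^sup>2 \<le> (1/2)\<^sup>2"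
   using w by (intro power2_le_iff_abs_le[THEN iffD2]) (auto simp: u_def)
  moreover have "(Im w)\<^sup>2 < (1/2)\<^sup>2" using i by (intro power_strict_mono) auto
  ultimately have "(cmod (den g w))\<^sup>2 < 1"
   by (simp add: cmod_den_sq g_def power_divide)
  moreover have "g \<in> SL2R" using g by (simp add: SL2Z_iff)
  ultimately have "Im (moebius g w) > Im w"
   using den_nz[OF \<open>g \<in> SL2R\<close> wu] i by (simp add: Im_moebius wu pos_less_divide_eq)
  moreover have ts: "translation t ** s \<in> SL2Z"
   using mat_subgroupD(3)[OF SL2Z_subgroup translation_SL2Z[OF t] s(1)] .
  moreover have "moebius g w = moebius (g ** (translation t ** s)) z"
   unfolding wm using ts by (intro moebius_mult[symmetric] \<open>g \<in> SL2R\<close> z) (simp add: SL2Z_iff)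
  ultimately show False
   using max[OF mat_subgroupD(3)[OF SL2Z_subgroup g ts]] w by simp
 qed
 then show ?thesis
  using that[of "translation t ** s"] mat_subgroupD(3)[OF SL2Z_subgroup translation_SL2Z[OF t] s(1)] w wm by simp
qed

text \<open>The width is N because N is a period of every invariant function at every cusp, so a
  horizontal segment of the set is a full period. The height 1/2 is that of the reduction
  lemma.\<close>

definition siegel_set :: "nat \<Rightarrow> complex set" where
 "siegel_set N = {w. 0 \<le> Re w \<and> Re w < real N \<and> 1/2 \<le> Im w}"

lemma siegel_borel [measurable]: "siegel_set N \<in> sets borel"
proof -
 have "siegel_set N = {w \<in> space borel. 0 \<le> Re w \<and> Re w < real N \<and> 1/2 \<le> Im w}"
  by (auto simp: siegel_set_def)
 also have "\<dots> \<in> sets borel" by measurable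
 finally show ?thesis .
qed

lemma siegel_uhp: "siegel_set N \<subseteq> uhp"
 by (auto simp: siegel_set_def uhp_iff)

text \<open>The multiplicity with which translates of the Siegel set cover z. Dividing by it turns
  overlapping translates into a partition of unity, which takes the place of an exact fundamental
  domain of \<open>SL2Z\<close>.\<close>

definition siegel_count :: "nat \<Rightarrow> complex \<Rightarrow> ennreal" where
 "siegel_count N z = (\<integral>\<^sup>+s. indicator (siegel_set N) (moebius s z) \<partial>count_space SL2Z)"

lemma siegel_count_measurable [measurable]: "siegel_count N \<in> borel_measurable borel"
 unfolding siegel_count_def[abs_def]
 using countable_subset[OF SL2Z_subset_SL2Q countable_SL2Q]
 by (intro measurable_nn_integral_count_space) measurable

lemma siegel_count_eq:
 "siegel_count N z = emeasure (count_space SL2Z) {s \<in> SL2Z. moebius s z \<in> siegel_set N}"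
proof -
 have "siegel_count N z = (\<integral>\<^sup>+s. indicator {s \<in> SL2Z. moebius s z \<in> siegel_set N} s \<partial>count_space SL2Z)"
  unfolding siegel_count_def by (intro nn_integral_cong) (auto simp: indicator_def)
 then show ?thesis by (simp add: nn_integral_indicator)
qed

lemma same_row_translation:
 assumes "s \<in> SL2Z" "s' \<in> SL2Z" "s $ 2 $ 1 = s' $ 2 $ 1" "s $ 2 $ 2 = s' $ 2 $ 2"
 obtains t :: int where "s' = translation (of_int t) ** s"
proof -
 have R: "s \<in> SL2R" "s' \<in> SL2R" using assms by (auto simp: SL2Z_iff)
 define g where "g = s' ** matrix_inv s"
 have "g \<in> SL2Z" unfolding g_def using assms mat_subgroupD[OF SL2Z_subgroup] by auto
 then obtain t where t: "g $ 1 $ 2 = of_int t" by (metis SL2Z_Ints)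
 have "g = translation (of_int t)"
  using SL2R_det[OF R(1)] SL2R_det[OF R(2)] assms(3,4) t
  by (simp add: mat2_eq_iff translation_def) (simp add: g_def matrix_inv_SL2R[OF R(1)] algebra_simps)
 moreover have "s' = g ** s" unfolding g_def using SL2R_cancel(3)[OF R(1)] by simp
 ultimately show ?thesis using that by simp
qed

text \<open>The condition Im (s z) >= 1/2 leaves finitely many second rows. Elements with the same
  second row differ by an integral translation, which is detected by the integer part of Re (s
  z).\<close>

lemma finite_siegel:
 assumes z: "z \<in> uhp"
 shows "finite {s \<in> SL2Z. moebius s z \<in> siegel_set N}"
proof -
 define Q where "Q = {(c :: int, e :: int). (of_int c * Re z + of_int e)\<^sup>2 + (of_int c * Im z)\<^sup>2 \<le> 2 * Im z}"
 let ?S = "{s \<in> SL2Z. moebius s z \<in> siegel_set N}"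
 define f where "f = (\<lambda>s :: mat2. ((\<lfloor>s$2$1\<rfloor>, \<lfloor>s$2$2\<rfloor>), \<lfloor>Re (moebius s z)\<rfloor>))"
 have "f ` ?S \<subseteq> Q \<times> {0..int N}"
 proof
  fix x assume "x \<in> f ` ?S"
  then obtain s where s: "s \<in> SL2Z" "moebius s z \<in> siegel_set N" "x = f s" by auto
  have R: "s \<in> SL2R" using s by (auto simp: SL2Z_iff)
  obtain a b c e where ce: "s $ 2 $ 1 = of_int c" "s $ 2 $ 2 = of_int e" using SL2Z_Ints[OF s(1)] by metis
  have "Im (moebius s z) \<ge> 1/2" using s by (simp add: siegel_set_def)
  then have "(cmod (den s z))\<^sup>2 \<le> 2 * Im z"
   using den_nz[OF R z] by (simp add: Im_moebius[OF R z] pos_le_divide_eq)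
  then have "(c, e) \<in> Q" by (simp add: Q_def cmod_den_sq ce)
  moreover have "\<lfloor>Re (moebius s z)\<rfloor> \<in> {0..int N}"
   using s(2) by (auto simp: siegel_set_def le_floor_iff floor_le_iff)
  ultimately show "x \<in> Q \<times> {0..int N}" by (simp add: s(3) f_def ce)
 qed
 moreover have "finite (Q \<times> {0..int N})" unfolding Q_def using finite_den_le[OF z] by auto
 ultimately have "finite (f ` ?S)" by (rule finite_subset)
 moreover have "inj_on f ?S"
 proof (rule inj_onI)
  fix s s' assume s: "s \<in> ?S" "s' \<in> ?S" and ff: "f s = f s'"
  have R: "s \<in> SL2R" "s' \<in> SL2R" using s by (auto simp: SL2Z_iff)
  have "s $ 2 $ 1 = s' $ 2 $ 1" "s $ 2 $ 2 = s' $ 2 $ 2"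
   using ff s unfolding f_def by (auto elim!: SL2Z_Ints[of s] SL2Z_Ints[of s'])
  then obtain t where t: "s' = translation (of_int t) ** s" using same_row_translation s by blast
  have "moebius s' z = moebius s z + of_int t"
   using moebius_mult[OF translation_SL2R R(1) z, of "of_int t"] by (simp add: t)
  then have "t = 0" using ff by (simp add: f_def)
  then have "translation (of_int t) = mat 1" by (simp add: translation_def mat2_eq_iff)
  then show "s = s'" using t by simp
 qed
 ultimately show ?thesis using finite_imageD by blast
qed

lemma siegel_count_card:
 assumes "z \<in> uhp"
 shows "siegel_count N z = ennreal (real (card {s \<in> SL2Z. moebius s z \<in> siegel_set N}))"
 using finite_siegel[OF assms] by (simp add: siegel_count_eq ennreal_of_nat_eq_real_of_nat)

lemma siegel_card_pos:
 assumes "z \<in> uhp" "N \<ge> 1"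
 shows "card {s \<in> SL2Z. moebius s z \<in> siegel_set N} \<ge> 1"
proof -
 obtain s where "s \<in> SL2Z" "Im (moebius s z) \<ge> 1/2" "0 \<le> Re (moebius s z)" "Re (moebius s z) < 1"
  using SL2Z_reduction[OF assms(1)] by blast
 then have "s \<in> {s \<in> SL2Z. moebius s z \<in> siegel_set N}" using assms(2) by (auto simp: siegel_set_def)
 then show ?thesis using finite_siegel[OF assms(1), of N]
  by (metis (no_types, lifting) One_nat_def Suc_leI card_gt_0_iff empty_iff)
qed

lemma siegel_count_inv:
 assumes "z \<in> uhp" "s \<in> SL2Z"
 shows "siegel_count N (moebius s z) = siegel_count N z"
proof -
 have "siegel_count N (moebius s z) = (\<integral>\<^sup>+g. indicator (siegel_set N) (moebius (g ** s) z) \<partial>count_space SL2Z)"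
  unfolding siegel_count_def
  by (intro nn_integral_cong) (use assms in \<open>auto simp: SL2Z_iff moebius_mult\<close>)
 also have "\<dots> = siegel_count N z"
  unfolding siegel_count_def
  by (rule nn_integral_bij_count_space[OF bij_betw_mult_right[OF SL2Z_subgroup assms(2)], of "\<lambda>g. indicator (siegel_set N) (moebius g z)"])
 finally show ?thesis .
qed

text \<open>|c z + e| >= |c| y >= y for a nonzero integer c. Points of height at least 1/2 are thus
  sent to height at most 2 unless infinity is fixed; this is the origin of the threshold 2 in what
  follows.\<close>

lemma Im_moebius_le_inverse:
 assumes "s \<in> SL2Z" "s $ 2 $ 1 \<noteq> 0" "z \<in> uhp"
 shows "Im (moebius s z) \<le> 1 / Im z"
proof -
 have R: "s \<in> SL2R" using assms by (simp add: SL2Z_iff)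
 have y: "Im z > 0" using assms by (simp add: uhp_iff)
 obtain c :: int where c: "s $ 2 $ 1 = of_int c" using SL2Z_Ints[OF assms(1)] by metis
 then have "c \<noteq> 0" using assms(2) by auto
 then have "1 \<le> c\<^sup>2" by (simp add: int_one_le_iff_zero_less)
 then have "1 \<le> (real_of_int c)\<^sup>2" by (metis of_int_1_le_iff of_int_power)
 then have "(Im z)\<^sup>2 \<le> (s $ 2 $ 1 * Im z)\<^sup>2"
  by (simp add: c power_mult_distrib mult_le_cancel_right1)
 also have "\<dots> \<le> (cmod (den s z))\<^sup>2" by (simp add: cmod_den_sq)
 finally have "Im z / (cmod (den s z))\<^sup>2 \<le> Im z / (Im z)\<^sup>2"
  using y den_nz[OF R assms(3)] by (intro divide_left_mono) auto
 then show ?thesis using y by (simp add: Im_moebius[OF R assms(3)] power2_eq_square)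
qed

lemma SL2Z_lower_left_0:
 assumes "s \<in> SL2Z" "s $ 2 $ 1 = 0"
 obtains t :: int where "s = translation (of_int t) \<or> s = - translation (of_int t)"
proof -
 obtain a b c e :: int where e: "s $ 1 $ 1 = of_int a" "s $ 1 $ 2 = of_int b"
  "s $ 2 $ 1 = of_int c" "s $ 2 $ 2 = of_int e" "a * e - b * c = 1"
  using SL2Z_Ints[OF assms(1)] by blast
 have "c = 0" using e(3) assms(2) by simp
 then have ae: "a * e = 1" using e(5) by simp
 then have "(a = 1 \<and> e = 1) \<or> (a = -1 \<and> e = -1)" by (simp add: zmult_eq_1_iff)
 then show ?thesis
 proof
  assume "a = 1 \<and> e = 1"
  then have "s = translation (of_int b)" using e \<open>c = 0\<close> by (simp add: mat2_eq_iff translation_def)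
  then show ?thesis using that by blast
 next
  assume "a = -1 \<and> e = -1"
  then have "s = - translation (of_int (-b))" using e \<open>c = 0\<close> by (simp add: mat2_eq_iff translation_def)
  then show ?thesis using that by blast
 qed
qed

text \<open>Above height 2 only the stabiliser of infinity contributes: N translations, each with
  both signs, because matrices and not transformations are counted. The multiplicity is therefore
  constant along horocycles.\<close>

lemma siegel_card_cusp:
 assumes "Im z > 2"
 shows "card {s \<in> SL2Z. moebius s z \<in> siegel_set N} = 2 * N"
proof -
 have z: "z \<in> uhp" using assms by (simp add: uhp_iff)
 define J where "J = {\<lceil>- Re z\<rceil>..<\<lceil>- Re z\<rceil> + int N}"
 have J: "t \<in> J \<longleftrightarrow> 0 \<le> Re z + of_int t \<and> Re z + of_int t < real N" for t
  unfolding J_def by (simp add: ceiling_le_iff) linarith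
 define f where "f = (\<lambda>(b, t). if b then translation (of_int t) else - translation (of_int t))"
 have "bij_betw f (UNIV \<times> J) {s \<in> SL2Z. moebius s z \<in> siegel_set N}"
 proof (rule bij_betw_imageI)
  show "inj_on f (UNIV \<times> J)"
   by (rule inj_onI) (auto simp: f_def translation_def mat2_eq_iff split: if_splits)
  show "f ` (UNIV \<times> J) = {s \<in> SL2Z. moebius s z \<in> siegel_set N}"
  proof (intro equalityI subsetI)
   fix s assume "s \<in> f ` (UNIV \<times> J)"
   then obtain b t where s: "s = f (b, t)" "t \<in> J" by auto
   have m: "moebius s z = z + of_int t" by (auto simp: s f_def moebius_uminus)
   have "s \<in> SL2Z" unfolding s f_def
    using translation_SL2Z[of "of_int t"] by (auto simp: SL2Z_iff SL2R_def det_mat2 int_mat_iff)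
   then show "s \<in> {s \<in> SL2Z. moebius s z \<in> siegel_set N}"
    using s(2) J assms by (simp add: m siegel_set_def)
  next
   fix s assume "s \<in> {s \<in> SL2Z. moebius s z \<in> siegel_set N}"
   then have s: "s \<in> SL2Z" "moebius s z \<in> siegel_set N" by auto
   have "s $ 2 $ 1 = 0"
   proof (rule ccontr)
    assume "s $ 2 $ 1 \<noteq> 0"
    then have "Im (moebius s z) \<le> 1 / Im z" using Im_moebius_le_inverse s z by blast
    also have "\<dots> < 1/2" using assms by (simp add: field_simps)
    finally show False using s(2) by (simp add: siegel_set_def)
   qed
   then obtain t :: int where t: "s = translation (of_int t) \<or> s = - translation (of_int t)"
    using SL2Z_lower_left_0 s by blast
   have m: "moebius s z = z + of_int t" using t by (auto simp: moebius_uminus)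
   have "t \<in> J" using s(2) J by (simp add: m siegel_set_def)
   then show "s \<in> f ` (UNIV \<times> J)"
    using t by (auto simp: f_def image_iff)
  qed
 qed
 then have "card {s \<in> SL2Z. moebius s z \<in> siegel_set N} = card (UNIV \<times> J :: (bool \<times> int) set)"
  by (simp add: bij_betw_same_card)
 also have "\<dots> = 2 * N" by (simp add: card_cartesian_product J_def)
 finally show ?thesis .
qed

section \<open>Unfolding over Siegel sets\<close>

lemma nn_integral_count_space_Times:
 assumes "countable A" "countable B"
 shows "(\<integral>\<^sup>+x. f x \<partial>count_space (A \<times> B)) = (\<integral>\<^sup>+b. \<integral>\<^sup>+a. f (a, b) \<partial>count_space A \<partial>count_space B)"
proof -
 interpret A: sigma_finite_measure "count_space A"
  using assms by (simp add: sigma_finite_measure_count_space_countable)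
 interpret B: sigma_finite_measure "count_space B"
  using assms by (simp add: sigma_finite_measure_count_space_countable)
 interpret pair_sigma_finite "count_space A" "count_space B" ..
 have eq: "count_space A \<Otimes>\<^sub>M count_space B = count_space (A \<times> B)"
  using assms by (rule pair_measure_countable)
 have "(\<integral>\<^sup>+b. \<integral>\<^sup>+a. f (a, b) \<partial>count_space A \<partial>count_space B) = (\<integral>\<^sup>+x. f x \<partial>(count_space A \<Otimes>\<^sub>M count_space B))"
  by (rule nn_integral_snd) (simp add: eq)
 then show ?thesis by (simp add: eq)
qed

lemma clear_denominators:
 assumes "\<And>i j. (X :: mat2) $ i $ j \<in> \<rat>"
 obtains D :: nat where "D \<ge> 1" "int_mat (real D *\<^sub>R X)"
proof -
 have *: "\<exists>D :: nat. D \<ge> 1 \<and> real D * x \<in> \<int>" if "x \<in> \<rat>" for x :: real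
 proof -
  from that obtain a b where ab: "b \<noteq> 0" "\<bar>x\<bar> = real a / real b" by (elim Rats_abs_nat_div_natE)
  have "real b * \<bar>x\<bar> \<in> \<int>" using ab by simp
  then have "\<bar>real b * x\<bar> \<in> \<int>" by (simp add: abs_mult)
  then have "real b * x \<in> \<int>" by (metis abs_if Ints_minus minus_minus)
  then show ?thesis using ab by (intro exI[of _ b]) simp
 qed
 obtain D11 D12 D21 D22 :: nat where D: "D11 \<ge> 1" "D12 \<ge> 1" "D21 \<ge> 1" "D22 \<ge> 1"
  "real D11 * X$1$1 \<in> \<int>" "real D12 * X$1$2 \<in> \<int>" "real D21 * X$2$1 \<in> \<int>" "real D22 * X$2$2 \<in> \<int>"
  using * assms by metis
 let ?D = "D11 * D12 * D21 * D22"
 have "real ?D * X$1$1 = real (D12 * D21 * D22) * (real D11 * X$1$1)"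
  "real ?D * X$1$2 = real (D11 * D21 * D22) * (real D12 * X$1$2)"
  "real ?D * X$2$1 = real (D11 * D12 * D22) * (real D21 * X$2$1)"
  "real ?D * X$2$2 = real (D11 * D12 * D21) * (real D22 * X$2$2)"
  by (simp_all add: ac_simps)
 then have "int_mat (real ?D *\<^sub>R X)" using D unfolding int_mat_iff by (metis Ints_mult Ints_of_nat vector_scaleR_component real_scaleR_def)
 moreover have "?D \<ge> 1" using D by (simp add: Suc_le_eq)
 ultimately show ?thesis using that by blast
qed

text \<open>All rational cusps are equivalent under \<open>SL2Z\<close>: the second row of g is
  proportional to a coprime pair (p, q), and Bezout completes (q, -p) as first column to a matrix s
  of determinant 1.\<close>

lemma SL2Q_to_upper_triangular:
 assumes "g \<in> SL2Q"
 obtains s where "s \<in> SL2Z" "(g ** s) $ 2 $ 1 = 0"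
proof -
 obtain D :: nat where D: "D \<ge> 1" "int_mat (real D *\<^sub>R g)"
  using clear_denominators[of g] assms by (auto simp: SL2Q_def)
 then obtain c e :: int where ce: "real D * g$2$1 = of_int c" "real D * g$2$2 = of_int e"
  by (auto simp: int_mat_iff elim!: Ints_cases)
 have "g \<in> SL2R" using assms by (auto simp: SL2Q_def SL2R_def)
 then have "g$2$1 \<noteq> 0 \<or> g$2$2 \<noteq> 0" using SL2R_det[of g] by auto
 then have nz: "c \<noteq> 0 \<or> e \<noteq> 0" using ce D by (metis mult_eq_0_iff of_int_0 of_nat_0_eq_iff not_one_le_zero)
 define k where "k = gcd c e"
 have k: "k \<noteq> 0" using nz by (simp add: k_def)
 obtain p q where pq: "c = k * p" "e = k * q" by (metis k_def gcd_dvd1 gcd_dvd2 dvdE)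
 have "coprime p q"
  using gcd_mult_distrib_int[of k p q] k nz unfolding pq[symmetric]
  by (simp add: coprime_iff_gcd_eq_1) (metis abs_of_nonneg gcd_ge_0_int k_def mult_cancel_left1)
 then obtain x y where xy: "x * p + y * q = 1"
  by (metis bezout_int coprime_iff_gcd_eq_1)
 define s where "s = mat2 (of_int q) (of_int x) (- of_int p) (of_int y)"
 have "real_of_int (x * p + y * q) = 1" using xy by simp
 then have "s \<in> SL2Z" by (auto simp: SL2Z_iff int_mat_iff s_def intro!: SL2R_I) (simp add: algebra_simps)
 moreover have "real D * (g ** s) $ 2 $ 1 = 0"
 proof -
  have "real D * (g ** s) $ 2 $ 1 = (real D * g$2$1) * of_int q - (real D * g$2$2) * of_int p"
   by (simp add: s_def algebra_simps)
  also have "\<dots> = 0" unfolding ce pq by simp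
  finally show ?thesis .
 qed
 then have "(g ** s) $ 2 $ 1 = 0" using D by simp
 ultimately show ?thesis using that by blast
qed

locale modular_domain =
 fixes \<Gamma> :: "mat2 set" and F :: "complex set" and N :: nat
 assumes congruence: "congruence_subgroup \<Gamma>" and fundamental: "fundamental_domain \<Gamma> F"
  and N: "N \<ge> 1" and principal_sub: "principal_subgroup N \<subseteq> \<Gamma>"
  and finite_index: "\<exists>R. finite R \<and> R \<subseteq> \<Gamma> \<and> \<Gamma> = {r ** g | r g. r \<in> R \<and> g \<in> principal_subgroup N}"
begin

abbreviation L1 :: "(complex \<Rightarrow> complex) \<Rightarrow> real" where
 "L1 h \<equiv> hyp_int F (\<lambda>z. cmod (h z))"

abbreviation trunc :: "real \<Rightarrow> complex set" where
 "trunc T \<equiv> truncated_uhp \<Gamma> T"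

lemma \<Gamma>_SL2Q: "\<Gamma> \<subseteq> SL2Q"
 using congruence by (simp add: congruence_subgroup_def)

lemma \<Gamma>_group: "mat_subgroup \<Gamma>"
 using congruence by (auto simp: congruence_subgroup_def mat_subgroup_def SL2Q_def SL2R_def)

lemma \<Gamma>_SL2R: "g \<in> \<Gamma> \<Longrightarrow> g \<in> SL2R"
 using mat_subgroupD(1)[OF \<Gamma>_group] .

lemma \<Gamma>_countable: "countable \<Gamma>"
 using countable_subset[OF \<Gamma>_SL2Q countable_SL2Q] .

lemma P_countable: "countable (principal_subgroup N)"
 using countable_subset[OF principal_sub \<Gamma>_countable] .

lemma F_borel [measurable]: "F \<in> sets borel"
 and F_uhp: "F \<subseteq> uhp"
 and F_covers: "z \<in> uhp \<Longrightarrow> \<exists>g\<in>\<Gamma>. moebius g z \<in> F"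
 using fundamental by (auto simp: fundamental_domain_def)

lemma sum_over_\<Gamma>:
 obtains I where "finite I" "I \<noteq> {}" "I \<subseteq> \<Gamma>"
  "\<And>G :: mat2 \<Rightarrow> ennreal. (\<integral>\<^sup>+g. G g \<partial>count_space \<Gamma>) = (\<Sum>i\<in>I. \<integral>\<^sup>+p. G (p ** i) \<partial>count_space (principal_subgroup N))"
proof -
 obtain R where R: "finite R" "R \<subseteq> \<Gamma>" "\<Gamma> = {r ** g | r g. r \<in> R \<and> g \<in> principal_subgroup N}"
  using finite_index by auto
 obtain I where I: "finite I" "I \<subseteq> \<Gamma>" "I \<noteq> {}" "bij_betw (\<lambda>(p, i). p ** i) (principal_subgroup N \<times> I) \<Gamma>"
  by (rule right_transversal[OF principal_group \<Gamma>_group principal_sub R(1,3,2)])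
 have "(\<integral>\<^sup>+g. G g \<partial>count_space \<Gamma>) = (\<Sum>i\<in>I. \<integral>\<^sup>+p. G (p ** i) \<partial>count_space (principal_subgroup N))" for G :: "mat2 \<Rightarrow> ennreal"
 proof -
  have "(\<integral>\<^sup>+g. G g \<partial>count_space \<Gamma>) = (\<integral>\<^sup>+x. G (case x of (p, i) \<Rightarrow> p ** i) \<partial>count_space (principal_subgroup N \<times> I))"
   by (rule nn_integral_bij_count_space[OF I(4), symmetric])
  also have "\<dots> = (\<Sum>i\<in>I. \<integral>\<^sup>+p. G (p ** i) \<partial>count_space (principal_subgroup N))"
   using I(1) P_countable by (subst nn_integral_count_space_Times) (auto simp: countable_finite nn_integral_count_space_finite)
  finally show ?thesis .
 qed
 then show ?thesis using that I by blast
qed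

text \<open>The representatives stand on the left here, unlike in \<open>sum_over_\<Gamma>\<close>:
  in the orbit sum of \<open>weight\<close> the element p of the principal subgroup acts first, and
  the representative is applied to the result. They are the inverses of a right transversal.\<close>

lemma sum_over_SL2Z:
 "\<exists>J. finite J \<and> J \<noteq> {} \<and> J \<subseteq> SL2Z \<and>
  (\<forall>G :: mat2 \<Rightarrow> ennreal. (\<integral>\<^sup>+g. G g \<partial>count_space SL2Z) = (\<Sum>i\<in>J. \<integral>\<^sup>+p. G (i ** p) \<partial>count_space (principal_subgroup N)))"
proof -
 obtain R where R: "finite R" "R \<subseteq> SL2Z" "SL2Z = {r ** g | r g. r \<in> R \<and> g \<in> principal_subgroup N}"
  by (rule principal_finite_index[OF N])
 obtain I where I: "finite I" "I \<subseteq> SL2Z" "I \<noteq> {}" "bij_betw (\<lambda>(p, i). p ** i) (principal_subgroup N \<times> I) SL2Z"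
  by (rule right_transversal[OF principal_group SL2Z_subgroup principal_subset R(1,3,2)])
 have SR: "\<And>g. g \<in> I \<Longrightarrow> g \<in> SL2R" "\<And>g. g \<in> principal_subgroup N \<Longrightarrow> g \<in> SL2R"
  using I(2) mat_subgroupD(1)[OF principal_group] by (auto simp: SL2Z_iff)
 have inj: "inj_on matrix_inv I"
  by (rule inj_on_inverseI[of _ matrix_inv]) (use SR SL2R_inv(4) in auto)
 have "(\<integral>\<^sup>+g. G g \<partial>count_space SL2Z) = (\<Sum>i\<in>matrix_inv ` I. \<integral>\<^sup>+p. G (i ** p) \<partial>count_space (principal_subgroup N))" for G :: "mat2 \<Rightarrow> ennreal"
 proof -
  have "(\<integral>\<^sup>+g. G g \<partial>count_space SL2Z) = (\<integral>\<^sup>+g. G (matrix_inv g) \<partial>count_space SL2Z)"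
   by (rule nn_integral_bij_count_space[OF bij_betw_matrix_inv[OF SL2Z_subgroup], symmetric])
  also have "\<dots> = (\<integral>\<^sup>+x. G (matrix_inv (case x of (p, i) \<Rightarrow> p ** i)) \<partial>count_space (principal_subgroup N \<times> I))"
   by (rule nn_integral_bij_count_space[OF I(4), of "\<lambda>g. G (matrix_inv g)", symmetric])
  also have "\<dots> = (\<Sum>i\<in>I. \<integral>\<^sup>+p. G (matrix_inv (p ** i)) \<partial>count_space (principal_subgroup N))"
   using I(1) P_countable by (subst nn_integral_count_space_Times) (auto simp: countable_finite nn_integral_count_space_finite)
  also have "\<dots> = (\<Sum>i\<in>I. \<integral>\<^sup>+p. G (matrix_inv i ** p) \<partial>count_space (principal_subgroup N))"
  proof (rule sum.cong[OF refl])
   fix i assume i: "i \<in> I"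
   have "(\<integral>\<^sup>+p. G (matrix_inv (p ** i)) \<partial>count_space (principal_subgroup N)) =
     (\<integral>\<^sup>+p. G (matrix_inv i ** matrix_inv p) \<partial>count_space (principal_subgroup N))"
    by (rule nn_integral_cong) (simp add: SR i matrix_inv_mult)
   also have "\<dots> = (\<integral>\<^sup>+p. G (matrix_inv i ** p) \<partial>count_space (principal_subgroup N))"
    by (rule nn_integral_bij_count_space[OF bij_betw_matrix_inv[OF principal_group], where f = "\<lambda>p. G (matrix_inv i ** p)"])
   finally show "(\<integral>\<^sup>+p. G (matrix_inv (p ** i)) \<partial>count_space (principal_subgroup N)) =
     (\<integral>\<^sup>+p. G (matrix_inv i ** p) \<partial>count_space (principal_subgroup N))" .
  qed
  also have "\<dots> = (\<Sum>i\<in>matrix_inv ` I. \<integral>\<^sup>+p. G (i ** p) \<partial>count_space (principal_subgroup N))"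
   by (subst sum.reindex[OF inj]) simp
  finally show ?thesis .
 qed
 moreover have "matrix_inv ` I \<subseteq> SL2Z" using I(2) mat_subgroupD(4)[OF SL2Z_subgroup] by auto
 ultimately show ?thesis using I by (intro exI[of _ "matrix_inv ` I"]) auto
qed

section \<open>A partition of unity and its comparison with \<open>F\<close>\<close>

definition reps :: "mat2 set" where
 "reps = (SOME J. finite J \<and> J \<noteq> {} \<and> J \<subseteq> SL2Z \<and>
  (\<forall>G :: mat2 \<Rightarrow> ennreal. (\<integral>\<^sup>+g. G g \<partial>count_space SL2Z) = (\<Sum>i\<in>J. \<integral>\<^sup>+p. G (i ** p) \<partial>count_space (principal_subgroup N))))"

lemma reps: "finite reps" "reps \<noteq> {}" "reps \<subseteq> SL2Z"
 "(\<integral>\<^sup>+g. (G :: mat2 \<Rightarrow> ennreal) g \<partial>count_space SL2Z) = (\<Sum>i\<in>reps. \<integral>\<^sup>+p. G (i ** p) \<partial>count_space (principal_subgroup N))"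
 using someI_ex[OF sum_over_SL2Z, folded reps_def] by auto

lemma reps_SL2R: "i \<in> reps \<Longrightarrow> i \<in> SL2R"
 using reps(3) by (auto simp: SL2Z_iff)

text \<open>A substitute for a fundamental domain of the principal subgroup: one translate of the
  Siegel set for each coset of this subgroup in \<open>SL2Z\<close>, divided by the multiplicity of
  the covering.\<close>

definition weight :: "complex \<Rightarrow> ennreal" where
 "weight z = (\<Sum>i\<in>reps. indicator (siegel_set N) (moebius i z) / siegel_count N z)"

lemma weight_measurable [measurable]: "weight \<in> borel_measurable borel"
 unfolding weight_def by measurable

lemma siegel_count_bounds:
 assumes "z \<in> uhp"
 shows "siegel_count N z \<noteq> 0" "siegel_count N z \<noteq> top" "enn2real (siegel_count N z) \<ge> 1"
  "ennreal (enn2real (siegel_count N z)) = siegel_count N z"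
 using siegel_card_pos[OF assms N] by (auto simp: siegel_count_card[OF assms])

text \<open>The elements p together with the representatives run through all of \<open>SL2Z\<close>,
  so the numerators add up to \<open>siegel_count\<close>, while the denominator is
  invariant.\<close>

lemma sum_weight:
 assumes z: "z \<in> uhp"
 shows "(\<integral>\<^sup>+p. weight (moebius p z) \<partial>count_space (principal_subgroup N)) = 1"
proof -
 have PR: "\<And>p. p \<in> principal_subgroup N \<Longrightarrow> p \<in> SL2R" using mat_subgroupD(1)[OF principal_group] .
 have "(\<integral>\<^sup>+p. weight (moebius p z) \<partial>count_space (principal_subgroup N)) =
   (\<integral>\<^sup>+p. (\<Sum>i\<in>reps. indicator (siegel_set N) (moebius (i ** p) z) / siegel_count N z) \<partial>count_space (principal_subgroup N))"
 proof (rule nn_integral_cong)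
  fix p assume "p \<in> space (count_space (principal_subgroup N))"
  then have p: "p \<in> principal_subgroup N" by simp
  have c: "siegel_count N (moebius p z) = siegel_count N z"
   using p principal_subset by (intro siegel_count_inv z) auto
  show "weight (moebius p z) = (\<Sum>i\<in>reps. indicator (siegel_set N) (moebius (i ** p) z) / siegel_count N z)"
   unfolding weight_def c by (intro sum.cong refl) (simp add: moebius_mult reps_SL2R PR[OF p] z)
 qed
 also have "\<dots> = (\<Sum>i\<in>reps. \<integral>\<^sup>+p. indicator (siegel_set N) (moebius (i ** p) z) / siegel_count N z \<partial>count_space (principal_subgroup N))"
  by (rule nn_integral_sum) simp
 also have "\<dots> = (\<integral>\<^sup>+g. indicator (siegel_set N) (moebius g z) / siegel_count N z \<partial>count_space SL2Z)"
  by (rule reps(4)[symmetric])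
 also have "\<dots> = siegel_count N z / siegel_count N z"
 proof -
  have "(\<integral>\<^sup>+g. indicator (siegel_set N) (moebius g z) / c \<partial>count_space SL2Z) =
   (\<integral>\<^sup>+g. indicator (siegel_set N) (moebius g z) \<partial>count_space SL2Z) / c" for c
   by (rule nn_integral_divide) simp
  then show ?thesis by (simp only: siegel_count_def[of N z, symmetric])
 qed
 also have "\<dots> = 1" using siegel_count_bounds[OF z] by (intro ennreal_divide_self) (auto simp: top.not_eq_extremum)
 finally show ?thesis .
qed

text \<open>Every coset of the principal subgroup in \<Gamma> contributes 1, so the constant is the
  number of these cosets.\<close>

lemma sum_weight_\<Gamma>: "\<exists>m > (0::real). \<forall>z\<in>uhp. (\<integral>\<^sup>+g. weight (moebius g z) \<partial>count_space \<Gamma>) = ennreal m"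
proof -
 obtain I where I: "finite I" "I \<noteq> {}" "I \<subseteq> \<Gamma>"
  "\<And>G :: mat2 \<Rightarrow> ennreal. (\<integral>\<^sup>+g. G g \<partial>count_space \<Gamma>) = (\<Sum>i\<in>I. \<integral>\<^sup>+p. G (p ** i) \<partial>count_space (principal_subgroup N))"
  using sum_over_\<Gamma> by blast
 have "(\<integral>\<^sup>+g. weight (moebius g z) \<partial>count_space \<Gamma>) = ennreal (real (card I))" if z: "z \<in> uhp" for z
 proof -
  have "(\<integral>\<^sup>+g. weight (moebius g z) \<partial>count_space \<Gamma>) = (\<Sum>i\<in>I. \<integral>\<^sup>+p. weight (moebius (p ** i) z) \<partial>count_space (principal_subgroup N))"
   by (rule I(4))
  also have "\<dots> = (\<Sum>i\<in>I. \<integral>\<^sup>+p. weight (moebius p (moebius i z)) \<partial>count_space (principal_subgroup N))"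
   using I(3) \<Gamma>_SL2R principal_sub by (intro sum.cong nn_integral_cong refl arg_cong[of _ _ weight] moebius_mult z) auto
  also have "\<dots> = (\<Sum>i\<in>I. 1)"
   using I(3) \<Gamma>_SL2R z by (intro sum.cong sum_weight refl) auto
  finally show ?thesis by (simp add: ennreal_of_nat_eq_real_of_nat)
 qed
 moreover have "real (card I) > 0" using I by (simp add: card_gt_0_iff)
 ultimately show ?thesis by blast
qed

text \<open>Almost every orbit meets \<open>F\<close> once, up to the sign of the matrix: if h z
  lies in \<open>F\<close>, the other elements that bring z into \<open>F\<close> are g h with g = 1
  or g = -1. The exceptional null sets, one for each pair (g, h), are countable in number.\<close>

lemma sum_indicator_F:
 "AE z in \<mu>. (\<integral>\<^sup>+g. indicator F (moebius g z) \<partial>count_space \<Gamma>) = ennreal (real (card (\<Gamma> \<inter> {mat 1, - mat 1})))"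
proof -
 have "AE z in \<mu>. moebius h z \<in> F \<longrightarrow> moebius g (moebius h z) \<notin> F"
  if "g \<in> \<Gamma>" "h \<in> \<Gamma>" "g \<noteq> mat 1" "g \<noteq> - mat 1" for g h
 proof (rule AE_hyp_moebius)
  show "h \<in> SL2R" using that \<Gamma>_SL2R by auto
  have "AE z in lborel. z \<in> F \<longrightarrow> moebius g z \<notin> F" using fundamental that by (auto simp: fundamental_domain_def)
  then show "AE z in \<mu>. z \<in> F \<longrightarrow> moebius g z \<notin> F" unfolding AE_hyp_iff by eventually_elim auto
 qed
 then have "AE z in \<mu>. \<forall>x\<in>(\<Gamma> - {mat 1, - mat 1}) \<times> \<Gamma>. moebius (snd x) z \<in> F \<longrightarrow> moebius (fst x) (moebius (snd x) z) \<notin> F"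
  using \<Gamma>_countable by (subst AE_ball_countable) (auto intro: countable_SIGMA countable_Diff)
 then show ?thesis using AE_uhp
 proof eventually_elim
  case (elim z)
  note * = elim(1) and z = elim(2)
  obtain h where h: "h \<in> \<Gamma>" "moebius h z \<in> F" using F_covers[OF z] by auto
  have hR: "h \<in> SL2R" using h \<Gamma>_SL2R by auto
  have "bij_betw (\<lambda>g. g ** h) (\<Gamma> \<inter> {mat 1, - mat 1}) {g \<in> \<Gamma>. moebius g z \<in> F}"
  proof (rule bij_betw_imageI)
   show "inj_on (\<lambda>g. g ** h) (\<Gamma> \<inter> {mat 1, - mat 1})"
    by (rule inj_on_inverseI[where g = "\<lambda>g. g ** matrix_inv h"]) (rule SL2R_cancel(4)[OF hR])
   show "(\<lambda>g. g ** h) ` (\<Gamma> \<inter> {mat 1, - mat 1}) = {g \<in> \<Gamma>. moebius g z \<in> F}"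
   proof (intro equalityI subsetI)
    fix x assume "x \<in> (\<lambda>g. g ** h) ` (\<Gamma> \<inter> {mat 1, - mat 1})"
    then obtain g where g: "g \<in> \<Gamma>" "g = mat 1 \<or> g = - mat 1" "x = g ** h" by auto
    have "moebius x z = moebius g (moebius h z)"
     using g(3) moebius_mult[OF \<Gamma>_SL2R[OF g(1)] hR z] by simp
    also have "\<dots> = moebius h z" using g(2) by auto
    finally have "moebius x z \<in> F" using h by simp
    then show "x \<in> {g \<in> \<Gamma>. moebius g z \<in> F}" using g h mat_subgroupD(3)[OF \<Gamma>_group] by auto
   next
    fix x assume "x \<in> {g \<in> \<Gamma>. moebius g z \<in> F}"
    then have x: "x \<in> \<Gamma>" "moebius x z \<in> F" by auto
    define g where "g = x ** matrix_inv h"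
    have g: "g \<in> \<Gamma>" unfolding g_def using x h mat_subgroupD[OF \<Gamma>_group] by auto
    have xg: "x = g ** h" using SL2R_cancel(3)[OF hR] by (simp add: g_def)
    have "moebius g (moebius h z) \<in> F" using x xg moebius_mult[OF \<Gamma>_SL2R[OF g] hR z] by simp
    then have "g = mat 1 \<or> g = - mat 1" using bspec[OF *, of "(g, h)"] g h by auto
    then show "x \<in> (\<lambda>g. g ** h) ` (\<Gamma> \<inter> {mat 1, - mat 1})" using g xg by auto
   qed
  qed
  then have card: "card {g \<in> \<Gamma>. moebius g z \<in> F} = card (\<Gamma> \<inter> {mat 1, - mat 1})"
    and fin: "finite {g \<in> \<Gamma>. moebius g z \<in> F}"
   by (auto dest: bij_betw_same_card bij_betw_finite)
  have "(\<integral>\<^sup>+g. indicator F (moebius g z) \<partial>count_space \<Gamma>) = (\<integral>\<^sup>+g. indicator {g \<in> \<Gamma>. moebius g z \<in> F} g \<partial>count_space \<Gamma>)"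
   by (intro nn_integral_cong) (auto simp: indicator_def)
  also have "\<dots> = ennreal (real (card (\<Gamma> \<inter> {mat 1, - mat 1})))"
   using fin card by (simp add: ennreal_of_nat_eq_real_of_nat)
  finally show "(\<integral>\<^sup>+g. indicator F (moebius g z) \<partial>count_space \<Gamma>) = ennreal (real (card (\<Gamma> \<inter> {mat 1, - mat 1})))" .
 qed
qed

definition orbit_mass :: real where
 "orbit_mass = (SOME m. m > 0 \<and> (\<forall>z\<in>uhp. (\<integral>\<^sup>+g. weight (moebius g z) \<partial>count_space \<Gamma>) = ennreal m))"

lemma orbit_mass: "orbit_mass > 0" "z \<in> uhp \<Longrightarrow> (\<integral>\<^sup>+g. weight (moebius g z) \<partial>count_space \<Gamma>) = ennreal orbit_mass"
 using someI_ex[OF sum_weight_\<Gamma>, folded orbit_mass_def] by auto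

text \<open>The ratio of the masses that almost every orbit gives to \<open>F\<close> and to
  \<open>weight\<close>; it converts integrals against the one into integrals against the
  other.\<close>

definition folding :: real where
 "folding = real (card (\<Gamma> \<inter> {mat 1, - mat 1})) / orbit_mass"

lemma card_pm: "card (\<Gamma> \<inter> {mat 1, - mat 1}) > 0"
 using mat_subgroupD(2)[OF \<Gamma>_group] by (auto simp: card_gt_0_iff)

lemma folding_pos: "folding > 0"
 unfolding folding_def using card_pm orbit_mass(1) by simp

text \<open>Mass transport between the indicator of \<open>F\<close> and \<open>weight\<close>,
  whose sums over \<Gamma>-orbits are both constant.\<close>

lemma unfold_weight:
 assumes [measurable]: "h \<in> borel_measurable borel"
  and inv: "\<And>g z. g \<in> \<Gamma> \<Longrightarrow> z \<in> uhp \<Longrightarrow> h (moebius g z) = h z"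
 shows "(\<integral>\<^sup>+z. indicator F z * h z \<partial>\<mu>) = ennreal folding * (\<integral>\<^sup>+z. weight z * h z \<partial>\<mu>)"
proof -
 define m where "m = orbit_mass"
 define e where "e = real (card (\<Gamma> \<inter> {mat 1, - mat 1}))"
 have m: "m > 0 \<and> (\<forall>z\<in>uhp. (\<integral>\<^sup>+g. weight (moebius g z) \<partial>count_space \<Gamma>) = ennreal m)"
  unfolding m_def using orbit_mass by auto
 have "(\<integral>\<^sup>+z. indicator F z * h z \<partial>\<mu>) * ennreal m =
   (\<integral>\<^sup>+z. indicator F z * h z * (\<integral>\<^sup>+g. weight (moebius g z) \<partial>count_space \<Gamma>) \<partial>\<mu>)"
  by (subst nn_integral_multc[symmetric], measurable, rule nn_integral_cong_AE, rule AE_mp[OF AE_uhp])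
    (use m in auto)
 also have "\<dots> = (\<integral>\<^sup>+z. weight z * h z * (\<integral>\<^sup>+g. indicator F (moebius g z) \<partial>count_space \<Gamma>) \<partial>\<mu>)"
  by (rule transfer_unfolding[OF \<Gamma>_group \<Gamma>_countable]) (use inv in auto)
 also have "\<dots> = (\<integral>\<^sup>+z. weight z * h z * ennreal e \<partial>\<mu>)"
  by (rule nn_integral_cong_AE, rule AE_mp[OF sum_indicator_F]) (auto simp: e_def)
 also have "\<dots> = (\<integral>\<^sup>+z. weight z * h z \<partial>\<mu>) * ennreal e"
  by (rule nn_integral_multc) measurable
 finally have *: "(\<integral>\<^sup>+z. indicator F z * h z \<partial>\<mu>) * ennreal m = (\<integral>\<^sup>+z. weight z * h z \<partial>\<mu>) * ennreal e" .
 have "(\<integral>\<^sup>+z. indicator F z * h z \<partial>\<mu>) = (\<integral>\<^sup>+z. indicator F z * h z \<partial>\<mu>) * (ennreal m * ennreal (1 / m))"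
  using m by (simp add: ennreal_mult[symmetric])
 also have "\<dots> = (\<integral>\<^sup>+z. weight z * h z \<partial>\<mu>) * (ennreal e * ennreal (1 / m))"
  by (simp only: mult.assoc[symmetric] *)
 also have "ennreal e * ennreal (1 / m) = ennreal folding"
  using m by (simp add: ennreal_mult[symmetric] folding_def m_def[symmetric] e_def)
 finally show ?thesis by (simp add: mult.commute)
qed

text \<open>The weight of one coset after the substitution w = i z has moved it to the standard
  Siegel set; the factor \<open>folding\<close> is absorbed, so that integrals over \<open>F\<close>
  are obtained exactly.\<close>

definition dens :: "complex \<Rightarrow> real" where
 "dens w = indicator (siegel_set N) w * folding / enn2real (siegel_count N w)"

lemma dens_measurable [measurable]: "dens \<in> borel_measurable borel"
 unfolding dens_def by measurable

lemma dens_outside: "w \<notin> siegel_set N \<Longrightarrow> dens w = 0"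
 by (simp add: dens_def)

lemma dens_bounds: "0 \<le> dens w" "dens w \<le> folding"
proof -
 show "0 \<le> dens w" using folding_pos by (simp add: dens_def)
 show "dens w \<le> folding"
 proof (cases "w \<in> siegel_set N")
  case True
  then have "enn2real (siegel_count N w) \<ge> 1" using siegel_uhp siegel_count_bounds by blast
  then show ?thesis using True folding_pos by (simp add: dens_def divide_le_eq mult_le_cancel_left1)
 qed (use folding_pos in \<open>simp add: dens_def\<close>)
qed

text \<open>Because the density is constant here, an integral along a horizontal segment of the
  Siegel set is a multiple of the mean over a period.\<close>

lemma dens_cusp: "w \<in> siegel_set N \<Longrightarrow> Im w > 2 \<Longrightarrow> dens w = folding / (2 * real N)"
proof -
 assume w: "w \<in> siegel_set N" "Im w > 2"
 then have "siegel_count N w = ennreal (2 * real N)"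
  using siegel_card_cusp[of w N] siegel_count_card[of w N] siegel_uhp by auto
 then show "dens w = folding / (2 * real N)" using w by (simp add: dens_def)
qed

definition tot_dens :: "complex \<Rightarrow> real" where
 "tot_dens z = (\<Sum>i\<in>reps. dens (moebius i z))"

lemma tot_dens_measurable [measurable]: "tot_dens \<in> borel_measurable borel"
 unfolding tot_dens_def by measurable

lemma tot_dens_nonneg: "tot_dens z \<ge> 0"
 unfolding tot_dens_def by (intro sum_nonneg dens_bounds)

lemma weight_tot_dens:
 assumes z: "z \<in> uhp"
 shows "ennreal folding * weight z = ennreal (tot_dens z)"
proof -
 have "ennreal folding * weight z = (\<Sum>i\<in>reps. ennreal (dens (moebius i z)))"
  unfolding weight_def sum_distrib_left
 proof (rule sum.cong[OF refl])
  fix i assume i: "i \<in> reps"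
  have c: "siegel_count N (moebius i z) = siegel_count N z" using siegel_count_inv[OF z] i reps(3) by auto
  define k where "k = enn2real (siegel_count N z)"
  have k: "k \<ge> 1" "ennreal k = siegel_count N z" using siegel_count_bounds[OF z] by (auto simp: k_def)
  show "ennreal folding * (indicator (siegel_set N) (moebius i z) / siegel_count N z) = ennreal (dens (moebius i z))"
   unfolding dens_def c k_def[symmetric] k(2)[symmetric] using k(1) folding_pos
   by (auto simp: indicator_def divide_ennreal[symmetric] ennreal_times_divide)
 qed
 also have "\<dots> = ennreal (tot_dens z)" unfolding tot_dens_def by (rule sum_ennreal) (rule dens_bounds)
 finally show ?thesis .
qed

lemma nn_unfold:
 assumes [measurable]: "h \<in> borel_measurable borel"
  and inv: "\<And>g z. g \<in> \<Gamma> \<Longrightarrow> z \<in> uhp \<Longrightarrow> h (moebius g z) = h z"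
 shows "(\<integral>\<^sup>+z. indicator F z * h z \<partial>\<mu>) = (\<integral>\<^sup>+z. ennreal (tot_dens z) * h z \<partial>\<mu>)"
proof -
 have "(\<integral>\<^sup>+z. indicator F z * h z \<partial>\<mu>) = (\<integral>\<^sup>+z. ennreal folding * (weight z * h z) \<partial>\<mu>)"
  by (subst unfold_weight[OF assms]) (auto simp: nn_integral_cmult)
 also have "\<dots> = (\<integral>\<^sup>+z. ennreal (tot_dens z) * h z \<partial>\<mu>)"
  by (rule nn_integral_cong_AE, rule AE_mp[OF AE_uhp]) (auto simp: weight_tot_dens mult.assoc[symmetric])
 finally show ?thesis .
qed

definition invariant :: "(complex \<Rightarrow> 'a) \<Rightarrow> bool" where
 "invariant h \<longleftrightarrow> (\<forall>g\<in>\<Gamma>. \<forall>z\<in>uhp. h (moebius g z) = h z)"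

lemma invariantD: "invariant h \<Longrightarrow> g \<in> \<Gamma> \<Longrightarrow> z \<in> uhp \<Longrightarrow> h (moebius g z) = h z"
 by (auto simp: invariant_def)

text \<open>\<open>nn_unfold\<close>, applied to indicators of preimages of Borel sets, shows that
  \<open>h'\<close> has the same distribution under the densities \<open>indicator F\<close> and
  \<open>tot_dens\<close>. Integrability and integrals then agree for values in any Banach space,
  with no splitting into positive parts. Finally each summand is moved to the Siegel set by w = i
  z.\<close>

lemma unfold_integral:
 fixes h :: "complex \<Rightarrow> 'a :: {banach, second_countable_topology}"
 assumes m: "uhp_measurable h" and inv: "invariant h"
 shows "set_integrable \<mu> F h \<longleftrightarrow> (\<forall>i\<in>reps. integrable \<mu> (\<lambda>w. dens w *\<^sub>R h (moebius (matrix_inv i) w)))"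
  and "set_integrable \<mu> F h \<Longrightarrow> hyp_int F h =
   (\<Sum>i\<in>reps. \<integral>w. dens w *\<^sub>R h (moebius (matrix_inv i) w) \<partial>\<mu>)"
proof -
 define h' where "h' = (\<lambda>z. indicator uhp z *\<^sub>R h z)"
 have [measurable]: "h' \<in> borel_measurable borel"
  using m by (simp add: h'_def set_borel_measurable_def)
 define N1 where "N1 = density \<mu> (\<lambda>z. ennreal (indicator F z))"
 define N2 where "N2 = density \<mu> (\<lambda>z. ennreal (tot_dens z))"
 have sets: "sets N1 = sets borel" "sets N2 = sets borel" by (auto simp: N1_def N2_def)
 have hN: "h' \<in> borel_measurable N1" "h' \<in> borel_measurable N2"
  by (simp_all add: measurable_cong_sets[OF sets(1) refl] measurable_cong_sets[OF sets(2) refl])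
 have eq: "distr N1 borel h' = distr N2 borel h'"
 proof (rule measure_eqI)
  fix A :: "'a set" assume "A \<in> sets (distr N1 borel h')"
  then have [measurable]: "A \<in> sets borel" by simp
  have [measurable]: "h' -` A \<in> sets borel" using measurable_sets[of h' borel borel A] by simp
  have "emeasure (distr N1 borel h') A = (\<integral>\<^sup>+z. indicator F z * indicator A (h' z) \<partial>\<mu>)"
   by (subst emeasure_distr) (auto simp: hN N1_def emeasure_density ennreal_indicator indicator_vimage intro!: nn_integral_cong split: split_indicator)
  also have "\<dots> = (\<integral>\<^sup>+z. ennreal (tot_dens z) * indicator A (h' z) \<partial>\<mu>)"
  proof (rule nn_unfold)
   fix g z assume "g \<in> \<Gamma>" "z \<in> uhp"
   then have "h' (moebius g z) = h' z"
    using invariantD[OF inv] \<Gamma>_SL2R moebius_uhp by (auto simp: h'_def)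
   then show "indicator A (h' (moebius g z)) = (indicator A (h' z) :: ennreal)" by simp
  qed measurable
  also have "\<dots> = emeasure (distr N2 borel h') A"
   by (subst emeasure_distr) (auto simp: hN N2_def emeasure_density intro!: nn_integral_cong split: split_indicator)
  finally show "emeasure (distr N1 borel h') A = emeasure (distr N2 borel h') A" .
 qed simp
 have 1: "integrable N1 h' \<longleftrightarrow> integrable N2 h'" "integral\<^sup>L N1 h' = integral\<^sup>L N2 h'"
  using integrable_distr_eq[OF hN(1), of "\<lambda>x. x"] integrable_distr_eq[OF hN(2), of "\<lambda>x. x"]
   integral_distr[OF hN(1), of "\<lambda>x. x"] integral_distr[OF hN(2), of "\<lambda>x. x"] by (auto simp: eq)
 have Fh: "indicator F z *\<^sub>R h z = indicat_real F z *\<^sub>R h' z" for z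
  using F_uhp by (auto simp: h'_def indicator_def)
 have 2: "integrable N1 h' \<longleftrightarrow> set_integrable \<mu> F h" "integral\<^sup>L N1 h' = hyp_int F h"
  unfolding N1_def set_integrable_def set_lebesgue_integral_def Fh
  by (subst integrable_density integral_density; auto simp: ennreal_indicator)+
 have 3: "integrable N2 h' \<longleftrightarrow> integrable \<mu> (\<lambda>z. tot_dens z *\<^sub>R h' z)"
   "integral\<^sup>L N2 h' = (\<integral>z. tot_dens z *\<^sub>R h' z \<partial>\<mu>)"
  unfolding N2_def using tot_dens_nonneg by (subst integrable_density integral_density; auto)+
 have pc: "integrable \<mu> (\<lambda>z. dens (moebius i z) *\<^sub>R h' z) \<longleftrightarrow> integrable \<mu> (\<lambda>w. dens w *\<^sub>R h (moebius (matrix_inv i) w))"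
  "(\<integral>z. dens (moebius i z) *\<^sub>R h' z \<partial>\<mu>) = (\<integral>w. dens w *\<^sub>R h (moebius (matrix_inv i) w) \<partial>\<mu>)" if i: "i \<in> reps" for i
 proof -
  have iR: "i \<in> SL2R" using i reps_SL2R by auto
  define g where "g = (\<lambda>w. dens w *\<^sub>R h' (moebius (matrix_inv i) w))"
  have gm [measurable]: "g \<in> borel_measurable borel" unfolding g_def by measurable
  have g: "g = (\<lambda>w. dens w *\<^sub>R h (moebius (matrix_inv i) w))"
  proof
   fix w show "g w = dens w *\<^sub>R h (moebius (matrix_inv i) w)"
   proof (cases "w \<in> siegel_set N")
    case True
    then have "moebius (matrix_inv i) w \<in> uhp" using siegel_uhp SL2R_inv(1)[OF iR] by blast
    then show ?thesis by (simp add: g_def h'_def)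
   qed (simp add: g_def dens_outside)
  qed
  have ae: "AE z in \<mu>. dens (moebius i z) *\<^sub>R h' z = g (moebius i z)"
   by (rule AE_mp[OF AE_uhp]) (use iR in \<open>auto simp: g_def\<close>)
  show "integrable \<mu> (\<lambda>z. dens (moebius i z) *\<^sub>R h' z) \<longleftrightarrow> integrable \<mu> (\<lambda>w. dens w *\<^sub>R h (moebius (matrix_inv i) w))"
   unfolding g[symmetric] integrable_hyp_moebius[OF gm iR, symmetric]
   by (rule integrable_cong_AE[OF _ _ ae]) measurable
  show "(\<integral>z. dens (moebius i z) *\<^sub>R h' z \<partial>\<mu>) = (\<integral>w. dens w *\<^sub>R h (moebius (matrix_inv i) w) \<partial>\<mu>)"
   unfolding g[symmetric] integral_hyp_moebius[OF gm iR, symmetric]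
   by (rule integral_cong_AE[OF _ _ ae]) measurable
 qed
 have 4: "integrable \<mu> (\<lambda>z. tot_dens z *\<^sub>R h' z) \<longleftrightarrow> (\<forall>i\<in>reps. integrable \<mu> (\<lambda>z. dens (moebius i z) *\<^sub>R h' z))"
 proof
  assume I: "integrable \<mu> (\<lambda>z. tot_dens z *\<^sub>R h' z)"
  show "\<forall>i\<in>reps. integrable \<mu> (\<lambda>z. dens (moebius i z) *\<^sub>R h' z)"
  proof
   fix i assume i: "i \<in> reps"
   have "dens (moebius i z) \<le> tot_dens z" for z
    unfolding tot_dens_def using i reps(1) dens_bounds by (intro member_le_sum) auto
   then have "norm (dens (moebius i z) *\<^sub>R h' z) \<le> norm (tot_dens z *\<^sub>R h' z)" for z
    using dens_bounds(1)[of "moebius i z"] tot_dens_nonneg[of z] by (simp add: mult_right_mono)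
   then show "integrable \<mu> (\<lambda>z. dens (moebius i z) *\<^sub>R h' z)"
    by (intro bochner_bound[OF I]) auto
  qed
 next
  assume "\<forall>i\<in>reps. integrable \<mu> (\<lambda>z. dens (moebius i z) *\<^sub>R h' z)"
  then show "integrable \<mu> (\<lambda>z. tot_dens z *\<^sub>R h' z)"
   unfolding tot_dens_def scaleR_sum_left by auto
 qed
 show iff: "set_integrable \<mu> F h \<longleftrightarrow> (\<forall>i\<in>reps. integrable \<mu> (\<lambda>w. dens w *\<^sub>R h (moebius (matrix_inv i) w)))"
  using 1 2 3 4 pc(1) by auto
 assume "set_integrable \<mu> F h"
 then have I: "\<And>i. i \<in> reps \<Longrightarrow> integrable \<mu> (\<lambda>z. dens (moebius i z) *\<^sub>R h' z)"
  using iff pc(1) by auto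
 have "hyp_int F h = (\<integral>z. (\<Sum>i\<in>reps. dens (moebius i z) *\<^sub>R h' z) \<partial>\<mu>)"
  using 1 2 3 by (simp add: tot_dens_def scaleR_sum_left)
 also have "\<dots> = (\<Sum>i\<in>reps. \<integral>z. dens (moebius i z) *\<^sub>R h' z \<partial>\<mu>)"
  using I by (rule Bochner_Integration.integral_sum)
 also have "\<dots> = (\<Sum>i\<in>reps. \<integral>w. dens w *\<^sub>R h (moebius (matrix_inv i) w) \<partial>\<mu>)"
  using pc(2) by simp
 finally show "hyp_int F h = (\<Sum>i\<in>reps. \<integral>w. dens w *\<^sub>R h (moebius (matrix_inv i) w) \<partial>\<mu>)" .
qed

section \<open>The truncated domain\<close>

text \<open>\<Gamma> is a finite union of cosets of an integral group, so one denominator D serves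
  all elements. Periods at the cusps are then multiples of 1 / D and cannot become small.\<close>

lemma \<Gamma>_denominator:
 obtains D :: nat where "D \<ge> 1" "\<And>g. g \<in> \<Gamma> \<Longrightarrow> int_mat (real D *\<^sub>R g)"
proof -
 obtain R where R: "finite R" "R \<subseteq> \<Gamma>" "\<Gamma> = {r ** g | r g. r \<in> R \<and> g \<in> principal_subgroup N}"
  using finite_index by auto
 have "\<exists>D::nat. D \<ge> 1 \<and> (\<forall>r\<in>R. int_mat (real D *\<^sub>R r))"
  using R(1) R(2)
 proof (induction R rule: finite_induct)
  case (insert r R)
  then obtain D :: nat where D: "D \<ge> 1" "\<forall>r\<in>R. int_mat (real D *\<^sub>R r)" by auto
  have "r \<in> SL2Q" using insert.prems \<Gamma>_SL2Q by auto
  then obtain D' :: nat where D': "D' \<ge> 1" "int_mat (real D' *\<^sub>R r)"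
   using clear_denominators[of r] by (auto simp: SL2Q_def)
  have "int_mat (real (D * D') *\<^sub>R r)" using int_mat_intros(4)[OF D'(2), of D] by simp
  moreover have "int_mat (real (D * D') *\<^sub>R s)" if "s \<in> R" for s
   using int_mat_intros(4)[OF D(2)[rule_format, OF that], of D'] by (simp add: mult.commute)
  ultimately show ?case using D D' by (intro exI[of _ "D * D'"]) auto
 qed auto
 then obtain D :: nat where D: "D \<ge> 1" "\<forall>r\<in>R. int_mat (real D *\<^sub>R r)" by auto
 have "int_mat (real D *\<^sub>R g)" if g: "g \<in> \<Gamma>" for g
 proof -
  obtain r p where rp: "g = r ** p" "r \<in> R" "p \<in> principal_subgroup N" using R(3) g by blast
  have "int_mat p" using rp(3) principal_subset[of N] by (auto simp: SL2Z_iff)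
  then have "int_mat ((real D *\<^sub>R r) ** p)" using D(2) rp by (intro int_mat_intros(1)) auto
  moreover have "(real D *\<^sub>R r) ** p = real D *\<^sub>R g" by (simp add: rp mat2_eq_iff algebra_simps)
  ultimately show ?thesis by simp
 qed
 then show ?thesis using that D by blast
qed

lemma cusp_period_iff:
 "cusp_period \<Gamma> s a \<longleftrightarrow> a > 0 \<and> s ** translation a ** matrix_inv s \<in> \<Gamma>"
 by (simp add: cusp_period_def translation_def)

lemma cusp_period_N:
 assumes "s \<in> SL2Z"
 shows "cusp_period \<Gamma> s (real N)"
proof -
 have "translation (real N) \<in> principal_subgroup N"
  unfolding principal_iff
  by (intro conjI exI[of _ "mat2 0 1 0 0"]) (auto simp: int_mat_iff mat2_eq_iff translation_def intro: SL2R_I)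
 then show ?thesis using principal_conj assms principal_sub N by (auto simp: cusp_period_iff)
qed

text \<open>Some uniform positive lower bound for the periods at all cusps; it is not claimed to be
  attained.\<close>

definition min_period :: real where
 "min_period = (SOME a. a > 0 \<and> (\<forall>s\<in>SL2Z. \<forall>b. cusp_period \<Gamma> s b \<longrightarrow> a \<le> b))"

lemma min_period: "min_period > 0" "s \<in> SL2Z \<Longrightarrow> cusp_period \<Gamma> s b \<Longrightarrow> min_period \<le> b"
proof -
 obtain D :: nat where D: "D \<ge> 1" "\<And>g. g \<in> \<Gamma> \<Longrightarrow> int_mat (real D *\<^sub>R g)"
  using \<Gamma>_denominator by blast
 have "1 / real D \<le> b" if s: "s \<in> SL2Z" and b: "cusp_period \<Gamma> s b" for s b
 proof -
  have sR: "s \<in> SL2R" and sZ: "int_mat s" using s by (auto simp: SL2Z_iff)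
  have g: "s ** translation b ** matrix_inv s \<in> \<Gamma>" "b > 0" using b by (auto simp: cusp_period_iff)
  let ?g = "s ** translation b ** matrix_inv s"
  have "int_mat (matrix_inv s ** (real D *\<^sub>R ?g) ** s)"
   using D(2)[OF g(1)] sZ int_mat_inv[OF sR sZ] by (intro int_mat_intros(1))
  moreover have "matrix_inv s ** (real D *\<^sub>R X) ** s = real D *\<^sub>R (matrix_inv s ** X ** s)" for X
   by (simp add: mat2_eq_iff algebra_simps)
  moreover have "matrix_inv s ** ?g ** s = translation b"
   using SL2R_cancel[OF sR] by (simp add: matrix_mul_assoc[symmetric] SL2R_inv(3)[OF sR])
  ultimately have "int_mat (real D *\<^sub>R translation b)" by simp
  then have "real D * b \<in> \<int>" by (simp add: int_mat_iff translation_def)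
  moreover have "real D * b > 0" using D(1) g(2) by simp
  ultimately have "real D * b \<ge> 1" by (auto elim!: Ints_cases)
  then show ?thesis using D(1) by (simp add: field_simps)
 qed
 then have "\<exists>a > 0. \<forall>s\<in>SL2Z. \<forall>b. cusp_period \<Gamma> s b \<longrightarrow> a \<le> b"
  using D(1) by (intro exI[of _ "1 / real D"]) auto
 from someI_ex[OF this] show "min_period > 0" "s \<in> SL2Z \<Longrightarrow> cusp_period \<Gamma> s b \<Longrightarrow> min_period \<le> b"
  unfolding min_period_def[symmetric] by auto
qed

text \<open>An infimum suffices: for T > 0 the inequalities y <= T a for all periods a amount to the
  single one at the infimum, whether or not it is a period.\<close>

definition width :: "mat2 \<Rightarrow> real" where
 "width s = Inf {a. cusp_period \<Gamma> s a}"

lemma width: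
 assumes s: "s \<in> SL2Z"
 shows "min_period \<le> width s" "width s \<le> real N"
  "T > 0 \<Longrightarrow> (\<forall>a. cusp_period \<Gamma> s a \<longrightarrow> y \<le> T * a) \<longleftrightarrow> y \<le> T * width s"
proof -
 let ?A = "{a. cusp_period \<Gamma> s a}"
 have ne: "?A \<noteq> {}" using cusp_period_N[OF s] by auto
 have bd: "bdd_below ?A" using min_period(2)[OF s] by (intro bdd_belowI[of _ min_period]) auto
 show "min_period \<le> width s" unfolding width_def using ne min_period(2)[OF s] by (intro cInf_greatest) auto
 show "width s \<le> real N" unfolding width_def using cusp_period_N[OF s] bd by (intro cInf_lower) auto
 assume T: "T > 0"
 have "(\<forall>a. cusp_period \<Gamma> s a \<longrightarrow> y \<le> T * a) \<longleftrightarrow> (\<forall>a\<in>?A. y / T \<le> a)"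
  using T by (auto simp: divide_le_eq mult.commute)
 also have "\<dots> \<longleftrightarrow> y / T \<le> width s" unfolding width_def using le_cInf_iff[OF ne bd] by simp
 also have "\<dots> \<longleftrightarrow> y \<le> T * width s" using T by (auto simp: divide_le_eq mult.commute)
 finally show "(\<forall>a. cusp_period \<Gamma> s a \<longrightarrow> y \<le> T * a) \<longleftrightarrow> y \<le> T * width s" .
qed

lemma truncated_eq:
 assumes "T > 0"
 shows "trunc T = {z \<in> uhp. \<forall>s\<in>SL2Z. Im (moebius (matrix_inv s) z) \<le> T * width s}"
 using width(3)[OF _ assms] by (auto simp: truncated_uhp_def)

lemma truncated_borel [measurable]:
 assumes "T > 0"
 shows "trunc T \<in> sets borel"
proof -
 have c: "countable SL2Z" using countable_subset[OF SL2Z_subset_SL2Q countable_SL2Q] .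
 have "trunc T = uhp \<inter> (\<Inter>s\<in>SL2Z. {z \<in> space borel. Im (moebius (matrix_inv s) z) \<le> T * width s})"
  by (auto simp: truncated_eq[OF assms])
 also have "\<dots> \<in> sets borel"
  using mat_subgroupD(2)[OF SL2Z_subgroup]
  by (intro sets.Int uhp_borel sets.countable_INT'[OF c]) auto
 finally show ?thesis .
qed

lemma truncated_uhp_sub: "trunc T \<subseteq> uhp"
 by (auto simp: truncated_uhp_def)

text \<open>Choose s' such that u = s^-1 g s' is upper triangular with lower right entry t. The
  height of z at s' is t^2 times the height of g z at s, and the period a at s becomes t^2 a at s'.
  Both sides of the truncation condition scale alike, which is why heights are measured in units of
  the period.\<close>

lemma truncated_invariant_aux:
 assumes g: "g \<in> \<Gamma>" and z: "z \<in> trunc T"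
 shows "moebius g z \<in> trunc T"
proof -
 have gR: "g \<in> SL2R" and zu: "z \<in> uhp" using g z \<Gamma>_SL2R truncated_uhp_sub by auto
 have "Im (moebius (matrix_inv s) (moebius g z)) \<le> T * a" if s: "s \<in> SL2Z" and a: "cusp_period \<Gamma> s a" for s a
 proof -
  have sR: "s \<in> SL2R" using s by (simp add: SL2Z_iff)
  define k where "k = matrix_inv s ** g"
  have kR: "k \<in> SL2R" unfolding k_def using SL2R_mult SL2R_inv(1) sR gR by auto
  have "k \<in> SL2Q"
  proof -
   have "\<And>i j. matrix_inv s $ i $ j \<in> \<rat>" "\<And>i j. g $ i $ j \<in> \<rat>"
    using SL2Z_subset_SL2Q mat_subgroupD(4)[OF SL2Z_subgroup s] g \<Gamma>_SL2Q by (auto simp: SL2Q_def)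
   then have "k $ i $ j \<in> \<rat>" for i j by (simp add: k_def)
   then show ?thesis using kR by (auto simp: SL2Q_def SL2R_def)
  qed
  then obtain s' where s': "s' \<in> SL2Z" "(k ** s') $ 2 $ 1 = 0" using SL2Q_to_upper_triangular by blast
  have s'R: "s' \<in> SL2R" using s' by (simp add: SL2Z_iff)
  define u where "u = k ** s'"
  have uR: "u \<in> SL2R" unfolding u_def using SL2R_mult kR s'R by auto
  define t where "t = u $ 2 $ 2"
  have u21: "u $ 2 $ 1 = 0" using s' by (simp add: u_def)
  have ut1: "u $ 1 $ 1 * t = 1" using SL2R_det[OF uR] u21 by (simp add: t_def)
  then have "t \<noteq> 0" by auto
  with ut1 have t: "t \<noteq> 0" "u $ 1 $ 1 = 1 / t" by (auto simp: nonzero_eq_divide_eq)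
  have ut: "matrix_inv u ** translation a ** u = translation (a * t\<^sup>2)"
   using t by (simp add: matrix_inv_SL2R[OF uR] u21 mat2_eq_iff translation_def t_def[symmetric] power2_eq_square algebra_simps)
  have sg: "matrix_inv g ** s = s' ** matrix_inv u"
  proof -
   have "matrix_inv u = matrix_inv s' ** (matrix_inv g ** s)"
    unfolding u_def k_def using sR s'R gR SL2R_mult SL2R_inv(1)[OF sR]
    by (simp add: matrix_inv_mult SL2R_inv(4))
   then show ?thesis using SL2R_cancel(2)[OF s'R] by simp
  qed
  have sg': "matrix_inv s ** g = u ** matrix_inv s'"
   unfolding u_def k_def[symmetric] using SL2R_cancel(4)[OF s'R] by simp
  have "s' ** translation (a * t\<^sup>2) ** matrix_inv s' = matrix_inv g ** (s ** translation a ** matrix_inv s) ** g"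
  proof -
   have "s' ** translation (a * t\<^sup>2) ** matrix_inv s' = (s' ** matrix_inv u) ** translation a ** (u ** matrix_inv s')"
    unfolding ut[symmetric] by (simp add: matrix_mul_assoc)
   also have "\<dots> = matrix_inv g ** (s ** translation a ** matrix_inv s) ** g"
    unfolding sg[symmetric] sg'[symmetric] by (simp add: matrix_mul_assoc)
   finally show ?thesis .
  qed
  also have "\<dots> \<in> \<Gamma>" using a g mat_subgroupD[OF \<Gamma>_group] by (auto simp: cusp_period_iff)
  finally have "cusp_period \<Gamma> s' (a * t\<^sup>2)" using a t by (auto simp: cusp_period_iff)
  then have le: "Im (moebius (matrix_inv s') z) \<le> T * (a * t\<^sup>2)" using z s' by (auto simp: truncated_uhp_def)
  have iR: "matrix_inv s' \<in> SL2R" using SL2R_inv(1)[OF s'R] .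
  have "moebius (matrix_inv s) (moebius g z) = moebius u (moebius (matrix_inv s') z)"
   using moebius_mult[OF SL2R_inv(1)[OF sR] gR zu] moebius_mult[OF uR iR zu] sg' by simp
  moreover have "Im (moebius u (moebius (matrix_inv s') z)) = Im (moebius (matrix_inv s') z) / t\<^sup>2"
   using Im_moebius[OF uR moebius_uhp[OF iR zu]] by (simp add: den_def u21 t_def)
  ultimately show ?thesis using le t by (simp add: divide_le_eq mult.assoc)
 qed
 then show ?thesis using moebius_uhp[OF gR zu] by (auto simp: truncated_uhp_def)
qed

lemma truncated_invariant:
 assumes g: "g \<in> \<Gamma>" and z: "z \<in> uhp"
 shows "moebius g z \<in> trunc T \<longleftrightarrow> z \<in> trunc T"
 using truncated_invariant_aux[OF g, of z T] truncated_invariant_aux[of "matrix_inv g" "moebius g z" T]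
  moebius_inv(2)[OF \<Gamma>_SL2R[OF g] z] mat_subgroupD(4)[OF \<Gamma>_group g] by auto

text \<open>On a Siegel set only the condition at its own cusp matters. If s'^-1 s fixes infinity,
  the widths at s and s' agree; otherwise the height at s' is at most 1 / Im w <= 2, which T has
  been taken large enough to allow.\<close>

lemma truncated_siegel:
 assumes s: "s \<in> SL2Z" and w: "Im w \<ge> 1/2" and T: "T * min_period \<ge> 2"
 shows "moebius s w \<in> trunc T \<longleftrightarrow> Im w \<le> T * width s"
proof -
 have T0: "T > 0" using T min_period(1) by (smt (verit) mult_nonneg_nonneg mult_nonpos_nonneg zero_less_mult_iff)
 have wu: "w \<in> uhp" using w by (simp add: uhp_iff)
 have sR: "s \<in> SL2R" using s by (simp add: SL2Z_iff)
 have per: "cusp_period \<Gamma> s' a \<longleftrightarrow> cusp_period \<Gamma> s a"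
  if "s' \<in> SL2Z" "matrix_inv s' ** s = translation t \<or> matrix_inv s' ** s = - translation t" for s' t a
 proof -
  have s'R: "s' \<in> SL2R" using that by (simp add: SL2Z_iff)
  define n where "n = matrix_inv s' ** s"
  have n: "n = translation t \<or> n = - translation t" using that by (simp add: n_def)
  have nR: "n \<in> SL2R" unfolding n_def using SL2R_mult SL2R_inv(1) sR s'R by auto
  have "s = s' ** n" unfolding n_def using SL2R_cancel(2)[OF s'R] by simp
  then have "s ** translation a ** matrix_inv s = s' ** (n ** translation a ** matrix_inv n) ** matrix_inv s'"
   using matrix_inv_mult[OF s'R nR] by (simp add: matrix_mul_assoc)
  moreover have "n ** translation a ** matrix_inv n = translation a"
   using n by (auto simp: matrix_inv_SL2R[OF nR] mat2_eq_iff translation_def algebra_simps)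
  ultimately show ?thesis by (simp add: cusp_period_iff)
 qed
 show ?thesis
 proof
  assume "moebius s w \<in> trunc T"
  then have "Im (moebius (matrix_inv s) (moebius s w)) \<le> T * width s" using s by (simp add: truncated_eq[OF T0])
  then show "Im w \<le> T * width s" using moebius_inv(2)[OF sR wu] by simp
 next
  assume le: "Im w \<le> T * width s"
  have "Im (moebius (matrix_inv s') (moebius s w)) \<le> T * width s'" if s': "s' \<in> SL2Z" for s'
  proof -
   have s'R: "s' \<in> SL2R" using s' by (simp add: SL2Z_iff)
   define n where "n = matrix_inv s' ** s"
   have n: "n \<in> SL2Z" unfolding n_def using mat_subgroupD[OF SL2Z_subgroup] s s' by auto
   have e: "moebius (matrix_inv s') (moebius s w) = moebius n w"
    unfolding n_def using moebius_mult[OF SL2R_inv(1)[OF s'R] sR wu] by simp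
   show ?thesis
   proof (cases "n $ 2 $ 1 = 0")
    case True
    then obtain t :: int where t: "n = translation (of_int t) \<or> n = - translation (of_int t)"
     using SL2Z_lower_left_0 n by blast
    have "Im (moebius n w) = Im w" using t by (auto simp: moebius_uminus)
    moreover have "cusp_period \<Gamma> s' = cusp_period \<Gamma> s"
     by (rule ext, rule per[OF s' t[unfolded n_def]])
    then have "width s' = width s" by (simp add: width_def)
    ultimately show ?thesis using le e by simp
   next
    case False
    have "Im (moebius n w) \<le> 1 / Im w" using Im_moebius_le_inverse[OF n False wu] .
    also have "\<dots> \<le> 2" using w by (simp add: field_simps)
    also have "\<dots> \<le> T * min_period" by fact
    also have "\<dots> \<le> T * width s'" using width(1)[OF s'] T0 by simp
    finally show ?thesis using e by simp
   qed
  qed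
  then show "moebius s w \<in> trunc T" using moebius_uhp[OF sR wu] by (auto simp: truncated_eq[OF T0])
 qed
qed

end

section \<open>Theta kernels\<close>

abbreviation coord :: "real \<Rightarrow> mat2 \<Rightarrow> complex \<Rightarrow> real" where
 "coord d X z \<equiv> bil d X (Xpt d z)"

lemma bil_eq: "bil d X Y = d * (X$1$1 * Y$2$2 + X$2$2 * Y$1$1 - X$1$2 * Y$2$1 - X$2$1 * Y$1$2)"
 by (simp add: bil_def qform_def det_mat2 algebra_simps)

lemma coord_eq:
 assumes "d > 0" "trace X = 0"
 shows "coord d X z = sqrt d * (X$1$2 + 2 * X$1$1 * Re z - X$2$1 * (cmod z)\<^sup>2) / Im z"
proof -
 have 22: "X$2$2 = - X$1$1" using assms(2) by (simp add: trace_def sum_2)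
 have d: "d / sqrt d = sqrt d" using assms(1) by (simp add: real_div_sqrt)
 have "coord d X z = (d / sqrt d) * (X$1$2 + 2 * X$1$1 * Re z - X$2$1 * (cmod z)\<^sup>2) / Im z"
  by (simp add: bil_eq Xpt_def 22 algebra_simps add_divide_distrib diff_divide_distrib)
 then show ?thesis by (simp only: d)
qed

lemma bil_self:
 assumes "trace X = 0"
 shows "bil d X X = - 2 * d * ((X$1$1)\<^sup>2 + X$1$2 * X$2$1)"
proof -
 have 22: "X$2$2 = - X$1$1" using assms by (simp add: trace_def sum_2)
 show ?thesis by (simp add: bil_eq 22 algebra_simps power2_eq_square)
qed

text \<open>The squares come from the entries of X conjugated by the translation by - Re z, scaled
  by y, 1 / y and 1; the diagonal entry counts twice. Positivity of the majorant becomes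
  visible.\<close>

lemma majorant_eq:
 assumes d: "d > 0" and X: "trace X = 0" and z: "z \<in> uhp"
 shows "majorant d X z = d * ((X$2$1 * Im z)\<^sup>2 + ((X$1$2 + 2 * X$1$1 * Re z - X$2$1 * (Re z)\<^sup>2) / Im z)\<^sup>2
   + 2 * (X$1$1 - X$2$1 * Re z)\<^sup>2)"
proof -
 have y: "Im z \<noteq> 0" using z by (simp add: uhp_iff)
 define B where "B = (X$1$2 + 2 * X$1$1 * Re z - X$2$1 * (Re z)\<^sup>2) / Im z"
 have e: "(X$1$2 + 2 * X$1$1 * Re z - X$2$1 * (cmod z)\<^sup>2) / Im z = B - X$2$1 * Im z"
  using y unfolding cmod_power2 by (simp add: B_def field_simps power2_eq_square)
 have be: "X$1$2 = B * Im z - 2 * X$1$1 * Re z + X$2$1 * (Re z)\<^sup>2" using y by (simp add: B_def)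
 have "bil d X X = - 2 * d * ((X$1$1 - X$2$1 * Re z)\<^sup>2 + B * (X$2$1 * Im z))"
  unfolding bil_self[OF X] be by (simp add: algebra_simps power2_eq_square)
 moreover have "(coord d X z)\<^sup>2 = d * (B - X$2$1 * Im z)\<^sup>2"
  using d by (simp add: coord_eq[OF d X] e power_mult_distrib flip: times_divide_eq_right)
 ultimately show ?thesis
  unfolding majorant_def B_def[symmetric] by (simp add: algebra_simps power2_eq_square)
qed

text \<open>The vector X(z) spans a positive line and has (X(z), X(z)) = 2, so the projection of X
  to it contributes p^2 / 2 to (X, X), and the orthogonal complement is negative definite. This is
  the relation 2 a <= p^2 under which all functions of (p, a) are estimated.\<close>

lemma bil_le_coord_sq:
 assumes d: "d > 0" and X: "trace X = 0" and z: "z \<in> uhp"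
 shows "2 * bil d X X \<le> (coord d X z)\<^sup>2"
proof -
 have y: "Im z \<noteq> 0" using z by (simp add: uhp_iff)
 define B where "B = (X$1$2 + 2 * X$1$1 * Re z - X$2$1 * (Re z)\<^sup>2) / Im z"
 define G where "G = X$2$1 * Im z"
 have e: "(X$1$2 + 2 * X$1$1 * Re z - X$2$1 * (cmod z)\<^sup>2) / Im z = B - G"
  using y unfolding cmod_power2 by (simp add: B_def G_def field_simps power2_eq_square)
 have be: "X$1$2 = B * Im z - 2 * X$1$1 * Re z + X$2$1 * (Re z)\<^sup>2" using y by (simp add: B_def)
 have "bil d X X = - 2 * d * ((X$1$1 - X$2$1 * Re z)\<^sup>2 + B * G)"
  unfolding bil_self[OF X] be by (simp add: G_def algebra_simps power2_eq_square)
 moreover have "(coord d X z)\<^sup>2 = d * (B - G)\<^sup>2"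
  using d by (simp add: coord_eq[OF d X] e power_mult_distrib flip: times_divide_eq_right)
 moreover have "d * (B - G)\<^sup>2 - 2 * (- 2 * d * ((X$1$1 - X$2$1 * Re z)\<^sup>2 + B * G)) =
   d * ((B + G)\<^sup>2 + 4 * (X$1$1 - X$2$1 * Re z)\<^sup>2)"
  by (simp add: algebra_simps power2_eq_square)
 moreover have "d * ((B + G)\<^sup>2 + 4 * (X$1$1 - X$2$1 * Re z)\<^sup>2) \<ge> 0" using d by simp
 ultimately show ?thesis by linarith
qed

section \<open>Equivariance under conjugation\<close>

lemma conj_act_nth:
 assumes "g \<in> SL2R" "trace X = 0"
 shows "trace (conj_act g X) = 0"
  "conj_act g X $ 1 $ 1 = (g$1$1 * g$2$2 + g$1$2 * g$2$1) * X$1$1 - g$1$1 * g$2$1 * X$1$2 + g$1$2 * g$2$2 * X$2$1"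
  "conj_act g X $ 1 $ 2 = - 2 * g$1$1 * g$1$2 * X$1$1 + (g$1$1)\<^sup>2 * X$1$2 - (g$1$2)\<^sup>2 * X$2$1"
  "conj_act g X $ 2 $ 1 = 2 * g$2$1 * g$2$2 * X$1$1 - (g$2$1)\<^sup>2 * X$1$2 + (g$2$2)\<^sup>2 * X$2$1"
proof -
 have 22: "X$2$2 = - X$1$1" using assms(2) by (simp add: trace_def sum_2)
 show "trace (conj_act g X) = 0"
  "conj_act g X $ 1 $ 1 = (g$1$1 * g$2$2 + g$1$2 * g$2$1) * X$1$1 - g$1$1 * g$2$1 * X$1$2 + g$1$2 * g$2$2 * X$2$1"
  "conj_act g X $ 1 $ 2 = - 2 * g$1$1 * g$1$2 * X$1$1 + (g$1$1)\<^sup>2 * X$1$2 - (g$1$2)\<^sup>2 * X$2$1"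
  "conj_act g X $ 2 $ 1 = 2 * g$2$1 * g$2$2 * X$1$1 - (g$2$1)\<^sup>2 * X$1$2 + (g$2$2)\<^sup>2 * X$2$1"
  by (simp_all add: conj_act_def matrix_inv_SL2R[OF assms(1)] trace_def sum_2 22 algebra_simps power2_eq_square)
qed

lemma bil_conj_act:
 assumes "g \<in> SL2R"
 shows "bil d (conj_act g X) (conj_act g X) = bil d X X"
proof -
 have "det (conj_act g X) = det X"
 proof -
  have "det (conj_act g X) = det g * det X * det (matrix_inv g)" by (simp add: conj_act_def det_mul)
  then show ?thesis using assms SL2R_inv(1)[OF assms] by (simp add: SL2R_def)
 qed
 moreover have "bil d Y Y = 2 * d * det Y" for Y by (simp add: bil_eq det_mat2 algebra_simps)
 ultimately show ?thesis by simp
qed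

text \<open>g acts on V by isometries, and X(g z) is the conjugate of X(z) by g. In coordinates this
  is a polynomial identity in which the determinant appears squared and is then replaced by
  1.\<close>

lemma coord_conj_act:
 assumes d: "d > 0" and X: "trace X = 0" and g: "g \<in> SL2R" and z: "z \<in> uhp"
 shows "coord d (conj_act g X) (moebius g z) = coord d X z"
proof -
 note c = conj_act_nth[OF g X]
 define x y where "x = Re z" and "y = Im z"
 have y: "y > 0" using z by (simp add: uhp_iff y_def)
 define n where "n = (cmod (den g z))\<^sup>2"
 have n: "n \<noteq> 0" using den_nz[OF g z] by (simp add: n_def)
 have nn: "n = (g$2$1 * x + g$2$2)\<^sup>2 + (g$2$1 * y)\<^sup>2" by (simp add: n_def cmod_den_sq x_def y_def)
 define a b c' e where "a = g$1$1" "b = g$1$2" "c' = g$2$1" "e = g$2$2"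
 note abce = this
 define al be ga where "al = X$1$1" "be = X$1$2" "ga = X$2$1"
 note abg = this
 have det: "a * e - b * c' = 1" using SL2R_det[OF g] by (simp add: abce)
 let ?al = "(a * e + b * c') * al - a * c' * be + b * e * ga"
 let ?be = "- 2 * a * b * al + a\<^sup>2 * be - b\<^sup>2 * ga"
 let ?ga = "2 * c' * e * al - c'\<^sup>2 * be + e\<^sup>2 * ga"
 have nz: "(cmod z)\<^sup>2 = x\<^sup>2 + y\<^sup>2" by (simp add: x_def y_def cmod_power2)
 have "?be * n + 2 * ?al * (a * c' * (x\<^sup>2 + y\<^sup>2) + (a * e + b * c') * x + b * e) - ?ga * ((a * x + b)\<^sup>2 + (a * y)\<^sup>2)
   = (a * e - b * c')\<^sup>2 * (be + 2 * al * x - ga * (x\<^sup>2 + y\<^sup>2))"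
  unfolding nn abce(3,4)[symmetric] by (simp add: algebra_simps power2_eq_square)
 then have key: "?be * n + 2 * ?al * (a * c' * (x\<^sup>2 + y\<^sup>2) + (a * e + b * c') * x + b * e) - ?ga * ((a * x + b)\<^sup>2 + (a * y)\<^sup>2)
   = be + 2 * al * x - ga * (x\<^sup>2 + y\<^sup>2)" by (simp add: det)
 have "coord d (conj_act g X) (moebius g z) =
   sqrt d * (?be + 2 * ?al * ((a * c' * (x\<^sup>2 + y\<^sup>2) + (a * e + b * c') * x + b * e) / n) - ?ga * (((a * x + b)\<^sup>2 + (a * y)\<^sup>2) / n)) / (y / n)"
  unfolding coord_eq[OF d c(1)] Re_moebius[OF g z] Im_moebius[OF g z] cmod_moebius[OF g z] c nz
  by (simp only: n_def[symmetric] abce[symmetric] abg[symmetric] x_def[symmetric] y_def[symmetric])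
 also have "\<dots> = sqrt d * (?be * n + 2 * ?al * (a * c' * (x\<^sup>2 + y\<^sup>2) + (a * e + b * c') * x + b * e) - ?ga * ((a * x + b)\<^sup>2 + (a * y)\<^sup>2)) / y"
  using n y by (simp add: field_simps)
 also have "\<dots> = coord d X z"
  unfolding key unfolding coord_eq[OF d X] nz abg x_def y_def by simp
 finally show ?thesis .
qed

text \<open>A product of one-variable exponentials, so that sums over a lattice factor. The entries
  are scaled as in the cusp: the upper right entry, along the direction fixed by translations, by 1
  / y and the lower left one by y.\<close>

definition cusp_weight :: "mat2 \<Rightarrow> real \<Rightarrow> real" where
 "cusp_weight X y = exp (- \<bar>X$1$1\<bar> - \<bar>X$1$2\<bar> / y - \<bar>X$2$1\<bar> * y)"

text \<open>A Gaussian absorbs exponentials of absolute values, because l |t| <= k t^2 + l^2 / (4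
  k). The factor exp |X11 - X21 Re z| on the left makes room for the horizontal derivative of
  \<open>coord\<close>, which is 2 sqrt d (X11 - X21 x) / y.\<close>

lemma gauss_le_cusp_weight:
 assumes d: "d > 0" and c: "c > 0" and M: "M \<ge> (0::real)"
 obtains K where "K > 0" "\<And>X z. trace X = 0 \<Longrightarrow> Im z \<ge> 1/2 \<Longrightarrow> 0 \<le> Re z \<Longrightarrow> Re z \<le> M \<Longrightarrow>
   exp \<bar>X$1$1 - X$2$1 * Re z\<bar> * exp (- c * majorant d X z) \<le> K * cusp_weight X (Im z)"
proof -
 \<comment> \<open>The coefficients of |A|, |B| and |G| that result in \<open>tot\<close> when the
   entries of X are bounded by these three quantities, with y >= 1/2 and 0 <= x <= M.\<close>
 define l1 l2 l3 where "l1 = 2 + 4 * M" "l2 = (1::real)" "l3 = 1 + 2 * M + 12 * M * M"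
 note l = this
 define k where "k = c * d"
 have k: "k > 0" using c d by (simp add: k_def)
 define K where "K = exp ((l1\<^sup>2 + l2\<^sup>2 + l3\<^sup>2) / (4 * k))"
 have lin: "l * \<bar>t\<bar> \<le> k * t\<^sup>2 + l\<^sup>2 / (4 * k)" for l t :: real
 proof -
  have "0 \<le> (2 * k * \<bar>t\<bar> - l)\<^sup>2" by simp
  also have "\<dots> = 4 * k * (k * t\<^sup>2 + l\<^sup>2 / (4 * k) - l * \<bar>t\<bar>)"
   using k by (simp add: power2_diff field_simps power2_eq_square)
  finally show ?thesis using k by (simp add: zero_le_mult_iff)
 qed
 have "exp \<bar>X$1$1 - X$2$1 * Re z\<bar> * exp (- c * majorant d X z) \<le> K * cusp_weight X (Im z)"
  if X: "trace X = 0" and y: "Im z \<ge> 1/2" and x: "0 \<le> Re z" "Re z \<le> M" for X z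
 proof -
  have z: "z \<in> uhp" using y by (simp add: uhp_iff)
  define A where "A = X$1$1 - X$2$1 * Re z"
  define B where "B = (X$1$2 + 2 * X$1$1 * Re z - X$2$1 * (Re z)\<^sup>2) / Im z"
  define G where "G = X$2$1 * Im z"
  have y0: "Im z > 0" using y by simp
  have m: "c * majorant d X z = k * (G\<^sup>2 + B\<^sup>2 + 2 * A\<^sup>2)"
   by (simp add: majorant_eq[OF d X z] A_def B_def G_def k_def algebra_simps)
  have ga: "\<bar>X$2$1\<bar> \<le> 2 * \<bar>G\<bar>"
  proof -
   have "\<bar>X$2$1\<bar> * (1/2) \<le> \<bar>X$2$1\<bar> * Im z" using y by (intro mult_left_mono) auto
   then show ?thesis using y0 by (simp add: G_def abs_mult)
  qed
  have al: "\<bar>X$1$1\<bar> \<le> \<bar>A\<bar> + 2 * M * \<bar>G\<bar>"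
  proof -
   have "\<bar>X$1$1\<bar> \<le> \<bar>A\<bar> + \<bar>X$2$1 * Re z\<bar>" unfolding A_def by linarith
   also have "\<bar>X$2$1 * Re z\<bar> \<le> (2 * \<bar>G\<bar>) * M"
    unfolding abs_mult using ga x by (intro mult_mono) auto
   finally show ?thesis by (simp add: mult_ac)
  qed
  have be: "\<bar>X$1$2\<bar> / Im z \<le> \<bar>B\<bar> + 4 * M * \<bar>X$1$1\<bar> + 4 * M * M * \<bar>G\<bar>"
  proof -
   have "X$1$2 / Im z = B - 2 * X$1$1 * (Re z / Im z) + X$2$1 * Re z * (Re z / Im z)"
    by (simp add: B_def add_divide_distrib diff_divide_distrib power2_eq_square)
   then have "\<bar>X$1$2 / Im z\<bar> \<le> \<bar>B\<bar> + \<bar>2 * X$1$1 * (Re z / Im z)\<bar> + \<bar>X$2$1 * Re z * (Re z / Im z)\<bar>" by linarith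
   moreover have q: "0 \<le> Re z / Im z" "Re z / Im z \<le> 2 * M"
   proof -
    have "Re z * 1 \<le> M * (2 * Im z)" using x y M by (intro mult_mono) auto
    then show "Re z / Im z \<le> 2 * M" using y0 by (simp add: divide_le_eq)
   qed (use x y0 in auto)
   moreover have "\<bar>2 * X$1$1 * (Re z / Im z)\<bar> \<le> 2 * \<bar>X$1$1\<bar> * (2 * M)"
    unfolding abs_mult using q by (intro mult_mono) auto
   moreover have "\<bar>X$2$1 * Re z * (Re z / Im z)\<bar> \<le> (2 * \<bar>G\<bar>) * M * (2 * M)"
    unfolding abs_mult using q ga x M by (intro mult_mono) auto
   moreover have "\<bar>X$1$2 / Im z\<bar> = \<bar>X$1$2\<bar> / Im z" using y0 by (simp add: abs_divide)
   ultimately show ?thesis by argo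
  qed
  have "M * \<bar>X$1$1\<bar> \<le> M * (\<bar>A\<bar> + 2 * M * \<bar>G\<bar>)" using al M by (rule mult_left_mono)
  then have Mal: "M * \<bar>X$1$1\<bar> \<le> M * \<bar>A\<bar> + 2 * M * M * \<bar>G\<bar>" by (simp add: algebra_simps)
  have tot: "\<bar>A\<bar> + \<bar>X$1$1\<bar> + \<bar>X$1$2\<bar> / Im z + \<bar>X$2$1\<bar> * Im z \<le> l1 * \<bar>A\<bar> + l2 * \<bar>B\<bar> + l3 * \<bar>G\<bar>"
  proof -
   have "\<bar>X$2$1\<bar> * Im z = \<bar>G\<bar>" using y0 by (simp add: G_def abs_mult)
   moreover have "l1 * \<bar>A\<bar> = 2 * \<bar>A\<bar> + 4 * (M * \<bar>A\<bar>)" "l2 * \<bar>B\<bar> = \<bar>B\<bar>"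
    "l3 * \<bar>G\<bar> = \<bar>G\<bar> + 2 * (M * \<bar>G\<bar>) + 12 * (M * M * \<bar>G\<bar>)" by (simp_all add: l algebra_simps)
   ultimately show ?thesis using al be Mal by argo
  qed
  have "l1 * \<bar>A\<bar> + l2 * \<bar>B\<bar> + l3 * \<bar>G\<bar> \<le> k * (G\<^sup>2 + B\<^sup>2 + 2 * A\<^sup>2) + (l1\<^sup>2 + l2\<^sup>2 + l3\<^sup>2) / (4 * k)"
  proof -
   have "k * A\<^sup>2 \<ge> 0" using k by simp
   then show ?thesis using lin[of l1 A] lin[of l2 B] lin[of l3 G] by (simp add: distrib_left add_divide_distrib)
  qed
  with tot have "\<bar>A\<bar> - c * majorant d X z \<le> (l1\<^sup>2 + l2\<^sup>2 + l3\<^sup>2) / (4 * k) + (- \<bar>X$1$1\<bar> - \<bar>X$1$2\<bar> / Im z - \<bar>X$2$1\<bar> * Im z)"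
   unfolding m by linarith
  then have "exp (\<bar>A\<bar> + - c * majorant d X z) \<le> exp ((l1\<^sup>2 + l2\<^sup>2 + l3\<^sup>2) / (4 * k) + (- \<bar>X$1$1\<bar> - \<bar>X$1$2\<bar> / Im z - \<bar>X$2$1\<bar> * Im z))"
   by simp
  then show ?thesis unfolding exp_add K_def cusp_weight_def A_def .
 qed
 moreover have "K > 0" by (simp add: K_def)
 ultimately show ?thesis using that by blast
qed

text \<open>A two-sided geometric series, with 1 / (1 - exp (- e)) <= 1 + 1 / e from 1 + e <= exp e.
  The order 1 / e for small e is what matters: e will be of size 1 / y.\<close>

lemma sum_exp_abs_le:
 assumes e: "e > 0" and "finite A"
 shows "(\<Sum>n\<in>A. exp (- e * \<bar>real_of_int n\<bar>)) \<le> 2 * (1 + 1 / e)"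
proof -
 define q where "q = exp (- e)"
 have q: "0 < q" "q < 1" using e by (auto simp: q_def)
 obtain M :: nat where M: "\<And>n. n \<in> A \<Longrightarrow> \<bar>n\<bar> \<le> int M"
 proof -
  have "\<And>n. n \<in> A \<Longrightarrow> nat \<bar>n\<bar> \<le> Max (insert 0 ((\<lambda>n. nat \<bar>n\<bar>) ` A))" using assms(2) by (intro Max_ge) auto
  then show ?thesis using that[of "Max (insert 0 ((\<lambda>n. nat \<bar>n\<bar>) ` A))"] by force
 qed
 have exp_q: "exp (- e * \<bar>real_of_int n\<bar>) = q ^ nat \<bar>n\<bar>" for n
  by (simp add: q_def exp_of_nat_mult[symmetric] mult.commute)
 have "A \<subseteq> int ` {..M} \<union> (\<lambda>n. - int n) ` {..M}"
 proof
  fix n assume "n \<in> A"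
  then have "nat \<bar>n\<bar> \<le> M" using M by force
  then show "n \<in> int ` {..M} \<union> (\<lambda>n. - int n) ` {..M}"
   by (cases "n \<ge> 0") (auto intro!: image_eqI[of _ _ "nat \<bar>n\<bar>"])
 qed
 then have "(\<Sum>n\<in>A. exp (- e * \<bar>real_of_int n\<bar>)) \<le> (\<Sum>n\<in>int ` {..M} \<union> (\<lambda>n. - int n) ` {..M}. exp (- e * \<bar>real_of_int n\<bar>))"
  by (intro sum_mono2) auto
 also have "\<dots> \<le> (\<Sum>n\<in>int ` {..M}. exp (- e * \<bar>real_of_int n\<bar>)) + (\<Sum>n\<in>(\<lambda>n. - int n) ` {..M}. exp (- e * \<bar>real_of_int n\<bar>))"
  by (subst sum.union_inter[symmetric]) (auto intro!: sum_nonneg)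
 also have "\<dots> = 2 * (\<Sum>n\<le>M. q ^ n)"
  by (subst (1 2) sum.reindex) (auto simp: inj_on_def exp_q[simplified])
 also have "(\<Sum>n\<le>M. q ^ n) \<le> 1 / (1 - q)"
  using q by (simp add: sum_gp0 divide_right_mono)
 also have "1 / (1 - q) \<le> 1 + 1 / e"
 proof -
  have "1 + e \<le> exp e" by (rule exp_ge_add_one_self)
  then have "q * (1 + e) \<le> 1" using e q unfolding q_def by (simp add: exp_minus field_simps)
  then show ?thesis using q e by (simp add: field_simps)
 qed
 finally show ?thesis by simp
qed

text \<open>The scaled entries D X11, D X12, D X21 are integers and determine X, so the sum is at
  most a product of three geometric series. Only the one for the upper right entry grows, linearly
  in y; the others are bounded since y >= 1/2. This is the linear growth of the theta kernels in the
  cusps.\<close>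

lemma cusp_weight_sum:
 assumes D: "D \<ge> (1::nat)" and C: "\<And>X. X \<in> C \<Longrightarrow> trace X = 0 \<and> int_mat (real D *\<^sub>R X)" and y: "y \<ge> 1/2"
 shows "(\<lambda>X. cusp_weight X y) summable_on C"
  "(\<Sum>\<^sub>\<infinity>X\<in>C. cusp_weight X y) \<le> 8 * (1 + real D) * (2 + real D) * (1 + 2 * real D) * y"
proof -
 have bd: "(\<Sum>X\<in>E. cusp_weight X y) \<le> 8 * (1 + real D) * (2 + real D) * (1 + 2 * real D) * y"
  if E: "finite E" "E \<subseteq> C" for E
 proof -
  define f where "f = (\<lambda>X :: mat2. (\<lfloor>real D * X$1$1\<rfloor>, \<lfloor>real D * X$1$2\<rfloor>, \<lfloor>real D * X$2$1\<rfloor>))"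
  have fl: "of_int \<lfloor>real D * X$1$1\<rfloor> = real D * X$1$1" "of_int \<lfloor>real D * X$1$2\<rfloor> = real D * X$1$2"
   "of_int \<lfloor>real D * X$2$1\<rfloor> = real D * X$2$1" if "X \<in> C" for X
   using C[OF that] by (auto simp: int_mat_iff)
  have inj: "inj_on f E"
  proof (rule inj_onI)
   fix X Y assume XY: "X \<in> E" "Y \<in> E" "f X = f Y"
   then have XC: "X \<in> C" "Y \<in> C" using E by auto
   have "real D * X$1$1 = real D * Y$1$1" "real D * X$1$2 = real D * Y$1$2" "real D * X$2$1 = real D * Y$2$1"
    using XY(3) fl[OF XC(1)] fl[OF XC(2)] by (auto simp: f_def)
   moreover have "X$2$2 = - X$1$1" "Y$2$2 = - Y$1$1" using C XC by (auto simp: trace_def sum_2 add_eq_0_iff)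
   ultimately show "X = Y" using D by (simp add: mat2_eq_iff)
  qed
  define w where "w = (\<lambda>(i :: int, j :: int, k :: int). exp (- (1 / real D) * \<bar>real_of_int i\<bar>) *
    (exp (- (1 / (real D * y)) * \<bar>real_of_int j\<bar>) * exp (- (1 / (2 * real D)) * \<bar>real_of_int k\<bar>)))"
  have wle: "cusp_weight X y \<le> w (f X)" if "X \<in> C" for X
  proof -
   have "w (f X) = exp (- \<bar>X$1$1\<bar> - \<bar>X$1$2\<bar> / y - \<bar>X$2$1\<bar> / 2)"
    unfolding w_def f_def using D y
    by (simp add: fl[OF that] abs_mult exp_add[symmetric] exp_diff[symmetric] mult_exp_exp algebra_simps)
   moreover have "\<bar>X$2$1\<bar> * (1/2) \<le> \<bar>X$2$1\<bar> * y" using y by (intro mult_left_mono) auto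
   ultimately show ?thesis by (simp add: cusp_weight_def)
  qed
  let ?I = "fst ` f ` E" and ?J = "(fst \<circ> snd) ` f ` E" and ?K = "(snd \<circ> snd) ` f ` E"
  have "(\<Sum>X\<in>E. cusp_weight X y) \<le> (\<Sum>X\<in>E. w (f X))" using E wle by (intro sum_mono) auto
  also have "\<dots> = (\<Sum>t\<in>f ` E. w t)" by (simp add: sum.reindex[OF inj])
  also have "\<dots> \<le> (\<Sum>t\<in>?I \<times> ?J \<times> ?K. w t)"
  proof (intro sum_mono2)
   show "f ` E \<subseteq> ?I \<times> ?J \<times> ?K" by (auto simp: image_iff) (metis fst_conv, metis fst_conv snd_conv, metis snd_conv)
  qed (use E in \<open>auto simp: w_def\<close>)
  also have "\<dots> = (\<Sum>i\<in>?I. exp (- (1 / real D) * \<bar>real_of_int i\<bar>)) * ((\<Sum>j\<in>?J. exp (- (1 / (real D * y)) * \<bar>real_of_int j\<bar>)) *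
     (\<Sum>k\<in>?K. exp (- (1 / (2 * real D)) * \<bar>real_of_int k\<bar>)))"
   unfolding w_def by (simp only: sum_product sum.cartesian_product split_beta' case_prod_beta)
  also have "\<dots> \<le> (2 * (1 + 1 / (1 / real D))) * ((2 * (1 + 1 / (1 / (real D * y)))) * (2 * (1 + 1 / (1 / (2 * real D)))))"
   using E D y by (intro mult_mono sum_exp_abs_le mult_nonneg_nonneg sum_nonneg) (auto)
  also have "\<dots> = 8 * (1 + real D) * (1 + real D * y) * (1 + 2 * real D)" by (simp add: algebra_simps)
  also have "\<dots> \<le> 8 * (1 + real D) * ((2 + real D) * y) * (1 + 2 * real D)"
   using y by (intro mult_right_mono mult_left_mono) (auto simp: algebra_simps)
  finally show ?thesis by (simp add: mult_ac)
 qed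
 show s: "(\<lambda>X. cusp_weight X y) summable_on C"
  by (rule nonneg_bdd_above_summable_on) (auto simp: cusp_weight_def intro!: bdd_aboveI bd[unfolded cusp_weight_def])
 show "(\<Sum>\<^sub>\<infinity>X\<in>C. cusp_weight X y) \<le> 8 * (1 + real D) * (2 + real D) * (1 + 2 * real D) * y"
  by (rule infsum_le_finite_sums[OF s bd])
qed

text \<open>Profiles g(p, a) of theta kernels, bounded in terms of the majorant p^2 - a on the
  region where (p, a) can lie. The derivative in p is included because horizontal differences in the
  cusps have to be estimated, and K is explicit so that small profiles give small pairings.\<close>

definition admissible :: "real \<Rightarrow> real \<Rightarrow> (real \<Rightarrow> real \<Rightarrow> complex) \<Rightarrow> bool" where
 "admissible c K g \<longleftrightarrow> (\<exists>g'. \<forall>p a. ((\<lambda>p. g p a) has_vector_derivative g' p a) (at p) \<and>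
   (2 * a \<le> p\<^sup>2 \<longrightarrow> cmod (g p a) \<le> K * exp (- c * (p\<^sup>2 - a)) \<and> cmod (g' p a) \<le> K * exp (- c * (p\<^sup>2 - a))))"

lemma admissible_nonneg: "admissible c K g \<Longrightarrow> K \<ge> 0"
proof -
 assume "admissible c K g"
 then have "cmod (g 0 0) \<le> K * exp (- c * (0\<^sup>2 - 0))" unfolding admissible_def by (metis mult_zero_right order_refl zero_power2)
 then show ?thesis using norm_ge_zero order_trans by (simp, blast)
qed

lemma admissible_continuous: "admissible c K g \<Longrightarrow> continuous_on UNIV (\<lambda>p. g p a)"
 unfolding admissible_def by (meson continuous_at_imp_continuous_on has_vector_derivative_continuous)

text \<open>\<open>C\<close> stands for a coset L + h. What is retained of it is a common
  denominator D, which makes the theta series converge, and the invariance under \<Gamma>, which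
  makes them automorphic.\<close>

locale theta_setting = modular_domain +
 fixes d :: real and C :: "mat2 set" and D :: nat
 assumes d: "d > 0" and D: "D \<ge> 1" and C: "X \<in> C \<Longrightarrow> trace X = 0 \<and> int_mat (real D *\<^sub>R X)"
  and C_inv: "g \<in> \<Gamma> \<Longrightarrow> conj_act g ` C = C"
begin

lemma C_trace: "X \<in> C \<Longrightarrow> trace X = 0"
 using C by blast

definition Theta :: "(real \<Rightarrow> real \<Rightarrow> complex) \<Rightarrow> complex \<Rightarrow> complex" where
 "Theta g z = (\<Sum>\<^sub>\<infinity>X\<in>C. g (coord d X z) (bil d X X))"

abbreviation Theta_abs :: "(real \<Rightarrow> real \<Rightarrow> complex) \<Rightarrow> complex \<Rightarrow> real" where
 "Theta_abs g z \<equiv> (\<Sum>\<^sub>\<infinity>X\<in>C. cmod (g (coord d X z) (bil d X X)))"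

lemma C_countable: "countable C"
proof -
 have "inj_on (\<lambda>X :: mat2. (\<lfloor>real D * X$1$1\<rfloor>, \<lfloor>real D * X$1$2\<rfloor>, \<lfloor>real D * X$2$1\<rfloor>)) C"
 proof (rule inj_onI)
  fix X Y assume XY: "X \<in> C" "Y \<in> C" and e: "(\<lfloor>real D * X$1$1\<rfloor>, \<lfloor>real D * X$1$2\<rfloor>, \<lfloor>real D * X$2$1\<rfloor>) = (\<lfloor>real D * Y$1$1\<rfloor>, \<lfloor>real D * Y$1$2\<rfloor>, \<lfloor>real D * Y$2$1\<rfloor>)"
  have fl: "of_int \<lfloor>real D * X$1$1\<rfloor> = real D * X$1$1" "of_int \<lfloor>real D * X$1$2\<rfloor> = real D * X$1$2"
   "of_int \<lfloor>real D * X$2$1\<rfloor> = real D * X$2$1" if "X \<in> C" for X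
   using C[OF that] by (auto simp: int_mat_iff)
  have "real D * X$1$1 = real D * Y$1$1" "real D * X$1$2 = real D * Y$1$2" "real D * X$2$1 = real D * Y$2$1"
   using e fl[OF XY(1)] fl[OF XY(2)] by auto
  moreover have "X$2$2 = - X$1$1" "Y$2$2 = - Y$1$1" using C XY by (auto simp: trace_def sum_2 add_eq_0_iff)
  ultimately show "X = Y" using D by (simp add: mat2_eq_iff)
 qed
 then show ?thesis by (rule countableI')
qed

lemma conj_act_inv:
 assumes "g \<in> SL2R"
 shows "conj_act (matrix_inv g) (conj_act g X) = X" "conj_act g (conj_act (matrix_inv g) X) = X"
 using SL2R_cancel[OF assms] by (simp_all add: conj_act_def SL2R_inv(4)[OF assms] matrix_mul_assoc[symmetric] SL2R_inv[OF assms])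

lemma inj_conj_act: "g \<in> SL2R \<Longrightarrow> inj_on (conj_act g) A"
 by (rule inj_on_inverseI[of _ "conj_act (matrix_inv g)"]) (rule conj_act_inv)

lemma Theta_invariant: "invariant (Theta g)"
 unfolding invariant_def
proof (intro ballI)
 fix s z assume s: "s \<in> \<Gamma>" and z: "z \<in> uhp"
 have sR: "s \<in> SL2R" using s by (rule \<Gamma>_SL2R)
 have "Theta g (moebius s z) = (\<Sum>\<^sub>\<infinity>X\<in>conj_act s ` C. g (coord d X (moebius s z)) (bil d X X))"
  unfolding Theta_def C_inv[OF s] ..
 also have "\<dots> = (\<Sum>\<^sub>\<infinity>X\<in>C. g (coord d (conj_act s X) (moebius s z)) (bil d (conj_act s X) (conj_act s X)))"
  by (subst infsum_reindex[OF inj_conj_act[OF sR]]) (simp add: o_def)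
 also have "\<dots> = Theta g z"
  unfolding Theta_def using C_trace by (intro infsum_cong) (simp add: bil_conj_act[OF sR] coord_conj_act[OF d _ sR z])
 finally show "Theta g (moebius s z) = Theta g z" .
qed

text \<open>The horizontal derivative of \<open>coord\<close> carries a factor 1 / Im w that cancels
  the growth of the sum over \<open>C\<close>; so differences along a segment of length N stay
  bounded although the series itself does not. The constant \<open>C0\<close> is uniform in g, K, w
  and s: conjugation by s in \<open>SL2Z\<close> keeps the denominator D.\<close>

lemma theta_majorant:
 assumes c: "c > 0"
 obtains C0 where "C0 > 0"
  "\<And>s w g K. s \<in> SL2Z \<Longrightarrow> admissible c K g \<Longrightarrow> Im w \<ge> 1/2 \<Longrightarrow> 0 \<le> Re w \<Longrightarrow> Re w \<le> real N \<Longrightarrow>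
   (\<lambda>X. cmod (g (coord d X (moebius s w)) (bil d X X))) summable_on C \<and>
   Theta_abs g (moebius s w) \<le> C0 * K * Im w"
  "\<And>s w g K. s \<in> SL2Z \<Longrightarrow> admissible c K g \<Longrightarrow> Im w \<ge> 1/2 \<Longrightarrow> 0 \<le> Re w \<Longrightarrow> Re w \<le> real N \<Longrightarrow>
   cmod (Theta g (moebius s w) - Theta g (moebius s (Complex 0 (Im w)))) \<le> C0 * K"
proof -
 obtain K0 where K0: "K0 > 0" "\<And>X z. trace X = 0 \<Longrightarrow> Im z \<ge> 1/2 \<Longrightarrow> 0 \<le> Re z \<Longrightarrow> Re z \<le> real N \<Longrightarrow>
   exp \<bar>X$1$1 - X$2$1 * Re z\<bar> * exp (- c * majorant d X z) \<le> K0 * cusp_weight X (Im z)"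
  using gauss_le_cusp_weight[OF d c, of "real N"] by (metis of_nat_0_le_iff)
 define W where "W = 8 * (1 + real D) * (2 + real D) * (1 + 2 * real D)"
 have W: "W > 0" by (simp add: W_def add_pos_nonneg)
 define C0 where "C0 = K0 * W * (1 + 2 * sqrt d * real N)"
 have C0: "K0 * W \<le> C0" "C0 > 0" "2 * sqrt d * real N * K0 * W \<le> C0"
  using K0(1) W d N unfolding C0_def by (auto simp: algebra_simps intro!: mult_pos_pos add_pos_nonneg)
 text \<open>Move the point \<open>s w\<close> to \<open>w\<close> by conjugating the lattice.\<close>
 define cX where "cX = (\<lambda>s X. conj_act (matrix_inv s) X)"
 have cX: "trace (cX s X) = 0" "int_mat (real D *\<^sub>R cX s X)" "bil d (cX s X) (cX s X) = bil d X X"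
   "z \<in> uhp \<Longrightarrow> coord d X (moebius s z) = coord d (cX s X) z" if s: "s \<in> SL2Z" and X: "X \<in> C" for s X z
 proof -
  have sR: "s \<in> SL2R" and sI: "int_mat s" using s by (auto simp: SL2Z_iff)
  have iR: "matrix_inv s \<in> SL2R" using SL2R_inv(1)[OF sR] .
  have tX: "trace X = 0" and iX: "int_mat (real D *\<^sub>R X)" using C[OF X] by auto
  show "trace (cX s X) = 0" unfolding cX_def by (rule conj_act_nth(1)[OF iR tX])
  show "bil d (cX s X) (cX s X) = bil d X X" unfolding cX_def by (rule bil_conj_act[OF iR])
  have "int_mat (matrix_inv s ** (real D *\<^sub>R X) ** matrix_inv (matrix_inv s))"
   using iX sI int_mat_inv[OF sR sI] by (intro int_mat_intros(1)) (auto simp: SL2R_inv(4)[OF sR])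
  moreover have "matrix_inv s ** (real D *\<^sub>R X) ** matrix_inv (matrix_inv s) = real D *\<^sub>R cX s X"
   by (simp add: cX_def conj_act_def mat2_eq_iff algebra_simps)
  ultimately show "int_mat (real D *\<^sub>R cX s X)" by simp
  assume z: "z \<in> uhp"
  show "coord d X (moebius s z) = coord d (cX s X) z"
   using coord_conj_act[OF d tX iR moebius_uhp[OF sR z]] moebius_inv(2)[OF sR z] by (simp add: cX_def)
 qed
 have ws: "(\<lambda>X. cusp_weight (cX s X) y) summable_on C" "(\<Sum>\<^sub>\<infinity>X\<in>C. cusp_weight (cX s X) y) \<le> W * y"
  if s: "s \<in> SL2Z" and y: "y \<ge> 1/2" for s y
 proof -
  have iR: "matrix_inv s \<in> SL2R" using s SL2R_inv(1) by (auto simp: SL2Z_iff)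
  have inj: "inj_on (cX s) C" unfolding cX_def by (rule inj_conj_act[OF iR])
  have *: "X \<in> cX s ` C \<Longrightarrow> trace X = 0 \<and> int_mat (real D *\<^sub>R X)" for X using cX(1,2)[OF s] by auto
  show "(\<lambda>X. cusp_weight (cX s X) y) summable_on C"
   using cusp_weight_sum(1)[where C = "cX s ` C", OF D * y] summable_on_reindex[OF inj, of "\<lambda>X. cusp_weight X y"] by (simp add: o_def)
  show "(\<Sum>\<^sub>\<infinity>X\<in>C. cusp_weight (cX s X) y) \<le> W * y"
   using cusp_weight_sum(2)[where C = "cX s ` C", OF D * y] infsum_reindex[OF inj, of "\<lambda>X. cusp_weight X y"] by (simp add: o_def W_def)
 qed
 have pt: "cmod (g (coord d X (moebius s w)) (bil d X X)) \<le> K * K0 * cusp_weight (cX s X) (Im w)"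
  if s: "s \<in> SL2Z" and X: "X \<in> C" and g: "admissible c K g" and w: "Im w \<ge> 1/2" "0 \<le> Re w" "Re w \<le> real N" for s X g K w
 proof -
  have wu: "w \<in> uhp" using w by (simp add: uhp_iff)
  note c = cX[OF s X]
  have le: "2 * bil d X X \<le> (coord d (cX s X) w)\<^sup>2" using bil_le_coord_sq[OF d c(1) wu] c(3) by simp
  have "cmod (g (coord d X (moebius s w)) (bil d X X)) \<le> K * exp (- c * ((coord d (cX s X) w)\<^sup>2 - bil d X X))"
   using g le unfolding admissible_def c(4)[OF wu] by blast
  also have "(coord d (cX s X) w)\<^sup>2 - bil d X X = majorant d (cX s X) w"
   by (simp add: majorant_def c(3))
  also have "K * exp (- c * majorant d (cX s X) w) \<le> K * (exp \<bar>cX s X$1$1 - cX s X$2$1 * Re w\<bar> * exp (- c * majorant d (cX s X) w))"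
   using admissible_nonneg[OF g] by (intro mult_left_mono) auto
  also have "\<dots> \<le> K * (K0 * cusp_weight (cX s X) (Im w))"
   using K0(2)[OF c(1) w] admissible_nonneg[OF g] by (intro mult_left_mono)
  finally show ?thesis by (simp add: mult.assoc)
 qed
 have 1: "(\<lambda>X. cmod (g (coord d X (moebius s w)) (bil d X X))) summable_on C \<and>
   Theta_abs g (moebius s w) \<le> C0 * K * Im w"
  if s: "s \<in> SL2Z" and g: "admissible c K g" and w: "Im w \<ge> 1/2" "0 \<le> Re w" "Re w \<le> real N" for s g K w
 proof
  have S: "(\<lambda>X. K * K0 * cusp_weight (cX s X) (Im w)) summable_on C"
   by (intro summable_on_cmult_right ws(1)[OF s w(1)])
  show ab: "(\<lambda>X. cmod (g (coord d X (moebius s w)) (bil d X X))) summable_on C"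
   by (rule summable_on_comparison_test[OF S]) (use pt[OF s _ g w] in auto)
  have "Theta_abs g (moebius s w) \<le> (\<Sum>\<^sub>\<infinity>X\<in>C. K * K0 * cusp_weight (cX s X) (Im w))"
   by (rule infsum_mono[OF ab S]) (use pt[OF s _ g w] in auto)
  also have "\<dots> = K * K0 * (\<Sum>\<^sub>\<infinity>X\<in>C. cusp_weight (cX s X) (Im w))"
   by (rule infsum_cmult_right')
  also have "\<dots> \<le> K * K0 * (W * Im w)"
   using ws(2)[OF s w(1)] K0(1) admissible_nonneg[OF g] by (intro mult_left_mono) auto
  also have "\<dots> = (K * Im w) * (K0 * W)" by (simp add: mult_ac)
  also have "\<dots> \<le> (K * Im w) * C0"
   using C0(1) admissible_nonneg[OF g] w(1) by (intro mult_left_mono) auto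
  finally show "Theta_abs g (moebius s w) \<le> C0 * K * Im w" by (simp add: mult_ac)
 qed
 have 2: "cmod (Theta g (moebius s w) - Theta g (moebius s (Complex 0 (Im w)))) \<le> C0 * K"
  if s: "s \<in> SL2Z" and g: "admissible c K g" and w: "Im w \<ge> 1/2" "0 \<le> Re w" "Re w \<le> real N" for s g K w
 proof -
  define y where "y = Im w"
  \<comment> \<open>Up to the cusp weight, \<open>b\<close> bounds the horizontal derivative of a
    summand: 2 sqrt d / y comes from \<open>coord\<close>, K from g', and K0 from the Gaussian,
    which has absorbed the linear factor |Y11 - Y21 x|.\<close>
  define b where "b = 2 * sqrt d * K * K0 / y"
  have y: "y \<ge> 1/2" "y > 0" using w by (auto simp: y_def)
  obtain g' where g': "\<And>p a. ((\<lambda>p. g p a) has_vector_derivative g' p a) (at p)"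
    "\<And>p a. 2 * a \<le> p\<^sup>2 \<Longrightarrow> cmod (g' p a) \<le> K * exp (- c * (p\<^sup>2 - a))"
   using g unfolding admissible_def by blast
  have K: "K \<ge> 0" using admissible_nonneg[OF g] .
  let ?f = "\<lambda>z X. g (coord d X (moebius s z)) (bil d X X)"
  have w0: "Im (Complex 0 y) \<ge> 1/2" "0 \<le> Re (Complex 0 y)" "Re (Complex 0 y) \<le> real N" using y by auto
  have diff: "cmod (?f w X - ?f (Complex 0 y) X) \<le> real N * b * cusp_weight (cX s X) y" if X: "X \<in> C" for X
  proof -
   note c = cX[OF s X]
   define Y where "Y = cX s X"
   define q where "q = (\<lambda>x. sqrt d * (Y$1$2 + 2 * Y$1$1 * x - Y$2$1 * (x\<^sup>2 + y\<^sup>2)) / y)"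
   have q: "coord d Y (Complex x y) = q x" for x
    unfolding q_def by (subst coord_eq[OF d]) (use c(1) in \<open>auto simp: Y_def cmod_power2\<close>)
   have dq: "(q has_vector_derivative 2 * sqrt d * (Y$1$1 - Y$2$1 * x) / y) (at x within S)" for x S
    unfolding q_def has_real_derivative_iff_has_vector_derivative[symmetric]
    using y by (auto intro!: derivative_eq_intros simp: field_simps)
   define G where "G = (\<lambda>x. g (q x) (bil d X X))"
   have dG: "(G has_vector_derivative (2 * sqrt d * (Y$1$1 - Y$2$1 * x) / y) *\<^sub>R g' (q x) (bil d X X)) (at x within {0..real N})" for x
    unfolding G_def using vector_diff_chain_within[OF dq has_vector_derivative_at_within[OF g'(1)]] by (simp add: o_def)
   have bG: "norm ((2 * sqrt d * (Y$1$1 - Y$2$1 * x) / y) *\<^sub>R g' (q x) (bil d X X)) \<le> b * cusp_weight Y y" if x: "x \<in> {0..real N}" for x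
   proof -
    have zu: "Complex x y \<in> uhp" using y by (simp add: uhp_iff)
    have tY: "trace Y = 0" "bil d Y Y = bil d X X" using c by (auto simp: Y_def)
    have "cmod (g' (q x) (bil d X X)) \<le> K * exp (- c * ((q x)\<^sup>2 - bil d X X))"
     using bil_le_coord_sq[OF d tY(1) zu] by (intro g'(2)) (simp add: tY q)
    also have "(q x)\<^sup>2 - bil d X X = majorant d Y (Complex x y)" by (simp add: majorant_def q tY)
    finally have 1: "cmod (g' (q x) (bil d X X)) \<le> K * exp (- c * majorant d Y (Complex x y))" .
    have 2: "\<bar>Y$1$1 - Y$2$1 * x\<bar> \<le> exp \<bar>Y$1$1 - Y$2$1 * x\<bar>" using exp_ge_add_one_self[of "\<bar>Y$1$1 - Y$2$1 * x\<bar>"] by linarith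
    have "norm ((2 * sqrt d * (Y$1$1 - Y$2$1 * x) / y) *\<^sub>R g' (q x) (bil d X X)) = (2 * sqrt d / y) * (\<bar>Y$1$1 - Y$2$1 * x\<bar> * cmod (g' (q x) (bil d X X)))"
     using d y by (simp add: abs_mult)
    also have "\<dots> \<le> (2 * sqrt d / y) * (exp \<bar>Y$1$1 - Y$2$1 * x\<bar> * (K * exp (- c * majorant d Y (Complex x y))))"
     using d y 1 2 by (intro mult_left_mono mult_mono) auto
    also have "\<dots> = (2 * sqrt d * K / y) * (exp \<bar>Y$1$1 - Y$2$1 * Re (Complex x y)\<bar> * exp (- c * majorant d Y (Complex x y)))"
     by simp
    also have "\<dots> \<le> (2 * sqrt d * K / y) * (K0 * cusp_weight Y (Im (Complex x y)))"
     using d y K x by (intro mult_left_mono K0(2) tY) auto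
    finally show ?thesis by (simp add: b_def mult_ac)
   qed
   have "norm (G (Re w) - G 0) \<le> (b * cusp_weight Y y) * norm (Re w - 0)"
   proof (rule differentiable_bound)
    show "(G has_derivative (\<lambda>h. h *\<^sub>R ((2 * sqrt d * (Y$1$1 - Y$2$1 * x) / y) *\<^sub>R g' (q x) (bil d X X)))) (at x within {0..real N})" for x
     using dG unfolding has_vector_derivative_def .
    show "onorm (\<lambda>h. h *\<^sub>R ((2 * sqrt d * (Y$1$1 - Y$2$1 * x) / y) *\<^sub>R g' (q x) (bil d X X))) \<le> b * cusp_weight Y y"
     if "x \<in> {0..real N}" for x
    proof (rule onorm_bound)
     show "0 \<le> b * cusp_weight Y y" using d y K K0(1) by (simp add: b_def cusp_weight_def)
     fix h :: real
     have "norm (h *\<^sub>R ((2 * sqrt d * (Y$1$1 - Y$2$1 * x) / y) *\<^sub>R g' (q x) (bil d X X))) =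
       norm ((2 * sqrt d * (Y$1$1 - Y$2$1 * x) / y) *\<^sub>R g' (q x) (bil d X X)) * norm h" by (simp add: abs_mult)
     also have "\<dots> \<le> b * cusp_weight Y y * norm h" using bG[OF that] by (rule mult_right_mono) simp
     finally show "norm (h *\<^sub>R ((2 * sqrt d * (Y$1$1 - Y$2$1 * x) / y) *\<^sub>R g' (q x) (bil d X X))) \<le> b * cusp_weight Y y * norm h" .
    qed
   qed (use w in auto)
   also have "\<dots> \<le> (b * cusp_weight Y y) * real N"
    using w d y K K0(1) by (intro mult_left_mono) (auto simp: b_def cusp_weight_def)
   finally have "norm (G (Re w) - G 0) \<le> real N * b * cusp_weight Y y" by (simp add: mult_ac)
   moreover have "?f w X = G (Re w)"
   proof -
    have "w \<in> uhp" "w = Complex (Re w) y" using y by (auto simp: uhp_iff y_def)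
    then show ?thesis unfolding G_def using c(4)[of w] q[of "Re w"] by (simp add: Y_def)
   qed
   moreover have "?f (Complex 0 y) X = G 0"
    unfolding G_def using c(4)[of "Complex 0 y"] q[of 0] y by (simp add: Y_def uhp_iff)
   ultimately show ?thesis by (simp add: Y_def)
  qed
  have s1: "(\<lambda>X. cmod (?f w X)) summable_on C" "(\<lambda>X. cmod (?f (Complex 0 y) X)) summable_on C"
   using 1[OF s g w] 1[OF s g w0] by auto
  have s2: "?f w summable_on C" "?f (Complex 0 y) summable_on C" using s1[THEN Infinite_Sum.abs_summable_summable] by auto
  have S: "(\<lambda>X. real N * b * cusp_weight (cX s X) y) summable_on C"
   by (intro summable_on_cmult_right ws(1)[OF s y(1)])
  have ab: "(\<lambda>X. cmod (?f w X - ?f (Complex 0 y) X)) summable_on C"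
   by (rule summable_on_comparison_test[OF S]) (use diff in auto)
  have "Theta g (moebius s w) - Theta g (moebius s (Complex 0 y)) = (\<Sum>\<^sub>\<infinity>X\<in>C. ?f w X - ?f (Complex 0 y) X)"
   using infsum_add[OF s2(1) summable_on_uminus[THEN iffD2, OF s2(2)]] by (simp add: Theta_def infsum_uminus)
  also have "cmod \<dots> \<le> (\<Sum>\<^sub>\<infinity>X\<in>C. cmod (?f w X - ?f (Complex 0 y) X))"
   by (rule norm_infsum_bound[OF ab])
  also have "\<dots> \<le> (\<Sum>\<^sub>\<infinity>X\<in>C. real N * b * cusp_weight (cX s X) y)"
   by (rule infsum_mono[OF ab S]) (use diff in auto)
  also have "\<dots> = real N * b * (\<Sum>\<^sub>\<infinity>X\<in>C. cusp_weight (cX s X) y)"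
   by (rule infsum_cmult_right')
  also have "\<dots> \<le> real N * b * (W * y)"
   using ws(2)[OF s y(1)] d y K K0(1) by (intro mult_left_mono) (auto simp: b_def)
  also have "\<dots> = K * (2 * sqrt d * real N * K0 * W)" using y by (simp add: b_def mult_ac)
  also have "\<dots> \<le> K * C0" using C0(3) K by (rule mult_left_mono)
  finally show ?thesis by (simp add: y_def mult_ac)
 qed
 show ?thesis using that[OF C0(2)] 1 2 by blast
qed

end

section \<open>Pairing cuspidal functions with theta kernels\<close>

lemma measurable_pair_count_space:
 assumes "countable I" "\<And>i. i \<in> I \<Longrightarrow> (\<lambda>x. f x i) \<in> measurable M K"
 shows "case_prod f \<in> measurable (M \<Otimes>\<^sub>M count_space I) K"
proof -
 have "(\<lambda>p. f (fst p) (snd p)) \<in> measurable (M \<Otimes>\<^sub>M count_space I) K"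
  using _ _ assms(1)
  by (rule measurable_compose_countable'[where f="\<lambda>a b. f (fst b) a" and g=snd and I=I, simplified])
    (use assms(2) in simp_all)
 then show ?thesis by (simp add: split_beta')
qed

lemma integral_hyp_eq_0:
 fixes k :: "complex \<Rightarrow> complex"
 assumes [measurable]: "k \<in> borel_measurable borel" and int: "integrable \<mu> k"
  and 0: "AE y in lborel. y > 0 \<longrightarrow> (\<integral>x. k (Complex x y) \<partial>lborel) = 0"
 shows "(\<integral>z. k z \<partial>\<mu>) = 0"
proof -
 let ?g = "\<lambda>z. (indicator uhp z / (Im z)\<^sup>2) *\<^sub>R k z"
 have g [measurable]: "?g \<in> borel_measurable borel" by measurable
 have 1: "(\<integral>z. k z \<partial>\<mu>) = (\<integral>z. ?g z \<partial>lborel)" "integrable lborel ?g"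
  using int unfolding hyp_measure_def by (auto simp: integral_density integrable_density)
 have 2: "(\<integral>z. ?g z \<partial>lborel) = (\<integral>p. ?g (Complex (fst p) (snd p)) \<partial>(lborel \<Otimes>\<^sub>M lborel))"
  "integrable (lborel \<Otimes>\<^sub>M lborel) (\<lambda>p. ?g (Complex (fst p) (snd p)))"
 proof -
  have "(\<integral>z. G z \<partial>lborel) = (\<integral>p. G (Complex (fst p) (snd p)) \<partial>(lborel \<Otimes>\<^sub>M lborel))"
   "integrable lborel G \<longleftrightarrow> integrable (lborel \<Otimes>\<^sub>M lborel) (\<lambda>p. G (Complex (fst p) (snd p)))"
   if [measurable]: "G \<in> borel_measurable borel" for G :: "complex \<Rightarrow> complex"
   by (subst lborel_complex_eq, simp add: integral_distr integrable_distr_eq)+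
  from this[OF g] 1(2) show "(\<integral>z. ?g z \<partial>lborel) = (\<integral>p. ?g (Complex (fst p) (snd p)) \<partial>(lborel \<Otimes>\<^sub>M lborel))"
   "integrable (lborel \<Otimes>\<^sub>M lborel) (\<lambda>p. ?g (Complex (fst p) (snd p)))" by auto
 qed
 have "(\<integral>y. (\<integral>x. ?g (Complex x y) \<partial>lborel) \<partial>lborel) = (\<integral>p. ?g (Complex (fst p) (snd p)) \<partial>(lborel \<Otimes>\<^sub>M lborel))"
  using lborel_pair.integral_snd[of "\<lambda>x y. ?g (Complex x y)"] 2(2) by (simp add: split_beta')
 moreover have "(\<integral>y. (\<integral>x. ?g (Complex x y) \<partial>lborel) \<partial>lborel) = 0"
 proof (rule integral_eq_zero_AE)
  show "AE y in lborel. (\<integral>x. ?g (Complex x y) \<partial>lborel) = 0"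
   using 0
  proof eventually_elim
   case (elim y)
   have "(\<integral>x. ?g (Complex x y) \<partial>lborel) = (\<integral>x. (indicator {0<..} y / y\<^sup>2) *\<^sub>R k (Complex x y) \<partial>lborel)"
    by (intro bochner_cong refl) (auto simp: indicator_def uhp_iff)
   also have "\<dots> = (indicator {0<..} y / y\<^sup>2) *\<^sub>R (\<integral>x. k (Complex x y) \<partial>lborel)" by simp
   also have "\<dots> = 0" using elim by (auto simp: indicator_def)
   finally show ?case .
  qed
 qed
 ultimately show ?thesis using 1(1) 2(1) by simp
qed

lemma coord_measurable [measurable]: "coord d X \<in> borel_measurable borel"
proof -
 have "coord d X = (\<lambda>z. d * (X$1$1 * (Re z / (sqrt d * Im z)) + X$2$2 * (- Re z / (sqrt d * Im z))
   - X$1$2 * (- 1 / (sqrt d * Im z)) - X$2$1 * ((cmod z)\<^sup>2 / (sqrt d * Im z))))"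
  by (rule ext) (simp add: bil_eq Xpt_def)
 then show ?thesis by simp
qed

lemma admissible_measurable:
 assumes "admissible c K g"
 shows "(\<lambda>p. g p a) \<in> borel_measurable borel"
 using admissible_continuous[OF assms] by (rule borel_measurable_continuous_onI)

context modular_domain
begin

text \<open>The properties of a cuspidal function that survive truncation and averaging:
  integrability, and mean zero on horocycles above some height Y. Averaging moves heights by at most
  a factor 3, so it raises Y from 2 to 6.\<close>

definition test_function :: "real \<Rightarrow> (complex \<Rightarrow> complex) \<Rightarrow> bool" where
 "test_function Y h \<longleftrightarrow> uhp_measurable h \<and> invariant h \<and> set_integrable \<mu> F h \<and>
   (\<forall>s\<in>SL2Z. AE y in lborel. y > Y \<longrightarrow>
    set_lebesgue_integral lborel {0..real N} (\<lambda>x. h (moebius s (Complex x y))) = 0)"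

text \<open>For T >= T0 the truncation cuts every Siegel set at height at least 2, where only the
  stabiliser of the cusp is left.\<close>

definition T0 :: real where
 "T0 = 2 / min_period"

lemma T0: "T \<ge> T0 \<Longrightarrow> T * min_period \<ge> 2" "T0 > 0"
 using min_period(1) by (auto simp: T0_def field_simps)

lemma siegel_representative:
 assumes z: "z \<in> uhp"
 obtains s w where "s \<in> SL2Z" "w \<in> siegel_set N" "z = moebius s w" "Im w \<ge> 1/2" "0 \<le> Re w" "Re w \<le> real N"
proof -
 obtain s where s: "s \<in> SL2Z" "Im (moebius s z) \<ge> 1/2" "0 \<le> Re (moebius s z)" "Re (moebius s z) < 1"
  using SL2Z_reduction[OF z] by blast
 have sR: "s \<in> SL2R" using s by (simp add: SL2Z_iff)
 show ?thesis
  by (rule that[of "matrix_inv s" "moebius s z"])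
    (use s N mat_subgroupD(4)[OF SL2Z_subgroup s(1)] moebius_inv(2)[OF sR z] in \<open>auto simp: siegel_set_def\<close>)
qed

end

context theta_setting
begin

lemma Theta_summable:
 assumes c: "c > 0" and g: "admissible c K g" and z: "z \<in> uhp"
 shows "(\<lambda>X. cmod (g (coord d X z) (bil d X X))) summable_on C"
  "(\<lambda>X. g (coord d X z) (bil d X X)) summable_on C"
proof -
 obtain s w where s0: "s \<in> SL2Z" "w \<in> siegel_set N" "z = moebius s w" and s1: "Im w \<ge> 1/2" "0 \<le> Re w" "Re w \<le> real N"
  by (rule siegel_representative[OF z])
 note s = s0(1,3) s1
 obtain C0 where C0: "C0 > 0"
  "\<And>s w g K. s \<in> SL2Z \<Longrightarrow> admissible c K g \<Longrightarrow> Im w \<ge> 1/2 \<Longrightarrow> 0 \<le> Re w \<Longrightarrow> Re w \<le> real N \<Longrightarrow>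
   (\<lambda>X. cmod (g (coord d X (moebius s w)) (bil d X X))) summable_on C \<and>
   Theta_abs g (moebius s w) \<le> C0 * K * Im w"
  "\<And>s w g K. s \<in> SL2Z \<Longrightarrow> admissible c K g \<Longrightarrow> Im w \<ge> 1/2 \<Longrightarrow> 0 \<le> Re w \<Longrightarrow> Re w \<le> real N \<Longrightarrow>
   cmod (Theta g (moebius s w) - Theta g (moebius s (Complex 0 (Im w)))) \<le> C0 * K"
  by (rule theta_majorant[OF c]) (rule that, assumption+)
 show "(\<lambda>X. cmod (g (coord d X z) (bil d X X))) summable_on C"
  using C0(2)[OF s(1) g s(3-5)] s(2) by simp
 then show "(\<lambda>X. g (coord d X z) (bil d X X)) summable_on C"
  by (rule Infinite_Sum.abs_summable_summable)
qed

text \<open>The unordered sum is absolutely convergent and hence a Bochner integral over the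
  counting measure on the countable set \<open>C\<close>; measurability of a parameter integral then
  applies.\<close>

lemma Theta_measurable:
 assumes c: "c > 0" and g: "admissible c K g"
 shows "uhp_measurable (Theta g)"
proof -
 have "(\<lambda>z. indicator uhp z *\<^sub>R Theta g z) = (\<lambda>z. \<integral>X. indicator uhp z *\<^sub>R g (coord d X z) (bil d X X) \<partial>count_space C)"
 proof
  fix z
  show "indicator uhp z *\<^sub>R Theta g z = (\<integral>X. indicator uhp z *\<^sub>R g (coord d X z) (bil d X X) \<partial>count_space C)"
  proof (cases "z \<in> uhp")
   case True
   have "Infinite_Set_Sum.abs_summable_on (\<lambda>X. g (coord d X z) (bil d X X)) C"
    using Theta_summable(1)[OF c g True] by (rule abs_summable_equivalent[THEN iffD1])
   then have "infsetsum (\<lambda>X. g (coord d X z) (bil d X X)) C = Theta g z"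
    unfolding Theta_def by (rule infsetsum_infsum)
   then show ?thesis using True by (simp add: infsetsum_def)
  qed simp
 qed
 moreover have "(\<lambda>z. \<integral>X. indicator uhp z *\<^sub>R g (coord d X z) (bil d X X) \<partial>count_space C) \<in> borel_measurable borel"
 proof -
  interpret sigma_finite_measure "count_space C"
   by (rule sigma_finite_measure_count_space_countable[OF C_countable])
  have "(\<lambda>z. indicator uhp z *\<^sub>R g (coord d X z) (bil d X X)) \<in> borel_measurable borel" for X
   using measurable_compose[OF coord_measurable[of d X] admissible_measurable[OF g, of "bil d X X"]] by measurable
  then show ?thesis
   by (intro borel_measurable_lebesgue_integral measurable_pair_count_space[OF C_countable])
 qed
 ultimately show ?thesis by (simp add: set_borel_measurable_def)
qed

lemma Theta_truncated_bound:
 assumes c: "c > 0"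
 obtains C0 where "C0 > 0" "\<And>g K T z. admissible c K g \<Longrightarrow> T \<ge> T0 \<Longrightarrow> z \<in> trunc T \<Longrightarrow>
  cmod (Theta g z) \<le> C0 * K * T \<and> Theta_abs g z \<le> C0 * K * T"
proof -
 obtain C0 where C0: "C0 > 0"
  "\<And>s w g K. s \<in> SL2Z \<Longrightarrow> admissible c K g \<Longrightarrow> Im w \<ge> 1/2 \<Longrightarrow> 0 \<le> Re w \<Longrightarrow> Re w \<le> real N \<Longrightarrow>
   (\<lambda>X. cmod (g (coord d X (moebius s w)) (bil d X X))) summable_on C \<and>
   Theta_abs g (moebius s w) \<le> C0 * K * Im w"
  "\<And>s w g K. s \<in> SL2Z \<Longrightarrow> admissible c K g \<Longrightarrow> Im w \<ge> 1/2 \<Longrightarrow> 0 \<le> Re w \<Longrightarrow> Re w \<le> real N \<Longrightarrow>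
   cmod (Theta g (moebius s w) - Theta g (moebius s (Complex 0 (Im w)))) \<le> C0 * K"
  by (rule theta_majorant[OF c]) (rule that, assumption+)
 have "cmod (Theta g z) \<le> C0 * real N * K * T \<and> Theta_abs g z \<le> C0 * real N * K * T"
  if g: "admissible c K g" and T: "T \<ge> T0" and z: "z \<in> trunc T" for g K T z
 proof -
  have zu: "z \<in> uhp" using z truncated_uhp_sub by auto
  obtain s w where s0: "s \<in> SL2Z" "w \<in> siegel_set N" "z = moebius s w" and s1: "Im w \<ge> 1/2" "0 \<le> Re w" "Re w \<le> real N"
   by (rule siegel_representative[OF zu])
  note s = s0(1,3) s1
  have T1: "T * min_period \<ge> 2" "T > 0" using T0 T by auto
  have "Im w \<le> T * width s" using truncated_siegel[OF s(1,3) T1(1)] z s(2) by simp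
  also have "\<dots> \<le> T * real N" using width(2)[OF s(1)] T1 by simp
  finally have y: "Im w \<le> T * real N" .
  have "Theta_abs g z \<le> C0 * K * Im w"
   using C0(2)[OF s(1) g s(3-5)] s(2) by simp
  also have "\<dots> \<le> C0 * K * (T * real N)" using y C0(1) admissible_nonneg[OF g] by (intro mult_left_mono) auto
  finally have 1: "Theta_abs g z \<le> C0 * real N * K * T" by (simp add: mult_ac)
  moreover have "cmod (Theta g z) \<le> Theta_abs g z"
   unfolding Theta_def by (rule norm_infsum_bound[OF Theta_summable(1)[OF c g zu]])
  ultimately show ?thesis by simp
 qed
 moreover have "C0 * real N > 0" using C0(1) N by simp
 ultimately show ?thesis using that by blast
qed

lemma set_borel_measurable_mult:
 fixes f g :: "complex \<Rightarrow> complex"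
 assumes "uhp_measurable f" "uhp_measurable g"
 shows "uhp_measurable (\<lambda>z. f z * g z)"
proof -
 have "(\<lambda>z. (indicator uhp z *\<^sub>R f z) * (indicator uhp z *\<^sub>R g z)) \<in> borel_measurable borel"
  using assms unfolding set_borel_measurable_def by measurable
 moreover have "(\<lambda>z. (indicator uhp z *\<^sub>R f z) * (indicator uhp z *\<^sub>R g z)) = (\<lambda>z. indicator uhp z *\<^sub>R (f z * g z))"
  by (auto simp: fun_eq_iff indicator_def)
 ultimately show ?thesis by (simp add: set_borel_measurable_def)
qed

lemma truncated_product_integrable:
 assumes c: "c > 0" and g: "admissible c K g" and h: "test_function Y h" and T: "T \<ge> T0"
 shows "set_integrable \<mu> F (\<lambda>z. indicator (trunc T) z *\<^sub>R (h z * Theta g z))"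
  "set_integrable \<mu> (F \<inter> trunc T) (\<lambda>z. h z * Theta g z)"
  "hyp_int (F \<inter> trunc T) (\<lambda>z. h z * Theta g z) =
   hyp_int F (\<lambda>z. indicator (trunc T) z *\<^sub>R (h z * Theta g z))"
  "uhp_measurable (\<lambda>z. indicator (trunc T) z *\<^sub>R (h z * Theta g z))"
proof -
 obtain C0 where C0: "C0 > 0" "\<And>g K T z. admissible c K g \<Longrightarrow> T \<ge> T0 \<Longrightarrow> z \<in> trunc T \<Longrightarrow>
  cmod (Theta g z) \<le> C0 * K * T \<and> Theta_abs g z \<le> C0 * K * T"
  by (rule Theta_truncated_bound[OF c]) (rule that, assumption+)
 have Tp: "T > 0" using T T0 by simp
 note [measurable] = truncated_borel[OF Tp]
 have eq: "indicator (F \<inter> trunc T) z *\<^sub>R (h z * Theta g z) =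
   indicator F z *\<^sub>R (indicator (trunc T) z *\<^sub>R (h z * Theta g z))" for z
  by (auto simp: indicator_def)
 have hm: "uhp_measurable (\<lambda>z. h z * Theta g z)"
  using h Theta_measurable[OF c g] by (intro set_borel_measurable_mult) (auto simp: test_function_def)
 have m: "(\<lambda>z. indicator uhp z *\<^sub>R (h z * Theta g z)) \<in> borel_measurable borel"
  using hm by (simp add: set_borel_measurable_def)
 have m1: "(\<lambda>z. indicator (trunc T) z *\<^sub>R (indicator uhp z *\<^sub>R (h z * Theta g z))) \<in> borel_measurable borel"
  using m by measurable
 show m2: "uhp_measurable (\<lambda>z. indicator (trunc T) z *\<^sub>R (h z * Theta g z))"
  unfolding set_borel_measurable_def using m1 by (simp add: mult.commute)
 have m3: "(\<lambda>z. indicator F z *\<^sub>R (indicator (trunc T) z *\<^sub>R (h z * Theta g z))) \<in> borel_measurable \<mu>"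
 proof -
  have "(\<lambda>z. indicator F z *\<^sub>R (indicator (trunc T) z *\<^sub>R (h z * Theta g z))) =
    (\<lambda>z. indicator F z *\<^sub>R (indicator (trunc T) z *\<^sub>R (indicator uhp z *\<^sub>R (h z * Theta g z))))"
   using F_uhp by (auto simp: fun_eq_iff indicator_def)
  moreover have "(\<lambda>z. indicator F z *\<^sub>R (indicator (trunc T) z *\<^sub>R (indicator uhp z *\<^sub>R (h z * Theta g z)))) \<in> borel_measurable borel"
   using m1 by (rule borel_measurable_scaleR[OF borel_measurable_indicator[OF F_borel]])
  ultimately show ?thesis by (simp only: measurable_cong_sets[OF sets_hyp refl])
 qed
 have hI: "integrable \<mu> (\<lambda>z. indicator F z *\<^sub>R h z)" using h by (simp add: test_function_def set_integrable_def)
 show 1: "set_integrable \<mu> F (\<lambda>z. indicator (trunc T) z *\<^sub>R (h z * Theta g z))"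
  unfolding set_integrable_def
 proof (rule bochner_bound[OF integrable_mult_right[OF integrable_norm[OF hI], of "C0 * K * T"] m3])
  show "AE z in \<mu>. norm (indicator F z *\<^sub>R (indicator (trunc T) z *\<^sub>R (h z * Theta g z))) \<le>
    norm (C0 * K * T * norm (indicator F z *\<^sub>R h z))"
  proof (rule AE_I2)
   fix z
   show "norm (indicator F z *\<^sub>R (indicator (trunc T) z *\<^sub>R (h z * Theta g z))) \<le>
    norm (C0 * K * T * norm (indicator F z *\<^sub>R h z))"
   proof (cases "z \<in> F \<and> z \<in> trunc T")
    case True
    have "norm (h z) * cmod (Theta g z) \<le> norm (h z) * (C0 * K * T)"
     using C0(2)[OF g T] True by (intro mult_left_mono) auto
    then show ?thesis using True C0(1) admissible_nonneg[OF g] Tp by (simp add: norm_mult mult.commute)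
   qed (auto simp: indicator_def)
  qed
 qed
 show "set_integrable \<mu> (F \<inter> trunc T) (\<lambda>z. h z * Theta g z)"
  using 1 unfolding set_integrable_def eq .
 show "hyp_int (F \<inter> trunc T) (\<lambda>z. h z * Theta g z) =
   hyp_int F (\<lambda>z. indicator (trunc T) z *\<^sub>R (h z * Theta g z))"
  unfolding set_lebesgue_integral_def eq ..
qed

text \<open>In a cusp the kernel is replaced by its difference with its value on the imaginary axis,
 which is bounded; this does not change the integral since \<open>h\<close> has mean zero on horocycles.\<close>

lemma cusp_integral_limit:
 assumes c: "c > 0" and Y: "Y \<ge> 2"
 obtains C1 where "C1 > 0"
  "\<And>h g K i. test_function Y h \<Longrightarrow> admissible c K g \<Longrightarrow> i \<in> reps \<Longrightarrow>
   \<exists>l. ((\<lambda>T. \<integral>w. dens w *\<^sub>R (indicator (trunc T) (moebius (matrix_inv i) w) *\<^sub>R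
     (h (moebius (matrix_inv i) w) * Theta g (moebius (matrix_inv i) w))) \<partial>\<mu>) \<longlongrightarrow> l) at_top \<and>
    cmod l \<le> C1 * K * (\<integral>w. dens w *\<^sub>R cmod (h (moebius (matrix_inv i) w)) \<partial>\<mu>)"
proof -
 obtain C0 where C0: "C0 > 0"
  "\<And>s w g K. s \<in> SL2Z \<Longrightarrow> admissible c K g \<Longrightarrow> Im w \<ge> 1/2 \<Longrightarrow> 0 \<le> Re w \<Longrightarrow> Re w \<le> real N \<Longrightarrow>
   (\<lambda>X. cmod (g (coord d X (moebius s w)) (bil d X X))) summable_on C \<and>
   Theta_abs g (moebius s w) \<le> C0 * K * Im w"
  "\<And>s w g K. s \<in> SL2Z \<Longrightarrow> admissible c K g \<Longrightarrow> Im w \<ge> 1/2 \<Longrightarrow> 0 \<le> Re w \<Longrightarrow> Re w \<le> real N \<Longrightarrow>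
   cmod (Theta g (moebius s w) - Theta g (moebius s (Complex 0 (Im w)))) \<le> C0 * K"
  by (rule theta_majorant[OF c]) (rule that, assumption+)
 have "\<exists>l. ((\<lambda>T. \<integral>w. dens w *\<^sub>R (indicator (trunc T) (moebius (matrix_inv i) w) *\<^sub>R
     (h (moebius (matrix_inv i) w) * Theta g (moebius (matrix_inv i) w))) \<partial>\<mu>) \<longlongrightarrow> l) at_top \<and>
    cmod l \<le> (C0 * Y) * K * (\<integral>w. dens w *\<^sub>R cmod (h (moebius (matrix_inv i) w)) \<partial>\<mu>)"
  if h: "test_function Y h" and g: "admissible c K g" and i: "i \<in> reps" for h g K i
 proof -
  define s where "s = matrix_inv i"
  have iZ: "i \<in> SL2Z" using i reps(3) by auto
  have s: "s \<in> SL2Z" unfolding s_def using mat_subgroupD(4)[OF SL2Z_subgroup iZ] .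
  have sR: "s \<in> SL2R" using s by (simp add: SL2Z_iff)
  have K: "K \<ge> 0" using admissible_nonneg[OF g] .
  have hm [measurable]: "(\<lambda>z. indicator uhp z *\<^sub>R h z) \<in> borel_measurable borel"
   using h by (simp add: test_function_def set_borel_measurable_def)
  have Tm [measurable]: "(\<lambda>z. indicator uhp z *\<^sub>R Theta g z) \<in> borel_measurable borel"
   using Theta_measurable[OF c g] by (simp add: set_borel_measurable_def)
  define H where "H = (\<lambda>w. indicator uhp (moebius s w) *\<^sub>R h (moebius s w))"
  define Q where "Q = (\<lambda>w. indicator uhp (moebius s w) *\<^sub>R Theta g (moebius s w))"
  have [measurable]: "H \<in> borel_measurable borel" "Q \<in> borel_measurable borel"
   unfolding H_def Q_def using measurable_compose[OF moebius_measurable hm] measurable_compose[OF moebius_measurable Tm] by auto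
  have HQ: "H w = h (moebius s w)" "Q w = Theta g (moebius s w)" if "w \<in> uhp" for w
   using that sR by (auto simp: H_def Q_def moebius_uhp)
  have Qb: "cmod (Q w) \<le> C0 * K * Im w" if w: "Im w \<ge> 1/2" "0 \<le> Re w" "Re w \<le> real N" for w
  proof -
   have wu: "w \<in> uhp" using w by (simp add: uhp_iff)
   have "cmod (Theta g (moebius s w)) \<le> Theta_abs g (moebius s w)"
    unfolding Theta_def using C0(2)[OF s g w] by (intro norm_infsum_bound) auto
   then show ?thesis using C0(2)[OF s g w] HQ[OF wu] by simp
  qed
  have Qd: "cmod (Q w - Q (Complex 0 (Im w))) \<le> C0 * K" if w: "Im w \<ge> 1/2" "0 \<le> Re w" "Re w \<le> real N" for w
   using C0(3)[OF s g w] HQ(2)[of w] HQ(2)[of "Complex 0 (Im w)"] w by (simp add: uhp_iff)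
  have S: "Im w \<ge> 1/2" "0 \<le> Re w" "Re w \<le> real N" "w \<in> uhp" if "w \<in> siegel_set N" for w
   using that by (auto simp: siegel_set_def uhp_iff)
  have dH: "dens w *\<^sub>R h (moebius s w) = dens w *\<^sub>R H w" for w
   using HQ(1)[of w] S(4)[of w] dens_outside[of w] by (cases "w \<in> siegel_set N") auto
  have HI: "integrable \<mu> (\<lambda>w. dens w *\<^sub>R H w)"
   unfolding dH[symmetric] using unfold_integral(1)[of h] h i by (simp add: test_function_def s_def)
  have HIn: "integrable \<mu> (\<lambda>w. dens w *\<^sub>R cmod (H w))"
   using integrable_norm[OF HI] dens_bounds(1) by simp
  \<comment> \<open>Below height Y the kernel is at most C0 K Y, above it the difference is at most
    C0 K; hence \<open>R\<close> is dominated by the density times |H| and is integrable without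
    truncation.\<close>
  define R where "R = (\<lambda>w. (dens w *\<^sub>R H w) * (Q w - indicator {Y<..} (Im w) *\<^sub>R Q (Complex 0 (Im w))))"
  have [measurable]: "R \<in> borel_measurable borel" unfolding R_def by measurable
  have Rb: "cmod (R w) \<le> C0 * Y * K * (dens w *\<^sub>R cmod (H w))" for w
  proof (cases "w \<in> siegel_set N")
   case True
   have "cmod (Q w - indicator {Y<..} (Im w) *\<^sub>R Q (Complex 0 (Im w))) \<le> C0 * Y * K"
   proof (cases "Im w > Y")
    case yes: True
    have "C0 * K * 1 \<le> C0 * K * Y" using C0(1) K Y by (intro mult_left_mono) auto
    then show ?thesis using Qd[OF S(1-3)[OF True]] yes by (simp add: mult_ac)
   next
    case False
    have "cmod (Q w) \<le> C0 * K * Im w" using Qb[OF S(1-3)[OF True]] .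
    also have "\<dots> \<le> C0 * K * Y" using C0(1) K False by (intro mult_left_mono) auto
    finally show ?thesis using False by (simp add: mult_ac)
   qed
   then have "cmod (dens w *\<^sub>R H w) * cmod (Q w - indicator {Y<..} (Im w) *\<^sub>R Q (Complex 0 (Im w))) \<le> cmod (dens w *\<^sub>R H w) * (C0 * Y * K)"
    by (rule mult_left_mono) simp
   then show ?thesis using dens_bounds(1)[of w] by (simp add: R_def norm_mult mult_ac)
  qed (simp add: R_def dens_outside)
  have RI: "integrable \<mu> R"
   by (rule bochner_bound[OF integrable_mult_right[OF HIn, of "C0 * Y * K"]])
     (use Rb dens_bounds(1) C0(1) Y K in \<open>auto intro!: AE_I2 simp: abs_mult\<close>)
  let ?I = "\<lambda>T. \<integral>w. dens w *\<^sub>R (indicator (trunc T) (moebius s w) *\<^sub>R (h (moebius s w) * Theta g (moebius s w))) \<partial>\<mu>"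
  have eqI: "?I T = (\<integral>w. indicator {..T * width s} (Im w) *\<^sub>R R w \<partial>\<mu>)" if T: "T \<ge> T0" for T
  proof -
   \<comment> \<open>The part that \<open>R\<close> leaves out below the truncation height. Above Y
     >= 2 it is a function of the height times \<open>H\<close> on a full period, so its horizontal
     integrals are multiples of means of h and vanish. For fixed T it is integrable, the kernel
     being bounded up to the cut.\<close>
   define k where "k = (\<lambda>w. (dens w *\<^sub>R H w) * (indicator {Y<..T * width s} (Im w) *\<^sub>R Q (Complex 0 (Im w))))"
   have km [measurable]: "k \<in> borel_measurable borel" unfolding k_def by measurable
   have T1: "T * min_period \<ge> 2" "T > 0" using T0 T by auto
   have kI: "integrable \<mu> k"
   proof (rule bochner_bound[OF integrable_mult_right[OF HIn, of "C0 * K * (T * width s)"]])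
    show "AE w in \<mu>. norm (k w) \<le> norm (C0 * K * (T * width s) * (dens w *\<^sub>R cmod (H w)))"
    proof (rule AE_I2)
     fix w
     show "norm (k w) \<le> norm (C0 * K * (T * width s) * (dens w *\<^sub>R cmod (H w)))"
     proof (cases "w \<in> siegel_set N \<and> Im w \<in> {Y<..T * width s}")
      case True
      have "cmod (Q (Complex 0 (Im w))) \<le> C0 * K * Im w"
       using Qb[of "Complex 0 (Im w)"] S[of w] True by auto
      also have "\<dots> \<le> C0 * K * (T * width s)" using C0(1) K True by (intro mult_left_mono) auto
      finally have "cmod (dens w *\<^sub>R H w) * cmod (Q (Complex 0 (Im w))) \<le> cmod (dens w *\<^sub>R H w) * (C0 * K * (T * width s))"
       by (rule mult_left_mono) simp
      also have "\<dots> = C0 * K * (T * width s) * (dens w *\<^sub>R cmod (H w))"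
       using dens_bounds(1)[of w] by simp
      also have "\<dots> \<le> norm (C0 * K * (T * width s) * (dens w *\<^sub>R cmod (H w)))"
       unfolding real_norm_def by (rule abs_ge_self)
      finally show ?thesis using True by (simp add: k_def norm_mult)
     qed (auto simp: k_def dens_outside indicator_def)
    qed
   qed measurable
   have k0: "(\<integral>w. k w \<partial>\<mu>) = 0"
   proof (rule integral_hyp_eq_0[OF km kI])
    have "AE y in lborel. y > Y \<longrightarrow> set_lebesgue_integral lborel {0..real N} (\<lambda>x. h (moebius s (Complex x y))) = 0"
     using h s by (auto simp: test_function_def)
    then show "AE y in lborel. y > 0 \<longrightarrow> (\<integral>x. k (Complex x y) \<partial>lborel) = 0"
    proof eventually_elim
     case (elim y)
     show ?case
     proof (cases "y > Y \<and> y \<le> T * width s")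
      case True
      have y2: "y > 2" using True Y by simp
      have ku: "k (Complex x y) = ((folding / (2 * real N)) *\<^sub>R Q (Complex 0 y)) * (indicator {0..<real N} x *\<^sub>R H (Complex x y))" for x
      proof (cases "x \<in> {0..<real N}")
       case x: True
       then have "Complex x y \<in> siegel_set N" using y2 by (auto simp: siegel_set_def)
       then have "dens (Complex x y) = folding / (2 * real N)" using y2 by (intro dens_cusp) auto
       then show ?thesis using True x by (simp add: k_def scaleR_conv_of_real)
      next
       case False
       then have "Complex x y \<notin> siegel_set N" by (auto simp: siegel_set_def)
       then show ?thesis using False by (simp add: k_def dens_outside)
      qed
      have "(\<integral>x. k (Complex x y) \<partial>lborel) = ((folding / (2 * real N)) *\<^sub>R Q (Complex 0 y)) * (\<integral>x. indicator {0..<real N} x *\<^sub>R H (Complex x y) \<partial>lborel)"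
       unfolding ku by (rule integral_mult_right_zero)
      also have "(\<integral>x. indicator {0..<real N} x *\<^sub>R H (Complex x y) \<partial>lborel) = (\<integral>x. indicator {0..real N} x *\<^sub>R H (Complex x y) \<partial>lborel)"
      proof (rule integral_cong_AE)
       show "AE x in lborel. indicator {0..<real N} x *\<^sub>R H (Complex x y) = indicator {0..real N} x *\<^sub>R H (Complex x y)"
        using AE_lborel_singleton[of "real N"] by eventually_elim (auto simp: indicator_def)
      qed measurable
      also have "\<dots> = set_lebesgue_integral lborel {0..real N} (\<lambda>x. h (moebius s (Complex x y)))"
       unfolding set_lebesgue_integral_def using y2 by (simp add: HQ(1) uhp_iff)
      also have "\<dots> = 0" using elim True by simp
      finally show ?thesis by simp
     next
      case False
      then show ?thesis by (simp add: k_def)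
     qed
    qed
   qed
   have RTI: "integrable \<mu> (\<lambda>w. indicator {..T * width s} (Im w) *\<^sub>R R w)"
    by (rule bochner_bound[OF RI]) (auto simp: indicator_def)
   have "?I T = (\<integral>w. indicator {..T * width s} (Im w) *\<^sub>R R w + k w \<partial>\<mu>)"
   proof (rule bochner_cong[OF refl])
    fix w
    show "dens w *\<^sub>R (indicator (trunc T) (moebius s w) *\<^sub>R (h (moebius s w) * Theta g (moebius s w))) =
     indicator {..T * width s} (Im w) *\<^sub>R R w + k w"
    proof (cases "w \<in> siegel_set N")
     case True
     have t: "moebius s w \<in> trunc T \<longleftrightarrow> Im w \<le> T * width s"
      using truncated_siegel[OF s _ T1(1)] S[OF True] by auto
     show ?thesis
      using HQ[OF S(4)[OF True]] t by (auto simp: R_def k_def indicator_def algebra_simps)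
    qed (simp add: R_def k_def dens_outside)
   qed
   also have "\<dots> = (\<integral>w. indicator {..T * width s} (Im w) *\<^sub>R R w \<partial>\<mu>)"
    using k0 by (simp add: Bochner_Integration.integral_add[OF RTI kI])
   finally show ?thesis .
  qed
  have lim: "((\<lambda>T. \<integral>w. indicator {..T * width s} (Im w) *\<^sub>R R w \<partial>\<mu>) \<longlongrightarrow> (\<integral>w. R w \<partial>\<mu>)) at_top"
  proof (rule integral_dominated_convergence_at_top)
   show "integrable \<mu> (\<lambda>w. cmod (R w))" using RI by simp
   show "\<forall>\<^sub>F T in at_top. AE w in \<mu>. norm (indicator {..T * width s} (Im w) *\<^sub>R R w) \<le> cmod (R w)"
    by (intro always_eventually allI AE_I2) (auto simp: indicator_def)
   show "AE w in \<mu>. ((\<lambda>T. indicator {..T * width s} (Im w) *\<^sub>R R w) \<longlongrightarrow> R w) at_top"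
   proof (rule AE_I2)
    fix w
    have wp: "width s > 0" using width(1)[OF s] min_period(1) by simp
    have "\<forall>\<^sub>F T in at_top. indicator {..T * width s} (Im w) *\<^sub>R R w = R w"
     using eventually_ge_at_top[of "Im w / width s"]
     by eventually_elim (use wp in \<open>auto simp: indicator_def field_simps\<close>)
    then show "((\<lambda>T. indicator {..T * width s} (Im w) *\<^sub>R R w) \<longlongrightarrow> R w) at_top"
     by (rule tendsto_eventually)
   qed
  qed measurable
  have "(?I \<longlongrightarrow> (\<integral>w. R w \<partial>\<mu>)) at_top"
  proof (rule Lim_transform_eventually[OF lim])
   show "\<forall>\<^sub>F T in at_top. (\<integral>w. indicator {..T * width s} (Im w) *\<^sub>R R w \<partial>\<mu>) = ?I T"
    using eventually_ge_at_top[of T0] by eventually_elim (rule eqI[symmetric])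
  qed
  moreover have "cmod (\<integral>w. R w \<partial>\<mu>) \<le> C0 * Y * K * (\<integral>w. dens w *\<^sub>R cmod (h (moebius s w)) \<partial>\<mu>)"
  proof -
   have "cmod (\<integral>w. R w \<partial>\<mu>) \<le> (\<integral>w. C0 * Y * K * (dens w *\<^sub>R cmod (H w)) \<partial>\<mu>)"
    by (rule order_trans[OF Bochner_Integration.integral_norm_bound],
      rule Bochner_Integration.integral_mono[OF integrable_norm[OF RI] integrable_mult_right[OF HIn]]) (rule Rb)
   also have "\<dots> = C0 * Y * K * (\<integral>w. dens w *\<^sub>R cmod (H w) \<partial>\<mu>)" by simp
   also have "(\<lambda>w. dens w *\<^sub>R cmod (H w)) = (\<lambda>w. dens w *\<^sub>R cmod (h (moebius s w)))"
   proof
    fix w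
    show "dens w *\<^sub>R cmod (H w) = dens w *\<^sub>R cmod (h (moebius s w))"
     using HQ(1)[of w] S(4)[of w] dens_outside[of w] by (cases "w \<in> siegel_set N") auto
   qed
   finally show ?thesis .
  qed
  ultimately show ?thesis unfolding s_def by blast
 qed
 moreover have "C0 * Y > 0" using C0(1) Y by simp
 ultimately show ?thesis using that by blast
qed

definition pairing :: "(complex \<Rightarrow> complex) \<Rightarrow> (real \<Rightarrow> real \<Rightarrow> complex) \<Rightarrow> complex" where
 "pairing h g = integral_M \<Gamma> F (\<lambda>z. h z * Theta g z)"

text \<open>The L^1 norms on the Siegel sets add up to the norm over \<open>F\<close> by
  \<open>unfold_integral\<close>. The constant \<open>C1\<close> depends on c and Y only: uniformity
  in g permits difference quotients of kernels, uniformity in h permits approximation of the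
  function.\<close>

theorem pairing_bound:
 assumes c: "c > 0" and Y: "Y \<ge> 2"
 obtains C1 where "C1 > 0"
  "\<And>h g K. test_function Y h \<Longrightarrow> admissible c K g \<Longrightarrow>
   ((\<lambda>T. hyp_int (F \<inter> trunc T) (\<lambda>z. h z * Theta g z)) \<longlongrightarrow> pairing h g) at_top \<and>
   cmod (pairing h g) \<le> C1 * K * L1 h"
proof -
 obtain C1 where C1: "C1 > 0"
  "\<And>h g K i. test_function Y h \<Longrightarrow> admissible c K g \<Longrightarrow> i \<in> reps \<Longrightarrow>
   \<exists>l. ((\<lambda>T. \<integral>w. dens w *\<^sub>R (indicator (trunc T) (moebius (matrix_inv i) w) *\<^sub>R
     (h (moebius (matrix_inv i) w) * Theta g (moebius (matrix_inv i) w))) \<partial>\<mu>) \<longlongrightarrow> l) at_top \<and>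
    cmod l \<le> C1 * K * (\<integral>w. dens w *\<^sub>R cmod (h (moebius (matrix_inv i) w)) \<partial>\<mu>)"
  by (rule cusp_integral_limit[OF c Y]) (rule that, assumption+)
 have "((\<lambda>T. hyp_int (F \<inter> trunc T) (\<lambda>z. h z * Theta g z)) \<longlongrightarrow> pairing h g) at_top \<and>
   cmod (pairing h g) \<le> C1 * K * L1 h"
  if h: "test_function Y h" and g: "admissible c K g" for h g K
 proof -
  let ?S = "\<lambda>T. hyp_int (F \<inter> trunc T) (\<lambda>z. h z * Theta g z)"
  let ?I = "\<lambda>i T. \<integral>w. dens w *\<^sub>R (indicator (trunc T) (moebius (matrix_inv i) w) *\<^sub>R
     (h (moebius (matrix_inv i) w) * Theta g (moebius (matrix_inv i) w))) \<partial>\<mu>"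
  have "\<forall>i\<in>reps. \<exists>l. (?I i \<longlongrightarrow> l) at_top \<and> cmod l \<le> C1 * K * (\<integral>w. dens w *\<^sub>R cmod (h (moebius (matrix_inv i) w)) \<partial>\<mu>)"
   using C1(2)[OF h g] by (rule ballI)
  from bchoice[OF this] obtain l where l': "\<forall>i\<in>reps. (?I i \<longlongrightarrow> l i) at_top \<and>
    cmod (l i) \<le> C1 * K * (\<integral>w. dens w *\<^sub>R cmod (h (moebius (matrix_inv i) w)) \<partial>\<mu>)"
   by (rule exE)
  then have l: "\<And>i. i \<in> reps \<Longrightarrow> (?I i \<longlongrightarrow> l i) at_top"
   "\<And>i. i \<in> reps \<Longrightarrow> cmod (l i) \<le> C1 * K * (\<integral>w. dens w *\<^sub>R cmod (h (moebius (matrix_inv i) w)) \<partial>\<mu>)"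
   by blast+
  have S: "?S T = (\<Sum>i\<in>reps. ?I i T)" if T: "T \<ge> T0" for T
  proof -
   note p = truncated_product_integrable[OF c g h T]
   have "invariant (\<lambda>z. indicator (trunc T) z *\<^sub>R (h z * Theta g z))"
    using h Theta_invariant[of g] truncated_invariant by (auto simp: test_function_def invariant_def indicator_def)
   from unfold_integral(2)[OF p(4) this p(1)] show ?thesis unfolding p(3) .
  qed
  have "((\<lambda>T. \<Sum>i\<in>reps. ?I i T) \<longlongrightarrow> (\<Sum>i\<in>reps. l i)) at_top"
   by (intro tendsto_sum l)
  then have lim: "(?S \<longlongrightarrow> (\<Sum>i\<in>reps. l i)) at_top"
  proof (rule Lim_transform_eventually)
   show "\<forall>\<^sub>F T in at_top. (\<Sum>i\<in>reps. ?I i T) = ?S T"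
    using eventually_ge_at_top[of T0] by eventually_elim (rule S[symmetric])
  qed
  have eq: "pairing h g = (\<Sum>i\<in>reps. l i)"
   unfolding pairing_def integral_M_def by (rule tendsto_Lim[OF _ lim]) simp
  have hI: "set_integrable \<mu> F h" "uhp_measurable h" "invariant h"
   using h by (auto simp: test_function_def)
  have "cmod (pairing h g) \<le> (\<Sum>i\<in>reps. C1 * K * (\<integral>w. dens w *\<^sub>R cmod (h (moebius (matrix_inv i) w)) \<partial>\<mu>))"
   unfolding eq by (rule order_trans[OF norm_sum]) (intro sum_mono l)
  also have "\<dots> = C1 * K * L1 h"
  proof -
   have "uhp_measurable (\<lambda>z. cmod (h z))"
   proof -
    have "(\<lambda>z. cmod (indicator uhp z *\<^sub>R h z)) \<in> borel_measurable borel"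
     using hI(2) unfolding set_borel_measurable_def by (rule measurable_compose[OF _ borel_measurable_norm])
    then show ?thesis by (simp add: set_borel_measurable_def)
   qed
   moreover have "invariant (\<lambda>z. cmod (h z))" using hI(3) by (simp add: invariant_def)
   moreover have "set_integrable \<mu> F (\<lambda>z. cmod (h z))"
    using integrable_norm[OF hI(1)[unfolded set_integrable_def]] by (simp add: set_integrable_def)
   ultimately have "L1 h =
     (\<Sum>i\<in>reps. \<integral>w. dens w *\<^sub>R cmod (h (moebius (matrix_inv i) w)) \<partial>\<mu>)"
    by (rule unfold_integral(2))
   then show ?thesis by (simp add: sum_distrib_left)
  qed
  finally show ?thesis using lim eq by simp
 qed
 then show ?thesis using that C1(1) by blast
qed

lemma pairing_tendsto:
 assumes "c > 0" "Y \<ge> 2" "test_function Y h" "admissible c K g"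
 shows "((\<lambda>T. hyp_int (F \<inter> trunc T) (\<lambda>z. h z * Theta g z)) \<longlongrightarrow> pairing h g) at_top"
 by (rule pairing_bound[OF assms(1,2)]) (use assms(3,4) in blast)

lemma pairing_eqI:
 assumes "((\<lambda>T. hyp_int (F \<inter> trunc T) (\<lambda>z. h z * Theta g z)) \<longlongrightarrow> l) at_top"
 shows "pairing h g = l"
 unfolding pairing_def integral_M_def by (rule tendsto_Lim[OF _ assms]) simp

section \<open>Linearity of the pairing\<close>

lemma Theta_linear:
 assumes c: "c > 0" and g1: "admissible c K1 g1" and g2: "admissible c K2 g2" and z: "z \<in> uhp"
 shows "Theta (\<lambda>p a. \<alpha> * g1 p a + \<beta> * g2 p a) z = \<alpha> * Theta g1 z + \<beta> * Theta g2 z"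
 unfolding Theta_def
 using Theta_summable(2)[OF c g1 z] Theta_summable(2)[OF c g2 z]
 by (subst infsum_add) (auto intro: summable_on_cmult_right simp: infsum_cmult_right')

lemma pairing_linear:
 assumes c: "c > 0" and Y: "Y \<ge> 2" and h: "test_function Y h"
  and g1: "admissible c K1 g1" and g2: "admissible c K2 g2"
 shows "pairing h (\<lambda>p a. \<alpha> * g1 p a + \<beta> * g2 p a) = \<alpha> * pairing h g1 + \<beta> * pairing h g2"
proof (rule pairing_eqI)
 let ?S = "\<lambda>g T. hyp_int (F \<inter> trunc T) (\<lambda>z. h z * Theta g z)"
 have "((\<lambda>T. \<alpha> * ?S g1 T + \<beta> * ?S g2 T) \<longlongrightarrow> \<alpha> * pairing h g1 + \<beta> * pairing h g2) at_top"
  by (intro tendsto_intros pairing_tendsto[OF c Y h g1] pairing_tendsto[OF c Y h g2])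
 moreover have "\<forall>\<^sub>F T in at_top. \<alpha> * ?S g1 T + \<beta> * ?S g2 T = ?S (\<lambda>p a. \<alpha> * g1 p a + \<beta> * g2 p a) T"
  using eventually_ge_at_top[of T0]
 proof eventually_elim
  case (elim T)
  note i = truncated_product_integrable(2)[OF c g1 h elim] truncated_product_integrable(2)[OF c g2 h elim]
  have "?S (\<lambda>p a. \<alpha> * g1 p a + \<beta> * g2 p a) T = hyp_int (F \<inter> trunc T)
    (\<lambda>z. \<alpha> * (h z * Theta g1 z) + \<beta> * (h z * Theta g2 z))"
   unfolding set_lebesgue_integral_def using F_uhp
   by (intro bochner_cong refl)
     (auto simp: indicator_def Theta_linear[OF c g1 g2] algebra_simps)
  also have "\<dots> = \<alpha> * ?S g1 T + \<beta> * ?S g2 T"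
   using i by (subst set_integral_add) auto
  finally show ?case by simp
 qed
 ultimately show "((\<lambda>T. ?S (\<lambda>p a. \<alpha> * g1 p a + \<beta> * g2 p a) T) \<longlongrightarrow> \<alpha> * pairing h g1 + \<beta> * pairing h g2) at_top"
  by (rule Lim_transform_eventually)
qed

lemma pairing_diff_left:
 assumes c: "c > 0" and Y: "Y \<ge> 2" and h: "test_function Y h1" "test_function Y h2" and g: "admissible c K g"
 shows "pairing (\<lambda>z. h1 z - h2 z) g = pairing h1 g - pairing h2 g"
proof (rule pairing_eqI)
 let ?S = "\<lambda>h T. hyp_int (F \<inter> trunc T) (\<lambda>z. h z * Theta g z)"
 have "((\<lambda>T. ?S h1 T - ?S h2 T) \<longlongrightarrow> pairing h1 g - pairing h2 g) at_top"
  by (intro tendsto_intros pairing_tendsto[OF c Y h(1) g] pairing_tendsto[OF c Y h(2) g])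
 moreover have "\<forall>\<^sub>F T in at_top. ?S h1 T - ?S h2 T = ?S (\<lambda>z. h1 z - h2 z) T"
  using eventually_ge_at_top[of T0]
 proof eventually_elim
  case (elim T)
  note i = truncated_product_integrable(2)[OF c g h(1) elim] truncated_product_integrable(2)[OF c g h(2) elim]
  show ?case using set_integral_diff(2)[OF i] by (simp add: left_diff_distrib)
 qed
 ultimately show "((\<lambda>T. ?S (\<lambda>z. h1 z - h2 z) T) \<longlongrightarrow> pairing h1 g - pairing h2 g) at_top"
  by (rule Lim_transform_eventually)
qed

lemma pairing_cmult_left:
 assumes c: "c > 0" and Y: "Y \<ge> 2" and h: "test_function Y h" and g: "admissible c K g"
 shows "pairing (\<lambda>z. \<alpha> * h z) g = \<alpha> * pairing h g"
proof (rule pairing_eqI)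
 show "((\<lambda>T. hyp_int (F \<inter> trunc T) (\<lambda>z. \<alpha> * h z * Theta g z)) \<longlongrightarrow> \<alpha> * pairing h g) at_top"
  using tendsto_mult_left[OF pairing_tendsto[OF c Y h g], of \<alpha>] by (simp add: mult.assoc)
qed

lemma pairing_cnj:
 assumes c: "c > 0" and Y: "Y \<ge> 2" and h: "test_function Y h" and g: "admissible c K g"
 shows "pairing (\<lambda>z. cnj (h z)) (\<lambda>p a. cnj (g p a)) = cnj (pairing h g)"
proof (rule pairing_eqI)
 let ?S = "\<lambda>T. hyp_int (F \<inter> trunc T) (\<lambda>z. h z * Theta g z)"
 have "hyp_int (F \<inter> trunc T) (\<lambda>z. cnj (h z) * Theta (\<lambda>p a. cnj (g p a)) z) = cnj (?S T)" for T
  unfolding set_lebesgue_integral_def Theta_def infsum_cnj by (subst Bochner_Integration.integral_cnj[symmetric]) (simp add: scaleR_conv_of_real)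
 then show "((\<lambda>T. hyp_int (F \<inter> trunc T) (\<lambda>z. cnj (h z) * Theta (\<lambda>p a. cnj (g p a)) z)) \<longlongrightarrow> cnj (pairing h g)) at_top"
  using tendsto_cnj[OF pairing_tendsto[OF c Y h g]] by simp
qed

end

section \<open>Differentiation in the modular variable\<close>

text \<open>The inequality x <= exp x at x = c (1 + m) / (n + 1), raised to the power n. Dividing by
  n + 1 rather than by n covers n = 0.\<close>

lemma one_plus_power_le_exp:
 assumes c: "c > (0::real)" and m: "m \<ge> 0"
 shows "(1 + m) ^ n \<le> ((real n + 1) / c) ^ n * exp c * exp (c * m)"
proof -
 have "x = (k / c) * (c * x / k)" if "k > 0" for x k :: real using c that by simp
 from this[of "real n + 1" "1 + m"] have "1 + m = ((real n + 1) / c) * (c * (1 + m) / (real n + 1))" by simp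
 also have "\<dots> \<le> ((real n + 1) / c) * exp (c * (1 + m) / (real n + 1))"
 proof (rule mult_left_mono)
  show "c * (1 + m) / (real n + 1) \<le> exp (c * (1 + m) / (real n + 1))"
   using exp_ge_add_one_self[of "c * (1 + m) / (real n + 1)"] by linarith
 qed (use c in auto)
 finally have "(1 + m) ^ n \<le> (((real n + 1) / c) * exp (c * (1 + m) / (real n + 1))) ^ n"
  using m by (intro power_mono) auto
 also have "\<dots> = ((real n + 1) / c) ^ n * exp (real n * (c * (1 + m) / (real n + 1)))"
  unfolding power_mult_distrib by (simp only: exp_of_nat_mult)
 also have "\<dots> \<le> ((real n + 1) / c) ^ n * exp (c * (1 + m))"
 proof (rule mult_left_mono)
  have "real n / (real n + 1) * (c * (1 + m)) \<le> 1 * (c * (1 + m))"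
   using c m by (intro mult_right_mono) auto
  then show "exp (real n * (c * (1 + m) / (real n + 1))) \<le> exp (c * (1 + m))" by simp
 qed (use c in auto)
 also have "\<dots> = ((real n + 1) / c) ^ n * exp c * exp (c * m)"
  by (simp add: distrib_left exp_add)
 finally show ?thesis .
qed

lemma coord_le_majorant:
 assumes "2 * a \<le> (p::real)\<^sup>2"
 shows "p\<^sup>2 - a \<ge> 0" "\<bar>p\<bar> \<le> 1 + (p\<^sup>2 - a)" "\<bar>a\<bar> \<le> p\<^sup>2 - a"
proof -
 have p: "p\<^sup>2 \<ge> 0" by simp
 show "p\<^sup>2 - a \<ge> 0" "\<bar>a\<bar> \<le> p\<^sup>2 - a" using assms p by linarith+
 have "0 \<le> (\<bar>p\<bar> - 1)\<^sup>2" by simp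
 then have "2 * \<bar>p\<bar> \<le> p\<^sup>2 + 1" by (simp add: power2_diff)
 then show "\<bar>p\<bar> \<le> 1 + (p\<^sup>2 - a)" using assms p by linarith
qed

section \<open>Gaussian profiles\<close>

definition gauss :: "complex \<Rightarrow> real \<Rightarrow> real \<Rightarrow> real \<Rightarrow> complex" where
 "gauss A B p a = exp (A * of_real a - of_real (B * (p\<^sup>2 - a)))"

lemma cmod_gauss: "Re A = 0 \<Longrightarrow> cmod (gauss A B p a) = exp (- (B * (p\<^sup>2 - a)))"
 by (simp add: gauss_def norm_exp_eq_Re)

lemma gauss_derivative:
 "((\<lambda>p. gauss A B p a) has_vector_derivative (- of_real (2 * B * p) * gauss A B p a)) (at p)"
proof -
 have "((\<lambda>p. A * of_real a - of_real (B * (p\<^sup>2 - a))) has_vector_derivative - of_real (2 * B * p)) (at p)"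
 proof -
  have "((\<lambda>p. - (B * (p\<^sup>2 - a))) has_real_derivative - (2 * B * p)) (at p)"
   by (auto intro!: derivative_eq_intros)
  from has_vector_derivative_add[OF has_vector_derivative_const[of "A * of_real a"] has_vector_derivative_of_real[OF this]]
  show ?thesis by simp
 qed
 from field_vector_diff_chain_at[OF this DERIV_exp] show ?thesis
  unfolding gauss_def by (simp add: o_def)
qed

text \<open>The constant of \<open>one_plus_power_le_exp\<close> for the exponent r + 1 and the rate
  B / 4. The additional power and the factor 1 + 2 B account for the derivative, which brings down -
  2 B p from the exponent.\<close>

definition gauss_const :: "real \<Rightarrow> nat \<Rightarrow> real" where
 "gauss_const B r = (1 + 2 * B) * (((real (Suc r) + 1) / (B / 4)) ^ Suc r * exp (B / 4))"

text \<open>Of the decay exp (- B m), where m = p^2 - a, one half is kept; one quarter pays for the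
  permitted exponential growth of P and one quarter for the polynomial factors.\<close>

lemma admissible_gauss:
 assumes B: "B > 0" and A: "Re A = 0" and K: "K \<ge> 0" and D: "\<And>p a. ((\<lambda>p. P p a) has_vector_derivative P' p a) (at p)"
   and P: "\<And>p a. 2 * a \<le> p\<^sup>2 \<Longrightarrow> cmod (P p a) \<le> K * (1 + (p\<^sup>2 - a)) ^ r * exp (B / 4 * (p\<^sup>2 - a))"
   and P': "\<And>p a. 2 * a \<le> p\<^sup>2 \<Longrightarrow> cmod (P' p a) \<le> K * (1 + (p\<^sup>2 - a)) ^ r * exp (B / 4 * (p\<^sup>2 - a))"
 shows "admissible (B / 2) (gauss_const B r * K) (\<lambda>p a. P p a * gauss A B p a)"
proof -
 define k where "k = ((real (Suc r) + 1) / (B / 4)) ^ Suc r * exp (B / 4)"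
 have k0: "k > 0" using B by (simp add: k_def)
 define K0 where "K0 = gauss_const B r"
 have K0k: "K0 = (1 + 2 * B) * k" by (simp add: K0_def gauss_const_def k_def)
 have "1 * k \<le> (1 + 2 * B) * k" using B k0 by (intro mult_right_mono) auto
 then have K0: "k \<le> K0" by (simp add: K0k)
 have bd: "K * (1 + m) ^ r * exp (B / 4 * m) * exp (- (B * m)) * (1 + m) \<le> k * K * exp (- (B / 2) * m)"
  if m: "m \<ge> 0" and K: "K \<ge> 0" for m K :: real
 proof -
  have "(1 + m) ^ Suc r \<le> k * exp (B / 4 * m)"
   unfolding k_def using one_plus_power_le_exp[of "B / 4" m "Suc r"] B m by simp
  then have "K * exp (B / 4 * m) * exp (- (B * m)) * (1 + m) ^ Suc r \<le> K * exp (B / 4 * m) * exp (- (B * m)) * (k * exp (B / 4 * m))"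
   using K by (intro mult_left_mono) auto
  also have "\<dots> = k * K * (exp (B / 4 * m) * exp (- (B * m)) * exp (B / 4 * m))" by (simp add: mult_ac)
  also have "exp (B / 4 * m) * exp (- (B * m)) * exp (B / 4 * m) = exp (- (B / 2) * m)"
   unfolding exp_add[symmetric] by (rule arg_cong[of _ _ exp]) (simp add: field_simps)
  finally show ?thesis by (simp add: mult_ac)
 qed
  define g' where "g' = (\<lambda>p a. P p a * (- of_real (2 * B * p) * gauss A B p a) + P' p a * gauss A B p a)"
  have d: "((\<lambda>p. P p a * gauss A B p a) has_vector_derivative g' p a) (at p)" for p a
   unfolding g'_def by (rule has_vector_derivative_mult[OF D gauss_derivative])
  have b: "cmod (P p a * gauss A B p a) \<le> K0 * K * exp (- (B / 2) * (p\<^sup>2 - a))"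
   "cmod (g' p a) \<le> K0 * K * exp (- (B / 2) * (p\<^sup>2 - a))" if a: "2 * a \<le> p\<^sup>2" for p a
  proof -
   define m where "m = p\<^sup>2 - a"
   have m: "m \<ge> 0" "\<bar>p\<bar> \<le> 1 + m" using coord_le_majorant[OF a] by (auto simp: m_def)
   define Z where "Z = K * (1 + m) ^ r * exp (B / 4 * m) * exp (- (B * m))"
   have Z: "Z \<ge> 0" using K m by (simp add: Z_def)
   have g: "cmod (gauss A B p a) = exp (- (B * m))" by (simp add: cmod_gauss[OF A] m_def)
   have 1: "cmod (P p a) * cmod (gauss A B p a) \<le> Z" "cmod (P' p a) * cmod (gauss A B p a) \<le> Z"
    unfolding g Z_def using P[OF a] P'[OF a] by (auto simp: m_def)
   have ZK: "Z * (1 + m) \<le> k * K * exp (- (B / 2) * m)" using bd[OF m(1) K] by (simp add: Z_def)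
   have le: "k * K * exp (- (B / 2) * m) \<le> K0 * K * exp (- (B / 2) * m)"
    using K0 K by (intro mult_right_mono) auto
   have Z1: "Z \<le> Z * (1 + m)" using Z m by (simp add: mult_le_cancel_left1)
   show "cmod (P p a * gauss A B p a) \<le> K0 * K * exp (- (B / 2) * (p\<^sup>2 - a))"
    using 1(1) Z1 ZK le by (simp add: norm_mult m_def)
   have "cmod (g' p a) \<le> cmod (P p a * (- of_real (2 * B * p) * gauss A B p a)) + cmod (P' p a * gauss A B p a)"
    unfolding g'_def by (rule norm_triangle_ineq)
   also have "\<dots> = (2 * B) * \<bar>p\<bar> * (cmod (P p a) * cmod (gauss A B p a)) + cmod (P' p a) * cmod (gauss A B p a)"
    using B by (simp add: norm_mult mult_ac)
   also have "\<dots> \<le> (2 * B) * (1 + m) * Z + Z * (1 + m)"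
   proof (rule add_mono)
    show "(2 * B) * \<bar>p\<bar> * (cmod (P p a) * cmod (gauss A B p a)) \<le> (2 * B) * (1 + m) * Z"
     using 1(1) m B Z by (intro mult_mono) auto
    show "cmod (P' p a) * cmod (gauss A B p a) \<le> Z * (1 + m)" using 1(2) Z1 by linarith
   qed
   also have "\<dots> = (1 + 2 * B) * (Z * (1 + m))" by (simp add: algebra_simps)
   also have "\<dots> \<le> (1 + 2 * B) * (k * K * exp (- (B / 2) * m))" using ZK B by (intro mult_left_mono) auto
   finally show "cmod (g' p a) \<le> K0 * K * exp (- (B / 2) * (p\<^sup>2 - a))" by (simp add: K0_def gauss_const_def k_def m_def mult_ac)
  qed
  show "admissible (B / 2) (gauss_const B r * K) (\<lambda>p a. P p a * gauss A B p a)"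
   unfolding admissible_def K0_def[symmetric] using d b by blast
qed

lemma admissible_linear:
 assumes g1: "admissible c K1 g1" and g2: "admissible c K2 g2"
 shows "admissible c (cmod \<alpha> * K1 + cmod \<beta> * K2) (\<lambda>p a. \<alpha> * g1 p a + \<beta> * g2 p a)"
proof -
 obtain g1' where 1: "\<And>p a. ((\<lambda>p. g1 p a) has_vector_derivative g1' p a) (at p)"
   "\<And>p a. 2 * a \<le> p\<^sup>2 \<Longrightarrow> cmod (g1 p a) \<le> K1 * exp (- c * (p\<^sup>2 - a))" "\<And>p a. 2 * a \<le> p\<^sup>2 \<Longrightarrow> cmod (g1' p a) \<le> K1 * exp (- c * (p\<^sup>2 - a))"
  using g1 unfolding admissible_def by blast
 obtain g2' where 2: "\<And>p a. ((\<lambda>p. g2 p a) has_vector_derivative g2' p a) (at p)"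
   "\<And>p a. 2 * a \<le> p\<^sup>2 \<Longrightarrow> cmod (g2 p a) \<le> K2 * exp (- c * (p\<^sup>2 - a))" "\<And>p a. 2 * a \<le> p\<^sup>2 \<Longrightarrow> cmod (g2' p a) \<le> K2 * exp (- c * (p\<^sup>2 - a))"
  using g2 unfolding admissible_def by blast
 have tri: "cmod (\<alpha> * x + \<beta> * y) \<le> (cmod \<alpha> * K1 + cmod \<beta> * K2) * E"
  if "cmod x \<le> K1 * E" "cmod y \<le> K2 * E" for x y E
 proof -
  have "cmod (\<alpha> * x + \<beta> * y) \<le> cmod \<alpha> * cmod x + cmod \<beta> * cmod y"
   by (rule order_trans[OF norm_triangle_ineq]) (simp add: norm_mult)
  also have "\<dots> \<le> cmod \<alpha> * (K1 * E) + cmod \<beta> * (K2 * E)"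
   using that by (intro add_mono mult_left_mono) auto
  finally show ?thesis by (simp add: algebra_simps)
 qed
 have "((\<lambda>p. \<alpha> * g1 p a + \<beta> * g2 p a) has_vector_derivative (\<alpha> * g1' p a + \<beta> * g2' p a)) (at p)" for p a
  by (intro has_vector_derivative_add has_vector_derivative_mult_right 1 2)
 then show ?thesis
  unfolding admissible_def using tri 1 2 by (intro exI[of _ "\<lambda>p a. \<alpha> * g1' p a + \<beta> * g2' p a"]) blast
qed

lemma has_vector_derivative_quadratic:
 fixes f :: "real \<Rightarrow> 'a :: real_normed_vector"
 assumes "\<delta> > 0" and le: "\<And>s. \<bar>s\<bar> \<le> \<delta> \<Longrightarrow> norm (f s - f 0 - s *\<^sub>R l) \<le> K * s\<^sup>2"
 shows "(f has_vector_derivative l) (at 0)"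
 unfolding has_vector_derivative_def has_derivative_at
proof
 show "bounded_linear (\<lambda>h. h *\<^sub>R l)" by (rule bounded_linear_scaleR_left)
 show "(\<lambda>h. norm (f (0 + h) - f 0 - h *\<^sub>R l) / norm h) \<midarrow>0\<rightarrow> 0"
 proof (rule tendsto_sandwich[of "\<lambda>_. 0" _ _ "\<lambda>h. \<bar>K\<bar> * \<bar>h\<bar>"])
  have "\<forall>\<^sub>F h in at 0. \<bar>h\<bar> \<le> \<delta>"
   unfolding eventually_at by (rule exI[of _ \<delta>]) (use assms(1) in \<open>auto simp: dist_real_def\<close>)
  then show "\<forall>\<^sub>F h in at 0. norm (f (0 + h) - f 0 - h *\<^sub>R l) / norm h \<le> \<bar>K\<bar> * \<bar>h\<bar>"
  proof eventually_elim
   case (elim h)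
   have "norm (f h - f 0 - h *\<^sub>R l) \<le> \<bar>K\<bar> * h\<^sup>2"
    using le[OF elim] by (rule order_trans) (intro mult_right_mono; simp)
   then show ?case by (cases "h = 0") (simp_all add: divide_le_eq power2_eq_square abs_mult_self mult.assoc)
  qed
  show "((\<lambda>h. \<bar>K\<bar> * \<bar>h\<bar>) \<longlongrightarrow> 0) (at 0)" by (auto intro!: tendsto_eq_intros)
 qed auto
qed

text \<open>Powers of p come from the polynomial in \<open>\<phi>_KM\<close> and from derivatives in
  B, powers of a from derivatives in A and in B.\<close>

definition kern :: "nat \<Rightarrow> nat \<Rightarrow> complex \<Rightarrow> real \<Rightarrow> real \<Rightarrow> real \<Rightarrow> complex" where
 "kern n l A B p a = (of_real p ^ n * of_real a ^ l) * gauss A B p a"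

lemma power_derivative:
 "((\<lambda>p. of_real p ^ n * z) has_vector_derivative (of_nat n * of_real p ^ (n - 1) * z :: complex)) (at p)"
proof -
 have "((\<lambda>p::real. p ^ n) has_real_derivative (real n * p ^ (n - 1))) (at p)"
  by (auto intro!: derivative_eq_intros)
 then have "((\<lambda>p::real. of_real (p ^ n) :: complex) has_vector_derivative of_real (real n * p ^ (n - 1))) (at p)"
  by (rule has_vector_derivative_of_real)
 from has_vector_derivative_mult_left[OF this, of z] show ?thesis by simp
qed

lemma power_abs_le:
 assumes "2 * a \<le> (p::real)\<^sup>2"
 shows "cmod (of_real p ^ n) \<le> (1 + (p\<^sup>2 - a)) ^ n" "cmod (of_nat n * of_real p ^ (n - 1)) \<le> real n * (1 + (p\<^sup>2 - a)) ^ n"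
proof -
 note c = coord_le_majorant[OF assms]
 show "cmod (of_real p ^ n) \<le> (1 + (p\<^sup>2 - a)) ^ n" using c by (simp add: norm_power power_mono)
 have "\<bar>p\<bar> ^ (n - 1) \<le> (1 + (p\<^sup>2 - a)) ^ (n - 1)" using c by (intro power_mono) auto
 also have "\<dots> \<le> (1 + (p\<^sup>2 - a)) ^ n" using c by (intro power_increasing) auto
 finally show "cmod (of_nat n * of_real p ^ (n - 1)) \<le> real n * (1 + (p\<^sup>2 - a)) ^ n"
  by (simp add: norm_mult norm_power mult_left_mono)
qed

lemma admissible_kern:
 assumes B: "B > 0" and A: "Re A = 0"
 obtains K where "admissible (B / 2) K (kern n l A B)"
proof -
 have "admissible (B / 2) (gauss_const B (n + l) * (1 + real n)) (\<lambda>p a. (of_real p ^ n * of_real a ^ l) * gauss A B p a)"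
 proof (rule admissible_gauss[OF B A _ power_derivative])
  fix p a :: real assume a: "2 * a \<le> p\<^sup>2"
  define m where "m = p\<^sup>2 - a"
  have m: "m \<ge> 0" "\<bar>a\<bar> \<le> 1 + m" using coord_le_majorant[OF a] by (auto simp: m_def)
  have E: "1 \<le> exp (B / 4 * m)" using B m by simp
  have al: "cmod (of_real a ^ l) \<le> (1 + m) ^ l" using m by (simp add: norm_power power_mono)
  have "cmod (of_real p ^ n) * cmod (of_real a ^ l) \<le> (1 + m) ^ n * (1 + m) ^ l"
   using power_abs_le(1)[OF a, of n] al m by (intro mult_mono) (auto simp: m_def)
  also have "\<dots> \<le> ((1 + real n) * ((1 + m) ^ n * (1 + m) ^ l)) * exp (B / 4 * m)"
   using m E by (smt (verit, ccfv_SIG) mult_le_cancel_left1 mult_nonneg_nonneg of_nat_0_le_iff zero_le_power mult_le_cancel_right1)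
  finally show "cmod (of_real p ^ n * of_real a ^ l) \<le> (1 + real n) * (1 + (p\<^sup>2 - a)) ^ (n + l) * exp (B / 4 * (p\<^sup>2 - a))"
   by (simp add: norm_mult m_def power_add mult.assoc)
  have "cmod (of_nat n * of_real p ^ (n - 1)) * cmod (of_real a ^ l) \<le> (real n * (1 + m) ^ n) * (1 + m) ^ l"
   using power_abs_le(2)[OF a, of n] al m by (intro mult_mono) (auto simp: m_def)
  also have "\<dots> \<le> ((1 + real n) * (1 + m) ^ n) * (1 + m) ^ l"
   using m by (intro mult_right_mono) auto
  also have "\<dots> \<le> ((1 + real n) * ((1 + m) ^ n * (1 + m) ^ l)) * exp (B / 4 * m)"
   using m E by (simp add: mult.assoc mult_le_cancel_left1)
  finally show "cmod (of_nat n * of_real p ^ (n - 1) * of_real a ^ l) \<le> (1 + real n) * (1 + (p\<^sup>2 - a)) ^ (n + l) * exp (B / 4 * (p\<^sup>2 - a))"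
   by (simp add: norm_mult m_def power_add mult.assoc)
 qed simp
 then show ?thesis using that unfolding kern_def by blast
qed

text \<open>Moving (A, B) by s (A', B') multiplies the Gaussian by exp (s eta) with eta = A' a - B'
  (p^2 - a). The error of the linear approximation is exp z - 1 - z at z = s eta, of size |z|^2 exp
  |z|, and for small s the exponential costs no more than a quarter of the Gaussian decay. The point
  is that the admissibility constant itself is O(s^2).\<close>

lemma admissible_remainder:
 assumes B: "B > 0" and A: "Re A = 0"
 obtains K \<delta> where "\<delta> > 0" "\<And>s. \<bar>s\<bar> \<le> \<delta> \<Longrightarrow> admissible (B / 2) (K * s\<^sup>2)
   (\<lambda>p a. kern n 0 (A + of_real s * A') (B + s * B') p a - kern n 0 A B p a -
     of_real s * ((A' * of_real a - of_real (B' * (p\<^sup>2 - a))) * kern n 0 A B p a))"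
proof -
 \<comment> \<open>|eta| <= M m with m = p^2 - a, since |a| <= m; the summand 1 makes M positive.
   Then |s| <= \<delta> gives |s eta| <= (B / 4) m.\<close>
 define M where "M = cmod A' + \<bar>B'\<bar> + 1"
 have M: "M > 0" by (simp add: M_def add_nonneg_pos)
 define \<delta> where "\<delta> = B / (4 * M)"
 have \<delta>: "\<delta> > 0" "\<delta> * M = B / 4" using B M by (auto simp: \<delta>_def)
 \<comment> \<open>Contributions to the bounds for p^n R and its derivative: n M^2 from
   differentiating p^n, M^2 from the function itself and 2 M^2 from differentiating R.\<close>
 define K1 where "K1 = real n * M\<^sup>2 + M\<^sup>2 + 2 * M\<^sup>2"
 have K1: "K1 \<ge> 0" by (simp add: K1_def)
 define \<eta> where "\<eta> = (\<lambda>p a. A' * of_real a - of_real (B' * (p\<^sup>2 - a)))"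
 have "admissible (B / 2) (gauss_const B (n + 2) * (K1 * s\<^sup>2))
   (\<lambda>p a. kern n 0 (A + of_real s * A') (B + s * B') p a - kern n 0 A B p a - of_real s * (\<eta> p a * kern n 0 A B p a))"
  if s: "\<bar>s\<bar> \<le> \<delta>" for s
 proof -
  define R where "R = (\<lambda>p a. exp (of_real s * \<eta> p a) - 1 - of_real s * \<eta> p a)"
  have eq: "kern n 0 (A + of_real s * A') (B + s * B') p a - kern n 0 A B p a - of_real s * (\<eta> p a * kern n 0 A B p a) =
    (of_real p ^ n * R p a) * gauss A B p a" for p a
  proof -
   have "gauss (A + of_real s * A') (B + s * B') p a = exp (of_real s * \<eta> p a) * gauss A B p a"
    unfolding gauss_def exp_add[symmetric] by (rule arg_cong[of _ _ exp]) (simp add: \<eta>_def algebra_simps)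
   then show ?thesis by (simp add: kern_def R_def algebra_simps)
  qed
  have d\<eta>: "((\<lambda>p. of_real s * \<eta> p a) has_vector_derivative - of_real (s * (2 * B' * p))) (at p)" for p a
  proof -
   have d: "((\<lambda>p. - (s * (B' * (p\<^sup>2 - a)))) has_real_derivative - (s * (2 * B' * p))) (at p)"
    by (auto intro!: derivative_eq_intros)
   have e: "(\<lambda>p. of_real s * \<eta> p a) = (\<lambda>p. of_real s * (A' * of_real a) + of_real (- (s * (B' * (p\<^sup>2 - a)))))"
    by (rule ext) (simp add: \<eta>_def algebra_simps)
   from has_vector_derivative_add[OF has_vector_derivative_const[of "of_real s * (A' * of_real a)"] has_vector_derivative_of_real[OF d]]
   show ?thesis unfolding e by simp
  qed
  have dR: "((\<lambda>p. R p a) has_vector_derivative - of_real (s * (2 * B' * p)) * (exp (of_real s * \<eta> p a) - 1)) (at p)" for p a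
  proof -
   have "((\<lambda>p. exp (of_real s * \<eta> p a)) has_vector_derivative - of_real (s * (2 * B' * p)) * exp (of_real s * \<eta> p a)) (at p)"
    using field_vector_diff_chain_at[OF d\<eta> DERIV_exp] by (simp add: o_def)
   from has_vector_derivative_diff[OF has_vector_derivative_diff[OF this has_vector_derivative_const[of 1]] d\<eta>]
   show ?thesis unfolding R_def by (simp add: right_diff_distrib)
  qed
  define P' where "P' = (\<lambda>p a. of_real p ^ n * (- of_real (s * (2 * B' * p)) * (exp (of_real s * \<eta> p a) - 1)) + (of_nat n * of_real p ^ (n - 1) * 1) * R p a)"
  have dP: "((\<lambda>p. of_real p ^ n * R p a) has_vector_derivative P' p a) (at p)" for p a
   unfolding P'_def using has_vector_derivative_mult[OF power_derivative[of n 1] dR] by simp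
  have "admissible (B / 2) (gauss_const B (n + 2) * (K1 * s\<^sup>2)) (\<lambda>p a. (of_real p ^ n * R p a) * gauss A B p a)"
  proof (rule admissible_gauss[OF B A _ dP])
   show "0 \<le> K1 * s\<^sup>2" using K1 by simp
   fix p a :: real assume a: "2 * a \<le> p\<^sup>2"
   define m where "m = p\<^sup>2 - a"
   have m: "m \<ge> 0" "\<bar>a\<bar> \<le> m" "\<bar>p\<bar> \<le> 1 + m" using coord_le_majorant[OF a] by (auto simp: m_def)
   define E where "E = exp (B / 4 * m)"
   have \<eta>b: "cmod (\<eta> p a) \<le> M * m"
   proof -
    have "cmod (\<eta> p a) \<le> cmod A' * \<bar>a\<bar> + \<bar>B'\<bar> * \<bar>m\<bar>"
     unfolding \<eta>_def m_def[symmetric] by (rule order_trans[OF norm_triangle_ineq4]) (simp add: norm_mult abs_mult)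
    also have "\<dots> \<le> cmod A' * m + \<bar>B'\<bar> * m" using m by (intro add_mono mult_left_mono) auto
    also have "\<dots> \<le> M * m" using m by (simp add: M_def distrib_right)
    finally show ?thesis .
   qed
   define z where "z = of_real s * \<eta> p a"
   have zb: "cmod z \<le> \<bar>s\<bar> * (M * m)" unfolding z_def norm_mult using \<eta>b by (simp add: mult_left_mono)
   have zE: "exp (cmod z) \<le> E"
   proof -
    have "\<bar>s\<bar> * (M * m) \<le> \<delta> * (M * m)" using s M m by (intro mult_right_mono) auto
    also have "\<dots> = B / 4 * m" using \<delta>(2) by (simp add: mult.assoc[symmetric])
    finally show ?thesis using zb by (simp add: E_def)
   qed
   have E: "E \<ge> 0" by (simp add: E_def)
   have R: "cmod (R p a) \<le> s\<^sup>2 * M\<^sup>2 * (1 + m)\<^sup>2 * E"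
   proof -
    have "cmod (R p a) \<le> exp (cmod z) * cmod z ^ 2"
     using Taylor_exp_field[of z 1] by (simp add: R_def z_def[symmetric] algebra_simps power2_eq_square)
    also have "\<dots> \<le> E * (\<bar>s\<bar> * (M * (1 + m))) ^ 2"
    proof (intro mult_mono power_mono zE)
     have "\<bar>s\<bar> * (M * m) \<le> \<bar>s\<bar> * (M * (1 + m))" using M by (intro mult_left_mono) auto
     then show "cmod z \<le> \<bar>s\<bar> * (M * (1 + m))" using zb by linarith
    qed (use E in auto)
    finally show ?thesis by (simp add: power_mult_distrib mult_ac)
   qed
   have e1: "cmod (exp z - 1) \<le> \<bar>s\<bar> * M * (1 + m) * E"
   proof -
    have "cmod (exp z - 1) \<le> exp (cmod z) * cmod z" using Taylor_exp_field[of z 0] by simp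
    also have "\<dots> \<le> E * (\<bar>s\<bar> * (M * (1 + m)))"
    proof (intro mult_mono zE)
     have "\<bar>s\<bar> * (M * m) \<le> \<bar>s\<bar> * (M * (1 + m))" using M by (intro mult_left_mono) auto
     then show "cmod z \<le> \<bar>s\<bar> * (M * (1 + m))" using zb by linarith
    qed (use E in auto)
    finally show ?thesis by (simp add: mult_ac)
   qed
   have pn: "cmod (of_real p ^ n) \<le> (1 + m) ^ n" "cmod (of_nat n * of_real p ^ (n - 1)) \<le> real n * (1 + m) ^ n"
    using power_abs_le[OF a] by (auto simp: m_def)
   define Z where "Z = s\<^sup>2 * M\<^sup>2 * ((1 + m) ^ (n + 2)) * E"
   have Z: "Z \<ge> 0" using E m by (simp add: Z_def)
   have 1: "cmod (of_real p ^ n) * cmod (R p a) \<le> Z"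
   proof -
    have "cmod (of_real p ^ n) * cmod (R p a) \<le> (1 + m) ^ n * (s\<^sup>2 * M\<^sup>2 * (1 + m)\<^sup>2 * E)"
     using pn R m by (intro mult_mono) auto
    also have "\<dots> = Z" by (simp add: Z_def power_add power2_eq_square)
    finally show ?thesis .
   qed
   have KZ: "K1 * s\<^sup>2 * (1 + (p\<^sup>2 - a)) ^ (n + 2) * exp (B / 4 * (p\<^sup>2 - a)) = (real n + 1 + 2) * Z"
   proof -
    have "(real n * M\<^sup>2 + M\<^sup>2 + 2 * M\<^sup>2) * s\<^sup>2 * X * E = (real n + 1 + 2) * (s\<^sup>2 * M\<^sup>2 * X * E)" for X
     by (simp add: algebra_simps)
    then show ?thesis by (simp only: K1_def Z_def E_def m_def)
   qed
   show "cmod (of_real p ^ n * R p a) \<le> K1 * s\<^sup>2 * (1 + (p\<^sup>2 - a)) ^ (n + 2) * exp (B / 4 * (p\<^sup>2 - a))"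
    unfolding KZ norm_mult distrib_right using 1 Z mult_nonneg_nonneg[OF of_nat_0_le_iff[of n] Z] by linarith
   have "cmod (of_nat n * of_real p ^ (n - 1)) * cmod (R p a) \<le> (real n * (1 + m) ^ n) * (s\<^sup>2 * M\<^sup>2 * (1 + m)\<^sup>2 * E)"
    using pn R m by (intro mult_mono) auto
   also have "\<dots> = real n * Z" by (simp add: Z_def power_add power2_eq_square)
   finally have 2: "cmod (of_nat n * of_real p ^ (n - 1)) * cmod (R p a) \<le> real n * Z" .
   have "\<bar>s * (2 * B' * p)\<bar> \<le> 2 * M * \<bar>s\<bar> * (1 + m)"
   proof -
    have "\<bar>B'\<bar> \<le> M" by (simp add: M_def)
    then have "\<bar>s\<bar> * (2 * \<bar>B'\<bar> * \<bar>p\<bar>) \<le> \<bar>s\<bar> * (2 * M * (1 + m))" using m M by (intro mult_left_mono mult_mono) auto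
    then show ?thesis by (simp add: abs_mult mult_ac)
   qed
   then have "cmod (of_real p ^ n) * (\<bar>s * (2 * B' * p)\<bar> * cmod (exp z - 1)) \<le> (1 + m) ^ n * ((2 * M * \<bar>s\<bar> * (1 + m)) * (\<bar>s\<bar> * M * (1 + m) * E))"
    using pn e1 m M by (intro mult_mono) auto
   also have "\<dots> = 2 * Z" by (simp add: Z_def power_add power2_eq_square mult_ac)
   finally have 3: "cmod (of_real p ^ n) * (\<bar>s * (2 * B' * p)\<bar> * cmod (exp z - 1)) \<le> 2 * Z" .
   have "cmod (P' p a) \<le> cmod (of_real p ^ n) * (\<bar>s * (2 * B' * p)\<bar> * cmod (exp z - 1)) + cmod (of_nat n * of_real p ^ (n - 1)) * cmod (R p a)"
    unfolding P'_def z_def[symmetric]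
    by (rule order_trans[OF norm_triangle_ineq]) (simp only: norm_mult norm_minus_cancel norm_of_real norm_one mult_1_right order_refl)
   also have "\<dots> \<le> (real n + 1 + 2) * Z" using 2 3 Z by (simp add: distrib_right)
   finally show "cmod (P' p a) \<le> K1 * s\<^sup>2 * (1 + (p\<^sup>2 - a)) ^ (n + 2) * exp (B / 4 * (p\<^sup>2 - a))" unfolding KZ .
  qed
  then show ?thesis unfolding eq .
 qed
 then show ?thesis using that[of \<delta> "gauss_const B (n + 2) * K1"] \<delta>(1) by (simp add: \<eta>_def mult.assoc)
qed

context theta_setting
begin

lemma pairing_combination:
 assumes B: "B > 0" and A: "Re A = 0" and h: "test_function Y h" and Y: "Y \<ge> 2"
 shows "pairing h (\<lambda>p a. \<alpha> * kern n1 l1 A B p a + \<beta> * kern n2 l2 A B p a) =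
  \<alpha> * pairing h (kern n1 l1 A B) + \<beta> * pairing h (kern n2 l2 A B)"
proof -
 obtain K1 where "admissible (B / 2) K1 (kern n1 l1 A B)" by (rule admissible_kern[OF B A])
 moreover obtain K2 where "admissible (B / 2) K2 (kern n2 l2 A B)" by (rule admissible_kern[OF B A])
 ultimately show ?thesis using B by (intro pairing_linear[OF _ Y h, of "B / 2"]) auto
qed

text \<open>The pairing is linear in the kernel and bounded by its admissibility constant, so a
  remainder with constant K s^2 becomes a quadratic remainder of the pairings. In this way the
  conditionally convergent integral is differentiated with no dominating function.\<close>

lemma pairing_kern_derivative:
 assumes B: "B > 0" and A: "Re A = 0" and h: "test_function Y h" and Y: "Y \<ge> 2"
 shows "((\<lambda>s. pairing h (kern n 0 (A + of_real s * A') (B + s * B'))) has_vector_derivative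
   ((A' + of_real B') * pairing h (kern n 1 A B) - of_real B' * pairing h (kern (n + 2) 0 A B))) (at 0)"
proof -
 have c: "B / 2 > 0" using B by simp
 obtain C1 where C1: "C1 > 0"
  "\<And>h g K. test_function Y h \<Longrightarrow> admissible (B / 2) K g \<Longrightarrow>
   ((\<lambda>T. hyp_int (F \<inter> trunc T) (\<lambda>z. h z * Theta g z)) \<longlongrightarrow> pairing h g) at_top \<and>
   cmod (pairing h g) \<le> C1 * K * L1 h"
  by (rule pairing_bound[OF c Y]) (rule that, assumption+)
 let ?R = "(\<lambda>s p a. kern n 0 (A + of_real s * A') (B + s * B') p a - kern n 0 A B p a -
     of_real s * ((A' * of_real a - of_real (B' * (p\<^sup>2 - a))) * kern n 0 A B p a))"
 obtain K \<delta> where K: "\<delta> > 0" "\<And>s. \<bar>s\<bar> \<le> \<delta> \<Longrightarrow> admissible (B / 2) (K * s\<^sup>2) (?R s)"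
  by (rule admissible_remainder[OF B A, of n A' B']) (rule that, assumption+)
 \<comment> \<open>The derivative of the exponent, A' a - B' (p^2 - a), regrouped by powers of a and
   p so that it is again a combination of functions \<open>kern\<close>.\<close>
 define G where "G = (\<lambda>p a. (A' + of_real B') * kern n 1 A B p a + (- of_real B') * kern (n + 2) 0 A B p a)"
 have G: "(A' * of_real a - of_real (B' * (p\<^sup>2 - a))) * kern n 0 A B p a = G p a" for p a
  by (simp add: G_def kern_def algebra_simps power2_eq_square)
 obtain K1 where k1: "admissible (B / 2) K1 (kern n 1 A B)" by (rule admissible_kern[OF B A])
 obtain K2 where k2: "admissible (B / 2) K2 (kern (n + 2) 0 A B)" by (rule admissible_kern[OF B A])
 obtain K3 where k3: "admissible (B / 2) K3 (kern n 0 A B)" by (rule admissible_kern[OF B A])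
 have Ga: "admissible (B / 2) (cmod (A' + of_real B') * K1 + cmod (- of_real B') * K2) G"
  unfolding G_def by (rule admissible_linear[OF k1 k2])
 have pG: "pairing h G = (A' + of_real B') * pairing h (kern n 1 A B) - of_real B' * pairing h (kern (n + 2) 0 A B)"
  unfolding G_def by (subst pairing_combination[OF B A h Y]) simp
 have "norm (pairing h (kern n 0 (A + of_real s * A') (B + s * B')) -
   pairing h (kern n 0 (A + of_real 0 * A') (B + 0 * B')) - s *\<^sub>R pairing h G)
   \<le> (C1 * K * L1 h) * s\<^sup>2" if s: "\<bar>s\<bar> \<le> \<delta>" for s
 proof -
  note a1 = admissible_linear[OF k3 Ga, of 1 "of_real s"]
  have e: "kern n 0 (A + of_real s * A') (B + s * B') = (\<lambda>p a. 1 * (1 * kern n 0 A B p a + of_real s * G p a) + 1 * ?R s p a)"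
   by (intro ext, unfold G) simp
  have "pairing h (kern n 0 (A + of_real s * A') (B + s * B')) =
    pairing h (\<lambda>p a. 1 * (1 * kern n 0 A B p a + of_real s * G p a) + 1 * ?R s p a)"
   by (rule arg_cong[OF e])
  also have "\<dots> = 1 * pairing h (\<lambda>p a. 1 * kern n 0 A B p a + of_real s * G p a) + 1 * pairing h (?R s)"
   by (rule pairing_linear[OF c Y h a1 K(2)[OF s]])
  also have "pairing h (\<lambda>p a. 1 * kern n 0 A B p a + of_real s * G p a) = 1 * pairing h (kern n 0 A B) + of_real s * pairing h G"
   by (rule pairing_linear[OF c Y h k3 Ga])
  finally have "pairing h (kern n 0 (A + of_real s * A') (B + s * B')) -
   pairing h (kern n 0 (A + of_real 0 * A') (B + 0 * B')) - s *\<^sub>R pairing h G = pairing h (?R s)"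
   by (simp add: scaleR_conv_of_real)
  then show ?thesis using C1(2)[OF h K(2)[OF s]] by (simp add: mult_ac)
 qed
 from has_vector_derivative_quadratic[OF K(1) this] show ?thesis unfolding pG .
qed

end

section \<open>Square integrable cusp forms\<close>

lemma hyp_siegel_finite: "emeasure \<mu> (siegel_set N) < top"
proof -
 have "emeasure \<mu> (siegel_set N) = (\<integral>\<^sup>+z. indicator (siegel_set N) z \<partial>\<mu>)" by simp
 also have "\<dots> = (\<integral>\<^sup>+y. ennreal (indicator {0<..} y / y\<^sup>2) * (\<integral>\<^sup>+x. indicator (siegel_set N) (Complex x y) \<partial>lborel) \<partial>lborel)"
  by (rule nn_integral_hyp) measurable
 also have "\<dots> \<le> (\<integral>\<^sup>+y. ennreal (real N) * (ennreal (1 / y\<^sup>2) * indicator {1/2..} y) \<partial>lborel)"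
 proof (rule nn_integral_mono)
  fix y :: real
  have "(\<integral>\<^sup>+x. indicator (siegel_set N) (Complex x y) \<partial>lborel) \<le> (\<integral>\<^sup>+x. indicator {1/2..} y * indicator {0..real N} x \<partial>lborel)"
   by (intro nn_integral_mono) (auto simp: siegel_set_def indicator_def)
  also have "\<dots> = indicator {1/2..} y * ennreal (real N)" by (simp add: nn_integral_cmult)
  finally have "ennreal (indicator {0<..} y / y\<^sup>2) * (\<integral>\<^sup>+x. indicator (siegel_set N) (Complex x y) \<partial>lborel) \<le>
    ennreal (indicator {0<..} y / y\<^sup>2) * (indicator {1/2..} y * ennreal (real N))"
   by (rule mult_left_mono) simp
  also have "\<dots> = ennreal (real N) * (ennreal (1 / y\<^sup>2) * indicator {1/2..} y)"
   by (auto simp: indicator_def mult.commute)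
  finally show "ennreal (indicator {0<..} y / y\<^sup>2) * (\<integral>\<^sup>+x. indicator (siegel_set N) (Complex x y) \<partial>lborel) \<le>
    ennreal (real N) * (ennreal (1 / y\<^sup>2) * indicator {1/2..} y)" .
 qed
 also have "\<dots> = ennreal (real N) * (\<integral>\<^sup>+y. ennreal (1 / y\<^sup>2) * indicator {1/2..} y \<partial>lborel)"
  by (rule nn_integral_cmult) measurable
 also have "(\<integral>\<^sup>+y. ennreal (1 / y\<^sup>2) * indicator {1/2..} y \<partial>lborel) = ennreal (0 - (- 1 / (1/2)))"
 proof (rule nn_integral_FTC_atLeast)
  show "((\<lambda>y::real. - 1 / y) \<longlongrightarrow> 0) at_top"
   by (intro tendsto_divide_0[OF tendsto_const] filterlim_at_top_imp_at_infinity filterlim_ident)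
  show "DERIV (\<lambda>y. - 1 / y) x :> 1 / x\<^sup>2" if "1/2 \<le> x" for x :: real
   using that by (auto intro!: derivative_eq_intros simp: power2_eq_square)
 qed auto
 also have "ennreal (real N) * ennreal (0 - (- 1 / (1/2))) < top"
  by (simp add: ennreal_mult_less_top)
 finally show ?thesis .
qed

context modular_domain
begin

lemma F_finite_measure: "set_integrable \<mu> F (\<lambda>_. 1 :: real)"
proof -
 have "integrable \<mu> (\<lambda>w. dens w *\<^sub>R (1 :: real))"
 proof (rule bochner_bound)
  show "integrable \<mu> (\<lambda>w. folding * indicator (siegel_set N) w)"
   using hyp_siegel_finite by (intro integrable_mult_right integrable_real_indicator) auto
  show "AE w in \<mu>. norm (dens w *\<^sub>R (1 :: real)) \<le> norm (folding * indicator (siegel_set N) w)"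
   using dens_bounds dens_outside folding_pos by (intro AE_I2) (auto simp: indicator_def)
 qed auto
 then show ?thesis
  by (subst unfold_integral(1)) (auto simp: set_borel_measurable_def invariant_def)
qed

text \<open>Integrability follows from |f| <= 1 + |f|^2 and the finite volume of \<open>F\<close>.
  Cuspidality is used for the period N, which is available at every cusp.\<close>

lemma L2_cusp_test_function:
 assumes f: "f \<in> L2_cusp \<Gamma> F"
 shows "test_function 2 f"
proof -
 have m: "uhp_measurable f" and i: "invariant f"
  and l2: "set_integrable \<mu> F (\<lambda>z. (cmod (f z))\<^sup>2)"
  and cusp: "\<And>s a. s \<in> SL2Z \<Longrightarrow> cusp_period \<Gamma> s a \<Longrightarrow> AE y in lborel. y > 0 \<longrightarrow>
      set_lebesgue_integral lborel {0..a} (\<lambda>x. f (moebius s (Complex x y))) = 0"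
  using f by (auto simp: L2_cusp_def invariant_def)
 have "set_integrable \<mu> F f"
  unfolding set_integrable_def
 proof (rule bochner_bound)
  show "integrable \<mu> (\<lambda>z. indicator F z *\<^sub>R (1 :: real) + indicator F z *\<^sub>R (cmod (f z))\<^sup>2)"
   using F_finite_measure l2 by (intro Bochner_Integration.integrable_add) (auto simp: set_integrable_def)
  have "(\<lambda>z. indicator F z *\<^sub>R (indicator uhp z *\<^sub>R f z)) \<in> borel_measurable borel"
   using m by (intro borel_measurable_scaleR[OF borel_measurable_indicator[OF F_borel]]) (simp add: set_borel_measurable_def)
  moreover have "(\<lambda>z. indicator F z *\<^sub>R (indicator uhp z *\<^sub>R f z)) = (\<lambda>z. indicator F z *\<^sub>R f z)"
   using F_uhp by (auto simp: fun_eq_iff indicator_def)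
  ultimately show "(\<lambda>z. indicator F z *\<^sub>R f z) \<in> borel_measurable \<mu>"
   by (simp only: measurable_cong_sets[OF sets_hyp refl])
  have "x \<le> 1 + x\<^sup>2" for x :: real
   using zero_le_power2[of "x - 1"] by (simp add: power2_diff) (smt (verit) zero_le_power2)
  then show "AE z in \<mu>. norm (indicator F z *\<^sub>R f z) \<le> norm (indicator F z *\<^sub>R (1 :: real) + indicator F z *\<^sub>R (cmod (f z))\<^sup>2)"
   by (intro AE_I2) (auto simp: indicator_def)
 qed
 moreover have "AE y in lborel. y > 2 \<longrightarrow> set_lebesgue_integral lborel {0..real N} (\<lambda>x. f (moebius s (Complex x y))) = 0"
  if "s \<in> SL2Z" for s
  using cusp[OF that cusp_period_N[OF that]] by eventually_elim auto
 ultimately show ?thesis using m i by (simp add: test_function_def)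
qed

end

section \<open>The lifts as pairings\<close>

lemma conj_act_linear:
 "conj_act g (X + Y) = conj_act g X + conj_act g Y" "conj_act g (- X) = - conj_act g X"
 by (simp_all add: conj_act_def mat2_eq_iff algebra_simps)

lemma clear_denominators_finite:
 assumes "finite S" "\<And>X i j. X \<in> S \<Longrightarrow> (X :: mat2) $ i $ j \<in> \<rat>"
 shows "\<exists>D::nat. D \<ge> 1 \<and> (\<forall>X\<in>S. int_mat (real D *\<^sub>R X))"
 using assms
proof (induction S rule: finite_induct)
 case (insert X S)
 then obtain D :: nat where D: "D \<ge> 1" "\<forall>Y\<in>S. int_mat (real D *\<^sub>R Y)" by auto
 obtain D' :: nat where D': "D' \<ge> 1" "int_mat (real D' *\<^sub>R X)"
  using clear_denominators[of X] insert.prems by auto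
 have "int_mat (real (D * D') *\<^sub>R X)" using int_mat_intros(4)[OF D'(2), of D] by simp
 moreover have "int_mat (real (D * D') *\<^sub>R Y)" if "Y \<in> S" for Y
  using int_mat_intros(4)[OF D(2)[rule_format, OF that], of D'] by (simp add: mult.commute)
 ultimately show ?case using D D' by (intro exI[of _ "D * D'"]) auto
qed auto

lemma int_mat_sum:
 assumes "\<And>b. b \<in> B \<Longrightarrow> int_mat (f b)"
 shows "int_mat (\<Sum>b\<in>B. f b)"
 using assms by (auto simp: int_mat_def)

text \<open>Invariance of the coset: g (X + h) = g X + (g h - h) + h, where g h - h lies in L
  because \<Gamma> acts trivially on the discriminant group. A denominator for h and a basis of L
  serves for the whole coset.\<close>

lemma theta_setting_exists:
 assumes d: "d > 0" and L: "even_lattice d L" and cong: "congruence_subgroup \<Gamma>"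
  and inv: "\<forall>g\<in>\<Gamma>. conj_act g ` L = L" "\<forall>g\<in>\<Gamma>. \<forall>X\<in>dual_lattice d L. conj_act g X - X \<in> L"
  and F: "fundamental_domain \<Gamma> F" and C: "C \<in> discriminant_group d L"
 obtains N D where "theta_setting \<Gamma> F N d C D"
proof -
 obtain N where N: "N \<ge> 1" "principal_subgroup N \<subseteq> \<Gamma>"
  "\<exists>R. finite R \<and> R \<subseteq> \<Gamma> \<and> \<Gamma> = {r ** g | r g. r \<in> R \<and> g \<in> principal_subgroup N}"
  using cong unfolding congruence_subgroup_def by blast
 interpret modular_domain \<Gamma> F N using cong F N by unfold_locales
 obtain h where h: "h \<in> dual_lattice d L" "C = (\<lambda>X. X + h) ` L" using C by (auto simp: discriminant_group_def)
 obtain B where B: "B \<subseteq> VQ" "finite B" "L = {(\<Sum>b\<in>B. of_int (c b) *\<^sub>R b) | c :: mat2 \<Rightarrow> int. True}"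
  using L by (auto simp: even_lattice_def lattice_in_V_def)
 have hV: "h \<in> VQ" using h by (simp add: dual_lattice_def)
 obtain D :: nat where D: "D \<ge> 1" "\<forall>X\<in>insert h B. int_mat (real D *\<^sub>R X)"
  using clear_denominators_finite[of "insert h B"] B hV by (auto simp: VQ_def)
 have tr: "trace X = 0" if XL: "X \<in> L" for X
 proof -
  obtain c where "X = (\<Sum>b\<in>B. of_int (c b) *\<^sub>R b)" using XL B by auto
  moreover have "(\<Sum>b\<in>B. c b * b $ 1 $ 1) + (\<Sum>b\<in>B. c b * b $ 2 $ 2) = 0"
  proof -
   have "(\<Sum>b\<in>B. c b * b $ 1 $ 1) + (\<Sum>b\<in>B. c b * b $ 2 $ 2) = (\<Sum>b\<in>B. c b * (b $ 1 $ 1 + b $ 2 $ 2))"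
    by (simp add: sum.distrib distrib_left)
   also have "\<dots> = 0" using B(1) by (intro sum.neutral) (auto simp: VQ_def trace_def sum_2)
   finally show ?thesis .
  qed
  ultimately show ?thesis by (simp add: trace_def sum_2)
 qed
 have int: "int_mat (real D *\<^sub>R X)" if XL: "X \<in> L" for X
 proof -
  obtain c where c: "X = (\<Sum>b\<in>B. of_int (c b) *\<^sub>R b)" using XL B by auto
  have "int_mat (\<Sum>b\<in>B. of_int (c b) *\<^sub>R (real D *\<^sub>R b))"
   using D(2) by (intro int_mat_sum) (simp add: int_mat_def mult.assoc)
  then show ?thesis by (simp add: c scaleR_sum_right mult.commute)
 qed
 have add: "X + Y \<in> L" if XY: "X \<in> L" "Y \<in> L" for X Y
 proof -
  obtain c c' where "X = (\<Sum>b\<in>B. of_int (c b) *\<^sub>R b)" "Y = (\<Sum>b\<in>B. of_int (c' b) *\<^sub>R b)" using XY B by auto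
  then have "X + Y = (\<Sum>b\<in>B. of_int (c b + c' b) *\<^sub>R b)" by (simp add: sum.distrib scaleR_left_distrib)
  then show ?thesis unfolding B(3) by (auto intro!: exI[of _ "\<lambda>b. c b + c' b"])
 qed
 have sub: "conj_act g ` C \<subseteq> C" if g: "g \<in> \<Gamma>" for g
 proof
  fix Y assume "Y \<in> conj_act g ` C"
  then obtain X where X: "X \<in> L" "Y = conj_act g (X + h)" using h by auto
  have "Y = (conj_act g X + (conj_act g h - h)) + h" by (simp add: X conj_act_linear)
  moreover have "conj_act g X + (conj_act g h - h) \<in> L"
   using inv g X h by (intro add) blast+
  ultimately show "Y \<in> C" unfolding h(2) by blast
 qed
 have CC: "conj_act g ` C = C" if g: "g \<in> \<Gamma>" for g
 proof
  show "C \<subseteq> conj_act g ` C"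
  proof
   fix X assume X: "X \<in> C"
   have gR: "g \<in> SL2R" using \<Gamma>_SL2R[OF g] .
   have "X = conj_act g (conj_act (matrix_inv g) X)"
    using SL2R_inv[OF gR] by (simp add: conj_act_def matrix_mul_assoc) (simp add: matrix_mul_assoc[symmetric])
   moreover have "conj_act (matrix_inv g) X \<in> C"
    using sub[OF mat_subgroupD(4)[OF \<Gamma>_group g]] X by auto
   ultimately show "X \<in> conj_act g ` C" by blast
  qed
 qed (rule sub[OF g])
 have "trace X = 0 \<and> int_mat (real D *\<^sub>R X)" if X: "X \<in> C" for X
 proof -
  obtain Y where Y: "Y \<in> L" "X = Y + h" using X h by auto
  have "trace h = 0" using hV by (simp add: VQ_def)
  moreover have "int_mat (real D *\<^sub>R Y + real D *\<^sub>R h)"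
   using int[OF Y(1)] D(2) by (intro int_mat_intros(2)) auto
  ultimately show ?thesis using tr[OF Y(1)] by (simp add: Y(2) trace_add scaleR_right_distrib)
 qed
 then have "theta_setting \<Gamma> F N d C D"
  using d D(1) CC by unfold_locales auto
 then show ?thesis using that by blast
qed

lemma cnj_gauss: "cnj (gauss A B p a) = gauss (cnj A) B p a"
 by (simp add: gauss_def exp_cnj)

lemma cnj_kern: "cnj (kern n l A B p a) = kern n l (cnj A) B p a"
 by (simp add: kern_def cnj_gauss)

text \<open>The sign of u is opposite to the one in \<open>\<phi>_KM\<close>, so the two kernels
  have conjugate parameters A. The conjugation contained in xi carries the one into the
  other.\<close>

lemma phi_21_kern:
 "\<phi>_21 d X t z = of_real (sqrt (Im t)) * kern 0 0 (- \<i> * of_real (pi * Re t)) (pi * Im t) (coord d X z) (bil d X X)"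
proof -
 have "of_real pi * \<i> * (- of_real (Re t * bil d X X) + \<i> * of_real (Im t * majorant d X z)) =
   - \<i> * of_real (pi * Re t) * of_real (bil d X X) - of_real (pi * Im t * ((coord d X z)\<^sup>2 - bil d X X))"
  by (simp add: majorant_def algebra_simps)
 then show ?thesis by (simp only: \<phi>_21_def kern_def gauss_def power_0 mult_1)
qed

lemma phi_KM_kern:
 "\<phi>_KM d X t z = of_real (Im t) * kern 2 0 (\<i> * of_real (pi * Re t)) (pi * Im t) (coord d X z) (bil d X X) +
   of_real (- 1 / (2 * pi)) * kern 0 0 (\<i> * of_real (pi * Re t)) (pi * Im t) (coord d X z) (bil d X X)"
proof -
 have e: "of_real pi * \<i> * (of_real (Re t * bil d X X) + \<i> * of_real (Im t * majorant d X z)) =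
   \<i> * of_real (pi * Re t) * of_real (bil d X X) - of_real (pi * Im t * ((coord d X z)\<^sup>2 - bil d X X))"
  by (simp add: majorant_def algebra_simps)
 show ?thesis unfolding \<phi>_KM_def e kern_def gauss_def
  by (simp add: algebra_simps)
qed

context theta_setting
begin

text \<open>The zero summand puts the kernel into the two-term form shared with
  \<open>lift_KM_pairing\<close>, so that \<open>pairing_combination\<close> and its conjugate
  version apply to both lifts.\<close>

lemma lift_Maass_pairing:
 "lift_Maass d \<Gamma> F t h C = pairing h (\<lambda>p a. of_real (sqrt (Im t)) * kern 0 0 (- \<i> * of_real (pi * Re t)) (pi * Im t) p a +
   0 * kern 0 0 (- \<i> * of_real (pi * Re t)) (pi * Im t) p a)"
 unfolding lift_Maass_def pairing_def Theta_def phi_21_kern by simp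

lemma lift_KM_pairing:
 "lift_KM d \<Gamma> F t h C = pairing h (\<lambda>p a. of_real (Im t) * kern 2 0 (\<i> * of_real (pi * Re t)) (pi * Im t) p a +
   of_real (- 1 / (2 * pi)) * kern 0 0 (\<i> * of_real (pi * Re t)) (pi * Im t) p a)"
 unfolding lift_KM_def pairing_def Theta_def phi_KM_kern ..

lemma lift_Maass_eq:
 assumes f: "test_function 2 f" and t: "Im t > 0"
 shows "lift_Maass d \<Gamma> F t f C = of_real (sqrt (Im t)) * pairing f (kern 0 0 (- \<i> * of_real (pi * Re t)) (pi * Im t))"
 unfolding lift_Maass_pairing by (subst pairing_combination[OF _ _ f]) (use t in auto)

lemma lift_KM_eq:
 assumes f: "test_function 2 f" and t: "Im t > 0"
 shows "lift_KM d \<Gamma> F t f C = of_real (Im t) * pairing f (kern 2 0 (\<i> * of_real (pi * Re t)) (pi * Im t)) -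
   of_real (1 / (2 * pi)) * pairing f (kern 0 0 (\<i> * of_real (pi * Re t)) (pi * Im t))"
 unfolding lift_KM_pairing by (subst pairing_combination[OF _ _ f]) (use t in auto)

lemma pairing_cnj_combination:
 assumes f: "test_function 2 f" and B: "B > 0" and A: "Re A = 0"
 shows "pairing (\<lambda>z. cnj (f z)) (\<lambda>p a. of_real x * kern n1 l1 A B p a + of_real y * kern n2 l2 A B p a) =
   cnj (of_real x * pairing f (kern n1 l1 (cnj A) B) + of_real y * pairing f (kern n2 l2 (cnj A) B))"
proof -
 have A': "Re (cnj A) = 0" using A by simp
 obtain K1 where 1: "admissible (B / 2) K1 (kern n1 l1 (cnj A) B)" by (rule admissible_kern[OF B A'])
 obtain K2 where 2: "admissible (B / 2) K2 (kern n2 l2 (cnj A) B)" by (rule admissible_kern[OF B A'])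
 have c: "B / 2 > 0" using B by simp
 note ad = admissible_linear[OF 1 2, of "of_real x" "of_real y"]
 have "pairing (\<lambda>z. cnj (f z)) (\<lambda>p a. cnj (of_real x * kern n1 l1 (cnj A) B p a + of_real y * kern n2 l2 (cnj A) B p a)) =
   cnj (pairing f (\<lambda>p a. of_real x * kern n1 l1 (cnj A) B p a + of_real y * kern n2 l2 (cnj A) B p a))"
  by (rule pairing_cnj[OF c _ f ad]) simp
 also have "pairing f (\<lambda>p a. of_real x * kern n1 l1 (cnj A) B p a + of_real y * kern n2 l2 (cnj A) B p a) =
   of_real x * pairing f (kern n1 l1 (cnj A) B) + of_real y * pairing f (kern n2 l2 (cnj A) B)"
  by (rule pairing_combination[OF B A' f]) simp
 finally show ?thesis by (simp add: cnj_kern)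
qed

lemma lift_KM_cnj_eq:
 assumes f: "test_function 2 f" and t: "Im t > 0"
 shows "lift_KM d \<Gamma> F t (\<lambda>z. cnj (f z)) C =
  cnj (of_real (Im t) * pairing f (kern 2 0 (- \<i> * of_real (pi * Re t)) (pi * Im t)) -
   of_real (1 / (2 * pi)) * pairing f (kern 0 0 (- \<i> * of_real (pi * Re t)) (pi * Im t)))"
 unfolding lift_KM_pairing by (subst pairing_cnj_combination[OF f]) (use t in auto)

lemma lift_Maass_cnj_eq:
 assumes f: "test_function 2 f" and t: "Im t > 0"
 shows "lift_Maass d \<Gamma> F t (\<lambda>z. cnj (f z)) C =
  cnj (of_real (sqrt (Im t)) * pairing f (kern 0 0 (\<i> * of_real (pi * Re t)) (pi * Im t)))"
 unfolding lift_Maass_pairing using pairing_cnj_combination[OF f, of "pi * Im t" "- \<i> * of_real (pi * Re t)" "sqrt (Im t)" 0 0 0 0 0] t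
 by simp

text \<open>Let J0, Ja, J2 be the pairings with 1, a, p^2 times the Gaussian. In a + i b the terms
  in Ja cancel, and what remains is proportional to v J2 - J0 / (2 pi), the polynomial of the
  Kudla-Millson kernel. Its term 1 / (2 pi) comes from differentiating sqrt v.\<close>

theorem xi_lift_Maass:
 assumes f: "test_function 2 f" and t: "\<tau> \<in> uhp"
 shows "has_xi (1/2) (\<lambda>t. lift_Maass d \<Gamma> F t f C) \<tau> (- of_real pi * lift_KM d \<Gamma> F \<tau> (\<lambda>z. cnj (f z)) C)"
proof -
 define u v where "u = Re \<tau>" and "v = Im \<tau>"
 have v: "v > 0" using t by (simp add: uhp_iff v_def)
 define A where "A = - \<i> * of_real (pi * u)"
 define B where "B = pi * v"
 have AB: "B > 0" "Re A = 0" using v by (auto simp: A_def B_def)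
 define J0 where "J0 = pairing f (kern 0 0 A B)"
 define Ja where "Ja = pairing f (kern 0 (Suc 0) A B)"
 define J2 where "J2 = pairing f (kern 2 0 A B)"
 note D = pairing_kern_derivative[OF AB f, of 0, simplified, folded numeral_2_eq_2, folded J0_def Ja_def J2_def]
 define a where "a = of_real (sqrt v) * ((- \<i> * of_real pi) * Ja)"
 define b where "b = of_real (sqrt v) * (of_real pi * Ja - of_real pi * J2) + of_real (1 / (2 * sqrt v)) * J0"
 have da: "((\<lambda>s. lift_Maass d \<Gamma> F (\<tau> + of_real s) f C) has_vector_derivative a) (at 0)"
 proof -
  have "((\<lambda>s. of_real (sqrt v) * pairing f (kern 0 0 (A + of_real s * (- \<i> * of_real pi)) (B + s * 0))) has_vector_derivative a) (at 0)"
   unfolding a_def using has_vector_derivative_mult_right[OF D[of "- \<i> * of_real pi" 0], of "of_real (sqrt v)"] by simp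
  moreover have "lift_Maass d \<Gamma> F (\<tau> + of_real s) f C = of_real (sqrt v) * pairing f (kern 0 0 (A + of_real s * (- \<i> * of_real pi)) (B + s * 0))" for s
   using v by (subst lift_Maass_eq[OF f]) (simp_all add: v_def[symmetric] u_def[symmetric] A_def B_def algebra_simps)
  ultimately show ?thesis by simp
 qed
 have db: "((\<lambda>s. lift_Maass d \<Gamma> F (\<tau> + \<i> * of_real s) f C) has_vector_derivative b) (at 0)"
 proof (rule has_vector_derivative_transform_within_open)
  show "open {-v<..<v}" "(0::real) \<in> {-v<..<v}" using v by auto
  have sq: "((\<lambda>s. sqrt (v + s)) has_field_derivative 1 / (2 * sqrt v)) (at 0)"
   using v by (auto intro!: derivative_eq_intros simp: field_simps)
  have "((\<lambda>s. sqrt (v + s) *\<^sub>R pairing f (kern 0 0 (A + of_real s * 0) (B + s * pi))) has_vector_derivative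
    (sqrt (v + 0) *\<^sub>R (of_real pi * Ja - of_real pi * J2) + (1 / (2 * sqrt v)) *\<^sub>R pairing f (kern 0 0 (A + of_real 0 * 0) (B + 0 * pi)))) (at 0)"
   using has_vector_derivative_scaleR[OF sq D[of 0 pi]] by simp
  then show "((\<lambda>s. sqrt (v + s) *\<^sub>R pairing f (kern 0 0 (A + of_real s * 0) (B + s * pi))) has_vector_derivative b) (at 0)"
   by (simp add: b_def J0_def scaleR_conv_of_real)
  show "sqrt (v + s) *\<^sub>R pairing f (kern 0 0 (A + of_real s * 0) (B + s * pi)) = lift_Maass d \<Gamma> F (\<tau> + \<i> * of_real s) f C" if "s \<in> {-v<..<v}" for s
   using that by (subst lift_Maass_eq[OF f]) (simp_all add: v_def[symmetric] u_def[symmetric] A_def B_def algebra_simps scaleR_conv_of_real)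
 qed
 have "a + \<i> * b = \<i> * of_real (sqrt v) * (of_real (1 / (2 * v)) * J0 - of_real pi * J2)"
 proof -
  have "1 / (2 * sqrt v) = sqrt v * (1 / (2 * v))" using v by (simp add: field_simps real_sqrt_mult_self)
  then show ?thesis by (simp only: a_def b_def of_real_mult) (simp add: algebra_simps)
 qed
 moreover have "-2 * \<i> * V * ((\<i> * S * W) / 2) = V * S * W" for V S W
  by (simp add: complex_eq_iff algebra_simps)
 ultimately have "-2 * \<i> * of_real (v\<^sup>2) * ((a + \<i> * b) / 2) = of_real (v\<^sup>2) * of_real (sqrt v) * (of_real (1 / (2 * v)) * J0 - of_real pi * J2)"
  by (simp only:)
 also have "\<dots> = - of_real (pi * (v * sqrt v)) * (of_real v * J2 - of_real (1 / (2 * pi)) * J0)"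
 proof -
  have "v\<^sup>2 * (1 / (2 * v)) = pi * v * (1 / (2 * pi))" using v by (simp add: power2_eq_square)
  from arg_cong[OF this, of complex_of_real] show ?thesis
   by (simp add: algebra_simps power2_eq_square)
 qed
 finally have L: "-2 * \<i> * of_real (v\<^sup>2) * ((a + \<i> * b) / 2) = - of_real (pi * (v * sqrt v)) * (of_real v * J2 - of_real (1 / (2 * pi)) * J0)" .
 have pw: "v powr (1/2 - 2) * (v * sqrt v) = 1"
 proof -
  have "v * sqrt v = v powr 1 * v powr (1/2)" using v by (simp add: powr_half_sqrt)
  also have "\<dots> = v powr (1 + 1/2)" by (rule powr_add[symmetric])
  finally show ?thesis using v by (simp add: powr_add[symmetric])
 qed
 have "- of_real pi * lift_KM d \<Gamma> F \<tau> (\<lambda>z. cnj (f z)) C = - of_real pi * cnj (of_real v * J2 - of_real (1 / (2 * pi)) * J0)"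
  using v by (subst lift_KM_cnj_eq[OF f]) (simp_all add: v_def[symmetric] u_def[symmetric] A_def[symmetric] B_def[symmetric] J0_def J2_def A_def)
 also have "\<dots> = of_real (v powr (1/2 - 2)) * cnj (-2 * \<i> * of_real (v\<^sup>2) * ((a + \<i> * b) / 2))"
  unfolding L complex_cnj_mult complex_cnj_minus complex_cnj_complex_of_real
 proof -
  have "of_real (v powr (1/2 - 2)) * (- of_real (pi * (v * sqrt v)) * z) = - of_real pi * (of_real (v powr (1/2 - 2) * (v * sqrt v)) * z)" for z :: complex
   by (simp add: mult_ac)
  then show "- of_real pi * cnj (of_real v * J2 - of_real (1 / (2 * pi)) * J0) = of_real (v powr (1/2 - 2)) * (- of_real (pi * (v * sqrt v)) * cnj (of_real v * J2 - of_real (1 / (2 * pi)) * J0))"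
   by (simp only: pw) simp
 qed
 finally show ?thesis
  unfolding has_xi_def v_def[symmetric] using da db by blast
qed

text \<open>Here a + i b is i times the left-hand side of the hypothesis \<open>ev\<close>, and the
  hypothesis replaces it by a multiple of the pairing with the pure Gaussian, the kernel of the
  Maass lift. The left-hand side is the Laplacian of that Gaussian divided by 4 pi v; the sign of
  the eigenvalue is the one for \<open>hyp_laplacian\<close>, which contains the minus sign.\<close>

theorem xi_lift_KM:
 assumes f: "test_function 2 f" and t: "\<tau> \<in> uhp"
  and ev: "of_real (2 * pi * Im \<tau>) * pairing f (kern 2 1 (\<i> * of_real (pi * Re \<tau>)) (pi * Im \<tau>)) -
    pairing f (kern 0 1 (\<i> * of_real (pi * Re \<tau>)) (pi * Im \<tau>)) +
    of_real (3 / 2) * pairing f (kern 2 0 (\<i> * of_real (pi * Re \<tau>)) (pi * Im \<tau>)) -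
    of_real (pi * Im \<tau>) * pairing f (kern 4 0 (\<i> * of_real (pi * Re \<tau>)) (pi * Im \<tau>)) =
    of_real (ev / (4 * pi * Im \<tau>)) * pairing f (kern 0 0 (\<i> * of_real (pi * Re \<tau>)) (pi * Im \<tau>))"
 shows "has_xi (3/2) (\<lambda>t. lift_KM d \<Gamma> F t f C) \<tau> (of_real (ev / (4 * pi)) * lift_Maass d \<Gamma> F \<tau> (\<lambda>z. cnj (f z)) C)"
proof -
 define u v where "u = Re \<tau>" and "v = Im \<tau>"
 have v: "v > 0" using t by (simp add: uhp_iff v_def)
 define A where "A = \<i> * of_real (pi * u)"
 define B where "B = pi * v"
 have AB: "B > 0" "Re A = 0" using v by (auto simp: A_def B_def)
 define J0 where "J0 = pairing f (kern 0 0 A B)"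
 define Ja where "Ja = pairing f (kern 0 (Suc 0) A B)"
 define J2 where "J2 = pairing f (kern 2 0 A B)"
 define Ja2 where "Ja2 = pairing f (kern 2 (Suc 0) A B)"
 define J4 where "J4 = pairing f (kern 4 0 A B)"
 have key: "of_real (2 * pi * v) * Ja2 - Ja + of_real (3 / 2) * J2 - of_real (pi * v) * J4 = of_real (ev / (4 * pi * v)) * J0"
  using ev unfolding u_def[symmetric] v_def[symmetric] A_def[symmetric] B_def[symmetric] J0_def Ja_def J2_def Ja2_def J4_def One_nat_def .
 note D0 = pairing_kern_derivative[OF AB f, of 0, simplified, folded numeral_2_eq_2, folded J0_def Ja_def J2_def]
 note D2 = pairing_kern_derivative[OF AB f, of 2, simplified, folded J4_def Ja2_def]
 define a where "a = of_real v * ((\<i> * of_real pi) * Ja2) - of_real (1 / (2 * pi)) * ((\<i> * of_real pi) * Ja)"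
 define b where "b = of_real v * (of_real pi * Ja2 - of_real pi * J4) + J2 - of_real (1 / (2 * pi)) * (of_real pi * Ja - of_real pi * J2)"
 have da: "((\<lambda>s. lift_KM d \<Gamma> F (\<tau> + of_real s) f C) has_vector_derivative a) (at 0)"
 proof -
  have "((\<lambda>s. of_real v * pairing f (kern 2 0 (A + of_real s * (\<i> * of_real pi)) (B + s * 0)) -
    of_real (1 / (2 * pi)) * pairing f (kern 0 0 (A + of_real s * (\<i> * of_real pi)) (B + s * 0))) has_vector_derivative a) (at 0)"
   unfolding a_def
   using has_vector_derivative_diff[OF has_vector_derivative_mult_right[OF D2[of "\<i> * of_real pi" 0], of "of_real v"]
     has_vector_derivative_mult_right[OF D0[of "\<i> * of_real pi" 0], of "of_real (1 / (2 * pi))"]] by simp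
  moreover have "lift_KM d \<Gamma> F (\<tau> + of_real s) f C = of_real v * pairing f (kern 2 0 (A + of_real s * (\<i> * of_real pi)) (B + s * 0)) -
    of_real (1 / (2 * pi)) * pairing f (kern 0 0 (A + of_real s * (\<i> * of_real pi)) (B + s * 0))" for s
   using v by (subst lift_KM_eq[OF f]) (simp_all add: v_def[symmetric] u_def[symmetric] A_def B_def algebra_simps)
  ultimately show ?thesis by simp
 qed
 have db: "((\<lambda>s. lift_KM d \<Gamma> F (\<tau> + \<i> * of_real s) f C) has_vector_derivative b) (at 0)"
 proof (rule has_vector_derivative_transform_within_open)
  show "open {-v<..<v}" "(0::real) \<in> {-v<..<v}" using v by auto
  have sq: "((\<lambda>s. v + s) has_field_derivative 1) (at 0)"
   by (auto intro!: derivative_eq_intros)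
  show "((\<lambda>s. (v + s) *\<^sub>R pairing f (kern 2 0 (A + of_real s * 0) (B + s * pi)) -
    of_real (1 / (2 * pi)) * pairing f (kern 0 0 (A + of_real s * 0) (B + s * pi))) has_vector_derivative b) (at 0)"
   using has_vector_derivative_diff[OF has_vector_derivative_scaleR[OF sq D2[of 0 pi]]
     has_vector_derivative_mult_right[OF D0[of 0 pi], of "of_real (1 / (2 * pi))"]]
   by (simp add: b_def J2_def scaleR_conv_of_real)
  show "(v + s) *\<^sub>R pairing f (kern 2 0 (A + of_real s * 0) (B + s * pi)) -
    of_real (1 / (2 * pi)) * pairing f (kern 0 0 (A + of_real s * 0) (B + s * pi)) = lift_KM d \<Gamma> F (\<tau> + \<i> * of_real s) f C" if "s \<in> {-v<..<v}" for s
   using that by (subst lift_KM_eq[OF f]) (simp_all add: v_def[symmetric] u_def[symmetric] A_def B_def algebra_simps scaleR_conv_of_real)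
 qed
 have "a + \<i> * b = \<i> * (of_real (2 * pi * v) * Ja2 - Ja + of_real (3 / 2) * J2 - of_real (pi * v) * J4)"
  by (simp add: a_def b_def field_simps)
 then have ab: "a + \<i> * b = \<i> * (of_real (ev / (4 * pi * v)) * J0)" unfolding key .
 have "-2 * \<i> * V * ((\<i> * (S * W)) / 2) = V * S * W" for V S W
  by (simp add: complex_eq_iff algebra_simps)
 then have "-2 * \<i> * of_real (v\<^sup>2) * ((a + \<i> * b) / 2) = of_real (v\<^sup>2 * (ev / (4 * pi * v))) * J0"
  unfolding ab by (simp only: of_real_mult)
 also have "v\<^sup>2 * (ev / (4 * pi * v)) = v * (ev / (4 * pi))" using v by (simp add: power2_eq_square)
 finally have L: "-2 * \<i> * of_real (v\<^sup>2) * ((a + \<i> * b) / 2) = of_real (v * (ev / (4 * pi))) * J0" .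
 have pw: "v powr (3/2 - 2) * v = sqrt v"
 proof -
  have "v powr (3/2 - 2) * v powr 1 = v powr (1/2)" by (simp only: powr_add[symmetric]) simp
  then show ?thesis using v by (simp add: powr_half_sqrt)
 qed
 have "of_real (ev / (4 * pi)) * lift_Maass d \<Gamma> F \<tau> (\<lambda>z. cnj (f z)) C = of_real (ev / (4 * pi)) * (of_real (sqrt v) * cnj J0)"
  using v by (subst lift_Maass_cnj_eq[OF f]) (simp_all add: v_def[symmetric] u_def[symmetric] A_def[symmetric] B_def[symmetric] J0_def A_def)
 also have "\<dots> = of_real (v powr (3/2 - 2)) * cnj (-2 * \<i> * of_real (v\<^sup>2) * ((a + \<i> * b) / 2))"
  unfolding L complex_cnj_mult complex_cnj_complex_of_real pw[symmetric] by (simp add: mult_ac)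
 finally show ?thesis
  unfolding has_xi_def v_def[symmetric] using da db by blast
qed

end

section \<open>Point-pair kernels\<close>

text \<open>Not a metric: for points at hyperbolic distance r it is 2 cosh r - 2. It is preferred
  because it is rational in the coordinates and in the squares of their differences.\<close>

definition hyp_dist :: "complex \<Rightarrow> complex \<Rightarrow> real" where
 "hyp_dist z w = (cmod (z - w))\<^sup>2 / (Im z * Im w)"

lemma hyp_dist_sym: "hyp_dist z w = hyp_dist w z"
 by (simp add: hyp_dist_def norm_minus_commute mult.commute)

lemma hyp_dist_moebius:
 assumes g: "g \<in> SL2R" and z: "z \<in> uhp" and w: "w \<in> uhp"
 shows "hyp_dist (moebius g z) (moebius g w) = hyp_dist z w"
proof -
 have nz: "den g z \<noteq> 0" "den g w \<noteq> 0" using den_nz g z w by auto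
 have "complex_of_real (g$1$1 * g$2$2 - g$1$2 * g$2$1) = 1" using SL2R_det[OF g] by simp
 then have det: "of_real (g$1$1) * of_real (g$2$2) - of_real (g$1$2) * of_real (g$2$1) = (1 :: complex)" by simp
 have "moebius g z - moebius g w = ((of_real (g$1$1) * z + of_real (g$1$2)) * den g w -
   (of_real (g$1$1) * w + of_real (g$1$2)) * den g z) / (den g z * den g w)"
  using nz by (simp add: moebius_def den_def[symmetric] diff_frac_eq)
 also have "(of_real (g$1$1) * z + of_real (g$1$2)) * den g w - (of_real (g$1$1) * w + of_real (g$1$2)) * den g z
   = (of_real (g$1$1) * of_real (g$2$2) - of_real (g$1$2) * of_real (g$2$1)) * (z - w)"
  by (simp add: den_def algebra_simps)
 also have "\<dots> = z - w" by (simp add: det)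
 finally have "cmod (moebius g z - moebius g w) = cmod (z - w) / (cmod (den g z) * cmod (den g w))"
  by (simp add: norm_divide norm_mult)
 then show ?thesis
  using nz z w by (simp add: hyp_dist_def Im_moebius[OF g] uhp_iff power_divide power_mult_distrib)
qed

text \<open>The inequality (y - y')^2 < y y' bounds the ratio of the heights by (3 + sqrt 5) / 2,
  rounded up to 3; then (x - x')^2 < y y' <= 3 y^2, rounded up to (2 y)^2.\<close>

lemma hyp_dist_less_1:
 assumes z: "z \<in> uhp" and w: "w \<in> uhp" and l: "hyp_dist z w < 1"
 shows "Im w \<le> 3 * Im z" "Im z \<le> 3 * Im w" "\<bar>Re w - Re z\<bar> \<le> 2 * Im z"
proof -
 have y: "Im z > 0" "Im w > 0" using z w by (auto simp: uhp_iff)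
 have *: "(Re z - Re w)\<^sup>2 + (Im z - Im w)\<^sup>2 < Im z * Im w"
  using l y by (simp add: hyp_dist_def cmod_power2 divide_less_eq)
 have a: "(Im z - Im w)\<^sup>2 < Im z * Im w" using * zero_le_power2[of "Re z - Re w"] by linarith
 show 1: "Im w \<le> 3 * Im z"
 proof (rule ccontr)
  assume "\<not> Im w \<le> 3 * Im z"
  then have "0 < Im w * (Im w - 3 * Im z)" using y by (intro mult_pos_pos) auto
  moreover have "Im w * (Im w - 3 * Im z) = Im w * Im w - 3 * (Im z * Im w)"
   "(Im z - Im w)\<^sup>2 = Im z * Im z - 2 * (Im z * Im w) + Im w * Im w"
   by (simp_all add: power2_eq_square algebra_simps)
  ultimately show False using a zero_le_square[of "Im z"] by linarith
 qed
 show "Im z \<le> 3 * Im w"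
 proof (rule ccontr)
  assume "\<not> Im z \<le> 3 * Im w"
  then have "0 < Im z * (Im z - 3 * Im w)" using y by (intro mult_pos_pos) auto
  moreover have "Im z * (Im z - 3 * Im w) = Im z * Im z - 3 * (Im z * Im w)"
   "(Im z - Im w)\<^sup>2 = Im z * Im z - 2 * (Im z * Im w) + Im w * Im w"
   by (simp_all add: power2_eq_square algebra_simps)
  ultimately show False using a zero_le_square[of "Im w"] by linarith
 qed
 have "(Re w - Re z)\<^sup>2 < Im z * Im w"
  using * zero_le_power2[of "Im z - Im w"] power2_commute[of "Re w" "Re z"] by linarith
 also have "\<dots> \<le> Im z * (3 * Im z)" using 1 y by (intro mult_left_mono) auto
 also have "\<dots> \<le> (2 * Im z)\<^sup>2" using y by (simp add: power2_eq_square)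
 finally have "(Re w - Re z)\<^sup>2 \<le> (2 * Im z)\<^sup>2" by simp
 then show "\<bar>Re w - Re z\<bar> \<le> 2 * Im z" using y by (simp only: power2_le_iff_abs_le)
qed

definition hyp_box :: "complex \<Rightarrow> complex set" where
 "hyp_box z = cbox (Complex (Re z - 2 * Im z) (Im z / 3)) (Complex (Re z + 2 * Im z) (3 * Im z))"

lemma hyp_box_iff: "w \<in> hyp_box z \<longleftrightarrow> \<bar>Re w - Re z\<bar> \<le> 2 * Im z \<and> Im z / 3 \<le> Im w \<and> Im w \<le> 3 * Im z"
 by (auto simp: hyp_box_def cbox_def Basis_complex_def inner_complex_def)

lemma hyp_dist_box: "z \<in> uhp \<Longrightarrow> w \<in> uhp \<Longrightarrow> hyp_dist z w < 1 \<Longrightarrow> w \<in> hyp_box z"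
 using hyp_dist_less_1[of z w] by (auto simp: hyp_box_iff)

lemma hyp_box_uhp: "z \<in> uhp \<Longrightarrow> hyp_box z \<subseteq> uhp"
proof
 fix w assume "z \<in> uhp" "w \<in> hyp_box z"
 then have "0 < Im z / 3" "Im z / 3 \<le> Im w" by (auto simp: hyp_box_iff uhp_iff)
 then show "w \<in> uhp" by (simp add: uhp_iff)
qed

lemma hyp_box_compact: "compact (hyp_box z)"
 by (simp add: hyp_box_def)

lemma hyp_box_finite_measure:
 assumes z: "z \<in> uhp"
 shows "emeasure \<mu> (hyp_box z) < top"
proof -
 have b: "hyp_box z \<in> sets borel" by (simp add: hyp_box_def)
 have y: "Im z > 0" using z by (simp add: uhp_iff)
 have "emeasure \<mu> (hyp_box z) = (\<integral>\<^sup>+w. ennreal (indicator uhp w / (Im w)\<^sup>2) * indicator (hyp_box z) w \<partial>lborel)"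
  unfolding hyp_measure_def using b by (subst emeasure_density) auto
 also have "\<dots> \<le> (\<integral>\<^sup>+w. ennreal (9 / (Im z)\<^sup>2) * indicator (hyp_box z) w \<partial>lborel)"
 proof (rule nn_integral_mono)
  fix w
  show "ennreal (indicator uhp w / (Im w)\<^sup>2) * indicator (hyp_box z) w \<le> ennreal (9 / (Im z)\<^sup>2) * indicator (hyp_box z) w"
  proof (cases "w \<in> hyp_box z")
   case True
   then have w: "Im z / 3 \<le> Im w" by (simp add: hyp_box_iff)
   then have "(Im z / 3)\<^sup>2 \<le> (Im w)\<^sup>2" using y by (intro power_mono) auto
   then have "1 / (Im w)\<^sup>2 \<le> 1 / (Im z / 3)\<^sup>2" using y w by (intro divide_left_mono mult_pos_pos) auto
   then have "indicator uhp w / (Im w)\<^sup>2 \<le> 9 / (Im z)\<^sup>2"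
    using y by (auto simp: indicator_def power_divide)
   then show ?thesis using True by (simp add: ennreal_leI)
  qed simp
 qed
 also have "\<dots> = ennreal (9 / (Im z)\<^sup>2) * emeasure lborel (hyp_box z)"
  using b by (subst nn_integral_cmult) auto
 also have "\<dots> < top"
  by (simp add: emeasure_lborel_cbox_finite[unfolded infinity_ennreal_def] hyp_box_def ennreal_mult_less_top)
 finally show ?thesis .
qed

text \<open>Bounded point-pair invariants in the sense of Selberg, supported on discs of fixed size.
  The integral operators with such kernels commute with the action of \<open>SL2R\<close> and are
  symmetric.\<close>

definition point_pair :: "(complex \<Rightarrow> complex \<Rightarrow> real) \<Rightarrow> bool" where
 "point_pair k \<longleftrightarrow> (\<lambda>p. k (fst p) (snd p)) \<in> borel_measurable (borel \<Otimes>\<^sub>M borel) \<and>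
   (\<forall>g\<in>SL2R. \<forall>z\<in>uhp. \<forall>w\<in>uhp. k (moebius g z) (moebius g w) = k z w) \<and> (\<forall>z w. k z w = k w z) \<and>
   (\<exists>M. \<forall>z\<in>uhp. \<forall>w\<in>uhp. \<bar>k z w\<bar> \<le> M * indicator {..<1} (hyp_dist z w))"

lemma point_pairD:
 assumes "point_pair k"
 shows "(\<lambda>p. k (fst p) (snd p)) \<in> borel_measurable (borel \<Otimes>\<^sub>M borel)"
  "\<And>g z w. g \<in> SL2R \<Longrightarrow> z \<in> uhp \<Longrightarrow> w \<in> uhp \<Longrightarrow> k (moebius g z) (moebius g w) = k z w"
  "\<And>z w. k z w = k w z"
  "\<And>z w. z \<in> uhp \<Longrightarrow> w \<in> uhp \<Longrightarrow> k z w \<noteq> 0 \<Longrightarrow> hyp_dist z w < 1"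
  "\<exists>M\<ge>0. \<forall>z\<in>uhp. \<forall>w\<in>uhp. \<bar>k z w\<bar> \<le> M"
proof -
 obtain M where M: "\<forall>z\<in>uhp. \<forall>w\<in>uhp. \<bar>k z w\<bar> \<le> M * indicator {..<1} (hyp_dist z w)"
  using assms unfolding point_pair_def by blast
 show "\<And>z w. z \<in> uhp \<Longrightarrow> w \<in> uhp \<Longrightarrow> k z w \<noteq> 0 \<Longrightarrow> hyp_dist z w < 1"
 proof -
  fix z w assume "z \<in> uhp" "w \<in> uhp" "k z w \<noteq> 0"
  then show "hyp_dist z w < 1" using M[rule_format, of z w] by (cases "hyp_dist z w < 1") auto
 qed
 show "\<exists>M\<ge>0. \<forall>z\<in>uhp. \<forall>w\<in>uhp. \<bar>k z w\<bar> \<le> M"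
 proof (intro exI[of _ "\<bar>M\<bar>"] conjI ballI)
  fix z w assume "z \<in> uhp" "w \<in> uhp"
  then have "\<bar>k z w\<bar> \<le> M * indicator {..<1} (hyp_dist z w)" using M by blast
  also have "\<dots> \<le> \<bar>M\<bar>" by (auto simp: indicator_def)
  finally show "\<bar>k z w\<bar> \<le> \<bar>M\<bar>" .
 qed simp
qed (use assms in \<open>auto simp: point_pair_def\<close>)

lemma point_pair_measurable:
 assumes "point_pair k"
 shows "(\<lambda>w. k z w) \<in> borel_measurable borel" "(\<lambda>w. k w z) \<in> borel_measurable borel"
 using measurable_compose[OF _ point_pairD(1)[OF assms], of "\<lambda>w. (z, w)" borel]
  measurable_compose[OF _ point_pairD(1)[OF assms], of "\<lambda>w. (w, z)" borel] by simp_all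

text \<open>The L^1 norm of k(z, .), computed at z = i. By transitivity of the action it is the same
  at every point, and it bounds the operator on L^1 of the quotient.\<close>

definition mass :: "(complex \<Rightarrow> complex \<Rightarrow> real) \<Rightarrow> ennreal" where
 "mass k = (\<integral>\<^sup>+w. ennreal \<bar>k \<i> w\<bar> \<partial>\<mu>)"

lemma transitive_SL2R:
 assumes "z \<in> uhp"
 obtains g where "g \<in> SL2R" "moebius g \<i> = z"
proof -
 define y where "y = Im z"
 have y: "y > 0" using assms by (simp add: uhp_iff y_def)
 define g where "g = mat2 (sqrt y) (Re z / sqrt y) 0 (1 / sqrt y)"
 have "g \<in> SL2R" by (rule SL2R_I) (use y in \<open>simp add: g_def\<close>)
 moreover have "moebius g \<i> = z"
  using y by (simp add: moebius_def g_def complex_eq_iff y_def Re_divide Im_divide field_simps power2_eq_square)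
 ultimately show ?thesis using that by blast
qed

lemma mass_eq:
 assumes k: "point_pair k" and z: "z \<in> uhp"
 shows "(\<integral>\<^sup>+w. ennreal \<bar>k z w\<bar> \<partial>\<mu>) = mass k" "(\<integral>\<^sup>+w. ennreal \<bar>k w z\<bar> \<partial>\<mu>) = mass k"
proof -
 obtain g where g: "g \<in> SL2R" "moebius g \<i> = z" using transitive_SL2R[OF z] by blast
 note [measurable] = point_pair_measurable[OF k]
 have "mass k = (\<integral>\<^sup>+w. ennreal \<bar>k (moebius g \<i>) (moebius g w)\<bar> \<partial>\<mu>)"
  unfolding mass_def
  by (rule nn_integral_cong_AE, rule AE_mp[OF AE_uhp]) (use point_pairD(2)[OF k g(1)] in \<open>auto simp: uhp_iff\<close>)
 also have "\<dots> = (\<integral>\<^sup>+w. ennreal \<bar>k z w\<bar> \<partial>\<mu>)"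
  unfolding g(2) by (rule nn_integral_hyp_moebius[OF _ g(1), of "\<lambda>w. ennreal \<bar>k z w\<bar>"]) measurable
 finally show "(\<integral>\<^sup>+w. ennreal \<bar>k z w\<bar> \<partial>\<mu>) = mass k" ..
 then show "(\<integral>\<^sup>+w. ennreal \<bar>k w z\<bar> \<partial>\<mu>) = mass k"
  using point_pairD(3)[OF k] by simp
qed

lemma mass_finite:
 assumes k: "point_pair k"
 shows "mass k < top"
proof -
 obtain M where M: "M \<ge> 0" "\<forall>z\<in>uhp. \<forall>w\<in>uhp. \<bar>k z w\<bar> \<le> M" using point_pairD(5)[OF k] by blast
 have i: "\<i> \<in> uhp" by (simp add: uhp_iff)
 have b [measurable]: "hyp_box \<i> \<in> sets borel" by (simp add: hyp_box_def)
 have "mass k \<le> (\<integral>\<^sup>+w. ennreal M * indicator (hyp_box \<i>) w \<partial>\<mu>)"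
  unfolding mass_def
 proof (rule nn_integral_mono_AE, rule AE_mp[OF AE_uhp], rule AE_I2, rule impI)
  fix w assume w: "w \<in> uhp"
  show "ennreal \<bar>k \<i> w\<bar> \<le> ennreal M * indicator (hyp_box \<i>) w"
  proof (cases "k \<i> w = 0")
   case False
   then have "w \<in> hyp_box \<i>" using point_pairD(4)[OF k i w] hyp_dist_box[OF i w] by blast
   then show ?thesis using M i w by (simp add: ennreal_leI)
  qed simp
 qed
 also have "\<dots> = ennreal M * emeasure \<mu> (hyp_box \<i>)" by (subst nn_integral_cmult) auto
 also have "\<dots> < top" using hyp_box_finite_measure[OF i] by (simp add: ennreal_mult_less_top)
 finally show ?thesis .
qed

text \<open>Unlike continuity, this condition survives multiplication by the indicator of a
  truncated domain; it ensures that averages over discs exist at every point.\<close>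

definition bounded_on_compacts :: "(complex \<Rightarrow> complex) \<Rightarrow> bool" where
 "bounded_on_compacts h \<longleftrightarrow> (\<forall>K. compact K \<longrightarrow> K \<subseteq> uhp \<longrightarrow> (\<exists>B. \<forall>w\<in>K. cmod (h w) \<le> B))"

lemma bounded_on_compactsD:
 "bounded_on_compacts h \<Longrightarrow> compact K \<Longrightarrow> K \<subseteq> uhp \<Longrightarrow> \<exists>B. \<forall>w\<in>K. cmod (h w) \<le> B"
 unfolding bounded_on_compacts_def by blast

lemma bounded_near:
 assumes "bounded_on_compacts h" "z \<in> uhp"
 shows "\<exists>B. \<forall>w\<in>uhp. hyp_dist z w < 1 \<longrightarrow> cmod (h w) \<le> B"
proof -
 obtain B where "\<forall>w\<in>hyp_box z. cmod (h w) \<le> B"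
  using bounded_on_compactsD[OF assms(1) hyp_box_compact hyp_box_uhp[OF assms(2)]] by (elim exE)
 then show ?thesis using hyp_dist_box[OF assms(2)] by (intro exI[of _ B] ballI impI) simp
qed

lemma continuous_bounded_on_compacts:
 assumes "continuous_on uhp h"
 shows "bounded_on_compacts h"
 unfolding bounded_on_compacts_def
proof (intro allI impI)
 fix K assume "compact K" "K \<subseteq> uhp"
 then have "compact (h ` K)"
  using compact_continuous_image[OF continuous_on_subset[OF assms]] by simp
 then have "\<exists>B. \<forall>x\<in>h ` K. norm x \<le> B" using compact_imp_bounded[of "h ` K"] by (simp add: bounded_iff)
 then obtain B where "\<forall>x\<in>h ` K. norm x \<le> B" by (elim exE)
 then show "\<exists>B. \<forall>w\<in>K. cmod (h w) \<le> B" by (intro exI[of _ B]) auto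
qed

section \<open>Averaging operators\<close>

definition conv :: "(complex \<Rightarrow> complex \<Rightarrow> real) \<Rightarrow> (complex \<Rightarrow> complex) \<Rightarrow> complex \<Rightarrow> complex" where
 "conv k h z = (\<integral>w. k z w *\<^sub>R (indicator uhp w *\<^sub>R h w) \<partial>\<mu>)"

lemma conv_integrable:
 assumes k: "point_pair k" and m: "uhp_measurable h" and z: "z \<in> uhp"
  and B: "\<forall>w\<in>uhp. hyp_dist z w < 1 \<longrightarrow> cmod (h w) \<le> B"
 shows "integrable \<mu> (\<lambda>w. k z w *\<^sub>R (indicator uhp w *\<^sub>R h w))"
  "cmod (conv k h z) \<le> enn2real (mass k) * B"
  "integrable \<mu> (\<lambda>w. \<bar>k z w\<bar>)" "(\<integral>w. \<bar>k z w\<bar> \<partial>\<mu>) = enn2real (mass k)"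
  "AE w in \<mu>. cmod (k z w *\<^sub>R (indicator uhp w *\<^sub>R h w)) \<le> \<bar>k z w\<bar> * B"
proof -
 note [measurable] = point_pair_measurable[OF k]
 have [measurable]: "(\<lambda>w. indicator uhp w *\<^sub>R h w) \<in> borel_measurable borel"
  using m by (simp add: set_borel_measurable_def)
 show 1: "integrable \<mu> (\<lambda>w. \<bar>k z w\<bar>)"
  by (rule integrableI_bounded) (use mass_eq(1)[OF k z] mass_finite[OF k] in auto)
 show 2: "(\<integral>w. \<bar>k z w\<bar> \<partial>\<mu>) = enn2real (mass k)"
  using mass_eq(1)[OF k z] by (subst integral_eq_nn_integral) auto
 show 3: "AE w in \<mu>. cmod (k z w *\<^sub>R (indicator uhp w *\<^sub>R h w)) \<le> \<bar>k z w\<bar> * B"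
 proof (rule AE_mp[OF AE_uhp], rule AE_I2, rule impI)
  fix w assume w: "w \<in> uhp"
  show "cmod (k z w *\<^sub>R (indicator uhp w *\<^sub>R h w)) \<le> \<bar>k z w\<bar> * B"
   using B[rule_format, OF w] point_pairD(4)[OF k z w] w by (cases "k z w = 0") (auto intro: mult_left_mono)
 qed
 have 4: "integrable \<mu> (\<lambda>w. \<bar>k z w\<bar> * B)" using 1 by simp
 show 5: "integrable \<mu> (\<lambda>w. k z w *\<^sub>R (indicator uhp w *\<^sub>R h w))"
 proof (rule bochner_bound[OF 4])
  show "AE w in \<mu>. norm (k z w *\<^sub>R (indicator uhp w *\<^sub>R h w)) \<le> norm (\<bar>k z w\<bar> * B)"
   using 3
  proof eventually_elim
   case (elim w)
   then show ?case using abs_ge_self[of "\<bar>k z w\<bar> * B"] unfolding real_norm_def by linarith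
  qed
 qed measurable
 have "cmod (conv k h z) \<le> (\<integral>w. cmod (k z w *\<^sub>R (indicator uhp w *\<^sub>R h w)) \<partial>\<mu>)"
  unfolding conv_def by (rule Bochner_Integration.integral_norm_bound)
 also have "\<dots> \<le> (\<integral>w. \<bar>k z w\<bar> * B \<partial>\<mu>)"
  by (rule integral_mono_AE[OF integrable_norm[OF 5] 4 3])
 also have "\<dots> = enn2real (mass k) * B" using 2 by simp
 finally show "cmod (conv k h z) \<le> enn2real (mass k) * B" .
qed

lemma conv_measurable:
 assumes k: "point_pair k" and m: "uhp_measurable h"
 shows "conv k h \<in> borel_measurable borel"
proof -
 note [measurable] = point_pairD(1)[OF k]
 have [measurable]: "(\<lambda>w. indicator uhp w *\<^sub>R h w) \<in> borel_measurable borel"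
  using m by (simp add: set_borel_measurable_def)
 have "(\<lambda>p. k (fst p) (snd p) *\<^sub>R (indicator uhp (snd p) *\<^sub>R h (snd p))) \<in> borel_measurable (borel \<Otimes>\<^sub>M borel)"
  using measurable_compose[OF measurable_snd, of "\<lambda>w. indicator uhp w *\<^sub>R h w" borel borel borel] by measurable
 then have "(\<lambda>p. k (fst p) (snd p) *\<^sub>R (indicator uhp (snd p) *\<^sub>R h (snd p))) \<in> borel_measurable (borel \<Otimes>\<^sub>M \<mu>)"
  by (simp cong: measurable_cong_sets sets_pair_measure_cong)
 then show ?thesis
  unfolding conv_def[abs_def] by (intro hyp.borel_measurable_lebesgue_integral) (simp add: split_beta')
qed

lemma conv_cong:
 assumes k: "point_pair k" and z: "z \<in> uhp" and "\<And>w. w \<in> uhp \<Longrightarrow> hyp_dist z w < 1 \<Longrightarrow> h w = h' w"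
 shows "conv k h z = conv k h' z"
 unfolding conv_def
proof (intro bochner_cong refl)
 fix w
 show "k z w *\<^sub>R (indicator uhp w *\<^sub>R h w) = k z w *\<^sub>R (indicator uhp w *\<^sub>R h' w)"
  using assms(3)[of w] point_pairD(4)[OF k z, of w] by (cases "w \<in> uhp \<and> k z w \<noteq> 0") auto
qed

lemma conv_moebius:
 assumes k: "point_pair k" and m: "uhp_measurable h" and g: "g \<in> SL2R" and z: "z \<in> uhp"
 shows "conv k h (moebius g z) = conv k (\<lambda>w. h (moebius g w)) z"
proof -
 note [measurable] = point_pair_measurable[OF k]
 have [measurable]: "(\<lambda>w. indicator uhp w *\<^sub>R h w) \<in> borel_measurable borel"
  using m by (simp add: set_borel_measurable_def)
 have hm: "(\<lambda>w. indicator uhp (moebius g w) *\<^sub>R h (moebius g w)) \<in> borel_measurable borel"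
  using measurable_compose[OF moebius_measurable[of g], of "\<lambda>w. indicator uhp w *\<^sub>R h w" borel] by simp
 have e: "indicator uhp w *\<^sub>R h (moebius g w) = indicator uhp w *\<^sub>R (indicator uhp (moebius g w) *\<^sub>R h (moebius g w))" for w
  using g by (auto simp: indicator_def)
 have [measurable]: "(\<lambda>w. indicator uhp w *\<^sub>R h (moebius g w)) \<in> borel_measurable borel"
  unfolding e using hm by measurable
 have "conv k h (moebius g z) = (\<integral>w. k (moebius g z) (moebius g w) *\<^sub>R (indicator uhp (moebius g w) *\<^sub>R h (moebius g w)) \<partial>\<mu>)"
  unfolding conv_def
  by (rule integral_hyp_moebius[OF _ g, of "\<lambda>w. k (moebius g z) w *\<^sub>R (indicator uhp w *\<^sub>R h w)", symmetric]) measurable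
 also have "\<dots> = conv k (\<lambda>w. h (moebius g w)) z"
  unfolding conv_def
 proof (rule integral_cong_AE)
  show "AE w in \<mu>. k (moebius g z) (moebius g w) *\<^sub>R (indicator uhp (moebius g w) *\<^sub>R h (moebius g w)) =
    k z w *\<^sub>R (indicator uhp w *\<^sub>R h (moebius g w))"
   by (rule AE_mp[OF AE_uhp]) (use g z point_pairD(2)[OF k g z] in \<open>auto simp: moebius_uhp[OF g]\<close>)
  show "(\<lambda>w. k (moebius g z) (moebius g w) *\<^sub>R indicat_real uhp (moebius g w) *\<^sub>R h (moebius g w)) \<in> borel_measurable \<mu>"
   using measurable_compose[OF moebius_measurable[of g] point_pair_measurable(1)[OF k]] hm by measurable
 qed measurable
 finally show ?thesis .
qed

section \<open>Mass transport and symmetry of averaging\<close>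

lemma pair_hyp_measurable:
 "f \<in> borel_measurable (borel \<Otimes>\<^sub>M borel) \<Longrightarrow> f \<in> borel_measurable (\<mu> \<Otimes>\<^sub>M \<mu>)"
 by (simp cong: measurable_cong_sets sets_pair_measure_cong)

context modular_domain
begin

text \<open>Insert the sum over \<Gamma> of the indicator of \<open>F\<close> in the second
  variable, which is almost everywhere the constant e. Moving both variables by g leaves
  \<open>B\<close> unchanged and transfers the sum to the first variable, where it is again e. Being
  1 or 2, this constant can be cancelled.\<close>

lemma mass_transport_nn:
 fixes B :: "complex \<times> complex \<Rightarrow> ennreal"
 assumes Bm [measurable]: "B \<in> borel_measurable (borel \<Otimes>\<^sub>M borel)"
  and inv: "\<And>g z w. g \<in> \<Gamma> \<Longrightarrow> z \<in> uhp \<Longrightarrow> w \<in> uhp \<Longrightarrow> B (moebius g z, moebius g w) = B (z, w)"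
 shows "(\<integral>\<^sup>+z. \<integral>\<^sup>+w. indicator F z * B (z, w) \<partial>\<mu> \<partial>\<mu>) =
     (\<integral>\<^sup>+z. \<integral>\<^sup>+w. indicator F w * B (z, w) \<partial>\<mu> \<partial>\<mu>)"
proof -
 define n where "n = card (\<Gamma> \<inter> {mat 1, - mat 1})"
 define e where "e = ennreal (real n)"
 have pm: "G \<in> borel_measurable (borel \<Otimes>\<^sub>M borel) \<Longrightarrow> (\<lambda>z. \<integral>\<^sup>+w. G (z, w) \<partial>\<mu>) \<in> borel_measurable borel" for G :: "complex \<times> complex \<Rightarrow> ennreal"
  by (rule hyp.borel_measurable_nn_integral_fst) (simp cong: measurable_cong_sets sets_pair_measure_cong)
 have dbl: "(\<integral>\<^sup>+z. \<integral>\<^sup>+w. (\<integral>\<^sup>+g. G g z w \<partial>count_space \<Gamma>) \<partial>\<mu> \<partial>\<mu>) = (\<integral>\<^sup>+g. \<integral>\<^sup>+z. \<integral>\<^sup>+w. G g z w \<partial>\<mu> \<partial>\<mu> \<partial>count_space \<Gamma>)"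
  if G: "\<And>g. (\<lambda>p. G g (fst p) (snd p)) \<in> borel_measurable (borel \<Otimes>\<^sub>M borel)" for G :: "mat2 \<Rightarrow> complex \<Rightarrow> complex \<Rightarrow> ennreal"
 proof -
  have "(\<lambda>w. G g z w) \<in> borel_measurable borel" for g z
   using measurable_compose[OF _ G[of g], of "\<lambda>w. (z, w)" borel] by simp
  then have "(\<integral>\<^sup>+z. \<integral>\<^sup>+w. (\<integral>\<^sup>+g. G g z w \<partial>count_space \<Gamma>) \<partial>\<mu> \<partial>\<mu>) = (\<integral>\<^sup>+z. \<integral>\<^sup>+g. \<integral>\<^sup>+w. G g z w \<partial>\<mu> \<partial>count_space \<Gamma> \<partial>\<mu>)"
   by (intro nn_integral_cong nn_integral_count_space_nn_integral[OF \<Gamma>_countable]) simp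
  also have "\<dots> = (\<integral>\<^sup>+g. \<integral>\<^sup>+z. \<integral>\<^sup>+w. G g z w \<partial>\<mu> \<partial>\<mu> \<partial>count_space \<Gamma>)"
   using pm[OF G] by (intro nn_integral_count_space_nn_integral[OF \<Gamma>_countable]) simp
  finally show ?thesis .
 qed
 have "(\<integral>\<^sup>+z. \<integral>\<^sup>+w. indicator F z * B (z, w) \<partial>\<mu> \<partial>\<mu>) * e =
   (\<integral>\<^sup>+z. \<integral>\<^sup>+w. (\<integral>\<^sup>+g. indicator F z * B (z, w) * indicator F (moebius g w) \<partial>count_space \<Gamma>) \<partial>\<mu> \<partial>\<mu>)"
 proof -
  have "(\<integral>\<^sup>+w. (\<integral>\<^sup>+g. indicator F z * B (z, w) * indicator F (moebius g w) \<partial>count_space \<Gamma>) \<partial>\<mu>) =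
    (\<integral>\<^sup>+w. indicator F z * B (z, w) \<partial>\<mu>) * e" for z
  proof -
   have "(\<integral>\<^sup>+w. (\<integral>\<^sup>+g. indicator F z * B (z, w) * indicator F (moebius g w) \<partial>count_space \<Gamma>) \<partial>\<mu>) =
     (\<integral>\<^sup>+w. indicator F z * B (z, w) * e \<partial>\<mu>)"
    by (rule nn_integral_cong_AE, rule AE_mp[OF sum_indicator_F]) (simp add: nn_integral_cmult e_def n_def)
   then show ?thesis by (simp add: nn_integral_multc)
  qed
  then show ?thesis using pm[of "\<lambda>p. indicator F (fst p) * B p"] by (simp add: nn_integral_multc)
 qed
 also have "\<dots> = (\<integral>\<^sup>+g. \<integral>\<^sup>+z. \<integral>\<^sup>+w. indicator F z * B (z, w) * indicator F (moebius g w) \<partial>\<mu> \<partial>\<mu> \<partial>count_space \<Gamma>)"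
  by (rule dbl) measurable
 also have "\<dots> = (\<integral>\<^sup>+g. \<integral>\<^sup>+z. \<integral>\<^sup>+w. indicator F (moebius (matrix_inv g) z) * B (z, w) * indicator F w \<partial>\<mu> \<partial>\<mu> \<partial>count_space \<Gamma>)"
 proof (rule nn_integral_cong)
  fix g assume "g \<in> space (count_space \<Gamma>)"
  then have g: "g \<in> \<Gamma>" by simp
  have gR: "g \<in> SL2R" using \<Gamma>_SL2R[OF g] .
  have iR: "matrix_inv g \<in> SL2R" using SL2R_inv(1)[OF gR] .
  have "(\<integral>\<^sup>+z. \<integral>\<^sup>+w. indicator F z * B (z, w) * indicator F (moebius g w) \<partial>\<mu> \<partial>\<mu>) =
    (\<integral>\<^sup>+z. \<integral>\<^sup>+w. indicator F (moebius (matrix_inv g) (moebius g z)) * B (moebius g z, w) * indicator F w \<partial>\<mu> \<partial>\<mu>)"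
  proof (rule nn_integral_cong_AE, rule AE_mp[OF AE_uhp], rule AE_I2, rule impI)
   fix z assume z: "z \<in> uhp"
   have "(\<integral>\<^sup>+w. indicator F z * B (z, w) * indicator F (moebius g w) \<partial>\<mu>) =
     (\<integral>\<^sup>+w. indicator F z * B (moebius g z, moebius g w) * indicator F (moebius g w) \<partial>\<mu>)"
    by (rule nn_integral_cong_AE, rule AE_mp[OF AE_uhp]) (use inv[OF g z] in auto)
   also have "\<dots> = (\<integral>\<^sup>+w. indicator F z * B (moebius g z, w) * indicator F w \<partial>\<mu>)"
    by (rule nn_integral_hyp_moebius[OF _ gR, of "\<lambda>w. indicator F z * B (moebius g z, w) * indicator F w"]) measurable
   finally show "(\<integral>\<^sup>+w. indicator F z * B (z, w) * indicator F (moebius g w) \<partial>\<mu>) =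
     (\<integral>\<^sup>+w. indicator F (moebius (matrix_inv g) (moebius g z)) * B (moebius g z, w) * indicator F w \<partial>\<mu>)"
    using moebius_inv(2)[OF gR z] by simp
  qed
  also have "\<dots> = (\<integral>\<^sup>+z. \<integral>\<^sup>+w. indicator F (moebius (matrix_inv g) z) * B (z, w) * indicator F w \<partial>\<mu> \<partial>\<mu>)"
  proof (rule nn_integral_hyp_moebius[OF _ gR, of "\<lambda>z. \<integral>\<^sup>+w. indicator F (moebius (matrix_inv g) z) * B (z, w) * indicator F w \<partial>\<mu>"])
   show "(\<lambda>z. \<integral>\<^sup>+w. indicator F (moebius (matrix_inv g) z) * B (z, w) * indicator F w \<partial>\<mu>) \<in> borel_measurable borel"
    using pm[of "\<lambda>p. indicator F (moebius (matrix_inv g) (fst p)) * B p * indicator F (snd p)"] by simp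
  qed
  finally show "(\<integral>\<^sup>+z. \<integral>\<^sup>+w. indicator F z * B (z, w) * indicator F (moebius g w) \<partial>\<mu> \<partial>\<mu>) =
    (\<integral>\<^sup>+z. \<integral>\<^sup>+w. indicator F (moebius (matrix_inv g) z) * B (z, w) * indicator F w \<partial>\<mu> \<partial>\<mu>)" .
 qed
 also have "\<dots> = (\<integral>\<^sup>+g. \<integral>\<^sup>+z. \<integral>\<^sup>+w. indicator F (moebius g z) * B (z, w) * indicator F w \<partial>\<mu> \<partial>\<mu> \<partial>count_space \<Gamma>)"
  by (rule nn_integral_bij_count_space[OF bij_betw_matrix_inv[OF \<Gamma>_group],
    where f = "\<lambda>g. \<integral>\<^sup>+z. \<integral>\<^sup>+w. indicator F (moebius g z) * B (z, w) * indicator F w \<partial>\<mu> \<partial>\<mu>"])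
 also have "\<dots> = (\<integral>\<^sup>+z. \<integral>\<^sup>+w. (\<integral>\<^sup>+g. indicator F (moebius g z) * B (z, w) * indicator F w \<partial>count_space \<Gamma>) \<partial>\<mu> \<partial>\<mu>)"
  by (rule dbl[symmetric]) measurable
 also have "\<dots> = (\<integral>\<^sup>+z. \<integral>\<^sup>+w. indicator F w * B (z, w) * e \<partial>\<mu> \<partial>\<mu>)"
 proof (rule nn_integral_cong_AE, rule AE_mp[OF sum_indicator_F], rule AE_I2, rule impI)
  fix z assume "(\<integral>\<^sup>+g. indicator F (moebius g z) \<partial>count_space \<Gamma>) = ennreal (real (card (\<Gamma> \<inter> {mat 1, - mat 1})))"
  then have s: "(\<integral>\<^sup>+g. indicator F (moebius g z) \<partial>count_space \<Gamma>) = e" by (simp only: e_def n_def)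
  have "(\<integral>\<^sup>+g. indicator F (moebius g z) * B (z, w) * indicator F w \<partial>count_space \<Gamma>) = indicator F w * B (z, w) * e" for w
  proof -
   have "(\<integral>\<^sup>+g. indicator F (moebius g z) * (B (z, w) * indicator F w) \<partial>count_space \<Gamma>) = e * (B (z, w) * indicator F w)"
    unfolding s[symmetric] by (rule nn_integral_multc) simp
   then show ?thesis by (simp add: mult_ac)
  qed
  then show "(\<integral>\<^sup>+w. (\<integral>\<^sup>+g. indicator F (moebius g z) * B (z, w) * indicator F w \<partial>count_space \<Gamma>) \<partial>\<mu>) =
    (\<integral>\<^sup>+w. indicator F w * B (z, w) * e \<partial>\<mu>)" by simp
 qed
 also have "\<dots> = (\<integral>\<^sup>+z. \<integral>\<^sup>+w. indicator F w * B (z, w) \<partial>\<mu> \<partial>\<mu>) * e"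
  using pm[of "\<lambda>p. indicator F (snd p) * B p"] by (simp add: nn_integral_multc)
 finally have eq: "(\<integral>\<^sup>+z. \<integral>\<^sup>+w. indicator F z * B (z, w) \<partial>\<mu> \<partial>\<mu>) * e =
   (\<integral>\<^sup>+z. \<integral>\<^sup>+w. indicator F w * B (z, w) \<partial>\<mu> \<partial>\<mu>) * e" .
 have "e * ennreal (1 / real n) = 1" using card_pm by (simp add: e_def n_def[symmetric] ennreal_mult[symmetric])
 then have "X = X * e * ennreal (1 / real n)" for X by (simp add: mult.assoc)
 then show ?thesis using eq by (metis (no_types))
qed

text \<open>As in \<open>unfold_integral\<close>: the nonnegative case for preimages of Borel sets
  shows that \<open>B\<close> has equal distributions under the two densities.\<close>

lemma mass_transport:
 fixes B :: "complex \<times> complex \<Rightarrow> complex"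
 assumes Bm: "B \<in> borel_measurable (borel \<Otimes>\<^sub>M borel)"
  and inv: "\<And>g z w. g \<in> \<Gamma> \<Longrightarrow> z \<in> uhp \<Longrightarrow> w \<in> uhp \<Longrightarrow> B (moebius g z, moebius g w) = B (z, w)"
 shows "integrable (\<mu> \<Otimes>\<^sub>M \<mu>) (\<lambda>p. indicator F (fst p) *\<^sub>R B p) \<longleftrightarrow>
   integrable (\<mu> \<Otimes>\<^sub>M \<mu>) (\<lambda>p. indicator F (snd p) *\<^sub>R B p)"
  "(\<integral>p. indicator F (fst p) *\<^sub>R B p \<partial>(\<mu> \<Otimes>\<^sub>M \<mu>)) =
   (\<integral>p. indicator F (snd p) *\<^sub>R B p \<partial>(\<mu> \<Otimes>\<^sub>M \<mu>))"
proof -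
 let ?P = "\<mu> \<Otimes>\<^sub>M \<mu>"
 have sP: "sets ?P = sets (borel \<Otimes>\<^sub>M borel)" by (intro sets_pair_measure_cong) auto
 have Bm' [measurable]: "B \<in> borel_measurable ?P" using pair_hyp_measurable[OF Bm] .
 have [measurable]: "(\<lambda>p. indicator F (fst p) :: real) \<in> borel_measurable ?P" "(\<lambda>p. indicator F (snd p) :: real) \<in> borel_measurable ?P"
  by measurable
 define N1 where "N1 = density ?P (\<lambda>p. ennreal (indicator F (fst p)))"
 define N2 where "N2 = density ?P (\<lambda>p. ennreal (indicator F (snd p)))"
 have BN: "B \<in> borel_measurable N1" "B \<in> borel_measurable N2" by (simp_all add: N1_def N2_def)
 have eq: "distr N1 borel B = distr N2 borel B"
 proof (rule measure_eqI)
  fix A :: "complex set" assume "A \<in> sets (distr N1 borel B)"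
  then have A [measurable]: "A \<in> sets borel" by simp
  have vA: "B -` A \<inter> space ?P \<in> sets ?P" by measurable
  have sp: "space ?P = UNIV" by (simp add: space_pair_measure)
  have "emeasure (distr N1 borel B) A = (\<integral>\<^sup>+p. indicator F (fst p) * indicator A (B p) \<partial>?P)"
   using vA by (subst emeasure_distr) (auto simp: BN N1_def sp emeasure_density ennreal_indicator intro!: nn_integral_cong split: split_indicator)
  also have "\<dots> = (\<integral>\<^sup>+z. \<integral>\<^sup>+w. indicator F z * indicator A (B (z, w)) \<partial>\<mu> \<partial>\<mu>)"
   by (subst hyp.nn_integral_fst[symmetric]) auto
  also have "\<dots> = (\<integral>\<^sup>+z. \<integral>\<^sup>+w. indicator F w * indicator A (B (z, w)) \<partial>\<mu> \<partial>\<mu>)"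
   using Bm inv by (intro mass_transport_nn[of "\<lambda>p. indicator A (B p)"]) auto
  also have "\<dots> = (\<integral>\<^sup>+p. indicator F (snd p) * indicator A (B p) \<partial>?P)"
   by (subst hyp.nn_integral_fst[symmetric]) auto
  also have "\<dots> = emeasure (distr N2 borel B) A"
   using vA by (subst emeasure_distr) (auto simp: BN N2_def sp emeasure_density ennreal_indicator intro!: nn_integral_cong split: split_indicator)
  finally show "emeasure (distr N1 borel B) A = emeasure (distr N2 borel B) A" .
 qed simp
 have 1: "integrable N1 B \<longleftrightarrow> integrable N2 B" "integral\<^sup>L N1 B = integral\<^sup>L N2 B"
  using integrable_distr_eq[OF BN(1), of "\<lambda>x. x"] integrable_distr_eq[OF BN(2), of "\<lambda>x. x"]
   integral_distr[OF BN(1), of "\<lambda>x. x"] integral_distr[OF BN(2), of "\<lambda>x. x"] by (auto simp: eq)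
 have 2: "integrable N1 B \<longleftrightarrow> integrable ?P (\<lambda>p. indicator F (fst p) *\<^sub>R B p)"
  "integral\<^sup>L N1 B = (\<integral>p. indicator F (fst p) *\<^sub>R B p \<partial>?P)"
  unfolding N1_def by (subst integrable_density integral_density; auto)+
 have 3: "integrable N2 B \<longleftrightarrow> integrable ?P (\<lambda>p. indicator F (snd p) *\<^sub>R B p)"
  "integral\<^sup>L N2 B = (\<integral>p. indicator F (snd p) *\<^sub>R B p \<partial>?P)"
  unfolding N2_def by (subst integrable_density integral_density; auto)+
 show "integrable ?P (\<lambda>p. indicator F (fst p) *\<^sub>R B p) \<longleftrightarrow> integrable ?P (\<lambda>p. indicator F (snd p) *\<^sub>R B p)"
  "(\<integral>p. indicator F (fst p) *\<^sub>R B p \<partial>?P) = (\<integral>p. indicator F (snd p) *\<^sub>R B p \<partial>?P)"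
  using 1 2 3 by auto
qed

lemma truncated_neighbour:
 assumes z: "z \<in> trunc T" and w: "w \<in> uhp" and l: "hyp_dist z w < 1"
 shows "w \<in> trunc (3 * T)"
proof -
 have zu: "z \<in> uhp" using z truncated_uhp_sub by auto
 have "Im (moebius (matrix_inv s) w) \<le> 3 * T * a" if s: "s \<in> SL2Z" and a: "cusp_period \<Gamma> s a" for s a
 proof -
  have iR: "matrix_inv s \<in> SL2R" using s SL2R_inv(1) by (auto simp: SL2Z_iff)
  have "Im (moebius (matrix_inv s) w) \<le> 3 * Im (moebius (matrix_inv s) z)"
   using l by (intro hyp_dist_less_1(1)) (auto simp: hyp_dist_moebius[OF iR zu w] iR zu w)
  also have "\<dots> \<le> 3 * (T * a)" using z s a by (auto simp: truncated_uhp_def)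
  finally show ?thesis by simp
 qed
 then show ?thesis using w by (auto simp: truncated_uhp_def)
qed

text \<open>Mass transport for k(z, w) h1(z) h2(w). Since \<open>h1\<close> lives on
  \<open>trunc T\<close>, only values of \<open>h2\<close> within distance 1 of it enter; these lie
  in \<open>trunc (3 * T)\<close>, where \<open>h2\<close> is bounded, and integrability on the
  product follows. In the application \<open>h2\<close> is a theta kernel, which grows in the
  cusps.\<close>

lemma conv_symmetric:
 assumes k: "point_pair k" and m1: "uhp_measurable h1" and m2: "uhp_measurable h2"
  and i1: "invariant h1" and i2: "invariant h2" and int: "set_integrable \<mu> F h1"
  and supp: "\<And>z. z \<in> uhp \<Longrightarrow> h1 z \<noteq> 0 \<Longrightarrow> z \<in> trunc T"
  and bd: "\<And>z. z \<in> trunc (3 * T) \<Longrightarrow> cmod (h2 z) \<le> Bd" and Bd: "Bd \<ge> 0"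
 shows "hyp_int F (\<lambda>z. h1 z * conv k h2 z) = hyp_int F (\<lambda>z. conv k h1 z * h2 z)"
proof -
 let ?P = "\<mu> \<Otimes>\<^sub>M \<mu>"
 define g1 g2 where "g1 = (\<lambda>z. indicator uhp z *\<^sub>R h1 z)" and "g2 = (\<lambda>z. indicator uhp z *\<^sub>R h2 z)"
 have [measurable]: "g1 \<in> borel_measurable borel" "g2 \<in> borel_measurable borel"
  using m1 m2 by (simp_all add: g1_def g2_def set_borel_measurable_def)
 note [measurable] = point_pairD(1)[OF k] point_pair_measurable[OF k]
 define B where "B = (\<lambda>p. k (fst p) (snd p) *\<^sub>R (g1 (fst p) * g2 (snd p)))"
 have Bm: "B \<in> borel_measurable (borel \<Otimes>\<^sub>M borel)" unfolding B_def by measurable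
 note Bm' [measurable] = pair_hyp_measurable[OF Bm]
 have inv: "B (moebius g z, moebius g w) = B (z, w)" if "g \<in> \<Gamma>" "z \<in> uhp" "w \<in> uhp" for g z w
  using that invariantD[OF i1] invariantD[OF i2] \<Gamma>_SL2R point_pairD(2)[OF k] by (simp add: B_def g1_def g2_def moebius_uhp)
 have bnd: "(\<integral>w. norm (indicator F z *\<^sub>R B (z, w)) \<partial>\<mu>) \<le> enn2real (mass k) * Bd * norm (indicator F z *\<^sub>R h1 z)"
  "integrable \<mu> (\<lambda>w. indicator F z *\<^sub>R B (z, w))" for z
 proof -
  have "(\<integral>w. norm (indicator F z *\<^sub>R B (z, w)) \<partial>\<mu>) \<le> enn2real (mass k) * Bd * norm (indicator F z *\<^sub>R h1 z) \<and>
   integrable \<mu> (\<lambda>w. indicator F z *\<^sub>R B (z, w))"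
  proof (cases "z \<in> F \<and> h1 z \<noteq> 0")
   case True
   then have z: "z \<in> uhp" "z \<in> trunc T" using F_uhp supp by auto
   have b2: "\<forall>w\<in>uhp. hyp_dist z w < 1 \<longrightarrow> cmod (h2 w) \<le> Bd"
    using bd truncated_neighbour[OF z(2)] by blast
   note c = conv_integrable[OF k m2 z(1) b2]
   have e: "indicator F z *\<^sub>R B (z, w) = h1 z * (k z w *\<^sub>R (indicator uhp w *\<^sub>R h2 w))" for w
    using True z by (simp add: B_def g1_def g2_def)
   have ii: "integrable \<mu> (\<lambda>w. indicator F z *\<^sub>R B (z, w))" unfolding e using c(1) by (rule integrable_mult_right)
   moreover have "(\<integral>w. norm (indicator F z *\<^sub>R B (z, w)) \<partial>\<mu>) \<le> (\<integral>w. cmod (h1 z) * (\<bar>k z w\<bar> * Bd) \<partial>\<mu>)"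
   proof (rule integral_mono_AE)
    show "integrable \<mu> (\<lambda>w. cmod (h1 z) * (\<bar>k z w\<bar> * Bd))" using c(3) by simp
    show "AE w in \<mu>. norm (indicator F z *\<^sub>R B (z, w)) \<le> cmod (h1 z) * (\<bar>k z w\<bar> * Bd)"
     using c(5) unfolding e norm_mult[of "h1 z"] by eventually_elim (intro mult_left_mono, auto)
   qed (rule integrable_norm[OF ii])
   ultimately show ?thesis using c(4) True by (simp add: mult_ac)
  next
   case False
   then have e0: "indicator F z *\<^sub>R B (z, w) = 0" for w by (auto simp: B_def g1_def indicator_def)
   show ?thesis unfolding e0 using Bd by (simp add: enn2real_nonneg)
  qed
  then show "(\<integral>w. norm (indicator F z *\<^sub>R B (z, w)) \<partial>\<mu>) \<le> enn2real (mass k) * Bd * norm (indicator F z *\<^sub>R h1 z)"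
   "integrable \<mu> (\<lambda>w. indicator F z *\<^sub>R B (z, w))" by auto
 qed
 have I1: "integrable ?P (\<lambda>p. indicator F (fst p) *\<^sub>R B p)"
 proof (rule hyp_pair.Fubini_integrable)
  show "(\<lambda>p. indicator F (fst p) *\<^sub>R B p) \<in> borel_measurable ?P" by measurable
  show "integrable \<mu> (\<lambda>z. \<integral>w. norm (indicator F (fst (z, w)) *\<^sub>R B (z, w)) \<partial>\<mu>)"
  proof (rule bochner_bound)
   show "integrable \<mu> (\<lambda>z. enn2real (mass k) * Bd * norm (indicator F z *\<^sub>R h1 z))"
    using int unfolding set_integrable_def by (intro integrable_mult_right integrable_norm)
   show "(\<lambda>z. \<integral>w. norm (indicator F (fst (z, w)) *\<^sub>R B (z, w)) \<partial>\<mu>) \<in> borel_measurable \<mu>"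
    by (rule hyp.borel_measurable_lebesgue_integral) (simp add: split_beta')
   show "AE z in \<mu>. norm (\<integral>w. norm (indicator F (fst (z, w)) *\<^sub>R B (z, w)) \<partial>\<mu>) \<le>
    norm (enn2real (mass k) * Bd * norm (indicator F z *\<^sub>R h1 z))"
    using bnd(1) Bd by (intro AE_I2) (simp add: enn2real_nonneg)
  qed
  show "AE z in \<mu>. integrable \<mu> (\<lambda>w. indicator F (fst (z, w)) *\<^sub>R B (z, w))"
   using bnd(2) by (intro AE_I2) simp
 qed
 then have I2: "integrable ?P (\<lambda>p. indicator F (snd p) *\<^sub>R B p)" using mass_transport(1)[OF Bm inv] by blast
 have "hyp_int F (\<lambda>z. h1 z * conv k h2 z) = (\<integral>z. \<integral>w. indicator F z *\<^sub>R B (z, w) \<partial>\<mu> \<partial>\<mu>)"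
  unfolding set_lebesgue_integral_def
 proof (rule bochner_cong[OF refl])
  fix z
  have e1: "indicator F z *\<^sub>R B (z, w) = (indicator F z *\<^sub>R h1 z) * (k z w *\<^sub>R (indicator uhp w *\<^sub>R h2 w))" for w
   using F_uhp by (auto simp: B_def g1_def g2_def indicator_def)
  show "indicator F z *\<^sub>R (h1 z * conv k h2 z) = (\<integral>w. indicator F z *\<^sub>R B (z, w) \<partial>\<mu>)"
   unfolding e1 integral_mult_right_zero conv_def[symmetric] by simp
 qed
 also have "\<dots> = (\<integral>p. indicator F (fst p) *\<^sub>R B p \<partial>?P)"
  using hyp_pair.integral_fst'[OF I1] by simp
 also have "\<dots> = (\<integral>p. indicator F (snd p) *\<^sub>R B p \<partial>?P)" by (rule mass_transport(2)[OF Bm inv])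
 also have "\<dots> = (\<integral>w. \<integral>z. indicator F w *\<^sub>R B (z, w) \<partial>\<mu> \<partial>\<mu>)"
  using hyp_pair.integral_snd[of "\<lambda>z w. indicator F w *\<^sub>R B (z, w)"] I2 by (simp add: split_beta')
 also have "\<dots> = hyp_int F (\<lambda>z. conv k h1 z * h2 z)"
  unfolding set_lebesgue_integral_def
 proof (rule bochner_cong[OF refl])
  fix w
  have e2: "indicator F w *\<^sub>R B (z, w) = (k w z *\<^sub>R (indicator uhp z *\<^sub>R h1 z)) * (indicator F w *\<^sub>R h2 w)" for z
   using F_uhp point_pairD(3)[OF k, of z w] by (auto simp: B_def g1_def g2_def indicator_def)
  show "(\<integral>z. indicator F w *\<^sub>R B (z, w) \<partial>\<mu>) = indicator F w *\<^sub>R (conv k h1 w * h2 w)"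
   unfolding e2 integral_mult_left_zero conv_def[symmetric] by simp
 qed
 finally show ?thesis .
qed

end

section \<open>Point-pair operators on cuspidal functions\<close>

lemma AE_Im:
 assumes "AE y in lborel. P y"
 shows "AE z in \<mu>. P (Im z)"
proof -
 obtain M where M: "{y. \<not> P y} \<subseteq> M" "emeasure lborel M = 0" "M \<in> sets borel"
  using assms by (auto elim!: AE_E)
 note [measurable] = M(3)
 have vM: "Im -` M \<in> sets borel" using measurable_sets[of Im borel borel M] M(3) by simp
 have "emeasure lborel (Im -` M) = (\<integral>\<^sup>+z. indicator M (Im z) \<partial>lborel)"
  using vM by (subst nn_integral_indicator[symmetric]) (auto intro!: nn_integral_cong simp del: nn_integral_indicator simp: indicator_def)
 also have "\<dots> = (\<integral>\<^sup>+y. \<integral>\<^sup>+x. indicator M y \<partial>(lborel :: real measure) \<partial>lborel)"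
  by (subst nn_integral_complex) auto
 also have "\<dots> = (\<integral>\<^sup>+y. 0 \<partial>(lborel :: real measure))"
 proof (rule nn_integral_cong_AE)
  have "AE y in lborel. y \<notin> M" using M by (intro AE_I[of _ _ M]) auto
  then show "AE y in lborel. (\<integral>\<^sup>+x. indicator M y \<partial>(lborel :: real measure)) = 0" by eventually_elim auto
 qed
 finally have "AE z in lborel. Im z \<notin> M" using vM by (intro AE_I[of _ _ "Im -` M"]) auto
 then show ?thesis unfolding AE_hyp_iff by eventually_elim (use M in auto)
qed

lemma periodic_int:
 assumes "\<And>x. g (x + p) = g (x :: real)"
 shows "g (x + of_int m * p) = g x"
proof (induction m arbitrary: x rule: int_induct[where k = 0])
 case (step1 i)
 have "g (x + of_int (i + 1) * p) = g ((x + of_int i * p) + p)" by (simp add: algebra_simps)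
 then show ?case using assms step1 by simp
next
 case (step2 i)
 have "g (x + of_int (i - 1) * p) = g ((x + of_int (i - 1) * p) + p)" using assms by simp
 also have "\<dots> = g (x + of_int i * p)" by (simp add: algebra_simps)
 finally show ?case using step2 by simp
qed simp

text \<open>After reducing the shift modulo p to b in [0, p), the interval [b, b + p] is cut at p
  and its second piece is moved back by one period.\<close>

lemma periodic_integral_shift:
 fixes g :: "real \<Rightarrow> complex"
 assumes [measurable]: "g \<in> borel_measurable borel" and p: "p > 0" and per: "\<And>x. g (x + p) = g x"
  and bd: "\<And>x. cmod (g x) \<le> B"
 shows "(\<integral>x. indicator {0..p} x *\<^sub>R g (a + x) \<partial>lborel) = (\<integral>x. indicator {0..p} x *\<^sub>R g x \<partial>lborel)"
proof -
 have i: "integrable lborel (\<lambda>x. indicator S x *\<^sub>R g x)" if S: "S \<in> sets borel" "S \<subseteq> {0..2 * p}" for S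
 proof (rule bochner_bound)
  show "integrable lborel (\<lambda>x. B * indicator {0..2 * p} x)" using p by (intro integrable_mult_right integrable_real_indicator) auto
  show "AE x in lborel. norm (indicator S x *\<^sub>R g x) \<le> norm (B * indicator {0..2 * p} x)"
   using S bd by (intro AE_I2) (auto simp: indicator_def intro: order_trans[OF bd abs_ge_self])
  show "(\<lambda>x. indicator S x *\<^sub>R g x) \<in> borel_measurable lborel" using S by measurable
 qed
 define b where "b = a - of_int \<lfloor>a / p\<rfloor> * p"
 have b: "0 \<le> b" "b < p"
  using floor_divide_lower[OF p, of a] floor_divide_upper[OF p, of a] by (simp_all add: b_def algebra_simps)
 have "g (a + x) = g (b + x)" for x
  using periodic_int[of g p "b + x" "\<lfloor>a / p\<rfloor>", OF per] by (simp add: b_def algebra_simps)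
 then have "(\<integral>x. indicator {0..p} x *\<^sub>R g (a + x) \<partial>lborel) = (\<integral>x. indicator {b..b + p} (b + x) *\<^sub>R g (b + x) \<partial>lborel)"
  by (intro bochner_cong) (auto simp: indicator_def)
 also have "\<dots> = (\<integral>x. indicator {b..b + p} x *\<^sub>R g x \<partial>lborel)"
  using lborel_integral_real_affine[of 1 "\<lambda>x. indicator {b..b + p} x *\<^sub>R g x" b] by simp
 also have "\<dots> = (\<integral>x. indicator {b..<p} x *\<^sub>R g x + indicator {p..b + p} x *\<^sub>R g x \<partial>lborel)"
  using b by (intro bochner_cong) (auto simp: indicator_def)
 also have "\<dots> = (\<integral>x. indicator {b..<p} x *\<^sub>R g x \<partial>lborel) + (\<integral>x. indicator {p..b + p} x *\<^sub>R g x \<partial>lborel)"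
  using b by (intro Bochner_Integration.integral_add i) auto
 also have "(\<integral>x. indicator {p..b + p} x *\<^sub>R g x \<partial>lborel) = (\<integral>x. indicator {p..b + p} (p + x) *\<^sub>R g (p + x) \<partial>lborel)"
  using lborel_integral_real_affine[of 1 "\<lambda>x. indicator {p..b + p} x *\<^sub>R g x" p] by simp
 also have "\<dots> = (\<integral>x. indicator {0..b} x *\<^sub>R g x \<partial>lborel)"
  using per by (intro bochner_cong) (auto simp: indicator_def add.commute)
 finally have 1: "(\<integral>x. indicator {0..p} x *\<^sub>R g (a + x) \<partial>lborel) =
   (\<integral>x. indicator {b..<p} x *\<^sub>R g x \<partial>lborel) + (\<integral>x. indicator {0..b} x *\<^sub>R g x \<partial>lborel)" .
 have "(\<integral>x. indicator {0..p} x *\<^sub>R g x \<partial>lborel) = (\<integral>x. indicator {b..<p} x *\<^sub>R g x + indicator {0..b} x *\<^sub>R g x \<partial>lborel)"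
 proof (rule integral_cong_AE)
  show "AE x in lborel. indicator {0..p} x *\<^sub>R g x = indicator {b..<p} x *\<^sub>R g x + indicator {0..b} x *\<^sub>R g x"
   using AE_lborel_singleton[of p] AE_lborel_singleton[of b]
   by eventually_elim (use b in \<open>auto simp: indicator_def\<close>)
 qed measurable
 also have "\<dots> = (\<integral>x. indicator {b..<p} x *\<^sub>R g x \<partial>lborel) + (\<integral>x. indicator {0..b} x *\<^sub>R g x \<partial>lborel)"
  using b by (intro Bochner_Integration.integral_add i) auto
 finally show ?thesis using 1 by simp
qed

lemma continuous_on_moebius:
 assumes "s \<in> SL2R"
 shows "continuous_on uhp (moebius s)"
 unfolding moebius_def[abs_def] using den_nz[OF assms]
 by (intro continuous_intros) (auto simp: den_def)

lemma bounded_on_compacts_moebius: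
 assumes h: "bounded_on_compacts h" and s: "s \<in> SL2R"
 shows "bounded_on_compacts (\<lambda>w. h (moebius s w))"
 unfolding bounded_on_compacts_def
proof (intro allI impI)
 fix K assume K: "compact K" "K \<subseteq> uhp"
 have "compact (moebius s ` K)" "moebius s ` K \<subseteq> uhp"
  using K s continuous_on_subset[OF continuous_on_moebius[OF s]] by (auto intro: compact_continuous_image)
 from bounded_on_compactsD[OF h this] show "\<exists>B. \<forall>w\<in>K. cmod (h (moebius s w)) \<le> B" by blast
qed

lemma set_borel_measurable_moebius:
 fixes h :: "complex \<Rightarrow> complex"
 assumes m: "uhp_measurable h" and s: "s \<in> SL2R"
 shows "uhp_measurable (\<lambda>w. h (moebius s w))"
proof -
 have "(\<lambda>w. indicator uhp w *\<^sub>R h (moebius s w)) = (\<lambda>w. indicator uhp w *\<^sub>R (indicator uhp (moebius s w) *\<^sub>R h (moebius s w)))"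
  using moebius_uhp[OF s] by (auto simp: fun_eq_iff indicator_def)
 moreover have "(\<lambda>w. indicator uhp (moebius s w) *\<^sub>R h (moebius s w)) \<in> borel_measurable borel"
  using measurable_compose[OF moebius_measurable[of s], of "\<lambda>w. indicator uhp w *\<^sub>R h w" borel] m by (simp add: set_borel_measurable_def)
 moreover have "(indicator uhp :: complex \<Rightarrow> real) \<in> borel_measurable borel" by measurable
 ultimately show ?thesis unfolding set_borel_measurable_def by (simp only: borel_measurable_scaleR)
qed

context modular_domain
begin

lemma conv_invariant:
 assumes k: "point_pair k" and m: "uhp_measurable h" and i: "invariant h"
 shows "invariant (conv k h)"
 unfolding invariant_def
proof (intro ballI)
 fix g z assume g: "g \<in> \<Gamma>" and z: "z \<in> uhp"
 show "conv k h (moebius g z) = conv k h z"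
  unfolding conv_moebius[OF k m \<Gamma>_SL2R[OF g] z] by (rule conv_cong[OF k z]) (rule invariantD[OF i g])
qed

text \<open>Young's inequality on the quotient: bound the average by the integral of |k| |h|, use
  mass transport to restrict the variable of \<open>h\<close> to \<open>F\<close>, and integrate |k|
  over the other variable.\<close>

lemma conv_L1:
 assumes k: "point_pair k" and m: "uhp_measurable h" and i: "invariant h"
  and b: "bounded_on_compacts h" and int: "set_integrable \<mu> F h"
 shows "set_integrable \<mu> F (conv k h)"
  "L1 (conv k h) \<le> enn2real (mass k) * L1 h"
proof -
 define h' where "h' = (\<lambda>w. indicator uhp w *\<^sub>R h w)"
 have [measurable]: "h' \<in> borel_measurable borel" using m by (simp add: h'_def set_borel_measurable_def)
 note [measurable] = point_pairD(1)[OF k] point_pair_measurable[OF k] conv_measurable[OF k m]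
 have Fh: "indicator F w *\<^sub>R h w = indicator F w *\<^sub>R h' w" for w using F_uhp by (auto simp: h'_def indicator_def)
 have "(\<integral>\<^sup>+z. ennreal (norm (indicator F z *\<^sub>R conv k h z)) \<partial>\<mu>) \<le>
   (\<integral>\<^sup>+z. \<integral>\<^sup>+w. indicator F z * (ennreal \<bar>k z w\<bar> * ennreal (cmod (h' w))) \<partial>\<mu> \<partial>\<mu>)"
 proof (rule nn_integral_mono)
  fix z
  show "ennreal (norm (indicator F z *\<^sub>R conv k h z)) \<le> (\<integral>\<^sup>+w. indicator F z * (ennreal \<bar>k z w\<bar> * ennreal (cmod (h' w))) \<partial>\<mu>)"
  proof (cases "z \<in> F")
   case True
   then have z: "z \<in> uhp" using F_uhp by auto
   obtain B where B: "\<forall>w\<in>uhp. hyp_dist z w < 1 \<longrightarrow> cmod (h w) \<le> B" using bounded_near[OF b z] by blast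
   have "ennreal (norm (conv k h z)) \<le> (\<integral>\<^sup>+w. ennreal (norm (k z w *\<^sub>R (indicator uhp w *\<^sub>R h w))) \<partial>\<mu>)"
    unfolding conv_def by (rule integral_norm_bound_ennreal[OF conv_integrable(1)[OF k m z B]])
   then show ?thesis using True by (simp add: h'_def ennreal_mult[symmetric] abs_mult mult.assoc)
  qed simp
 qed
 also have "\<dots> = (\<integral>\<^sup>+z. \<integral>\<^sup>+w. indicator F w * (ennreal \<bar>k z w\<bar> * ennreal (cmod (h' w))) \<partial>\<mu> \<partial>\<mu>)"
 proof -
  have "(\<lambda>p. ennreal \<bar>k (fst p) (snd p)\<bar> * ennreal (cmod (h' (snd p)))) \<in> borel_measurable (borel \<Otimes>\<^sub>M borel)" by measurable
  from mass_transport_nn[OF this] show ?thesis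
   using point_pairD(2)[OF k] \<Gamma>_SL2R invariantD[OF i] by (simp add: h'_def moebius_uhp)
 qed
 also have "\<dots> = (\<integral>\<^sup>+w. \<integral>\<^sup>+z. indicator F w * (ennreal \<bar>k z w\<bar> * ennreal (cmod (h' w))) \<partial>\<mu> \<partial>\<mu>)"
 proof (rule hyp_pair.Fubini')
  have "(\<lambda>p. indicator F (snd p) * (ennreal \<bar>k (fst p) (snd p)\<bar> * ennreal (cmod (h' (snd p))))) \<in> borel_measurable (borel \<Otimes>\<^sub>M borel)"
   by measurable
  from pair_hyp_measurable[OF this]
  show "(\<lambda>(w, z). indicator F w * (ennreal \<bar>k z w\<bar> * ennreal (cmod (h' w)))) \<in> borel_measurable (\<mu> \<Otimes>\<^sub>M \<mu>)"
   using measurable_pair_swap[of "\<lambda>p. indicator F (snd p) * (ennreal \<bar>k (fst p) (snd p)\<bar> * ennreal (cmod (h' (snd p))))" \<mu> \<mu> borel]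
   by (simp add: split_beta')
 qed
 also have "\<dots> = (\<integral>\<^sup>+w. ennreal (norm (indicator F w *\<^sub>R h w)) * mass k \<partial>\<mu>)"
 proof (rule nn_integral_cong)
  fix w
  have "(\<integral>\<^sup>+z. indicator F w * (ennreal \<bar>k z w\<bar> * ennreal (cmod (h' w))) \<partial>\<mu>) =
    (indicator F w * ennreal (cmod (h' w))) * (\<integral>\<^sup>+z. ennreal \<bar>k z w\<bar> \<partial>\<mu>)"
   by (subst nn_integral_cmult[symmetric]) (auto simp: mult_ac)
  also have "\<dots> = ennreal (norm (indicator F w *\<^sub>R h w)) * mass k"
   using mass_eq(2)[OF k, of w] F_uhp by (cases "w \<in> F") (auto simp: h'_def)
  finally show "(\<integral>\<^sup>+z. indicator F w * (ennreal \<bar>k z w\<bar> * ennreal (cmod (h' w))) \<partial>\<mu>) = ennreal (norm (indicator F w *\<^sub>R h w)) * mass k" .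
 qed
 also have "\<dots> = (\<integral>\<^sup>+w. ennreal (norm (indicator F w *\<^sub>R h w)) \<partial>\<mu>) * mass k"
 proof (rule nn_integral_multc)
  have "(\<lambda>w. ennreal (norm (indicator F w *\<^sub>R h' w))) \<in> borel_measurable \<mu>" by measurable
  then show "(\<lambda>w. ennreal (norm (indicator F w *\<^sub>R h w))) \<in> borel_measurable \<mu>" unfolding Fh .
 qed
 also have "(\<integral>\<^sup>+w. ennreal (norm (indicator F w *\<^sub>R h w)) \<partial>\<mu>) = ennreal (\<integral>w. norm (indicator F w *\<^sub>R h w) \<partial>\<mu>)"
  using int unfolding set_integrable_def by (intro nn_integral_eq_integral integrable_norm) auto
 also have "\<dots> * mass k = ennreal (enn2real (mass k) * L1 h)"
 proof -
  have "mass k = ennreal (enn2real (mass k))" using mass_finite[OF k] by simp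
  then have "ennreal (\<integral>w. norm (indicator F w *\<^sub>R h w) \<partial>\<mu>) * mass k = ennreal ((\<integral>w. norm (indicator F w *\<^sub>R h w) \<partial>\<mu>) * enn2real (mass k))"
   by (metis ennreal_mult enn2real_nonneg integral_nonneg_AE AE_I2 norm_ge_zero)
  then show ?thesis by (simp add: set_lebesgue_integral_def mult.commute)
 qed
 finally have le: "(\<integral>\<^sup>+z. ennreal (norm (indicator F z *\<^sub>R conv k h z)) \<partial>\<mu>) \<le>
   ennreal (enn2real (mass k) * L1 h)" .
 show 1: "set_integrable \<mu> F (conv k h)"
  unfolding set_integrable_def
  by (rule integrableI_bounded) (use le in \<open>auto intro: order.strict_trans1[OF _ ennreal_less_top]\<close>)
 have "ennreal (\<integral>z. norm (indicator F z *\<^sub>R conv k h z) \<partial>\<mu>) \<le> ennreal (enn2real (mass k) * L1 h)"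
  using le nn_integral_eq_integral[OF integrable_norm[OF 1[unfolded set_integrable_def]]] by simp
 moreover have "enn2real (mass k) * L1 h \<ge> 0"
  unfolding set_lebesgue_integral_def by (intro mult_nonneg_nonneg enn2real_nonneg integral_nonneg_AE) auto
 ultimately have "(\<integral>z. norm (indicator F z *\<^sub>R conv k h z) \<partial>\<mu>) \<le> enn2real (mass k) * L1 h"
  by (simp only: ennreal_le_iff)
 then show "L1 (conv k h) \<le> enn2real (mass k) * L1 h"
  by (simp add: set_lebesgue_integral_def)
qed

lemma periodic_cusp:
 assumes i: "invariant h" and s: "s \<in> SL2Z" and w: "w \<in> uhp"
 shows "h (moebius s (w + of_real (real N))) = h (moebius s w)"
proof -
 have sR: "s \<in> SL2R" using s by (simp add: SL2Z_iff)
 define g where "g = s ** translation (real N) ** matrix_inv s"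
 have g: "g \<in> \<Gamma>" using cusp_period_N[OF s] by (simp add: cusp_period_iff g_def)
 have "moebius g (moebius s w) = moebius (g ** s) w" using moebius_mult[OF \<Gamma>_SL2R[OF g] sR w] by simp
 also have "g ** s = s ** translation (real N)" unfolding g_def by (rule SL2R_cancel(3)[OF sR])
 also have "moebius (s ** translation (real N)) w = moebius s (w + of_real (real N))"
  using moebius_mult[OF sR translation_SL2R w, of "real N"] by simp
 finally show ?thesis using invariantD[OF i g moebius_uhp[OF sR w]] by simp
qed

text \<open>Averaging commutes with translations, so a horocyclic mean of the average is an average
  of horocyclic means of \<open>h\<close>, taken at heights at least y / 3. For y > 6 these exceed
  2.\<close>

lemma conv_test_function:
 assumes k: "point_pair k" and h: "test_function 2 h" and b: "bounded_on_compacts h"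
 shows "test_function 6 (conv k h)"
proof -
 have m: "uhp_measurable h" and i: "invariant h" and int: "set_integrable \<mu> F h"
  and cusp: "\<And>s. s \<in> SL2Z \<Longrightarrow> AE y in lborel. y > 2 \<longrightarrow> set_lebesgue_integral lborel {0..real N} (\<lambda>x. h (moebius s (Complex x y))) = 0"
  using h by (auto simp: test_function_def)
 have "set_lebesgue_integral lborel {0..real N} (\<lambda>x. conv k h (moebius s (Complex x y))) = 0" if s: "s \<in> SL2Z" and y: "y > 6" for s y
 proof -
  have sR: "s \<in> SL2R" using s by (simp add: SL2Z_iff)
  define H where "H = (\<lambda>w. indicator uhp w *\<^sub>R h (moebius s w))"
  have Hm [measurable]: "H \<in> borel_measurable borel"
   using set_borel_measurable_moebius[OF m sR] by (simp add: H_def set_borel_measurable_def)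
  have Hs: "uhp_measurable H" unfolding set_borel_measurable_def by measurable
  define z0 where "z0 = Complex 0 y"
  have z0: "z0 \<in> uhp" using y by (simp add: z0_def uhp_iff)
  note [measurable] = point_pair_measurable[OF k]
  \<comment> \<open>Contains all points w + x with w within reach of \<open>z0\<close> and 0 <= x <=
    N, so that \<open>h\<close> is bounded on all that enters the double integral.\<close>
  define K where "K = cbox (Complex (- 2 * y) (y / 3)) (Complex (2 * y + real N) (3 * y))"
  have Ki: "w \<in> K \<longleftrightarrow> - 2 * y \<le> Re w \<and> Re w \<le> 2 * y + real N \<and> y / 3 \<le> Im w \<and> Im w \<le> 3 * y" for w
   by (auto simp: K_def cbox_def Basis_complex_def inner_complex_def)
  have "compact K" "K \<subseteq> uhp" using y by (auto simp: K_def[symmetric] Ki uhp_iff) (simp add: K_def)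
  from bounded_on_compactsD[OF bounded_on_compacts_moebius[OF b sR] this]
  obtain B where B: "\<forall>w\<in>K. cmod (h (moebius s w)) \<le> B" by blast
  have near: "w + of_real x \<in> K" "Im w > 2" if "w \<in> uhp" "k z0 w \<noteq> 0" "x \<in> {0..real N}" for w x
   using hyp_dist_less_1[OF z0 that(1) point_pairD(4)[OF k z0 that(1,2)]] that(3) y
   by (auto simp: Ki z0_def)
  have HB: "cmod (k z0 w *\<^sub>R (indicator uhp w *\<^sub>R H (w + of_real x))) \<le> \<bar>k z0 w\<bar> * \<bar>B\<bar>" if x: "x \<in> {0..real N}" for w x
  proof (cases "w \<in> uhp \<and> k z0 w \<noteq> 0")
   case True
   then have "w + of_real x \<in> K" using near x by blast
   then have "cmod (H (w + of_real x)) \<le> \<bar>B\<bar>" using B True by (auto simp: H_def uhp_iff)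
   then show ?thesis using True by (simp add: mult_left_mono)
  qed auto
  have c: "conv k h (moebius s (Complex x y)) = (\<integral>w. k z0 w *\<^sub>R (indicator uhp w *\<^sub>R H (w + of_real x)) \<partial>\<mu>)" for x
  proof -
   have xu: "Complex x y \<in> uhp" using y by (simp add: uhp_iff)
   have "conv k h (moebius s (Complex x y)) = conv k (\<lambda>w. h (moebius s w)) (Complex x y)" by (rule conv_moebius[OF k m sR xu])
   also have "\<dots> = conv k H (Complex x y)" by (rule conv_cong[OF k xu]) (simp add: H_def)
   also have "\<dots> = conv k H (moebius (translation x) z0)"
    by (rule arg_cong[of _ _ "conv k H"]) (simp add: z0_def complex_eq_iff)
   also have "\<dots> = conv k (\<lambda>w. H (moebius (translation x) w)) z0"
    by (rule conv_moebius[OF k Hs translation_SL2R z0])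
   finally show ?thesis by (simp add: conv_def)
  qed
  define f where "f = (\<lambda>p. indicator {0..real N} (fst p) *\<^sub>R (k z0 (snd p) *\<^sub>R (indicator uhp (snd p) *\<^sub>R H (snd p + of_real (fst p)))))"
  interpret P: pair_sigma_finite lborel \<mu> ..
  have km: "(\<lambda>w. \<bar>k z0 w\<bar>) \<in> borel_measurable \<mu>" "integrable \<mu> (\<lambda>w. \<bar>k z0 w\<bar>)"
   using conv_integrable(3)[OF k Hs z0] bounded_near[OF b z0] by simp_all (metis (no_types) conv_integrable(3) bounded_near k m b z0)
  have fm: "f \<in> borel_measurable (lborel \<Otimes>\<^sub>M \<mu>)"
   unfolding f_def using measurable_compose[OF measurable_snd point_pair_measurable(1)[OF k, of z0]]
   by (simp cong: measurable_cong_sets sets_pair_measure_cong)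
  have f1: "integrable \<mu> (\<lambda>w. f (x, w))" for x
  proof (rule bochner_bound)
   show "integrable \<mu> (\<lambda>w. \<bar>k z0 w\<bar> * \<bar>B\<bar>)" using km(2) by simp
   show "(\<lambda>w. f (x, w)) \<in> borel_measurable \<mu>" unfolding f_def by simp
   show "AE w in \<mu>. norm (f (x, w)) \<le> norm (\<bar>k z0 w\<bar> * \<bar>B\<bar>)"
    using HB[of x] by (intro AE_I2) (auto simp: f_def indicator_def abs_mult)
  qed
  have fI: "integrable (lborel \<Otimes>\<^sub>M \<mu>) f"
  proof (rule P.Fubini_integrable[OF fm])
   show "integrable lborel (\<lambda>x. \<integral>w. norm (f (x, w)) \<partial>\<mu>)"
   proof (rule bochner_bound)
    show "integrable lborel (\<lambda>x. (\<integral>w. \<bar>k z0 w\<bar> * \<bar>B\<bar> \<partial>\<mu>) * indicator {0..real N} x)" by simp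
    show "(\<lambda>x. \<integral>w. norm (f (x, w)) \<partial>\<mu>) \<in> borel_measurable lborel"
     using fm by (intro hyp.borel_measurable_lebesgue_integral) (simp add: split_beta')
    show "AE x in lborel. norm (\<integral>w. norm (f (x, w)) \<partial>\<mu>) \<le> norm ((\<integral>w. \<bar>k z0 w\<bar> * \<bar>B\<bar> \<partial>\<mu>) * indicator {0..real N} x)"
    proof (rule AE_I2)
     fix x
     show "norm (\<integral>w. norm (f (x, w)) \<partial>\<mu>) \<le> norm ((\<integral>w. \<bar>k z0 w\<bar> * \<bar>B\<bar> \<partial>\<mu>) * indicator {0..real N} x)"
     proof (cases "x \<in> {0..real N}")
      case True
      have "(\<integral>w. norm (f (x, w)) \<partial>\<mu>) \<le> (\<integral>w. \<bar>k z0 w\<bar> * \<bar>B\<bar> \<partial>\<mu>)"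
       using km(2) HB[OF True] True by (intro Bochner_Integration.integral_mono integrable_norm f1) (auto simp: f_def)
      moreover have "0 \<le> (\<integral>w. norm (f (x, w)) \<partial>\<mu>)" by (intro integral_nonneg_AE) auto
      ultimately show ?thesis using True by (simp only: real_norm_def) simp
     qed (simp add: f_def)
    qed
   qed
   show "AE x in lborel. integrable \<mu> (\<lambda>w. f (x, w))" using f1 by simp
  qed
  \<comment> \<open>Means of \<open>h\<close> vanish at almost every height, hence on the horocycle
    through almost every w. The integral over x starts at Re w; by periodicity it equals the one
    over [0, N].\<close>
  have inner: "AE w in \<mu>. (\<integral>x. f (x, w) \<partial>lborel) = 0"
   using AE_Im[OF cusp[OF s]] AE_uhp
  proof eventually_elim
   case (elim w)
   show ?case
   proof (cases "k z0 w = 0")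
    case False
    have "Im w > 2" using near(2)[OF elim(2) False, of 0] by simp
    then have zero: "set_lebesgue_integral lborel {0..real N} (\<lambda>x. h (moebius s (Complex x (Im w)))) = 0" and y0: "Im w > 0"
     using elim by auto
    define g where "g = (\<lambda>x. H (Complex x (Im w)))"
    have gm: "g \<in> borel_measurable borel" unfolding g_def by measurable
    have gH: "g x = h (moebius s (Complex x (Im w)))" for x using y0 by (simp add: g_def H_def uhp_iff)
    have gper: "g (x + real N) = g x" for x
    proof -
     have "Complex x (Im w) \<in> uhp" using y0 by (simp add: uhp_iff)
     moreover have "Complex (x + real N) (Im w) = Complex x (Im w) + of_real (real N)" by (simp add: complex_eq_iff)
     ultimately show ?thesis unfolding gH using periodic_cusp[OF i s] by metis
    qed
    have "compact (cbox (Complex 0 (Im w)) (Complex (real N) (Im w)))" "cbox (Complex 0 (Im w)) (Complex (real N) (Im w)) \<subseteq> uhp"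
     using y0 by (simp, auto simp: cbox_def Basis_complex_def inner_complex_def uhp_iff)
    from bounded_on_compactsD[OF bounded_on_compacts_moebius[OF b sR] this]
    obtain B' where B': "\<forall>v\<in>cbox (Complex 0 (Im w)) (Complex (real N) (Im w)). cmod (h (moebius s v)) \<le> B'" by blast
    have gb: "cmod (g x) \<le> B'" for x
    proof -
     define x' where "x' = x - of_int \<lfloor>x / real N\<rfloor> * real N"
     have N0: "real N > 0" using N by simp
     have x': "0 \<le> x'" "x' \<le> real N"
      using floor_divide_lower[OF N0, of x] floor_divide_upper[OF N0, of x] by (simp_all add: x'_def algebra_simps)
     have "g x = g x'" using periodic_int[of g "real N" x' "\<lfloor>x / real N\<rfloor>", OF gper] by (simp add: x'_def)
     moreover have "Complex x' (Im w) \<in> cbox (Complex 0 (Im w)) (Complex (real N) (Im w))"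
      using x' by (auto simp: cbox_def Basis_complex_def inner_complex_def)
     ultimately show ?thesis using B' by (simp add: gH)
    qed
    have "(\<integral>x. f (x, w) \<partial>lborel) = (\<integral>x. k z0 w *\<^sub>R (indicator {0..real N} x *\<^sub>R g (Re w + x)) \<partial>lborel)"
    proof (rule bochner_cong[OF refl])
     fix x
     have "w + of_real x = Complex (Re w + x) (Im w)" by (simp add: complex_eq_iff)
     then show "f (x, w) = k z0 w *\<^sub>R (indicator {0..real N} x *\<^sub>R g (Re w + x))"
      using elim(2) by (simp add: f_def g_def)
    qed
    also have "\<dots> = k z0 w *\<^sub>R (\<integral>x. indicator {0..real N} x *\<^sub>R g (Re w + x) \<partial>lborel)" by (rule integral_scaleR_right)
    also have "(\<integral>x. indicator {0..real N} x *\<^sub>R g (Re w + x) \<partial>lborel) = (\<integral>x. indicator {0..real N} x *\<^sub>R g x \<partial>lborel)"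
     by (rule periodic_integral_shift[OF gm _ gper gb]) (use N in simp)
    also have "\<dots> = 0" using zero unfolding set_lebesgue_integral_def gH .
    finally show ?thesis by simp
   qed (simp add: f_def)
  qed
  have "set_lebesgue_integral lborel {0..real N} (\<lambda>x. conv k h (moebius s (Complex x y))) = (\<integral>x. \<integral>w. f (x, w) \<partial>\<mu> \<partial>lborel)"
   unfolding set_lebesgue_integral_def c f_def fst_conv snd_conv integral_scaleR_right ..
  also have "\<dots> = (\<integral>w. \<integral>x. f (x, w) \<partial>lborel \<partial>\<mu>)"
   using P.Fubini_integral[of "\<lambda>x w. f (x, w)"] fI by (simp add: split_beta')
  also have "\<dots> = 0" using inner by (rule integral_eq_zero_AE)
  finally show ?thesis .
 qed
 moreover have "uhp_measurable (conv k h)"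
  unfolding set_borel_measurable_def using conv_measurable[OF k m] by measurable
 ultimately show ?thesis
  using conv_invariant[OF k m i] conv_L1(1)[OF k m i b int] unfolding test_function_def by auto
qed

text \<open>By the last hypothesis the indicator is constant on each horocycle above height 2, so it
  does not disturb the vanishing of the means.\<close>

lemma test_function_indicator:
 assumes h: "test_function 2 h" and S [measurable]: "S \<in> sets borel"
  and inv: "\<And>g z. g \<in> \<Gamma> \<Longrightarrow> z \<in> uhp \<Longrightarrow> moebius g z \<in> S \<longleftrightarrow> z \<in> S"
  and Q: "\<And>s. s \<in> SL2Z \<Longrightarrow> \<exists>Q. \<forall>w. Im w > 2 \<longrightarrow> (moebius s w \<in> S \<longleftrightarrow> Q (Im w))"
 shows "test_function 2 (\<lambda>z. indicator S z *\<^sub>R h z)"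
proof -
 have m: "uhp_measurable h" and i: "invariant h" and int: "set_integrable \<mu> F h"
  and cusp: "\<And>s. s \<in> SL2Z \<Longrightarrow> AE y in lborel. y > 2 \<longrightarrow> set_lebesgue_integral lborel {0..real N} (\<lambda>x. h (moebius s (Complex x y))) = 0"
  using h by (auto simp: test_function_def)
 have hm [measurable]: "(\<lambda>z. indicator uhp z *\<^sub>R h z) \<in> borel_measurable borel" using m by (simp add: set_borel_measurable_def)
 have "(\<lambda>z. indicator S z *\<^sub>R (indicator uhp z *\<^sub>R h z)) \<in> borel_measurable borel" by measurable
 then have 1: "uhp_measurable (\<lambda>z. indicator S z *\<^sub>R h z)"
  by (simp add: set_borel_measurable_def mult.commute)
 have 2: "invariant (\<lambda>z. indicator S z *\<^sub>R h z)" using i inv by (simp add: invariant_def indicator_def)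
 have 3: "set_integrable \<mu> F (\<lambda>z. indicator S z *\<^sub>R h z)"
  unfolding set_integrable_def
 proof (rule bochner_bound[OF int[unfolded set_integrable_def]])
  have "(\<lambda>z. indicator S z *\<^sub>R (indicator F z *\<^sub>R h z)) \<in> borel_measurable \<mu>"
   using borel_measurable_integrable[OF int[unfolded set_integrable_def]] by measurable
  then show "(\<lambda>z. indicator F z *\<^sub>R (indicator S z *\<^sub>R h z)) \<in> borel_measurable \<mu>" by (simp add: mult.commute)
  show "AE z in \<mu>. norm (indicator F z *\<^sub>R (indicator S z *\<^sub>R h z)) \<le> norm (indicator F z *\<^sub>R h z)"
   by (intro AE_I2) (auto simp: indicator_def)
 qed
 have 4: "AE y in lborel. y > 2 \<longrightarrow> set_lebesgue_integral lborel {0..real N} (\<lambda>x. indicator S (moebius s (Complex x y)) *\<^sub>R h (moebius s (Complex x y))) = 0"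
  if s: "s \<in> SL2Z" for s
 proof -
  obtain Q where Q: "\<forall>w. Im w > 2 \<longrightarrow> (moebius s w \<in> S \<longleftrightarrow> Q (Im w))" using assms(4)[OF s] by blast
  show ?thesis using cusp[OF s]
  proof eventually_elim
   case (elim y)
   show ?case
   proof
    assume y: "y > 2"
    then have "indicator S (moebius s (Complex x y)) = (if Q y then 1 else 0 :: real)" for x
     using Q by (simp add: indicator_def)
    then show "set_lebesgue_integral lborel {0..real N} (\<lambda>x. indicator S (moebius s (Complex x y)) *\<^sub>R h (moebius s (Complex x y))) = 0"
     using elim y by (simp add: set_lebesgue_integral_def)
   qed
  qed
 qed
 show ?thesis unfolding test_function_def using 1 2 3 4 by blast
qed

lemma test_function_truncated:
 assumes h: "test_function 2 h" and T: "T \<ge> T0"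
 shows "test_function 2 (\<lambda>z. indicator (trunc T) z *\<^sub>R h z)"
  "test_function 2 (\<lambda>z. indicator (- trunc T) z *\<^sub>R h z)"
proof -
 have T1: "T * min_period \<ge> 2" "T > 0" using T0 T by auto
 have Q: "\<forall>w. Im w > 2 \<longrightarrow> (moebius s w \<in> trunc T \<longleftrightarrow> Im w \<le> T * width s)" if "s \<in> SL2Z" for s
  using truncated_siegel[OF that _ T1(1)] by auto
 show "test_function 2 (\<lambda>z. indicator (trunc T) z *\<^sub>R h z)"
  by (rule test_function_indicator[OF h truncated_borel[OF T1(2)] truncated_invariant])
    (use Q in \<open>auto intro!: exI[of _ "\<lambda>y. y \<le> T * width _"]\<close>)
 show "test_function 2 (\<lambda>z. indicator (- trunc T) z *\<^sub>R h z)"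
 proof (rule test_function_indicator[OF h])
  show "- trunc T \<in> sets borel" using truncated_borel[OF T1(2)] by auto
  show "moebius g z \<in> - trunc T \<longleftrightarrow> z \<in> - trunc T" if "g \<in> \<Gamma>" "z \<in> uhp" for g z
   using truncated_invariant[OF that] by auto
  show "\<exists>Q. \<forall>w. Im w > 2 \<longrightarrow> (moebius s w \<in> - trunc T \<longleftrightarrow> Q (Im w))" if "s \<in> SL2Z" for s
   using Q[OF that] by (intro exI[of _ "\<lambda>y. \<not> y \<le> T * width s"]) auto
 qed
qed

lemma test_function_mono: "test_function Y h \<Longrightarrow> Y \<le> Y' \<Longrightarrow> test_function Y' h"
 unfolding test_function_def by (fastforce elim: AE_mp)

lemma truncated_exhausts:
 assumes z: "z \<in> uhp"
 shows "\<forall>\<^sub>F T in at_top. z \<in> trunc T"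
proof -
 obtain s w where s: "s \<in> SL2Z" "w \<in> siegel_set N" "z = moebius s w" and w: "Im w \<ge> 1/2" "0 \<le> Re w" "Re w \<le> real N"
  by (rule siegel_representative[OF z])
 have p: "width s > 0" using width(1)[OF s(1)] min_period(1) by simp
 show ?thesis
  using eventually_ge_at_top[of "max T0 (Im w / width s)"]
 proof eventually_elim
  case (elim T)
  then have "T * min_period \<ge> 2" "Im w \<le> T * width s" using T0 p by (auto simp: divide_le_eq)
  then show ?case using truncated_siegel[OF s(1) w(1)] s(3) by simp
 qed
qed

lemma tail_tendsto_0:
 assumes int: "set_integrable \<mu> F h"
 shows "((\<lambda>T. hyp_int F (\<lambda>z. cmod (indicator (- trunc T) z *\<^sub>R h z))) \<longlongrightarrow> 0) at_top"
proof -
 have hm: "(\<lambda>z. cmod (indicator F z *\<^sub>R h z)) \<in> borel_measurable \<mu>"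
  using borel_measurable_integrable[OF int[unfolded set_integrable_def]] by measurable
 let ?g = "\<lambda>T z. indicator F z *\<^sub>R cmod (indicator (- trunc T) z *\<^sub>R h z)"
 have g: "?g T z = indicator (- trunc T) z * cmod (indicator F z *\<^sub>R h z)" for T z
  by (auto simp: indicator_def)
 \<comment> \<open>The \<open>max\<close> keeps the parameter positive, as the measurability of the
   truncated domain requires; in the limit it makes no difference.\<close>
 have "((\<lambda>n. \<integral>z. indicator (- trunc (max n 1)) z * cmod (indicator F z *\<^sub>R h z) \<partial>\<mu>) \<longlongrightarrow> (\<integral>z. 0 \<partial>\<mu>)) at_top"
 proof (rule integral_dominated_convergence_at_top)
  show "integrable \<mu> (\<lambda>z. cmod (indicator F z *\<^sub>R h z))" using int unfolding set_integrable_def by (rule integrable_norm)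
  have [measurable]: "- trunc (max n 1) \<in> sets borel" for n using truncated_borel[of "max n 1"] by auto
  show "(\<lambda>z. indicator (- trunc (max n 1)) z * cmod (indicator F z *\<^sub>R h z)) \<in> borel_measurable \<mu>" for n
   using hm by measurable
  show "\<forall>\<^sub>F n in at_top. AE z in \<mu>. norm (indicator (- trunc (max n 1)) z * cmod (indicator F z *\<^sub>R h z)) \<le> cmod (indicator F z *\<^sub>R h z)"
   by (intro always_eventually allI AE_I2) (auto simp: indicator_def)
  show "AE z in \<mu>. ((\<lambda>n. indicator (- trunc (max n 1)) z * cmod (indicator F z *\<^sub>R h z)) \<longlongrightarrow> 0) at_top"
   using AE_uhp
  proof eventually_elim
   case (elim z)
   have "\<forall>\<^sub>F n in at_top. indicator (- trunc (max n 1)) z * cmod (indicator F z *\<^sub>R h z) = 0"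
    using truncated_exhausts[OF elim] eventually_ge_at_top[of 1] by eventually_elim (simp add: max_absorb1)
   then show ?case by (rule tendsto_eventually)
  qed
 qed simp
 then have "((\<lambda>n. \<integral>z. indicator (- trunc (max n 1)) z * cmod (indicator F z *\<^sub>R h z) \<partial>\<mu>) \<longlongrightarrow> 0) at_top" by simp
 then show ?thesis
  unfolding set_lebesgue_integral_def g
  by (rule Lim_transform_eventually) (use eventually_ge_at_top[of 1] in \<open>simp, eventually_elim, simp add: max_absorb1\<close>)
qed

end

section \<open>Point-pair operators and the Laplacian\<close>

text \<open>Derivatives along horizontal and vertical lines, without mixed ones: Green's formula on
  a box integrates one coordinate at a time. The values lie in any normed space, so that the
  definition covers both the real bump and the complex kernels.\<close>

definition second_partials :: "(complex \<Rightarrow> 'a :: real_normed_vector) \<Rightarrow> (complex \<Rightarrow> 'a) \<Rightarrow> (complex \<Rightarrow> 'a) \<Rightarrow>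
  (complex \<Rightarrow> 'a) \<Rightarrow> (complex \<Rightarrow> 'a) \<Rightarrow> bool" where
 "second_partials g gx gy gxx gyy \<longleftrightarrow> continuous_on uhp g \<and> continuous_on uhp gx \<and> continuous_on uhp gy \<and>
   continuous_on uhp gxx \<and> continuous_on uhp gyy \<and>
   (\<forall>w\<in>uhp. ((\<lambda>x. g (Complex x (Im w))) has_vector_derivative gx w) (at (Re w)) \<and>
    ((\<lambda>x. gx (Complex x (Im w))) has_vector_derivative gxx w) (at (Re w)) \<and>
    ((\<lambda>y. g (Complex (Re w) y)) has_vector_derivative gy w) (at (Im w)) \<and>
    ((\<lambda>y. gy (Complex (Re w) y)) has_vector_derivative gyy w) (at (Im w)))"

lemma second_partials_compose:
 fixes p :: "complex \<Rightarrow> real" and h :: "real \<Rightarrow> 'a :: real_normed_vector"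
 assumes p: "second_partials p px py pxx pyy"
  and h: "\<And>s. (h has_vector_derivative h' s) (at s)" "\<And>s. (h' has_vector_derivative h'' s) (at s)" "continuous_on UNIV h''"
 shows "second_partials (\<lambda>w. h (p w)) (\<lambda>w. px w *\<^sub>R h' (p w)) (\<lambda>w. py w *\<^sub>R h' (p w))
  (\<lambda>w. px w *\<^sub>R (px w *\<^sub>R h'' (p w)) + pxx w *\<^sub>R h' (p w)) (\<lambda>w. py w *\<^sub>R (py w *\<^sub>R h'' (p w)) + pyy w *\<^sub>R h' (p w))"
proof -
 have ch: "continuous_on UNIV h" "continuous_on UNIV h'"
  using h(1,2) by (auto intro!: continuous_at_imp_continuous_on has_vector_derivative_continuous)
 have c: "continuous_on uhp p" "continuous_on uhp px" "continuous_on uhp py" "continuous_on uhp pxx" "continuous_on uhp pyy"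
  using p by (auto simp: second_partials_def)
 have ct: "continuous_on uhp (\<lambda>w. f (p w))" if "continuous_on UNIV f" for f :: "real \<Rightarrow> 'a"
  using continuous_on_compose2[OF that c(1)] by simp
 have 1: "((\<lambda>s. f (r s)) has_vector_derivative r' *\<^sub>R f') (at s)"
  if "(r has_vector_derivative r') (at s)" "(f has_vector_derivative f') (at (r s))" for f :: "real \<Rightarrow> 'a" and r r' f' s
  using vector_diff_chain_at[OF that] by (simp add: o_def)
 show ?thesis
  unfolding second_partials_def
 proof (intro conjI ballI)
  fix w assume w: "w \<in> uhp"
  have dx: "((\<lambda>x. p (Complex x (Im w))) has_vector_derivative px w) (at (Re w))"
   and dxx: "((\<lambda>x. px (Complex x (Im w))) has_vector_derivative pxx w) (at (Re w))"
   and dy: "((\<lambda>y. p (Complex (Re w) y)) has_vector_derivative py w) (at (Im w))"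
   and dyy: "((\<lambda>y. py (Complex (Re w) y)) has_vector_derivative pyy w) (at (Im w))"
   using p w by (auto simp: second_partials_def)
  show "((\<lambda>x. h (p (Complex x (Im w)))) has_vector_derivative px w *\<^sub>R h' (p w)) (at (Re w))"
   "((\<lambda>y. h (p (Complex (Re w) y))) has_vector_derivative py w *\<^sub>R h' (p w)) (at (Im w))"
   using 1[OF dx, of h "h' (p w)"] 1[OF dy, of h "h' (p w)"] h(1) by simp_all
  show "((\<lambda>x. px (Complex x (Im w)) *\<^sub>R h' (p (Complex x (Im w)))) has_vector_derivative
    px w *\<^sub>R (px w *\<^sub>R h'' (p w)) + pxx w *\<^sub>R h' (p w)) (at (Re w))"
   using has_vector_derivative_scaleR[OF dxx[folded has_real_derivative_iff_has_vector_derivative] 1[OF dx, of h' "h'' (p w)"]] h(2) by simp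
  show "((\<lambda>y. py (Complex (Re w) y) *\<^sub>R h' (p (Complex (Re w) y))) has_vector_derivative
    py w *\<^sub>R (py w *\<^sub>R h'' (p w)) + pyy w *\<^sub>R h' (p w)) (at (Im w))"
   using has_vector_derivative_scaleR[OF dyy[folded has_real_derivative_iff_has_vector_derivative] 1[OF dy, of h' "h'' (p w)"]] h(2) by simp
 qed (intro continuous_intros c ct ch h(3))+
qed

text \<open>Both \<open>coord d X\<close> and \<open>hyp_dist z + 2\<close> have this form.\<close>

definition quot :: "real \<Rightarrow> real \<Rightarrow> real \<Rightarrow> complex \<Rightarrow> real" where
 "quot a b c w = (a + b * Re w + c * (cmod w)\<^sup>2) / Im w"

lemma quot_partials:
 "second_partials (quot a b c) (\<lambda>w. (b + 2 * c * Re w) / Im w) (\<lambda>w. c - (a + b * Re w + c * (Re w)\<^sup>2) / (Im w)\<^sup>2)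
   (\<lambda>w. 2 * c / Im w) (\<lambda>w. 2 * (a + b * Re w + c * (Re w)\<^sup>2) / Im w ^ 3)"
 unfolding second_partials_def quot_def
proof (intro conjI ballI)
 fix w assume "w \<in> uhp"
 then have y: "Im w > 0" by (simp add: uhp_iff)
 show "((\<lambda>x. (a + b * Re (Complex x (Im w)) + c * (cmod (Complex x (Im w)))\<^sup>2) / Im (Complex x (Im w)))
   has_vector_derivative (b + 2 * c * Re w) / Im w) (at (Re w))"
  "((\<lambda>x. (b + 2 * c * Re (Complex x (Im w))) / Im (Complex x (Im w))) has_vector_derivative 2 * c / Im w) (at (Re w))"
  "((\<lambda>y. c - (a + b * Re (Complex (Re w) y) + c * (Re (Complex (Re w) y))\<^sup>2) / (Im (Complex (Re w) y))\<^sup>2)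
   has_vector_derivative 2 * (a + b * Re w + c * (Re w)\<^sup>2) / Im w ^ 3) (at (Im w))"
  "((\<lambda>y. (a + b * Re (Complex (Re w) y) + c * (cmod (Complex (Re w) y))\<^sup>2) / Im (Complex (Re w) y))
   has_vector_derivative c - (a + b * Re w + c * (Re w)\<^sup>2) / (Im w)\<^sup>2) (at (Im w))"
  unfolding has_real_derivative_iff_has_vector_derivative[symmetric] cmod_power2 complex.sel
  using y by (auto intro!: derivative_eq_intros simp: field_simps power2_eq_square power3_eq_cube)
qed (auto intro!: continuous_intros simp: uhp_iff)

text \<open>For q of this form y^2 times the Euclidean Laplacian of q is 2 q, and y^2 times the
  squared gradient is q^2 + b^2 - 4 a c. Hence the Laplacian of h(q) is again a function of
  q.\<close>

lemma quot_compose: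
 fixes h :: "real \<Rightarrow> 'a :: real_normed_vector"
 assumes h: "\<And>s. (h has_vector_derivative h' s) (at s)" "\<And>s. (h' has_vector_derivative h'' s) (at s)" "continuous_on UNIV h''"
 obtains gx gy gxx gyy where "second_partials (\<lambda>w. h (quot a b c w)) gx gy gxx gyy"
  "\<And>w. h' (quot a b c w) = 0 \<Longrightarrow> gx w = 0 \<and> gy w = 0"
  "\<And>w. w \<in> uhp \<Longrightarrow> (Im w)\<^sup>2 *\<^sub>R (gxx w + gyy w) =
    (2 * quot a b c w) *\<^sub>R h' (quot a b c w) + ((quot a b c w)\<^sup>2 + b\<^sup>2 - 4 * a * c) *\<^sub>R h'' (quot a b c w)"
proof (rule that[OF second_partials_compose[OF quot_partials h]])
 fix w assume "w \<in> uhp"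
 then have y: "Im w > 0" by (simp add: uhp_iff)
 define x y q where "x = Re w" and "y = Im w" and "q = quot a b c w"
 define r where "r = a + b * x + c * x\<^sup>2"
 have y: "y > 0" using y by (simp add: y_def)
 have q: "q = r / y + c * y"
  using y unfolding q_def quot_def r_def x_def y_def cmod_power2 by (simp add: field_simps power2_eq_square)
 have 1: "y\<^sup>2 * (2 * c / y + 2 * r / y ^ 3) = 2 * q" using y by (simp add: q field_simps power2_eq_square power3_eq_cube)
 have "y\<^sup>2 * (((b + 2 * c * x) / y)\<^sup>2 + (c - r / y\<^sup>2)\<^sup>2) = (b + 2 * c * x)\<^sup>2 + (c * y - r / y)\<^sup>2"
  using y by (simp add: field_simps power2_eq_square)
 also have "\<dots> = (r / y + c * y)\<^sup>2 + ((b + 2 * c * x)\<^sup>2 - 4 * c * r)"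
  using y by (simp add: field_simps power2_eq_square)
 also have "(b + 2 * c * x)\<^sup>2 - 4 * c * r = b\<^sup>2 - 4 * a * c"
  by (simp add: r_def algebra_simps power2_eq_square)
 finally have 2: "y\<^sup>2 * (((b + 2 * c * x) / y)\<^sup>2 + (c - r / y\<^sup>2)\<^sup>2) = q\<^sup>2 + b\<^sup>2 - 4 * a * c" by (simp add: q)
 have comb: "m *\<^sub>R (s *\<^sub>R (s *\<^sub>R H2) + s' *\<^sub>R H1 + (t *\<^sub>R (t *\<^sub>R H2) + t' *\<^sub>R H1)) = (m * (s' + t')) *\<^sub>R H1 + (m * (s\<^sup>2 + t\<^sup>2)) *\<^sub>R H2"
  for m s t s' t' :: real and H1 H2 :: 'a by (simp add: algebra_simps power2_eq_square)
 show "(Im w)\<^sup>2 *\<^sub>R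
    (((b + 2 * c * Re w) / Im w) *\<^sub>R ((b + 2 * c * Re w) / Im w) *\<^sub>R h'' (quot a b c w) + (2 * c / Im w) *\<^sub>R h' (quot a b c w) +
    ((c - (a + b * Re w + c * (Re w)\<^sup>2) / (Im w)\<^sup>2) *\<^sub>R (c - (a + b * Re w + c * (Re w)\<^sup>2) / (Im w)\<^sup>2) *\<^sub>R h'' (quot a b c w) +
     (2 * (a + b * Re w + c * (Re w)\<^sup>2) / Im w ^ 3) *\<^sub>R h' (quot a b c w))) =
    (2 * quot a b c w) *\<^sub>R h' (quot a b c w) + ((quot a b c w)\<^sup>2 + b\<^sup>2 - 4 * a * c) *\<^sub>R h'' (quot a b c w)"
  unfolding comb using 1 2 by (simp add: x_def y_def r_def q_def)
qed simp

section \<open>Integration by parts on boxes\<close>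

lemma integral_box:
 fixes f :: "complex \<Rightarrow> complex" and a b c e :: real
 defines "K \<equiv> cbox (Complex a c) (Complex b e)"
 assumes f: "continuous_on K f"
 shows "integrable lborel (\<lambda>w. indicator K w *\<^sub>R f w)"
  "(\<integral>w. indicator K w *\<^sub>R f w \<partial>lborel) = (\<integral>y. indicator {c..e} y *\<^sub>R (\<integral>x. indicator {a..b} x *\<^sub>R f (Complex x y) \<partial>lborel) \<partial>lborel)"
  "(\<integral>w. indicator K w *\<^sub>R f w \<partial>lborel) = (\<integral>x. indicator {a..b} x *\<^sub>R (\<integral>y. indicator {c..e} y *\<^sub>R f (Complex x y) \<partial>lborel) \<partial>lborel)"
proof -
 let ?G = "\<lambda>w. indicator K w *\<^sub>R f w"
 show 1: "integrable lborel ?G" unfolding K_def using f by (intro borel_integrable_compact) (auto simp: K_def)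
 then have m [measurable]: "?G \<in> borel_measurable borel" using borel_measurable_integrable by force
 have 2: "(\<integral>z. ?G z \<partial>lborel) = (\<integral>p. ?G (Complex (fst p) (snd p)) \<partial>(lborel \<Otimes>\<^sub>M lborel))"
  "integrable lborel ?G \<longleftrightarrow> integrable (lborel \<Otimes>\<^sub>M lborel) (\<lambda>p. ?G (Complex (fst p) (snd p)))"
  using m by (subst lborel_complex_eq, simp add: integral_distr integrable_distr_eq)+
 have K: "indicator K (Complex x y) = indicator {c..e} y * (indicator {a..b} x :: real)" for x y
  by (auto simp: K_def indicator_def cbox_def Basis_complex_def inner_complex_def)
 have "(\<integral>z. ?G z \<partial>lborel) = (\<integral>y. \<integral>x. ?G (Complex x y) \<partial>lborel \<partial>lborel)"
  using lborel_pair.integral_snd[of "\<lambda>x y. ?G (Complex x y)"] 1 2 by (simp add: split_beta')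
 then show "(\<integral>w. ?G w \<partial>lborel) = (\<integral>y. indicator {c..e} y *\<^sub>R (\<integral>x. indicator {a..b} x *\<^sub>R f (Complex x y) \<partial>lborel) \<partial>lborel)"
  unfolding K scaleR_scaleR[symmetric] integral_scaleR_right .
 have "(\<integral>z. ?G z \<partial>lborel) = (\<integral>x. \<integral>y. ?G (Complex x y) \<partial>lborel \<partial>lborel)"
  using lborel_pair.integral_fst'[of "\<lambda>p. ?G (Complex (fst p) (snd p))"] 1 2 by simp
 then show "(\<integral>w. ?G w \<partial>lborel) = (\<integral>x. indicator {a..b} x *\<^sub>R (\<integral>y. indicator {c..e} y *\<^sub>R f (Complex x y) \<partial>lborel) \<partial>lborel)"
  unfolding K mult.commute[of "indicator {c..e} _"] scaleR_scaleR[symmetric] integral_scaleR_right .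
qed

text \<open>Each summand is integrated first along its own coordinate, where the fundamental theorem
  leaves boundary values only, and these are zero.\<close>

lemma box_divergence:
 fixes P Q Px Qy :: "complex \<Rightarrow> complex" and a b c e :: real
 defines "K \<equiv> cbox (Complex a c) (Complex b e)"
 assumes ab: "a \<le> b" "c \<le> e" and cont: "continuous_on K Px" "continuous_on K Qy"
  and dP: "\<And>w. w \<in> K \<Longrightarrow> ((\<lambda>x. P (Complex x (Im w))) has_vector_derivative Px w) (at (Re w))"
  and dQ: "\<And>w. w \<in> K \<Longrightarrow> ((\<lambda>y. Q (Complex (Re w) y)) has_vector_derivative Qy w) (at (Im w))"
  and bP: "\<And>w. w \<in> K \<Longrightarrow> Re w = a \<or> Re w = b \<Longrightarrow> P w = 0"
  and bQ: "\<And>w. w \<in> K \<Longrightarrow> Im w = c \<or> Im w = e \<Longrightarrow> Q w = 0"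
 shows "(\<integral>w. indicator K w *\<^sub>R (Px w + Qy w) \<partial>lborel) = 0"
proof -
 have K: "Complex x y \<in> K \<longleftrightarrow> x \<in> {a..b} \<and> y \<in> {c..e}" for x y
  by (auto simp: K_def cbox_def Basis_complex_def inner_complex_def)
 have cc: "continuous_on {c..e} (\<lambda>y. Complex x y)" "continuous_on {a..b} (\<lambda>x. Complex x y)" for x y
  unfolding Complex_eq by (auto intro!: continuous_intros)
 have Z1: "indicator {c..e} y *\<^sub>R (\<integral>x. indicator {a..b} x *\<^sub>R Px (Complex x y) \<partial>lborel) = 0" for y
 proof (cases "y \<in> {c..e}")
  case True
  have "(\<integral>x. indicator {a..b} x *\<^sub>R Px (Complex x y) \<partial>lborel) = P (Complex b y) - P (Complex a y)"
  proof (rule integral_FTC_atLeastAtMost[OF ab(1)])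
   fix x assume "a \<le> x" "x \<le> b"
   then show "((\<lambda>x. P (Complex x y)) has_vector_derivative Px (Complex x y)) (at x within {a..b})"
    using dP[of "Complex x y"] True by (auto simp: K intro: has_vector_derivative_at_within)
  qed (rule continuous_on_compose2[OF cont(1) cc(2)], use True K in auto)
  then show ?thesis using bP[of "Complex b y"] bP[of "Complex a y"] True ab by (simp add: K)
 qed simp
 have Z2: "indicator {a..b} x *\<^sub>R (\<integral>y. indicator {c..e} y *\<^sub>R Qy (Complex x y) \<partial>lborel) = 0" for x
 proof (cases "x \<in> {a..b}")
  case True
  have "(\<integral>y. indicator {c..e} y *\<^sub>R Qy (Complex x y) \<partial>lborel) = Q (Complex x e) - Q (Complex x c)"
  proof (rule integral_FTC_atLeastAtMost[OF ab(2)])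
   fix y assume "c \<le> y" "y \<le> e"
   then show "((\<lambda>y. Q (Complex x y)) has_vector_derivative Qy (Complex x y)) (at y within {c..e})"
    using dQ[of "Complex x y"] True by (auto simp: K intro: has_vector_derivative_at_within)
  qed (rule continuous_on_compose2[OF cont(2) cc(1)], use True K in auto)
  then show ?thesis using bQ[of "Complex x e"] bQ[of "Complex x c"] True ab by (simp add: K)
 qed simp
 have "(\<integral>w. indicator K w *\<^sub>R Px w \<partial>lborel) = 0" "(\<integral>w. indicator K w *\<^sub>R Qy w \<partial>lborel) = 0"
  unfolding K_def integral_box(2)[OF cont(1)[unfolded K_def]] integral_box(3)[OF cont(2)[unfolded K_def]] Z1 Z2 by simp_all
 then show ?thesis
  unfolding scaleR_add_right K_def
  by (subst Bochner_Integration.integral_add[OF integral_box(1)[OF cont(1)[unfolded K_def]] integral_box(1)[OF cont(2)[unfolded K_def]]]) simp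
qed

text \<open>A radial kernel supported on a disc. The cube is the lowest integral power of the
  positive part that is twice continuously differentiable across the boundary of the disc, as
  Green's formula requires.\<close>

definition bump :: "real \<Rightarrow> complex \<Rightarrow> complex \<Rightarrow> real" where
 "bump t z w = (max 0 (t - hyp_dist z w)) ^ 3"

text \<open>The operator -y^2 (d_x^2 + d_y^2) in w, applied to \<open>bump t z\<close>. By
  \<open>quot_compose\<close> with q = u + 2 and b^2 - 4 a c = -4 it is -2 q k' - (q^2 - 4) k'',
  where q^2 - 4 = u^2 + 4 u, k = m^3, k' = -3 m^2 and k'' = 6 m.\<close>

definition bump_laplacian :: "real \<Rightarrow> complex \<Rightarrow> complex \<Rightarrow> real" where
 "bump_laplacian t z w = (let u = hyp_dist z w; m = max 0 (t - u) in 3 * m\<^sup>2 * (2 * u + 4) - 6 * m * (u\<^sup>2 + 4 * u))"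

lemma point_pair_radial:
 assumes [measurable]: "\<kappa> \<in> borel_measurable borel" and bd: "\<And>u. u \<ge> 0 \<Longrightarrow> \<bar>\<kappa> u\<bar> \<le> M * indicator {..<1} u"
 shows "point_pair (\<lambda>z w. \<kappa> (hyp_dist z w))"
 unfolding point_pair_def
proof (intro conjI ballI allI exI[of _ M])
 show "(\<lambda>p. \<kappa> (hyp_dist (fst p) (snd p))) \<in> borel_measurable (borel \<Otimes>\<^sub>M borel)"
  unfolding hyp_dist_def by measurable
 show "\<bar>\<kappa> (hyp_dist z w)\<bar> \<le> M * indicator {..<1} (hyp_dist z w)" if "z \<in> uhp" "w \<in> uhp" for z w
  using that by (intro bd) (simp add: hyp_dist_def uhp_iff)
qed (simp_all add: hyp_dist_moebius hyp_dist_sym)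

lemma point_pair_bump:
 assumes t: "0 < t" "t \<le> 1"
 shows "point_pair (bump t)" "point_pair (bump_laplacian t)"
proof -
 have m: "max 0 (t - u) \<le> indicator {..<1} u" "max 0 (t - u) \<le> 1" if "u \<ge> 0" for u using t that by (auto simp: indicator_def)
 show "point_pair (bump t)"
  unfolding bump_def[abs_def]
 proof (rule point_pair_radial[where \<kappa> = "\<lambda>u. (max 0 (t - u)) ^ 3" and M = 1])
  fix u :: real assume u: "u \<ge> 0"
  show "\<bar>(max 0 (t - u)) ^ 3\<bar> \<le> 1 * indicator {..<1} u"
   using m[OF u] t by (cases "u < 1") (simp_all add: power_le_one)
 qed measurable
 show "point_pair (bump_laplacian t)"
  unfolding bump_laplacian_def[abs_def]
 \<comment> \<open>The bound is 48 = 3 * 6 + 6 * 5: for u < 1 and m <= 1 one has m^2 (2 u + 4) <= 6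
   and m (u^2 + 4 u) <= 5.\<close>
 proof (rule point_pair_radial[where \<kappa> = "\<lambda>u. let m = max 0 (t - u) in 3 * m\<^sup>2 * (2 * u + 4) - 6 * m * (u\<^sup>2 + 4 * u)" and M = 48, unfolded Let_def] | unfold Let_def)+
  fix u :: real assume u: "u \<ge> 0"
  define n where "n = max 0 (t - u)"
  show "\<bar>3 * (max 0 (t - u))\<^sup>2 * (2 * u + 4) - 6 * max 0 (t - u) * (u\<^sup>2 + 4 * u)\<bar> \<le> 48 * indicator {..<1} u"
  proof (cases "u < 1")
   case True
   have n: "0 \<le> n" "n \<le> 1" "n\<^sup>2 \<le> 1" using m[OF u] by (auto simp: n_def power_le_one)
   have u2: "u\<^sup>2 \<le> 1" using u True by (simp add: power_le_one)
   have "n\<^sup>2 * (2 * u + 4) \<le> 1 * 6" "n * (u\<^sup>2 + 4 * u) \<le> 1 * 5" using n u True u2 by (intro mult_mono; simp)+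
   moreover have "0 \<le> n\<^sup>2 * (2 * u + 4)" "0 \<le> n * (u\<^sup>2 + 4 * u)" using n u by simp_all
   ultimately show ?thesis using True unfolding n_def[symmetric] by simp
  next
   case False
   then show ?thesis using t by simp
  qed
 qed measurable
qed

text \<open>The two sides are glued at 0, where the function is at most s^2 because the exponent is
  at least two.\<close>

lemma max_power_derivative:
 "((\<lambda>x :: real. (max 0 x) ^ Suc (Suc n)) has_real_derivative real (Suc (Suc n)) * (max 0 x) ^ Suc n) (at x)"
proof (cases x "0 :: real" rule: linorder_cases)
 case equal
 have "((\<lambda>x :: real. (max 0 x) ^ Suc (Suc n)) has_vector_derivative 0) (at 0)"
 proof (rule has_vector_derivative_quadratic[of 1 _ _ 1])
  fix s :: real assume s: "\<bar>s\<bar> \<le> 1"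
  have "(max 0 s) ^ Suc (Suc n) = (max 0 s)\<^sup>2 * (max 0 s) ^ n" by (simp add: power2_eq_square)
  also have "\<dots> \<le> s\<^sup>2 * 1" using s by (intro mult_mono power_le_one) (auto simp: max_def)
  finally show "norm ((max 0 s) ^ Suc (Suc n) - (max 0 0) ^ Suc (Suc n) - s *\<^sub>R 0) \<le> 1 * s\<^sup>2" by simp
 qed simp
 then show ?thesis using equal by (simp add: has_real_derivative_iff_has_vector_derivative)
next
 case less
 have "((\<lambda>x. 0) has_real_derivative real (Suc (Suc n)) * (max 0 x) ^ Suc n) (at x)" using less by simp
 moreover have "\<forall>\<^sub>F y in nhds x. (max 0 y) ^ Suc (Suc n) = 0"
  using eventually_nhds_in_open[of "{..<0}" x] less by (auto elim!: eventually_mono)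
 ultimately show ?thesis by (subst DERIV_cong_ev[OF refl _ refl, of _ "\<lambda>x. 0"])
next
 case greater
 have "((\<lambda>x. x ^ Suc (Suc n)) has_real_derivative real (Suc (Suc n)) * (max 0 x) ^ Suc n) (at x)"
  using greater DERIV_pow[of "Suc (Suc n)" x] by simp
 moreover have "\<forall>\<^sub>F y in nhds x. (max 0 y) ^ Suc (Suc n) = y ^ Suc (Suc n)"
  using eventually_nhds_in_open[of "{0<..}" x] greater by (auto elim!: eventually_mono)
 ultimately show ?thesis by (subst DERIV_cong_ev[OF refl _ refl, of _ "\<lambda>x. x ^ Suc (Suc n)"])
qed

text \<open>In w, \<open>hyp_dist z w\<close> + 2 is a \<open>quot\<close> of discriminant -4, and
  the bump is the cube of the positive part of t + 2 - q. The derivative of the cube vanishes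
  outside the disc, and with it the gradient.\<close>

lemma bump_partials:
 assumes z: "z \<in> uhp"
 obtains k kx ky kxx kyy where "second_partials k kx ky kxx kyy"
  "\<And>w. w \<in> uhp \<Longrightarrow> k w = bump t z w"
  "\<And>w. w \<in> uhp \<Longrightarrow> hyp_dist z w \<ge> t \<Longrightarrow> kx w = 0 \<and> ky w = 0"
  "\<And>w. w \<in> uhp \<Longrightarrow> (Im w)\<^sup>2 * (kxx w + kyy w) = - bump_laplacian t z w"
proof -
 define a b c where "a = (cmod z)\<^sup>2 / Im z" and "b = - 2 * Re z / Im z" and "c = 1 / Im z"
 have y: "Im z > 0" using z by (simp add: uhp_iff)
 have q: "quot a b c w = hyp_dist z w + 2" if "w \<in> uhp" for w
  using that y unfolding quot_def a_def b_def c_def hyp_dist_def cmod_power2 uhp_iff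
  by (simp add: field_simps power2_eq_square)
 let ?m = "\<lambda>s. max 0 (t + 2 - s)"
 have d: "((\<lambda>s. (?m s) ^ Suc (Suc n)) has_real_derivative - (real (Suc (Suc n)) * (?m s) ^ Suc n)) (at s)" for s n
 proof -
  have "((\<lambda>s. t + 2 - s) has_real_derivative - 1) (at s)" by (auto intro!: derivative_eq_intros)
  from DERIV_chain2[where f = "\<lambda>x. (max 0 x) ^ Suc (Suc n)", OF max_power_derivative this] show ?thesis by simp
 qed
 have 1: "((\<lambda>s. (?m s) ^ 3) has_vector_derivative - 3 * (?m s)\<^sup>2) (at s)" for s
  using d[of 1 s] by (simp add: has_real_derivative_iff_has_vector_derivative eval_nat_numeral)
 have 2: "((\<lambda>s. - 3 * (?m s)\<^sup>2) has_vector_derivative 6 * ?m s) (at s)" for s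
  using DERIV_cmult[OF d[of 0 s], of "-3"] by (simp add: has_real_derivative_iff_has_vector_derivative eval_nat_numeral)
 have 3: "continuous_on UNIV (\<lambda>s. 6 * ?m s)" by (intro continuous_intros)
 obtain kx ky kxx kyy where k: "second_partials (\<lambda>w. (?m (quot a b c w)) ^ 3) kx ky kxx kyy"
  "\<And>w. - 3 * (?m (quot a b c w))\<^sup>2 = 0 \<Longrightarrow> kx w = 0 \<and> ky w = 0"
  "\<And>w. w \<in> uhp \<Longrightarrow> (Im w)\<^sup>2 *\<^sub>R (kxx w + kyy w) =
    (2 * quot a b c w) *\<^sub>R (- 3 * (?m (quot a b c w))\<^sup>2) + ((quot a b c w)\<^sup>2 + b\<^sup>2 - 4 * a * c) *\<^sub>R (6 * ?m (quot a b c w))"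
  by (rule quot_compose[OF 1 2 3]) (rule that, assumption+)
 have disc: "b\<^sup>2 - 4 * a * c = - 4"
  using y unfolding a_def b_def c_def cmod_power2 by (simp add: field_simps power2_eq_square)
 show ?thesis
 proof (rule that[OF k(1)])
  fix w assume w: "w \<in> uhp"
  note q = q[OF w]
  show "(?m (quot a b c w)) ^ 3 = bump t z w" by (simp add: q bump_def)
  show "kx w = 0 \<and> ky w = 0" if "hyp_dist z w \<ge> t" by (rule k(2)) (use that in \<open>simp add: q\<close>)
  have "4 * a * c = b\<^sup>2 + 4" using disc by simp
  then show "(Im w)\<^sup>2 * (kxx w + kyy w) = - bump_laplacian t z w"
   using k(3)[OF w] by (simp add: q bump_laplacian_def Let_def algebra_simps power2_eq_square)
 qed
qed

lemma conv_lborel: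
 assumes k: "point_pair k" and m: "uhp_measurable h"
 shows "conv k h z = (\<integral>w. (indicator uhp w * (k z w / (Im w)\<^sup>2)) *\<^sub>R h w \<partial>lborel)"
proof -
 note [measurable] = point_pair_measurable[OF k]
 have [measurable]: "(\<lambda>w. indicator uhp w *\<^sub>R h w) \<in> borel_measurable borel"
  using m by (simp add: set_borel_measurable_def)
 have "conv k h z = (\<integral>w. (indicator uhp w / (Im w)\<^sup>2) *\<^sub>R (k z w *\<^sub>R (indicator uhp w *\<^sub>R h w)) \<partial>lborel)"
  unfolding conv_def hyp_measure_def
 proof (rule integral_density)
  have "(\<lambda>w. k z w *\<^sub>R (indicator uhp w *\<^sub>R h w)) \<in> borel_measurable borel" by measurable
  then show "(\<lambda>w. k z w *\<^sub>R (indicator uhp w *\<^sub>R h w)) \<in> borel_measurable lborel" by simp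
 qed auto
 also have "\<dots> = (\<integral>w. (indicator uhp w * (k z w / (Im w)\<^sup>2)) *\<^sub>R h w \<partial>lborel)"
  by (intro bochner_cong refl) (auto simp: indicator_def)
 finally show ?thesis .
qed

lemma continuous_set_borel_measurable:
 "continuous_on uhp h \<Longrightarrow> uhp_measurable (h :: complex \<Rightarrow> complex)"
 unfolding set_borel_measurable_def by (rule borel_measurable_continuous_on_indicator) auto

text \<open>Green's second identity for the bump and g. The factor y^2 of the Laplacian cancels the
  density 1 / y^2, so Euclidean derivatives and Lebesgue measure remain, and the boundary terms
  vanish because the bump and its gradient are zero outside the disc.\<close>

theorem conv_Green:
 fixes g :: "complex \<Rightarrow> complex"
 assumes g: "second_partials g gx gy gxx gyy" and t: "0 < t" "t \<le> 1" and z: "z \<in> uhp"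
 shows "conv (bump t) (\<lambda>w. - ((Im w)\<^sup>2 *\<^sub>R (gxx w + gyy w))) z = conv (bump_laplacian t) g z"
proof -
 obtain k kx ky kxx kyy where k: "second_partials k kx ky kxx kyy"
  "\<And>w. w \<in> uhp \<Longrightarrow> k w = bump t z w"
  "\<And>w. w \<in> uhp \<Longrightarrow> hyp_dist z w \<ge> t \<Longrightarrow> kx w = 0 \<and> ky w = 0"
  "\<And>w. w \<in> uhp \<Longrightarrow> (Im w)\<^sup>2 * (kxx w + kyy w) = - bump_laplacian t z w"
  by (rule bump_partials[OF z]) (rule that, assumption+)
 define y where "y = Im z"
 have y: "y > 0" using z by (simp add: y_def uhp_iff)
 \<comment> \<open>Strictly larger than the box with 2 y, y / 3 and 3 y that contains the disc, so
   that the boundary lies outside the disc.\<close>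
 let ?a = "Re z - 3 * y" and ?b = "Re z + 3 * y" and ?c = "y / 4" and ?e = "4 * y"
 define K where "K = cbox (Complex ?a ?c) (Complex ?b ?e)"
 have Ki: "w \<in> K \<longleftrightarrow> ?a \<le> Re w \<and> Re w \<le> ?b \<and> ?c \<le> Im w \<and> Im w \<le> ?e" for w
  by (auto simp: K_def cbox_def Basis_complex_def inner_complex_def)
 have Ku: "w \<in> uhp" if "w \<in> K" for w using that y by (auto simp: Ki uhp_iff)
 then have KU: "K \<subseteq> uhp" by blast
 have far: "bump t z w = 0 \<and> bump_laplacian t z w = 0 \<and> kx w = 0 \<and> ky w = 0"
  if w: "w \<in> uhp" and o: "w \<notin> K \<or> Re w = ?a \<or> Re w = ?b \<or> Im w = ?c \<or> Im w = ?e" for w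
 proof -
  have "\<not> hyp_dist z w < 1" using hyp_dist_less_1[OF z w] o y by (auto simp: Ki y_def[symmetric])
  then show ?thesis using t k(3)[OF w] by (simp add: bump_def bump_laplacian_def Let_def)
 qed
 have cg: "continuous_on uhp g" "continuous_on uhp gx" "continuous_on uhp gy" "continuous_on uhp gxx" "continuous_on uhp gyy"
  using g by (auto simp: second_partials_def)
 have ck: "continuous_on uhp k" "continuous_on uhp kx" "continuous_on uhp ky" "continuous_on uhp kxx" "continuous_on uhp kyy"
  using k(1) by (auto simp: second_partials_def)
 define L where "L = (\<lambda>w. - ((Im w)\<^sup>2 *\<^sub>R (gxx w + gyy w)))"
 have cL: "continuous_on uhp L" unfolding L_def by (intro continuous_intros cg)
 let ?X = "\<lambda>w. k w *\<^sub>R (gxx w + gyy w)" and ?Y = "\<lambda>w. (kxx w + kyy w) *\<^sub>R g w"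
 have 1: "conv (bump t) L z = (\<integral>w. indicator K w *\<^sub>R (- ?X w) \<partial>lborel)"
  unfolding conv_lborel[OF point_pair_bump(1)[OF t] continuous_set_borel_measurable[OF cL]]
 proof (intro bochner_cong refl)
  fix w
  show "(indicator uhp w * (bump t z w / (Im w)\<^sup>2)) *\<^sub>R L w = indicator K w *\<^sub>R (- ?X w)"
  proof (cases "w \<in> uhp")
   case True
   then have "Im w > 0" by (simp add: uhp_iff)
   then show ?thesis using far[OF True] k(2)[OF True] True by (cases "w \<in> K") (simp_all add: L_def)
  qed (use Ku in \<open>auto simp: indicator_def\<close>)
 qed
 have 2: "conv (bump_laplacian t) g z = (\<integral>w. indicator K w *\<^sub>R (- ?Y w) \<partial>lborel)"
  unfolding conv_lborel[OF point_pair_bump(2)[OF t] continuous_set_borel_measurable[OF cg(1)]]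
 proof (intro bochner_cong refl)
  fix w
  show "(indicator uhp w * (bump_laplacian t z w / (Im w)\<^sup>2)) *\<^sub>R g w = indicator K w *\<^sub>R (- ?Y w)"
  proof (cases "w \<in> uhp")
   case True
   then have "Im w > 0" by (simp add: uhp_iff)
   moreover have e: "bump_laplacian t z w = - ((Im w)\<^sup>2 * (kxx w + kyy w))" using k(4)[OF True] by simp
   ultimately have "bump_laplacian t z w / (Im w)\<^sup>2 = - (kxx w + kyy w)" by simp
   then have q: "(indicator uhp w * (bump_laplacian t z w / (Im w)\<^sup>2)) *\<^sub>R g w = - ?Y w" using True by (simp add: scaleR_diff_left scaleR_add_left)
   show ?thesis
   proof (cases "w \<in> K")
    case False
    then show ?thesis using far[OF True] by simp
   qed (simp only: q indicator_simps scaleR_one)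
  qed (use Ku in \<open>auto simp: indicator_def\<close>)
 qed
 have "(\<integral>w. indicator K w *\<^sub>R ((k w *\<^sub>R gxx w - kxx w *\<^sub>R g w) + (k w *\<^sub>R gyy w - kyy w *\<^sub>R g w)) \<partial>lborel) = 0"
 proof (rule box_divergence[where a = ?a and b = ?b and c = ?c and e = ?e and P = "\<lambda>w. k w *\<^sub>R gx w - kx w *\<^sub>R g w" and Q = "\<lambda>w. k w *\<^sub>R gy w - ky w *\<^sub>R g w", folded K_def])
  show "continuous_on K (\<lambda>w. k w *\<^sub>R gxx w - kxx w *\<^sub>R g w)" "continuous_on K (\<lambda>w. k w *\<^sub>R gyy w - kyy w *\<^sub>R g w)"
   by (intro continuous_intros continuous_on_subset[OF _ KU] ck cg)+
  fix w assume w: "w \<in> K"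
  note u = Ku[OF w]
  note prod = has_vector_derivative_scaleR[unfolded has_real_derivative_iff_has_vector_derivative]
  have G: "((\<lambda>x. g (Complex x (Im w))) has_vector_derivative gx w) (at (Re w))"
    "((\<lambda>x. gx (Complex x (Im w))) has_vector_derivative gxx w) (at (Re w))"
    "((\<lambda>y. g (Complex (Re w) y)) has_vector_derivative gy w) (at (Im w))"
    "((\<lambda>y. gy (Complex (Re w) y)) has_vector_derivative gyy w) (at (Im w))"
   using g u by (auto simp: second_partials_def)
  have H: "((\<lambda>x. k (Complex x (Im w))) has_vector_derivative kx w) (at (Re w))"
    "((\<lambda>x. kx (Complex x (Im w))) has_vector_derivative kxx w) (at (Re w))"
    "((\<lambda>y. k (Complex (Re w) y)) has_vector_derivative ky w) (at (Im w))"
    "((\<lambda>y. ky (Complex (Re w) y)) has_vector_derivative kyy w) (at (Im w))"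
   using k(1) u by (auto simp: second_partials_def)
  show "((\<lambda>x. k (Complex x (Im w)) *\<^sub>R gx (Complex x (Im w)) - kx (Complex x (Im w)) *\<^sub>R g (Complex x (Im w)))
    has_vector_derivative k w *\<^sub>R gxx w - kxx w *\<^sub>R g w) (at (Re w))"
   using has_vector_derivative_diff[OF prod[OF H(1) G(2)] prod[OF H(2) G(1)]] by simp
  show "((\<lambda>y. k (Complex (Re w) y) *\<^sub>R gy (Complex (Re w) y) - ky (Complex (Re w) y) *\<^sub>R g (Complex (Re w) y))
    has_vector_derivative k w *\<^sub>R gyy w - kyy w *\<^sub>R g w) (at (Im w))"
   using has_vector_derivative_diff[OF prod[OF H(3) G(4)] prod[OF H(4) G(3)]] by simp
  show "k w *\<^sub>R gx w - kx w *\<^sub>R g w = 0" if "Re w = ?a \<or> Re w = ?b" using far[OF u] k(2)[OF u] that by auto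
  show "k w *\<^sub>R gy w - ky w *\<^sub>R g w = 0" if "Im w = ?c \<or> Im w = ?e" using far[OF u] k(2)[OF u] that by auto
 qed (use y in auto)
 moreover have "(\<lambda>w. indicator K w *\<^sub>R ((k w *\<^sub>R gxx w - kxx w *\<^sub>R g w) + (k w *\<^sub>R gyy w - kyy w *\<^sub>R g w))) =
   (\<lambda>w. indicator K w *\<^sub>R (- ?Y w) - indicator K w *\<^sub>R (- ?X w))"
  by (auto simp: fun_eq_iff algebra_simps)
 moreover have "integrable lborel (\<lambda>w. indicator K w *\<^sub>R (- ?X w))" "integrable lborel (\<lambda>w. indicator K w *\<^sub>R (- ?Y w))"
  by (intro integral_box(1)[of ?a ?c ?b ?e, folded K_def] continuous_intros continuous_on_subset[OF _ KU] ck cg)+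
 ultimately have "(\<integral>w. indicator K w *\<^sub>R (- ?Y w) \<partial>lborel) - (\<integral>w. indicator K w *\<^sub>R (- ?X w) \<partial>lborel) = 0"
  using Bochner_Integration.integral_diff[of lborel "\<lambda>w. indicator K w *\<^sub>R (- ?Y w)" "\<lambda>w. indicator K w *\<^sub>R (- ?X w)"]
  by (simp only:)
 then show ?thesis unfolding L_def[symmetric] 1 2 by simp
qed

section \<open>Green's formula for eigenfunctions and for Gaussians\<close>

lemma laplace_eigenfunction_partials:
 assumes "laplace_eigenfunction ev f"
 shows "second_partials f (partial_x f) (partial_y f) (partial_x (partial_x f)) (partial_y (partial_y f))"
proof -
 have C1: "C1_uhp f" "C1_uhp (partial_x f)" "C1_uhp (partial_y f)" using assms by (auto simp: laplace_eigenfunction_def)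
 have ou: "open uhp" using open_halfspace_Im_gt[of 0] by (simp add: uhp_def)
 have d: "((\<lambda>x. g (Complex x (Im w))) has_vector_derivative partial_x g w) (at (Re w))"
  "((\<lambda>y. g (Complex (Re w) y)) has_vector_derivative partial_y g w) (at (Im w))"
  if g: "C1_uhp g" and w: "w \<in> uhp" for g w
 proof -
  have dg: "g differentiable (at w)"
   using g w ou differentiable_on_eq_differentiable_at unfolding C1_uhp_def by blast
  have "((\<lambda>t. g (w + e * of_real t)) has_vector_derivative vector_derivative (\<lambda>t. g (w + e * of_real t)) (at 0)) (at 0)" for e
  proof -
   have "(\<lambda>t. w + e * of_real t) differentiable (at (0 :: real))" by (intro derivative_intros)
   then have "(g \<circ> (\<lambda>t. w + e * of_real t)) differentiable (at 0)" by (rule differentiable_chain_at) (use dg in simp)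
   then show ?thesis by (simp add: o_def vector_derivative_works)
  qed
  note 1 = this
  have 2: "((\<lambda>s. G (s - r)) has_vector_derivative G') (at r)" if "(G has_vector_derivative G') (at 0)" for G :: "real \<Rightarrow> complex" and G' r
  proof -
   have "((\<lambda>s. s - r) has_vector_derivative 1) (at r)" by (auto intro!: derivative_eq_intros)
   from vector_diff_chain_at[OF this, of G G'] that show ?thesis by (simp add: o_def)
  qed
  have e: "w + 1 * of_real (s - Re w) = Complex s (Im w)" "w + \<i> * of_real (s - Im w) = Complex (Re w) s" for s
   by (simp_all add: complex_eq_iff)
  show "((\<lambda>x. g (Complex x (Im w))) has_vector_derivative partial_x g w) (at (Re w))"
   using 2[OF 1[of 1], of "Re w"] unfolding e by (simp add: partial_x_def)
  show "((\<lambda>y. g (Complex (Re w) y)) has_vector_derivative partial_y g w) (at (Im w))"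
   using 2[OF 1[of \<i>], of "Im w"] unfolding e by (simp add: partial_y_def)
 qed
 show ?thesis
  unfolding second_partials_def using C1 d differentiable_imp_continuous_on by (auto simp: C1_uhp_def)
qed

lemma conv_eigenfunction:
 assumes f: "laplace_eigenfunction ev f" and t: "0 < t" "t \<le> 1" and z: "z \<in> uhp"
 shows "conv (bump_laplacian t) f z = of_real ev * conv (bump t) f z"
proof -
 have "conv (bump_laplacian t) f z =
   conv (bump t) (\<lambda>w. - ((Im w)\<^sup>2 *\<^sub>R (partial_x (partial_x f) w + partial_y (partial_y f) w))) z"
  by (rule conv_Green[OF laplace_eigenfunction_partials[OF f] t z, symmetric])
 also have "\<dots> = conv (bump t) (\<lambda>w. of_real ev * f w) z"
  by (rule conv_cong[OF point_pair_bump(1)[OF t] z])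
    (use f in \<open>auto simp: laplace_eigenfunction_def hyp_laplacian_def scaleR_conv_of_real\<close>)
 also have "\<dots> = of_real ev * conv (bump t) f z"
  unfolding conv_def integral_mult_right_zero[symmetric] by (simp add: algebra_simps)
 finally show ?thesis .
qed

text \<open>The operator -y^2 (d_x^2 + d_y^2) applied to the Gaussian at p =
  \<open>coord d X w\<close> and a = (X, X). By \<open>quot_compose\<close> with b^2 - 4 a c = -2
  (X, X) it is -2 p G' - (p^2 - 2 a) G'', where G' = -2 B p G and G'' = (4 B^2 p^2 - 2 B) G. Divided
  by 4 B it is the combination of kernels that the derivative of the Kudla-Millson lift
  produces.\<close>

definition gauss_laplacian :: "complex \<Rightarrow> real \<Rightarrow> real \<Rightarrow> real \<Rightarrow> complex" where
 "gauss_laplacian A B p a = of_real (- 4 * B\<^sup>2) * kern 4 0 A B p a + of_real (8 * B\<^sup>2) * kern 2 1 A B p a +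
   (of_real (6 * B) * kern 2 0 A B p a + of_real (- 4 * B) * kern 0 1 A B p a)"

lemma conv_gauss:
 assumes t: "0 < t" "t \<le> 1" and z: "z \<in> uhp" and d: "d > 0" and X: "trace X = 0"
 shows "conv (bump t) (\<lambda>w. gauss_laplacian A B (coord d X w) (bil d X X)) z =
  conv (bump_laplacian t) (\<lambda>w. kern 0 0 A B (coord d X w) (bil d X X)) z"
proof -
 let ?a = "bil d X X"
 define a b c where "a = sqrt d * X$1$2" and "b = 2 * sqrt d * X$1$1" and "c = - sqrt d * X$2$1"
 have q: "coord d X w = quot a b c w" for w
  by (simp add: coord_eq[OF d X] quot_def a_def b_def c_def algebra_simps)
 have disc: "b\<^sup>2 - 4 * a * c = - 2 * ?a"
 proof -
  have "sqrt d * (sqrt d * x) = d * x" for x using d unfolding mult.assoc[symmetric] by simp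
  note sd = this
  show ?thesis by (simp add: sd bil_self[OF X] a_def b_def c_def power2_eq_square algebra_simps)
 qed
 let ?G = "\<lambda>s. gauss A B s ?a"
 have 1: "(?G has_vector_derivative - of_real (2 * B * s) * ?G s) (at s)" for s by (rule gauss_derivative)
 have 2: "((\<lambda>s. - of_real (2 * B * s) * ?G s) has_vector_derivative of_real (4 * B\<^sup>2 * s\<^sup>2 - 2 * B) * ?G s) (at s)" for s
 proof -
  have "((\<lambda>s. - (2 * B * s)) has_real_derivative - (2 * B)) (at s)"
   by (auto intro!: derivative_eq_intros)
  from has_vector_derivative_mult[OF has_vector_derivative_of_real[OF this] 1[of s]]
  show ?thesis by (simp add: o_def algebra_simps power2_eq_square)
 qed
 have "continuous_on UNIV ?G"
  using 1 by (auto intro!: continuous_at_imp_continuous_on has_vector_derivative_continuous)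
 then have 3: "continuous_on UNIV (\<lambda>s. of_real (4 * B\<^sup>2 * s\<^sup>2 - 2 * B) * ?G s)" by (intro continuous_intros)
 obtain gx gy gxx gyy where g: "second_partials (\<lambda>w. ?G (quot a b c w)) gx gy gxx gyy"
  "\<And>w. - of_real (2 * B * quot a b c w) * ?G (quot a b c w) = 0 \<Longrightarrow> gx w = 0 \<and> gy w = 0"
  "\<And>w. w \<in> uhp \<Longrightarrow> (Im w)\<^sup>2 *\<^sub>R (gxx w + gyy w) =
    (2 * quot a b c w) *\<^sub>R (- of_real (2 * B * quot a b c w) * ?G (quot a b c w)) +
    ((quot a b c w)\<^sup>2 + b\<^sup>2 - 4 * a * c) *\<^sub>R (of_real (4 * B\<^sup>2 * (quot a b c w)\<^sup>2 - 2 * B) * ?G (quot a b c w))"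
  by (rule quot_compose[OF 1 2 3]) (rule that, assumption+)
 have "conv (bump t) (\<lambda>w. gauss_laplacian A B (coord d X w) ?a) z = conv (bump t) (\<lambda>w. - ((Im w)\<^sup>2 *\<^sub>R (gxx w + gyy w))) z"
 proof (rule conv_cong[OF point_pair_bump(1)[OF t] z])
  fix w assume w: "w \<in> uhp"
  define p H where "p = quot a b c w" and "H = ?G (quot a b c w)"
  have "b\<^sup>2 - 4 * a * c + p\<^sup>2 = p\<^sup>2 - 2 * ?a" using disc by simp
  then have e: "p\<^sup>2 + b\<^sup>2 - 4 * a * c = p\<^sup>2 - 2 * ?a" by simp
  show "gauss_laplacian A B (coord d X w) ?a = - ((Im w)\<^sup>2 *\<^sub>R (gxx w + gyy w))"
   unfolding g(3)[OF w] q gauss_laplacian_def kern_def H_def[symmetric] p_def[symmetric] e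
   by (simp add: scaleR_conv_of_real algebra_simps power2_eq_square power4_eq_xxxx)
 qed
 also have "\<dots> = conv (bump_laplacian t) (\<lambda>w. ?G (quot a b c w)) z" by (rule conv_Green[OF g(1) t z])
 finally show ?thesis by (simp add: q kern_def)
qed

context theta_setting
begin

text \<open>Fubini for the sum over \<open>C\<close> and the disc: the absolute series is bounded
  near z because the disc stays inside a truncated domain. Green's formula can then be used for each
  X separately, which avoids differentiating the series in z.\<close>

lemma conv_Theta:
 assumes k: "point_pair k" and c: "c > 0" and g: "admissible c K g" and z: "z \<in> uhp"
 shows "conv k (Theta g) z = (\<integral>X. conv k (\<lambda>w. g (coord d X w) (bil d X X)) z \<partial>count_space C)"
proof -
 interpret cs: sigma_finite_measure "count_space C"
  by (rule sigma_finite_measure_count_space_countable[OF C_countable])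
 interpret P: pair_sigma_finite \<mu> "count_space C" ..
 note [measurable] = point_pair_measurable[OF k]
 let ?f = "\<lambda>w X. k z w *\<^sub>R (indicator uhp w *\<^sub>R g (coord d X w) (bil d X X))"
 have s: "integrable (count_space C) (\<lambda>X. g (coord d X w) (bil d X X))"
  "(\<integral>X. g (coord d X w) (bil d X X) \<partial>count_space C) = Theta g w"
  "(\<integral>X. cmod (g (coord d X w) (bil d X X)) \<partial>count_space C) = Theta_abs g w"
  if w: "w \<in> uhp" for w
 proof -
  have 1: "Infinite_Set_Sum.abs_summable_on (\<lambda>X. g (coord d X w) (bil d X X)) C"
   using Theta_summable(1)[OF c g w] by (rule abs_summable_equivalent[THEN iffD1])
  then show "integrable (count_space C) (\<lambda>X. g (coord d X w) (bil d X X))" by (simp add: Infinite_Set_Sum.abs_summable_on_def)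
  show "(\<integral>X. g (coord d X w) (bil d X X) \<partial>count_space C) = Theta g w"
   using infsetsum_infsum[OF 1] by (simp add: Theta_def infsetsum_def)
  have 2: "Infinite_Set_Sum.abs_summable_on (\<lambda>X. cmod (g (coord d X w) (bil d X X))) C"
   using 1 by (simp add: Infinite_Set_Sum.abs_summable_on_norm_iff)
  show "(\<integral>X. cmod (g (coord d X w) (bil d X X)) \<partial>count_space C) = Theta_abs g w"
   using infsetsum_infsum[OF 2] by (simp add: infsetsum_def)
 qed
 have m: "(\<lambda>w. ?f w X) \<in> borel_measurable \<mu>" for X
  using measurable_compose[OF coord_measurable[of d X] admissible_measurable[OF g, of "bil d X X"]] by measurable
 have fm: "case_prod ?f \<in> borel_measurable (\<mu> \<Otimes>\<^sub>M count_space C)"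
  by (rule measurable_pair_count_space[OF C_countable m])
 have mth: "(\<lambda>w. indicator uhp w *\<^sub>R Theta g w) \<in> borel_measurable borel"
  using Theta_measurable[OF c g] by (simp add: set_borel_measurable_def)
 obtain C0 where C0: "C0 > 0" "\<And>g K T z. admissible c K g \<Longrightarrow> T \<ge> T0 \<Longrightarrow> z \<in> trunc T \<Longrightarrow>
  cmod (Theta g z) \<le> C0 * K * T \<and> Theta_abs g z \<le> C0 * K * T"
  by (rule Theta_truncated_bound[OF c]) (rule that, assumption+)
 obtain T where T: "T \<ge> T0" "z \<in> trunc T"
  using eventually_happens[OF eventually_conj[OF truncated_exhausts[OF z] eventually_ge_at_top[of T0]]] by auto
 define B where "B = C0 * K * (3 * T)"
 have T3: "3 * T \<ge> T0" using T T0 by linarith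
 have int: "integrable (\<mu> \<Otimes>\<^sub>M count_space C) (case_prod ?f)"
 proof (rule P.Fubini_integrable[OF fm])
  show "AE w in \<mu>. integrable (count_space C) (\<lambda>X. case_prod ?f (w, X))"
   using AE_uhp by eventually_elim (simp add: s(1))
  have e: "(\<integral>X. norm (case_prod ?f (w, X)) \<partial>count_space C) = \<bar>k z w\<bar> * Theta_abs g w"
   if "w \<in> uhp" for w using that s(3)[OF that] by simp
  have 0: "\<forall>w\<in>uhp. hyp_dist z w < 1 \<longrightarrow> cmod (0 :: complex) \<le> 0" by simp
  have ki: "integrable \<mu> (\<lambda>w. \<bar>k z w\<bar>)"
   by (rule conv_integrable(3)[OF k _ z 0]) (simp add: set_borel_measurable_def)
  show "integrable \<mu> (\<lambda>w. \<integral>X. norm (case_prod ?f (w, X)) \<partial>count_space C)"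
  proof (rule bochner_bound)
   show "integrable \<mu> (\<lambda>w. \<bar>k z w\<bar> * B)" using ki by simp
   show "(\<lambda>w. \<integral>X. norm (case_prod ?f (w, X)) \<partial>count_space C) \<in> borel_measurable \<mu>"
    by (rule cs.borel_measurable_lebesgue_integral) (use measurable_compose[OF fm borel_measurable_norm] in \<open>simp only: split_beta' prod.collapse fst_conv snd_conv\<close>)
   show "AE w in \<mu>. norm (\<integral>X. norm (case_prod ?f (w, X)) \<partial>count_space C) \<le> norm (\<bar>k z w\<bar> * B)"
    using AE_uhp
   proof eventually_elim
    case (elim w)
    have nn: "0 \<le> Theta_abs g w" by (rule infsum_nonneg) simp
    show ?case
    proof (cases "k z w = 0")
     case False
     then have "w \<in> trunc (3 * T)" by (intro truncated_neighbour[OF T(2) elim] point_pairD(4)[OF k z elim])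
     then have "Theta_abs g w \<le> B" using C0(2)[OF g T3] by (simp add: B_def)
     then show ?thesis unfolding e[OF elim] using nn by (simp add: abs_mult mult_left_mono)
    qed simp
   qed
  qed
 qed
 have "conv k (Theta g) z = (\<integral>w. \<integral>X. ?f w X \<partial>count_space C \<partial>\<mu>)"
  unfolding conv_def
 proof (rule integral_cong_AE)
  show "(\<lambda>w. \<integral>X. ?f w X \<partial>count_space C) \<in> borel_measurable \<mu>"
   using fm by (rule cs.borel_measurable_lebesgue_integral)
  show "AE w in \<mu>. k z w *\<^sub>R (indicator uhp w *\<^sub>R Theta g w) = (\<integral>X. ?f w X \<partial>count_space C)"
   using AE_uhp by eventually_elim (simp add: s(2))
 qed (use mth in measurable)
 also have "\<dots> = (\<integral>X. \<integral>w. ?f w X \<partial>\<mu> \<partial>count_space C)"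
  by (rule P.Fubini_integral[OF int, symmetric])
 finally show ?thesis by (simp add: conv_def)
qed

lemma conv_Theta_gauss:
 assumes t: "0 < t" "t \<le> 1" and z: "z \<in> uhp" and c: "c > 0"
  and g: "admissible c K1 (kern 0 0 A B)" "admissible c K2 (gauss_laplacian A B)"
 shows "conv (bump t) (Theta (gauss_laplacian A B)) z = conv (bump_laplacian t) (Theta (kern 0 0 A B)) z"
 unfolding conv_Theta[OF point_pair_bump(1)[OF t] c g(2) z] conv_Theta[OF point_pair_bump(2)[OF t] c g(1) z]
 by (rule bochner_cong) (use conv_gauss[OF t z d] C_trace in auto)

end

section \<open>The Laplacian is symmetric for the pairing\<close>

lemma bump_nonneg: "0 \<le> bump t z w"
 by (simp add: bump_def)

text \<open>If the mass were 0, almost every point would satisfy the closed condition t Im w <= |i -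
  w|^2; then so would i, where it fails.\<close>

lemma bump_mass_pos:
 assumes t: "0 < t" "t \<le> 1"
 shows "0 < enn2real (mass (bump t))"
proof -
 note pp = point_pair_bump(1)[OF t]
 note [measurable] = point_pair_measurable[OF pp]
 have ou: "open uhp" using open_halfspace_Im_gt[of 0] by (simp add: uhp_def)
 have "mass (bump t) \<noteq> 0"
 proof
  assume "mass (bump t) = 0"
  then have "AE w in \<mu>. bump t \<i> w = 0"
   unfolding mass_def by (subst (asm) nn_integral_0_iff_AE) auto
  then have "AE w in lborel. w \<in> uhp \<longrightarrow> bump t \<i> w = 0" unfolding AE_hyp_iff .
  then have "AE w in lborel. w \<in> uhp \<longrightarrow> w \<in> {w. t * Im w \<le> (cmod (\<i> - w))\<^sup>2}"
  proof eventually_elim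
   case (elim w)
   then show ?case by (auto simp: bump_def hyp_dist_def uhp_iff field_simps max_def split: if_splits)
  qed
  then have ae: "AE w\<in>uhp in lebesgue. w \<in> {w. t * Im w \<le> (cmod (\<i> - w))\<^sup>2}" by (rule AE_completion)
  have "closed {w. t * Im w \<le> (cmod (\<i> - w))\<^sup>2}" by (intro closed_Collect_le continuous_intros)
  from mem_closed_if_AE_lebesgue_open[OF ou this ae, of \<i>] t show False by (simp add: uhp_iff)
 qed
 then show ?thesis using mass_finite[OF pp] by (simp add: enn2real_positive_iff zero_less_iff_neq_zero)
qed

lemma conv_diff:
 assumes k: "point_pair k" and h: "uhp_measurable h1" "uhp_measurable h2"
  "bounded_on_compacts h1" "bounded_on_compacts h2" and z: "z \<in> uhp"
 shows "conv k (\<lambda>w. h1 w - h2 w) z = conv k h1 z - conv k h2 z"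
proof -
 have i: "integrable \<mu> (\<lambda>w. k z w *\<^sub>R (indicator uhp w *\<^sub>R h w))"
  if hm: "uhp_measurable h" and hb: "bounded_on_compacts h" for h
 proof -
  obtain B where "\<forall>w\<in>uhp. hyp_dist z w < 1 \<longrightarrow> cmod (h w) \<le> B" using bounded_near[OF hb z] by (elim exE)
  then show ?thesis by (rule conv_integrable(1)[OF k hm z])
 qed
 show ?thesis
  unfolding conv_def scaleR_diff_right by (rule Bochner_Integration.integral_diff[OF i i]) (use h in auto)
qed

text \<open>The normalised average is a mean with nonnegative weights of the values of f on the
  disc, so it deviates from f(z) by no more than the oscillation there.\<close>

lemma conv_bump_deviation:
 assumes t: "0 < t" "t \<le> 1" and z: "z \<in> uhp" and f: "continuous_on uhp f"
  and B: "\<And>w. w \<in> uhp \<Longrightarrow> hyp_dist z w < t \<Longrightarrow> cmod (f w - f z) \<le> B" and B0: "B \<ge> 0"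
 shows "cmod (conv (bump t) f z / of_real (enn2real (mass (bump t))) - f z) \<le> B"
proof -
 note pp = point_pair_bump(1)[OF t]
 note pos = bump_mass_pos[OF t]
 let ?c = "enn2real (mass (bump t))"
 note fm = continuous_set_borel_measurable[OF f]
 have cm: "uhp_measurable (\<lambda>w. f z)" by (intro continuous_set_borel_measurable continuous_intros)
 have "conv (bump t) (\<lambda>w. f z) z = (\<integral>w. \<bar>bump t z w\<bar> *\<^sub>R f z \<partial>\<mu>)"
  unfolding conv_def
 proof (rule integral_cong_AE)
  show "AE w in \<mu>. bump t z w *\<^sub>R (indicator uhp w *\<^sub>R f z) = \<bar>bump t z w\<bar> *\<^sub>R f z"
   using AE_uhp by eventually_elim (simp add: bump_nonneg)
 qed (use point_pair_measurable[OF pp] in measurable)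
 also have "\<dots> = ?c *\<^sub>R f z"
 proof -
  have "\<forall>w\<in>uhp. hyp_dist z w < 1 \<longrightarrow> cmod (f z) \<le> cmod (f z)" by simp
  note i = conv_integrable(3,4)[OF pp cm z this]
  show ?thesis using i by simp
 qed
 finally have c: "conv (bump t) (\<lambda>w. f z) z = of_real ?c * f z" by (simp add: scaleR_conv_of_real)
 \<comment> \<open>The general bound for \<open>conv\<close> looks at the whole disc of parameter 1;
   cutting off by \<open>S\<close> restricts it to the support of the bump without changing the
   integral.\<close>
 define S where "S = {w. hyp_dist z w < t}"
 have [measurable]: "S \<in> sets borel" unfolding S_def hyp_dist_def by measurable
 let ?h = "\<lambda>w. f w - f z"
 have hm: "(\<lambda>w. indicator uhp w *\<^sub>R ?h w) \<in> borel_measurable borel"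
  using continuous_set_borel_measurable[of ?h] f by (simp add: set_borel_measurable_def continuous_intros)
 have "(\<lambda>w. indicator S w *\<^sub>R (indicator uhp w *\<^sub>R ?h w)) \<in> borel_measurable borel"
  using hm by measurable
 then have Sm: "uhp_measurable (\<lambda>w. indicator S w *\<^sub>R ?h w)"
  by (simp add: set_borel_measurable_def mult.commute)
 have "conv (bump t) f z - of_real ?c * f z = conv (bump t) ?h z"
  unfolding c[symmetric]
  by (rule conv_diff[OF pp fm cm _ _ z, symmetric]) (intro continuous_bounded_on_compacts f continuous_intros)+
 also have "\<dots> = conv (bump t) (\<lambda>w. indicator S w *\<^sub>R ?h w) z"
  unfolding conv_def by (intro bochner_cong refl) (auto simp: indicator_def S_def bump_def)
 finally have "cmod (conv (bump t) f z - of_real ?c * f z) \<le> ?c * B"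
  using conv_integrable(2)[OF pp Sm z, of B] B B0 by (simp add: S_def indicator_def)
 moreover have "conv (bump t) f z / of_real ?c - f z = (conv (bump t) f z - of_real ?c * f z) / of_real ?c"
  using pos by (simp add: field_simps)
 ultimately show ?thesis using pos by (simp add: norm_divide field_simps)
qed

lemma conv_bump_tendsto:
 assumes f: "continuous_on uhp f" and z: "z \<in> uhp"
 shows "(\<lambda>n. conv (bump (1 / real (Suc n))) f z / of_real (enn2real (mass (bump (1 / real (Suc n)))))) \<longlonglongrightarrow> f z"
proof (rule LIMSEQ_I)
 fix r :: real assume r: "r > 0"
 have y: "Im z > 0" using z by (simp add: uhp_iff)
 obtain \<delta> where \<delta>: "\<delta> > 0" "\<And>w. w \<in> uhp \<Longrightarrow> dist w z < \<delta> \<Longrightarrow> dist (f w) (f z) < r / 2"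
  using f z r unfolding continuous_on_iff by (metis half_gt_zero)
 \<comment> \<open>For n > b the parameter t = 1 / (n + 1) satisfies 3 t y^2 < \<delta>^2, and |z -
   w|^2 < t y Im w <= 3 t y^2 on the disc.\<close>
 define b where "b = 3 * (Im z)\<^sup>2 / \<delta>\<^sup>2"
 obtain n0 where n0: "real n0 > b" using reals_Archimedean2 by blast
 show "\<exists>no. \<forall>n\<ge>no. norm (conv (bump (1 / real (Suc n))) f z / of_real (enn2real (mass (bump (1 / real (Suc n))))) - f z) < r"
 proof (intro exI[of _ n0] allI impI)
  fix n assume n: "n \<ge> n0"
  define t where "t = 1 / real (Suc n)"
  have t: "0 < t" "t \<le> 1" by (simp_all add: t_def)
  have tb: "t * (3 * (Im z)\<^sup>2) < \<delta>\<^sup>2"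
  proof -
   have "b < real (Suc n)" using n0 n by simp
   then have "3 * (Im z)\<^sup>2 < real (Suc n) * \<delta>\<^sup>2" using \<delta>(1) by (simp add: b_def divide_less_eq)
   then show ?thesis by (simp add: t_def divide_less_eq mult.commute del: of_nat_Suc)
  qed
  have "cmod (conv (bump t) f z / of_real (enn2real (mass (bump t))) - f z) \<le> r / 2"
  proof (rule conv_bump_deviation[OF t z f])
   fix w assume w: "w \<in> uhp" "hyp_dist z w < t"
   have yw: "Im w > 0" "Im w \<le> 3 * Im z" using w t hyp_dist_less_1(1)[OF z w(1)] by (auto simp: uhp_iff)
   have "(cmod (z - w))\<^sup>2 < t * (Im z * Im w)"
    using w(2) y yw by (simp add: hyp_dist_def divide_less_eq)
   also have "\<dots> \<le> t * (3 * (Im z)\<^sup>2)" using t y yw by (intro mult_left_mono) (auto simp: power2_eq_square)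
   also have "\<dots> < \<delta>\<^sup>2" by (rule tb)
   finally have "cmod (z - w) < \<delta>" using \<delta>(1) by (simp add: power_less_imp_less_base)
   then show "cmod (f w - f z) \<le> r / 2"
    using \<delta>(2)[OF w(1)] by (simp add: dist_norm norm_minus_commute)
  qed (use r in simp)
  then show "norm (conv (bump (1 / real (Suc n))) f z / of_real (enn2real (mass (bump (1 / real (Suc n))))) - f z) < r"
   using r by (simp add: t_def)
 qed
qed

text \<open>Radial truncation of a value to the disc of radius R, written with \<open>max\<close> so
  that continuity is evident. It splits a function into a bounded continuous part and a part that is
  small in L^1.\<close>

definition clip :: "real \<Rightarrow> complex \<Rightarrow> complex" where
 "clip R x = x / of_real (max 1 (cmod x / R))"

lemma clip:
 assumes R: "R > 0"
 shows "cmod (clip R x) \<le> R" "cmod (x - clip R x) \<le> cmod x" "cmod x \<le> R \<Longrightarrow> clip R x = x"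
  "continuous_on A (clip R)"
proof -
 define m where "m = max 1 (cmod x / R)"
 have m: "m \<ge> 1" "cmod x \<le> R * m" using R by (auto simp: m_def max_def field_simps)
 have c: "clip R x = of_real (1 / m) * x" by (simp add: clip_def m_def)
 show "cmod (clip R x) \<le> R" unfolding c norm_mult norm_of_real using m R by (simp add: divide_le_eq mult.commute)
 have "x - clip R x = of_real (1 - 1 / m) * x" by (simp add: c algebra_simps)
 moreover have "\<bar>1 - 1 / m\<bar> \<le> 1" using m by auto
 ultimately show "cmod (x - clip R x) \<le> cmod x" by (simp only: norm_mult norm_of_real mult_left_le_one_le norm_ge_zero abs_ge_zero)
 show "cmod x \<le> R \<Longrightarrow> clip R x = x" using R by (simp add: clip_def max_def)
 show "continuous_on A (clip R)"
  unfolding clip_def[abs_def] using R by (intro continuous_intros) (auto simp: max_def)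
qed

context modular_domain
begin

section \<open>Convergence of averages in L^1\<close>

lemma L1_triangle:
 assumes "set_integrable \<mu> F h1" "set_integrable \<mu> F h2"
 shows "L1 (\<lambda>z. h1 z + h2 z) \<le> L1 h1 + L1 h2"
proof -
 note n = set_integrable_norm[OF assms(1)] set_integrable_norm[OF assms(2)]
 have "L1 (\<lambda>z. h1 z + h2 z) \<le> hyp_int F (\<lambda>z. cmod (h1 z) + cmod (h2 z))"
  by (rule set_integral_mono[OF set_integrable_norm[OF set_integral_add(1)[OF assms]] set_integral_add(1)[OF n] norm_triangle_ineq])
 also have "\<dots> = L1 h1 + L1 h2" by (rule set_integral_add(2)[OF n])
 finally show ?thesis .
qed

lemma clip_L1:
 assumes int: "set_integrable \<mu> F f"
 shows "set_integrable \<mu> F (\<lambda>z. f z - clip (real (Suc n)) (f z))"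
  "(\<lambda>n. L1 (\<lambda>z. f z - clip (real (Suc n)) (f z))) \<longlonglongrightarrow> 0"
proof -
 let ?G = "\<lambda>n z. indicator F z *\<^sub>R (f z - clip (real (Suc n)) (f z))"
 have i: "integrable \<mu> (\<lambda>z. indicator F z *\<^sub>R f z)" using int by (simp add: set_integrable_def)
 have e: "?G n z = indicator F z *\<^sub>R f z - clip (real (Suc n)) (indicator F z *\<^sub>R f z)" for n z
  by (auto simp: indicator_def clip_def)
 have [measurable]: "clip (real (Suc n)) \<in> borel_measurable borel" for n
  by (rule borel_measurable_continuous_onI) (rule clip(4), simp)
 have m: "?G n \<in> borel_measurable \<mu>" for n
  unfolding e using borel_measurable_integrable[OF i] by measurable
 have b: "norm (?G n z) \<le> norm (indicator F z *\<^sub>R f z)" for n z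
  using clip(2)[of "real (Suc n)" "f z"] by (auto simp: indicator_def)
 show "set_integrable \<mu> F (\<lambda>z. f z - clip (real (Suc n)) (f z))"
  unfolding set_integrable_def by (rule bochner_bound[OF i m]) (use b in blast)
 have "(\<lambda>n. \<integral>z. cmod (?G n z) \<partial>\<mu>) \<longlonglongrightarrow> (\<integral>z. 0 \<partial>\<mu>)"
 proof (rule integral_dominated_convergence[OF _ _ integrable_norm[OF i]])
  show "AE z in \<mu>. (\<lambda>n. cmod (?G n z)) \<longlonglongrightarrow> 0"
  proof (rule AE_I2, rule tendsto_eventually)
   fix z
   obtain n0 where n0: "cmod (f z) \<le> real n0" using real_arch_simple by blast
   show "\<forall>\<^sub>F n in sequentially. cmod (?G n z) = 0"
    using eventually_ge_at_top[of n0]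
   proof eventually_elim
    case (elim n)
    then show ?case using n0 clip(3)[of "real (Suc n)" "f z"] by simp
   qed
  qed
  show "AE z in \<mu>. norm (cmod (?G n z)) \<le> cmod (indicator F z *\<^sub>R f z)" for n using b by simp
  show "(\<lambda>z. cmod (?G n z)) \<in> borel_measurable \<mu>" for n using m by measurable
 qed simp
 moreover have "indicator F z *\<^sub>R cmod (f z - clip (real (Suc n)) (f z)) = cmod (?G n z)" for n z
  by (simp add: indicator_def)
 ultimately show "(\<lambda>n. L1 (\<lambda>z. f z - clip (real (Suc n)) (f z))) \<longlonglongrightarrow> 0"
  by (simp add: set_lebesgue_integral_def)
qed

text \<open>No integrable majorant of the averages of f is at hand, so f is split into a bounded
  part \<open>f1\<close> and a part \<open>f2\<close> that is small in L^1. For \<open>f1\<close>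
  dominated convergence applies with the constant 2 R on the finite measure space \<open>F\<close>;
  on \<open>f2\<close> the normalised averaging has norm at most 1. The three errors are each below
  r / 4.\<close>

lemma conv_bump_L1:
 assumes f: "continuous_on uhp f" and i: "invariant f" and int: "set_integrable \<mu> F f"
 shows "(\<lambda>n. L1 (\<lambda>z. conv (bump (1 / real (Suc n))) f z / of_real (enn2real (mass (bump (1 / real (Suc n))))) - f z)) \<longlonglongrightarrow> 0"
proof (rule LIMSEQ_I)
 fix r :: real assume r: "r > 0"
 obtain m where "norm (L1 (\<lambda>z. f z - clip (real (Suc m)) (f z)) - 0) < r / 4"
  using LIMSEQ_D[OF clip_L1(2)[OF int], of "r / 4"] r by auto
 then have m: "L1 (\<lambda>z. f z - clip (real (Suc m)) (f z)) < r / 4" by simp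
 define R where "R = real (Suc m)"
 have R: "R > 0" by (simp add: R_def)
 define f1 f2 where "f1 = (\<lambda>z. clip R (f z))" and "f2 = (\<lambda>z. f z - f1 z)"
 have cont: "continuous_on uhp f1" "continuous_on uhp f2"
  using continuous_on_compose2[OF clip(4)[OF R, of UNIV] f] f by (auto simp: f1_def f2_def intro: continuous_on_diff)
 have int2: "set_integrable \<mu> F f2" and L2: "L1 f2 < r / 4"
  using clip_L1(1)[OF int, of m] m by (simp_all add: f1_def f2_def R_def)
 have int1: "set_integrable \<mu> F f1" using set_integral_diff(1)[OF int int2] by (simp add: f2_def)
 have i2: "invariant f2" using i by (simp add: invariant_def f1_def f2_def)
 define k c where "k = (\<lambda>n. bump (1 / real (Suc n)))" and "c = (\<lambda>n. enn2real (mass (k n)))"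
 have pp: "point_pair (k n)" and cp: "c n > 0" for n
  using point_pair_bump(1)[of "1 / real (Suc n)"] bump_mass_pos[of "1 / real (Suc n)"] by (simp_all add: k_def c_def)
 let ?A = "\<lambda>n z. conv (k n) f1 z / of_real (c n) - f1 z"
 have Am: "(\<lambda>z. indicator F z *\<^sub>R ?A n z) \<in> borel_measurable \<mu>" for n
  unfolding scaleR_diff_right
  using conv_measurable[OF pp continuous_set_borel_measurable[OF cont(1)], of n] borel_measurable_integrable[OF int1[unfolded set_integrable_def]]
  by measurable
 have Ab: "cmod (?A n z) \<le> 2 * R" if z: "z \<in> uhp" for n z
  unfolding k_def c_def
 proof (rule conv_bump_deviation[OF _ _ z cont(1)])
  show "cmod (f1 w - f1 z) \<le> 2 * R" for w
   using norm_triangle_ineq4[of "f1 w" "f1 z"] clip(1)[OF R, of "f w"] clip(1)[OF R, of "f z"] by (simp add: f1_def)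
 qed (use R in auto)
 have Fi: "integrable \<mu> (\<lambda>z. 2 * R * indicator F z)"
  using F_finite_measure by (simp add: set_integrable_def)
 have bound: "AE z in \<mu>. norm (indicator F z *\<^sub>R ?A n z) \<le> 2 * R * indicator F z" for n
  using Ab F_uhp by (intro AE_I2) (auto simp: indicator_def)
 have Ai: "set_integrable \<mu> F (?A n)" for n
  unfolding set_integrable_def
 proof (rule bochner_bound[OF Fi Am])
  show "AE z in \<mu>. norm (indicator F z *\<^sub>R ?A n z) \<le> norm (2 * R * indicator F z :: real)"
   using bound[of n] R by (simp add: abs_mult)
 qed
 have "(\<lambda>n. \<integral>z. cmod (indicator F z *\<^sub>R ?A n z) \<partial>\<mu>) \<longlonglongrightarrow> (\<integral>z. 0 \<partial>\<mu>)"
 proof (rule integral_dominated_convergence[OF _ _ Fi])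
  show "AE z in \<mu>. (\<lambda>n. cmod (indicator F z *\<^sub>R ?A n z)) \<longlonglongrightarrow> 0"
  proof (rule AE_I2)
   fix z
   show "(\<lambda>n. cmod (indicator F z *\<^sub>R ?A n z)) \<longlonglongrightarrow> 0"
   proof (cases "z \<in> F")
    case True
    then have "z \<in> uhp" using F_uhp by auto
    then have "(\<lambda>n. ?A n z) \<longlonglongrightarrow> 0" unfolding k_def c_def by (intro LIM_zero conv_bump_tendsto cont(1))
    then show ?thesis using True by (simp add: tendsto_norm_zero)
   qed simp
  qed
  show "AE z in \<mu>. norm (cmod (indicator F z *\<^sub>R ?A n z)) \<le> 2 * R * indicator F z" for n
   using bound[of n] by simp
  show "(\<lambda>z. cmod (indicator F z *\<^sub>R ?A n z)) \<in> borel_measurable \<mu>" for n using Am by measurable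
 qed simp
 moreover have "indicator F z *\<^sub>R cmod (?A n z) = cmod (indicator F z *\<^sub>R ?A n z)" for n z by (simp add: indicator_def)
 ultimately have "(\<lambda>n. L1 (?A n)) \<longlonglongrightarrow> 0" by (simp add: set_lebesgue_integral_def)
 moreover have "r / 4 > 0" using r by simp
 ultimately obtain n0 where n0: "\<forall>n\<ge>n0. norm (L1 (?A n) - 0) < r / 4" using LIMSEQ_D by blast
 have "\<exists>no. \<forall>n\<ge>no. norm (L1 (\<lambda>z. conv (k n) f z / of_real (c n) - f z) - 0) < r"
 proof (intro exI[of _ n0] allI impI)
  fix n assume n: "n \<ge> n0"
  let ?B = "\<lambda>z. (1 / of_real (c n)) * conv (k n) f2 z"
  note b2 = continuous_bounded_on_compacts[OF cont(2)] and m2 = continuous_set_borel_measurable[OF cont(2)]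
  have Bi: "set_integrable \<mu> F ?B"
   using conv_L1(1)[OF pp m2 i2 b2 int2] by (rule set_integrable_mult_right)
  have "L1 ?B = 1 / c n * L1 (conv (k n) f2)"
   using cp[of n] by (simp add: norm_mult norm_divide set_integral_mult_right)
  also have "\<dots> \<le> 1 / c n * (c n * L1 f2)"
   using conv_L1(2)[OF pp m2 i2 b2 int2, of n] cp[of n] by (intro mult_left_mono) (auto simp: c_def)
  also have "\<dots> = L1 f2" using cp[of n] by simp
  finally have LB: "L1 ?B \<le> L1 f2" .
  have mi: "set_integrable \<mu> F (\<lambda>z. - f2 z)" using set_integrable_mult_right[OF int2, of "- 1"] by simp
  have "L1 (\<lambda>z. conv (k n) f z / of_real (c n) - f z) = L1 (\<lambda>z. (?A n z + ?B z) + - f2 z)"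
   unfolding set_lebesgue_integral_def
  proof (intro bochner_cong refl)
   fix z
   have "conv (k n) f z / of_real (c n) - f z = (?A n z + ?B z) + - f2 z" if z: "z \<in> F"
   proof -
    have zu: "z \<in> uhp" using z F_uhp by auto
    have "conv (k n) f2 z = conv (k n) f z - conv (k n) f1 z"
     unfolding f2_def by (rule conv_diff[OF pp _ _ _ _ zu])
      (intro continuous_set_borel_measurable continuous_bounded_on_compacts f cont(1))+
    then show ?thesis by (simp add: f2_def diff_divide_distrib)
   qed
   then show "indicator F z *\<^sub>R cmod (conv (k n) f z / of_real (c n) - f z) = indicator F z *\<^sub>R cmod ((?A n z + ?B z) + - f2 z)"
    by (simp add: indicator_def)
  qed
  also have "\<dots> \<le> L1 (\<lambda>z. ?A n z + ?B z) + L1 (\<lambda>z. - f2 z)" by (rule L1_triangle[OF set_integral_add(1)[OF Ai Bi] mi])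
  also have "\<dots> \<le> (L1 (?A n) + L1 ?B) + L1 f2" using L1_triangle[OF Ai Bi] by simp
  also have "\<dots> < r"
   using n0[rule_format, OF n] LB L2 r unfolding real_norm_def diff_0_right by linarith
  finally have "L1 (\<lambda>z. conv (k n) f z / of_real (c n) - f z) < r" .
  moreover have "0 \<le> L1 (\<lambda>z. conv (k n) f z / of_real (c n) - f z)"
   unfolding set_lebesgue_integral_def by (intro integral_nonneg_AE) auto
  ultimately show "norm (L1 (\<lambda>z. conv (k n) f z / of_real (c n) - f z) - 0) < r" by simp
 qed
 then show "\<exists>no. \<forall>n\<ge>no. norm (L1 (\<lambda>z. conv (bump (1 / real (Suc n))) f z / of_real (enn2real (mass (bump (1 / real (Suc n))))) - f z) - 0) < r"
  unfolding k_def c_def .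
qed

text \<open>Continuity of \<open>h2\<close> guarantees that its integrals along horocycles exist,
  which is what the subtraction of the two vanishing means rests on.\<close>

lemma test_function_diff:
 assumes h1: "test_function Y h1" and h2: "test_function Y h2" and c: "continuous_on uhp h2" and Y: "Y \<ge> 0"
 shows "test_function Y (\<lambda>z. h1 z - h2 z)"
proof -
 have m: "uhp_measurable (\<lambda>z. h1 z - h2 z)"
  using h1 h2 unfolding test_function_def set_borel_measurable_def scaleR_diff_right by (intro borel_measurable_diff) auto
 have i: "invariant (\<lambda>z. h1 z - h2 z)" using h1 h2 by (simp add: test_function_def invariant_def)
 have int: "set_integrable \<mu> F (\<lambda>z. h1 z - h2 z)" using h1 h2 by (simp add: test_function_def set_integral_diff)
 have "AE y in lborel. y > Y \<longrightarrow> set_lebesgue_integral lborel {0..real N} (\<lambda>x. h1 (moebius s (Complex x y)) - h2 (moebius s (Complex x y))) = 0"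
  if s: "s \<in> SL2Z" for s
 proof -
  have sR: "s \<in> SL2R" using s by (simp add: SL2Z_iff)
  have "AE y in lborel. y > Y \<longrightarrow> set_lebesgue_integral lborel {0..real N} (\<lambda>x. h1 (moebius s (Complex x y))) = 0"
   "AE y in lborel. y > Y \<longrightarrow> set_lebesgue_integral lborel {0..real N} (\<lambda>x. h2 (moebius s (Complex x y))) = 0"
   using h1 h2 s by (auto simp: test_function_def)
  then show ?thesis
  proof eventually_elim
   case (elim y)
   show ?case
   proof
    assume y: "y > Y"
    have "continuous_on {0..real N} (\<lambda>x. moebius s (Complex x y))"
     by (rule continuous_on_compose2[OF continuous_on_moebius[OF sR]])
       (use y Y in \<open>auto simp: Complex_eq uhp_iff intro!: continuous_intros\<close>)
    then have "continuous_on {0..real N} (\<lambda>x. h2 (moebius s (Complex x y)))"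
     by (rule continuous_on_compose2[OF c]) (use sR y Y in \<open>auto simp: uhp_iff\<close>)
    then have 2: "set_integrable lborel {0..real N} (\<lambda>x. h2 (moebius s (Complex x y)))"
     unfolding set_integrable_def by (intro borel_integrable_compact) auto
    show "set_lebesgue_integral lborel {0..real N} (\<lambda>x. h1 (moebius s (Complex x y)) - h2 (moebius s (Complex x y))) = 0"
    proof (cases "set_integrable lborel {0..real N} (\<lambda>x. h1 (moebius s (Complex x y)))")
     case True
     then show ?thesis using set_integral_diff(2)[OF True 2] elim y by simp
    next
     case False
     \<comment> \<open>A Bochner integral that does not exist has the value 0. So if
       \<open>h1\<close> is not integrable along the horocycle, neither is the difference, and the
       required value holds by this convention.\<close>
     then have "\<not> set_integrable lborel {0..real N} (\<lambda>x. h1 (moebius s (Complex x y)) - h2 (moebius s (Complex x y)))"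
      using set_integral_add(1)[OF _ 2, of "\<lambda>x. h1 (moebius s (Complex x y)) - h2 (moebius s (Complex x y))"] by auto
     then show ?thesis unfolding set_integrable_def set_lebesgue_integral_def by (rule not_integrable_integral_eq)
    qed
   qed
  qed
 qed
 then show ?thesis using m i int unfolding test_function_def by blast
qed

lemma test_function_cmult:
 assumes "test_function Y h"
 shows "test_function Y (\<lambda>z. \<alpha> * h z)"
 using assms unfolding test_function_def
 by (auto simp: invariant_def set_borel_measurable_def mult.left_commute scaleR_conv_of_real
   set_integrable_mult_right elim!: AE_mp)

end

context theta_setting
begin

section \<open>Moving the Laplacian across the pairing\<close>

lemma pairing_cong:
 assumes "\<And>z. z \<in> uhp \<Longrightarrow> h z = h' z"
 shows "pairing h g = pairing h' g"
proof -
 have "hyp_int (F \<inter> trunc T) (\<lambda>z. h z * Theta g z) =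
   hyp_int (F \<inter> trunc T) (\<lambda>z. h' z * Theta g z)" for T
  unfolding set_lebesgue_integral_def
  by (intro bochner_cong refl) (use assms F_uhp in \<open>auto simp: indicator_def\<close>)
 then show ?thesis unfolding pairing_def integral_M_def by simp
qed

text \<open>The average of a function supported in \<open>trunc T\<close> is supported in
  \<open>trunc (3 * T)\<close>. The limit that defines the pairing is therefore eventually constant,
  an ordinary integral over \<open>F\<close>, to which the symmetry of averaging applies.\<close>

lemma pairing_conv_truncated:
 assumes k: "point_pair k" and c: "c > 0" and g: "admissible c K g" and h: "test_function 2 h"
  and supp: "\<And>z. z \<in> uhp \<Longrightarrow> h z \<noteq> 0 \<Longrightarrow> z \<in> trunc T" and T: "T \<ge> T0"
 shows "pairing (conv k h) g = hyp_int F (\<lambda>z. h z * conv k (Theta g) z)"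
proof -
 obtain C0 where C0: "C0 > 0" "\<And>g K T z. admissible c K g \<Longrightarrow> T \<ge> T0 \<Longrightarrow> z \<in> trunc T \<Longrightarrow>
  cmod (Theta g z) \<le> C0 * K * T \<and> Theta_abs g z \<le> C0 * K * T"
  by (rule Theta_truncated_bound[OF c]) (rule that, assumption+)
 have T3: "3 * T \<ge> T0" "T > 0" using T T0(2) by linarith+
 have "hyp_int F (\<lambda>z. h z * conv k (Theta g) z) =
   hyp_int F (\<lambda>z. conv k h z * Theta g z)"
 proof (rule conv_symmetric[OF k _ Theta_measurable[OF c g] _ Theta_invariant _ supp])
  show "cmod (Theta g z) \<le> C0 * K * (3 * T)" if "z \<in> trunc (3 * T)" for z
   using C0(2)[OF g T3(1) that] by simp
  show "0 \<le> C0 * K * (3 * T)" using C0(1) admissible_nonneg[OF g] T3 by simp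
 qed (use h in \<open>auto simp: test_function_def\<close>)
 moreover have "pairing (conv k h) g = hyp_int F (\<lambda>z. conv k h z * Theta g z)"
 proof (rule pairing_eqI, rule tendsto_eventually)
  show "\<forall>\<^sub>F T' in at_top. hyp_int (F \<inter> trunc T') (\<lambda>z. conv k h z * Theta g z) =
    hyp_int F (\<lambda>z. conv k h z * Theta g z)"
   using eventually_ge_at_top[of "3 * T"]
  proof eventually_elim
   case (elim T')
   show ?case
    unfolding set_lebesgue_integral_def
   proof (intro bochner_cong refl)
    fix z
    have "conv k h z = 0" if z: "z \<in> F" "z \<notin> trunc T'"
    proof -
     have zu: "z \<in> uhp" using z F_uhp by auto
     have "3 * T * a \<le> T' * a" if "cusp_period \<Gamma> \<sigma> a" for \<sigma> a
      using elim that by (intro mult_right_mono) (auto simp: cusp_period_def)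
     then have sub: "trunc (3 * T) \<subseteq> trunc T'"
      unfolding truncated_uhp_def by (blast intro: order_trans)
     have "conv k h z = conv k (\<lambda>_. 0) z"
     proof (rule conv_cong[OF k zu], rule ccontr)
      fix w assume w: "w \<in> uhp" "hyp_dist z w < 1" "h w \<noteq> 0"
      then have "z \<in> trunc (3 * T)"
       using truncated_neighbour[OF supp[OF w(1,3)] zu] hyp_dist_sym[of z w] by simp
      then show False using z sub by auto
     qed
     then show ?thesis by (simp add: conv_def)
    qed
    then show "indicator (F \<inter> trunc T') z *\<^sub>R (conv k h z * Theta g z) = indicator F z *\<^sub>R (conv k h z * Theta g z)"
     by (auto simp: indicator_def)
   qed
  qed
 qed
 ultimately show ?thesis by simp
qed

text \<open>The error is the pairing with the average of h outside \<open>trunc T\<close>. This tail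
  is again a test function, so the pairing is bounded by its L^1 norm, which tends to 0.\<close>

lemma pairing_conv_tendsto:
 assumes k: "point_pair k" and c: "c > 0" and g: "admissible c K g" and h: "test_function 2 h" and cont: "continuous_on uhp h"
 shows "((\<lambda>T. pairing (conv k (\<lambda>z. indicator (trunc T) z *\<^sub>R h z)) g) \<longlongrightarrow> pairing (conv k h) g) at_top"
proof -
 have bd: "bounded_on_compacts (\<lambda>z. indicator S z *\<^sub>R h z)" for S
  unfolding bounded_on_compacts_def
 proof (intro allI impI)
  fix M assume "compact M" "M \<subseteq> uhp"
  from bounded_on_compactsD[OF continuous_bounded_on_compacts[OF cont] this]
  obtain B where "\<forall>w\<in>M. cmod (h w) \<le> B" by (elim exE)
  then show "\<exists>B. \<forall>w\<in>M. cmod (indicator S w *\<^sub>R h w) \<le> B"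
   by (intro exI[of _ "\<bar>B\<bar>"]) (auto simp: indicator_def intro: order_trans)
 qed
 have Y: "(2 :: real) \<le> 6" by simp
 obtain C1 where C1: "C1 > 0" "\<And>h g K. test_function 6 h \<Longrightarrow> admissible c K g \<Longrightarrow>
   ((\<lambda>T. hyp_int (F \<inter> trunc T) (\<lambda>z. h z * Theta g z)) \<longlongrightarrow> pairing h g) at_top \<and>
   cmod (pairing h g) \<le> C1 * K * L1 h"
  by (rule pairing_bound[OF c Y]) (rule that, assumption+)
 let ?in = "\<lambda>T z. indicator (trunc T) z *\<^sub>R h z" and ?out = "\<lambda>T z. indicator (- trunc T) z *\<^sub>R h z"
 have int: "set_integrable \<mu> F h" using h by (simp add: test_function_def)
 have K: "K \<ge> 0" using admissible_nonneg[OF g] .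
 have "((\<lambda>T. pairing (conv k h) g - pairing (conv k (?in T)) g) \<longlongrightarrow> 0) at_top"
 proof (rule Lim_null_comparison)
  show "((\<lambda>T. C1 * K * (enn2real (mass k) * L1 (?out T))) \<longlongrightarrow> 0) at_top"
   using tail_tendsto_0[OF int] by (auto intro!: tendsto_mult_right_zero)
  show "\<forall>\<^sub>F T in at_top. norm (pairing (conv k h) g - pairing (conv k (?in T)) g) \<le> C1 * K * (enn2real (mass k) * L1 (?out T))"
   using eventually_ge_at_top[of T0]
  proof eventually_elim
   case (elim T)
   note tin = test_function_truncated(1)[OF h elim] and tout = test_function_truncated(2)[OF h elim]
   have m: "uhp_measurable h" "uhp_measurable (?in T)" "uhp_measurable (?out T)"
    and i: "invariant (?out T)" "set_integrable \<mu> F (?out T)"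
    using h tin tout by (auto simp: test_function_def)
   have "pairing (conv k h) g - pairing (conv k (?in T)) g = pairing (\<lambda>z. conv k h z - conv k (?in T) z) g"
    by (rule pairing_diff_left[OF c Y _ _ g, symmetric])
      (intro conv_test_function[OF k] h tin bd continuous_bounded_on_compacts cont)+
   also have "\<dots> = pairing (conv k (?out T)) g"
   proof (rule pairing_cong)
    fix z assume z: "z \<in> uhp"
    have "conv k h z - conv k (?in T) z = conv k (\<lambda>z. h z - ?in T z) z"
     by (rule conv_diff[OF k m(1,2) continuous_bounded_on_compacts[OF cont] bd z, symmetric])
    also have "\<dots> = conv k (?out T) z" by (rule conv_cong[OF k z]) (auto simp: indicator_def)
    finally show "conv k h z - conv k (?in T) z = conv k (?out T) z" .
   qed
   also have "norm \<dots> \<le> C1 * K * L1 (conv k (?out T))"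
    using C1(2)[OF conv_test_function[OF k tout bd] g] by simp
   also have "\<dots> \<le> C1 * K * (enn2real (mass k) * L1 (?out T))"
    using C1(1) K conv_L1(2)[OF k m(3) i(1) bd i(2)] by (intro mult_left_mono) auto
   finally show ?case .
  qed
 qed
 from tendsto_diff[OF tendsto_const[of "pairing (conv k h) g"] this] show ?thesis by simp
qed

text \<open>For a fixed disc, Green's formula on the side of the kernel and on the side of f both
  replace the Laplacian by \<open>bump_laplacian\<close>, which proves the relation for the average
  of f. After normalisation the averages tend to f in L^1, and both pairings are continuous in this
  norm.\<close>

theorem pairing_laplacian:
 assumes f: "test_function 2 f" and ev: "laplace_eigenfunction ev f" and c: "c > 0"
  and g: "admissible c K1 (kern 0 0 A B)" "admissible c K2 (gauss_laplacian A B)"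
 shows "pairing f (gauss_laplacian A B) = of_real ev * pairing f (kern 0 0 A B)"
proof -
 have cont: "continuous_on uhp f"
  using laplace_eigenfunction_partials[OF ev] by (simp add: second_partials_def)
 have Y: "(2 :: real) \<le> 6" by simp
 obtain C1 where C1: "C1 > 0" "\<And>h g K. test_function 6 h \<Longrightarrow> admissible c K g \<Longrightarrow>
   ((\<lambda>T. hyp_int (F \<inter> trunc T) (\<lambda>z. h z * Theta g z)) \<longlongrightarrow> pairing h g) at_top \<and>
   cmod (pairing h g) \<le> C1 * K * L1 h"
  by (rule pairing_bound[OF c Y]) (rule that, assumption+)
 have i: "invariant f" and int: "set_integrable \<mu> F f" using f by (auto simp: test_function_def)
 have ct: "test_function 6 (conv (bump t) f)" if "0 < t" "t \<le> 1" for t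
  by (rule conv_test_function[OF point_pair_bump(1)[OF that] f continuous_bounded_on_compacts[OF cont]])
 have conv_eq: "pairing (conv (bump t) f) (gauss_laplacian A B) = of_real ev * pairing (conv (bump t) f) (kern 0 0 A B)"
  if t: "0 < t" "t \<le> 1" for t
 proof -
  note pp = point_pair_bump[OF t]
  let ?in = "\<lambda>T z. indicator (trunc T) z *\<^sub>R f z"
  \<comment> \<open>Symmetry of averaging is available for functions supported in a truncated domain
    only, so the identity is proved for the truncations of f and T then tends to infinity on both
    sides.\<close>
  have "\<forall>\<^sub>F T in at_top. pairing (conv (bump t) (?in T)) (gauss_laplacian A B) = pairing (conv (bump_laplacian t) (?in T)) (kern 0 0 A B)"
   using eventually_ge_at_top[of T0]
  proof eventually_elim
   case (elim T)
   have supp: "z \<in> trunc T" if "?in T z \<noteq> 0" for z using that by (auto simp: indicator_def split: if_splits)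
   have "hyp_int F (\<lambda>z. ?in T z * conv (bump t) (Theta (gauss_laplacian A B)) z) =
    hyp_int F (\<lambda>z. ?in T z * conv (bump_laplacian t) (Theta (kern 0 0 A B)) z)"
    unfolding set_lebesgue_integral_def
    by (intro bochner_cong refl)
      (use conv_Theta_gauss[OF t _ c g] F_uhp in \<open>auto simp: indicator_def\<close>)
   then show ?case
    using pairing_conv_truncated[OF pp(1) c g(2) test_function_truncated(1)[OF f elim] supp elim]
     pairing_conv_truncated[OF pp(2) c g(1) test_function_truncated(1)[OF f elim] supp elim] by simp
  qed
  then have "pairing (conv (bump t) f) (gauss_laplacian A B) = pairing (conv (bump_laplacian t) f) (kern 0 0 A B)"
   by (intro tendsto_unique[OF _ Lim_transform_eventually[OF pairing_conv_tendsto[OF pp(1) c g(2) f cont]] pairing_conv_tendsto[OF pp(2) c g(1) f cont]]) simp_all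
  also have "\<dots> = pairing (\<lambda>z. of_real ev * conv (bump t) f z) (kern 0 0 A B)"
   by (rule pairing_cong) (rule conv_eigenfunction[OF ev t])
  also have "\<dots> = of_real ev * pairing (conv (bump t) f) (kern 0 0 A B)" by (rule pairing_cmult_left[OF c Y ct[OF t] g(1)])
  finally show ?thesis .
 qed
 define t where "t = (\<lambda>n. 1 / real (Suc n))"
 have t: "0 < t n" "t n \<le> 1" for n by (simp_all add: t_def)
 define h where "h = (\<lambda>n z. conv (bump (t n)) f z / of_real (enn2real (mass (bump (t n)))))"
 have h_alt: "h n = (\<lambda>z. of_real (1 / enn2real (mass (bump (t n)))) * conv (bump (t n)) f z)" for n
  by (simp add: h_def fun_eq_iff)
 have h6: "test_function 6 (h n)" for n unfolding h_alt by (rule test_function_cmult[OF ct[OF t]])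
 have f6: "test_function 6 f" by (rule test_function_mono[OF f Y])
 have lim: "(\<lambda>n. pairing (h n) g') \<longlonglongrightarrow> pairing f g'" if g': "admissible c K g'" for g' K
 proof (rule LIM_zero_cancel, rule Lim_null_comparison)
  show "(\<lambda>n. C1 * K * L1 (\<lambda>z. h n z - f z)) \<longlonglongrightarrow> 0"
   using conv_bump_L1[OF cont i int] unfolding h_def t_def by (auto intro!: tendsto_mult_right_zero)
  show "\<forall>\<^sub>F n in sequentially. norm (pairing (h n) g' - pairing f g') \<le> C1 * K * L1 (\<lambda>z. h n z - f z)"
   using C1(2)[OF test_function_diff[OF h6 f6 cont] g'] by (simp add: pairing_diff_left[OF c Y h6 f6 g', symmetric])
 qed
 have "pairing (h n) (gauss_laplacian A B) = of_real ev * pairing (h n) (kern 0 0 A B)" for n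
  unfolding h_alt pairing_cmult_left[OF c Y ct[OF t] g(1)] pairing_cmult_left[OF c Y ct[OF t] g(2)] conv_eq[OF t] by simp
 with lim[OF g(2)] have "(\<lambda>n. of_real ev * pairing (h n) (kern 0 0 A B)) \<longlonglongrightarrow> pairing f (gauss_laplacian A B)" by simp
 moreover have "(\<lambda>n. of_real ev * pairing (h n) (kern 0 0 A B)) \<longlonglongrightarrow> of_real ev * pairing f (kern 0 0 A B)"
  by (intro tendsto_mult_left lim[OF g(1)])
 ultimately show ?thesis by (rule LIMSEQ_unique)
qed

text \<open>\<open>pairing_laplacian\<close> at A = i pi u and B = pi v, expanded by linearity and
  divided by 4 B, is the relation that \<open>xi_lift_KM\<close> asks for.\<close>

theorem xi_lift_KM_eigenfunction:
 assumes f: "test_function 2 f" and ev: "laplace_eigenfunction ev f" and t: "\<tau> \<in> uhp"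
 shows "has_xi (3/2) (\<lambda>t. lift_KM d \<Gamma> F t f C) \<tau> (of_real (ev / (4 * pi)) * lift_Maass d \<Gamma> F \<tau> (\<lambda>z. cnj (f z)) C)"
proof (rule xi_lift_KM[OF f t])
 let ?A = "\<i> * of_real (pi * Re \<tau>)" and ?B = "pi * Im \<tau>"
 have B: "?B > 0" and A: "Re ?A = 0" using t by (simp_all add: uhp_iff)
 have c: "?B / 2 > 0" using B by simp
 obtain K where K: "\<And>n l. admissible (?B / 2) (K n l) (kern n l ?A ?B)"
 proof -
  have "\<exists>K. admissible (?B / 2) K (kern n l ?A ?B)" for n l by (rule admissible_kern[OF B A]) (rule exI)
  then show ?thesis using that by metis
 qed
 note A1 = admissible_linear[OF K K, of "of_real (- 4 * ?B\<^sup>2)" 4 0 "of_real (8 * ?B\<^sup>2)" 2 1]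
  and A2 = admissible_linear[OF K K, of "of_real (6 * ?B)" 2 0 "of_real (- 4 * ?B)" 0 1]
 note L = admissible_linear[OF A1 A2, of 1 1]
 have "pairing f (gauss_laplacian ?A ?B) = of_real ev * pairing f (kern 0 0 ?A ?B)"
  by (rule pairing_laplacian[OF f ev c K]) (use L in \<open>simp add: gauss_laplacian_def[abs_def]\<close>)
 moreover have "pairing f (gauss_laplacian ?A ?B) =
   1 * pairing f (\<lambda>p a. of_real (- 4 * ?B\<^sup>2) * kern 4 0 ?A ?B p a + of_real (8 * ?B\<^sup>2) * kern 2 1 ?A ?B p a) +
   1 * pairing f (\<lambda>p a. of_real (6 * ?B) * kern 2 0 ?A ?B p a + of_real (- 4 * ?B) * kern 0 1 ?A ?B p a)"
  unfolding pairing_linear[OF c order_refl f A1 A2, symmetric] by (simp add: gauss_laplacian_def[abs_def])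
 ultimately have *: "of_real (- 4 * ?B\<^sup>2) * pairing f (kern 4 0 ?A ?B) + of_real (8 * ?B\<^sup>2) * pairing f (kern 2 1 ?A ?B) +
   (of_real (6 * ?B) * pairing f (kern 2 0 ?A ?B) + of_real (- 4 * ?B) * pairing f (kern 0 1 ?A ?B)) =
   of_real ev * pairing f (kern 0 0 ?A ?B)"
  unfolding pairing_linear[OF c order_refl f K K] by simp
 define b where "b = (of_real ?B :: complex)"
 have b: "b \<noteq> 0" using B unfolding b_def by (metis less_irrefl of_real_eq_0_iff)
 show "of_real (2 * pi * Im \<tau>) * pairing f (kern 2 1 ?A ?B) - pairing f (kern 0 1 ?A ?B) +
   of_real (3 / 2) * pairing f (kern 2 0 ?A ?B) - of_real (pi * Im \<tau>) * pairing f (kern 4 0 ?A ?B) =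
   of_real (ev / (4 * pi * Im \<tau>)) * pairing f (kern 0 0 ?A ?B)"
 proof -
  have e: "complex_of_real (2 * pi * Im \<tau>) = 2 * b" "complex_of_real (pi * Im \<tau>) = b"
   "complex_of_real (ev / (4 * pi * Im \<tau>)) = of_real ev / (4 * b)" by (simp_all add: b_def)
  have e2: "complex_of_real (- 4 * ?B\<^sup>2) = - 4 * b\<^sup>2" "complex_of_real (8 * ?B\<^sup>2) = 8 * b\<^sup>2"
   "complex_of_real (6 * ?B) = 6 * b" "complex_of_real (- 4 * ?B) = - 4 * b" by (simp_all add: b_def)
  have "of_real ev / (4 * b) * P = (of_real ev * P) / (4 * b)" for P by simp
  note e3 = this
  show ?thesis unfolding e e3 *[symmetric] e2 using b by (simp add: field_simps power2_eq_square)
 qed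
qed

end

theorem theorem7p7:
  fixes d :: real and L \<Gamma> :: "mat2 set" and F :: "complex set" and f :: "complex \<Rightarrow> complex"
  assumes "d \<in> \<rat>" and "d > 0"
    and "even_lattice d L"
    and "congruence_subgroup \<Gamma>"
    and "\<forall>g\<in>\<Gamma>. conj_act g ` L = L"
    and "\<forall>g\<in>\<Gamma>. \<forall>X\<in>dual_lattice d L. conj_act g X - X \<in> L"
    and "fundamental_domain \<Gamma> F"
    and "f \<in> L2_cusp \<Gamma> F"
  shows "(\<forall>C\<in>discriminant_group d L. \<forall>\<tau>\<in>uhp.
            has_xi (1/2) (\<lambda>t. lift_Maass d \<Gamma> F t f C) \<tau>
              (- of_real pi * lift_KM d \<Gamma> F \<tau> (\<lambda>z. cnj (f z)) C)) \<and>
         (\<forall>ev :: real. laplace_eigenfunction ev f \<longrightarrow>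
            (\<forall>C\<in>discriminant_group d L. \<forall>\<tau>\<in>uhp.
               has_xi (3/2) (\<lambda>t. lift_KM d \<Gamma> F t f C) \<tau>
                 (of_real (ev / (4 * pi)) * lift_Maass d \<Gamma> F \<tau> (\<lambda>z. cnj (f z)) C)))"
proof (intro conjI ballI allI impI)
  fix C \<tau> assume C: "C \<in> discriminant_group d L" and \<tau>: "\<tau> \<in> uhp"
  \<comment> \<open>Each coset receives its own interpretation of the locale, as the denominator D
    depends on the coset.\<close>
  obtain N D where "theta_setting \<Gamma> F N d C D" by (rule theta_setting_exists[OF assms(2-7) C])
  then interpret theta_setting \<Gamma> F N d C D .
  note f = L2_cusp_test_function[OF assms(8)]
  show "has_xi (1/2) (\<lambda>t. lift_Maass d \<Gamma> F t f C) \<tau> (- of_real pi * lift_KM d \<Gamma> F \<tau> (\<lambda>z. cnj (f z)) C)"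
    by (rule xi_lift_Maass[OF f \<tau>])
  show "has_xi (3/2) (\<lambda>t. lift_KM d \<Gamma> F t f C) \<tau>
      (of_real (ev / (4 * pi)) * lift_Maass d \<Gamma> F \<tau> (\<lambda>z. cnj (f z)) C)" if "laplace_eigenfunction ev f" for ev
    by (rule xi_lift_KM_eigenfunction[OF f that \<tau>])
qed

end
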